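(* Let $P$ be a polymatroid with lattice of flats $L$ and let $\mathcal G$ be a building set. Then \[ H^{\bullet}(B(P,\mathcal G),\mathrm d)\cong H^{\bullet}(\mathrm{CM}(P,\mathcal G),\mathrm d)\cong\bigoplus_{f\in L}\ \bigotimes_{g\in F}\tilde H_{2\mathrm{cd}(g)-2-\bullet}\bigl(n((\hat 0,g),\mathcal G)\bigr), \] where $F=F(P,\mathcal G,f)$ is the set of $\mathcal G$-factors of $f$. In particular, the summand $\tilde H_i(n((\hat 0,g),\mathcal G))$ contributes in bidegree $(2(\mathrm{cd}(g)-2-i),\,2+i)$.
   Context: Polymatroids. A polymatroid $P=(E,\mathrm{cd})$ is a finite set $E$ with a function $\mathrm{cd}\colon 2^E\to\mathbb N$ such that $\mathrm{cd}(\emptyset)=0$, $\mathrm{cd}(A)\le \mathrm{cd}(B)$ if $A\subseteq B$, and $\mathrm{cd}(A\cup B)+\mathrm{cd}(A\cap B)\le \mathrm{cd}(A)+\mathrm{cd}(B)$. The closure of $A\subseteq E$ is $\{a\in E: \mathrm{cd}(A\cup\{a\})=\mathrm{cd}(A)\}$; a flat is a closed set; the flats ordered by inclusion form a lattice $L$ with minimum $\hat 0$ and maximum $\hat 1$. For $X\subseteq L$, $\max(X)$ is the set of maximal elements of $X$, $X_{<g}=\{x\in X: x<g\}$, $\bigvee X$ is the join ($\bigvee\emptyset=\hat 0$). Building sets. $\mathcal G\subseteq L\setminus\{\hat 0\}$ is a (geometric) building set if for every $x\in L$, with $F(P,\mathcal G,x)=\max\{y\in\mathcal G: y\le x\}$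 (the set of $\mathcal G$-factors of $x$), the map $\prod_{y\in F(P,\mathcal G,x)}[\hat 0,y]\to[\hat 0,x]$, $(z_y)_y\mapsto\bigvee_y z_y$, is an isomorphism of lattices and $\mathrm{cd}(x)=\sum_{y\in F(P,\mathcal G,x)}\mathrm{cd}(y)$. For $g\in\mathcal G$ and $x\ge g$ there is a unique $\mathcal G$-factor of $x$ that is $\ge g$. A subset $S\subseteq\mathcal G$ is $\mathcal G$-nested if the join of any set of at least two pairwise incomparable elements of $S$ is not in $\mathcal G$; the $\mathcal G$-nested sets form a simplicial complex $n(P,\mathcal G)$. Fix a total order $\prec$ on $\mathcal G$ that is a linear extension of the order of $L$ ($g<h\Rightarrow g\prec h$). The complex $n((\hat 0,g),\mathcal G)$ is the full subcomplex of $n(P,\mathcal G)$ on the vertices $\{h\in\mathcal G: h<g\}$. Homology is reduced simplicial homology with rational coefficients, with $\tilde H_{-1}(\emptyset)=\mathbb Q$ for the complex without vertices. Leray model. Let $\mathcal R(\mathcal G)=\Lambda_{\mathbb Q}[e_g\mid g\in\mathcal G]\otimes\mathbb Q[x_g\mid g\in\mathcal G]$ be bigraded commutative with $e_g$ exterior of bidegree $(0,1)$ and $x_g$ commuting of bidegree $(2,0)$, with derivation $\mathrm d(e_g)=x_g$, $\mathrm d(x_g)=0$. Put $c_g=\sum_{h\in\mathcal G,h\ge g}x_h$, $e_T=\prod_{t\in T}e_t$ (in increasing $\prec$-order), $x_S=\prod_{s\in S}x_s$. Let $I(\mathcal G)$ be generated by (i) $e_Tx_S$ for $S\cup T\notin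 n(P,\mathcal G)$, and (ii) $e_Tx_Sc_g^b$ for $S,T\subseteq\mathcal G$, $g\in\mathcal G$, $b\ge\mathrm{cd}(g)-\mathrm{cd}(\bigvee(S\cup T)_{<g})$. Then $B(P,\mathcal G)=\mathcal R(\mathcal G)/I(\mathcal G)$ is a differential bigraded algebra. $\mathrm{CM}(P,\mathcal G)$ is, as a complex, the $\mathbb Q$-vector space with basis the $\mathcal G$-nested sets $T$, with $T$ in bidegree $(2(\mathrm{cd}(\bigvee T)-|T|),|T|)$, and differential $\mathrm d(T)=\sum_{t\in T\setminus\max(T)}(-1)^{|T_{\prec t}|}(T\setminus\{t\})$, where $T_{\prec t}=\{u\in T:u\prec t\}$. The superscript $\bullet$ is the total degree $p+q$ of bidegree $(p,q)$; the isomorphisms are of graded $\mathbb Q$-vector spaces and $\bigotimes$ is the tensor product of graded vector spaces, the factor for $g$ having $\tilde H_{2\mathrm{cd}(g)-2-k}(n((\hat 0,g),\mathcal G))$ in degree $k$ (the empty tensor product, for $f=\hat 0$, is $\mathbb Q$ in degree $0$). *)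

theory Defs
  imports
    Complex_Main
    "HOL-Algebra.QuotRing"
    "HOL-Algebra.Module"
    "HOL-Algebra.Lattice"
    "HOL-Library.Poly_Mapping"
    "HOL-Library.Product_Plus"
begin

section \<open>Rational vector spaces\<close>

text \<open>
  A vector space over the rationals is a HOL-Algebra module record with scalars of type
  \<^typ>\<open>rat\<close>. The fields \<open>mult\<close> and \<open>one\<close> of such a record belong to the ring structure only and
  are irrelevant for plain modules.
\<close>

definition rat_field :: "rat ring" where
  "rat_field = \<lparr>carrier = UNIV, mult = (*), one = 1, zero = 0, add = (+)\<rparr>"

definition vs_isomorphic :: "(rat, 'v) module \<Rightarrow> (rat, 'w) module \<Rightarrow> bool" (infix \<open>\<cong>\<^sub>\<rat>\<close> 50) where
  "M \<cong>\<^sub>\<rat> N \<longleftrightarrow> (\<exists>\<phi> \<in> iso (add_monoid M) (add_monoid N).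
     \<forall>c. \<forall>v\<in>carrier M. \<phi> (c \<odot>\<^bsub>M\<^esub> v) = c \<odot>\<^bsub>N\<^esub> \<phi> v)"

definition gen_submodule :: "(rat, 'v) module \<Rightarrow> 'v set \<Rightarrow> 'v set" where
  "gen_submodule M S = \<Inter>{N. submodule N rat_field M \<and> S \<subseteq> N}"

text \<open>Applied to a two-sided ideal of an algebra, this is \<open>FactRing\<close> with its scalar multiplication.\<close>

definition quot_module :: "(rat, 'v) module \<Rightarrow> 'v set \<Rightarrow> (rat, 'v set) module" where
  "quot_module M N = \<lparr>carrier = carrier (M Quot N), mult = mult (M Quot N), one = one (M Quot N),
     zero = zero (M Quot N), add = add (M Quot N),
     smult = (\<lambda>c V. \<Union>v\<in>V. N +>\<^bsub>M\<^esub> (c \<odot>\<^bsub>M\<^esub> v))\<rparr>"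

definition free_module :: "'x set \<Rightarrow> (rat, 'x \<Rightarrow>\<^sub>0 rat) module" where
  "free_module X = \<lparr>carrier = {v. Poly_Mapping.keys v \<subseteq> X}, mult = undefined, one = undefined,
     zero = 0, add = (+), smult = (\<lambda>c. Poly_Mapping.map ((*) c))\<rparr>"

definition direct_sum :: "'j set \<Rightarrow> ('j \<Rightarrow> (rat, 'v) module) \<Rightarrow> (rat, 'j \<Rightarrow> 'v) module" where
  "direct_sum J M = \<lparr>carrier = {v \<in> \<Pi>\<^sub>E j\<in>J. carrier (M j). finite {j\<in>J. v j \<noteq> \<zero>\<^bsub>M j\<^esub>}},
     mult = undefined, one = undefined,
     zero = (\<lambda>j\<in>J. \<zero>\<^bsub>M j\<^esub>),
     add = (\<lambda>v w. \<lambda>j\<in>J. v j \<oplus>\<^bsub>M j\<^esub> w j),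
     smult = (\<lambda>c v. \<lambda>j\<in>J. c \<odot>\<^bsub>M j\<^esub> v j)\<rparr>"

text \<open>The tensor product of a finite family: the free vector space on the product of the carriers,
  modulo multilinearity.\<close>

definition tensor_relations ::
    "'i set \<Rightarrow> ('i \<Rightarrow> (rat, 'v) module) \<Rightarrow> (('i \<Rightarrow> 'v) \<Rightarrow>\<^sub>0 rat) set" where
  "tensor_relations I M =
     {Poly_Mapping.single (v(i := a \<oplus>\<^bsub>M i\<^esub> b)) 1
        - Poly_Mapping.single (v(i := a)) 1 - Poly_Mapping.single (v(i := b)) 1 | v i a b.
        v \<in> (\<Pi>\<^sub>E j\<in>I. carrier (M j)) \<and> i \<in> I \<and> a \<in> carrier (M i) \<and> b \<in> carrier (M i)}
   \<union> {Poly_Mapping.single (v(i := c \<odot>\<^bsub>M i\<^esub> a)) 1 - Poly_Mapping.single (v(i := a)) c | v i a c.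
        v \<in> (\<Pi>\<^sub>E j\<in>I. carrier (M j)) \<and> i \<in> I \<and> a \<in> carrier (M i)}"

definition tensor :: "'i set \<Rightarrow> ('i \<Rightarrow> (rat, 'v) module) \<Rightarrow> (rat, (('i \<Rightarrow> 'v) \<Rightarrow>\<^sub>0 rat) set) module"
  where
  "tensor I M =
     (let T = free_module (\<Pi>\<^sub>E i\<in>I. carrier (M i))
      in quot_module T (gen_submodule T (tensor_relations I M)))"

text \<open>A graded vector space is a family of vector spaces indexed by degrees; the degrees are
  \<^typ>\<open>int\<close> or, for a bigrading, \<^typ>\<open>int \<times> int\<close>. Here \<open>\<kappa>\<close> distributes the degree \<open>k\<close> over the factors.\<close>

definition graded_tensor ::
    "'i set \<Rightarrow> ('i \<Rightarrow> 'd::comm_monoid_add \<Rightarrow> (rat, 'v) module) \<Rightarrow> 'd \<Rightarrow>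
     (rat, ('i \<Rightarrow> 'd) \<Rightarrow> (('i \<Rightarrow> 'v) \<Rightarrow>\<^sub>0 rat) set) module" where
  "graded_tensor I V k =
     direct_sum {\<kappa> \<in> I \<rightarrow>\<^sub>E UNIV. (\<Sum>i\<in>I. \<kappa> i) = k} (\<lambda>\<kappa>. tensor I (\<lambda>i. V i (\<kappa> i)))"

text \<open>The homology of \<open>d : B \<rightarrow> Z \<rightarrow> \<dots>\<close> at \<open>Z\<close>, where \<open>B\<close> and \<open>Z\<close> are consecutive homogeneous
  subspaces of \<open>M\<close>.\<close>

definition homology_at :: "(rat, 'v) module \<Rightarrow> ('v \<Rightarrow> 'v) \<Rightarrow> 'v set \<Rightarrow> 'v set \<Rightarrow> (rat, 'v set) module"
  where
  "homology_at M d B Z = quot_module (M\<lparr>carrier := {z\<in>Z. d z = \<zero>\<^bsub>M\<^esub>}\<rparr>) (d ` B)"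


section \<open>Reduced simplicial homology\<close>

text \<open>A complex is a set of finite sets closed under subsets, including the empty simplex, which
  spans the chains of degree \<open>-1\<close>. Simplices are oriented by a strict total order \<open>r\<close> of the vertices.\<close>

definition preceding :: "'v rel \<Rightarrow> 'v set \<Rightarrow> 'v \<Rightarrow> 'v set" where
  "preceding r T t = {u\<in>T. (u, t) \<in> r}"

definition simplicial_boundary :: "'v rel \<Rightarrow> ('v set \<Rightarrow>\<^sub>0 rat) \<Rightarrow> ('v set \<Rightarrow>\<^sub>0 rat)" where
  "simplicial_boundary r c = (\<Sum>\<sigma>\<in>Poly_Mapping.keys c. \<Sum>v\<in>\<sigma>.
     Poly_Mapping.single (\<sigma> - {v}) ((-1) ^ card (preceding r \<sigma> v) * Poly_Mapping.lookup c \<sigma>))"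

definition simplicial_chains :: "'v set set \<Rightarrow> int \<Rightarrow> ('v set \<Rightarrow>\<^sub>0 rat) set" where
  "simplicial_chains K i = {c. Poly_Mapping.keys c \<subseteq> {\<sigma>\<in>K. int (card \<sigma>) = i + 1}}"

definition reduced_homology :: "'v rel \<Rightarrow> 'v set set \<Rightarrow> int \<Rightarrow> (rat, ('v set \<Rightarrow>\<^sub>0 rat) set) module" where
  "reduced_homology r K i = homology_at (free_module K) (simplicial_boundary r)
     (simplicial_chains K (i + 1)) (simplicial_chains K i)"


section \<open>Polymatroids and building sets\<close>

locale polymatroid =
  fixes E :: "'a set" and cd :: "'a set \<Rightarrow> nat"
  assumes finite_ground: "finite E"
    and cd_empty: "cd {} = 0"
    and cd_mono: "A \<subseteq> B \<Longrightarrow> B \<subseteq> E \<Longrightarrow> cd A \<le> cd B"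
    and cd_submodular: "A \<subseteq> E \<Longrightarrow> B \<subseteq> E \<Longrightarrow> cd (A \<union> B) + cd (A \<inter> B) \<le> cd A + cd B"

definition pm_closure :: "'a set \<Rightarrow> ('a set \<Rightarrow> nat) \<Rightarrow> 'a set \<Rightarrow> 'a set" where
  "pm_closure E cd A = {a\<in>E. cd (A \<union> {a}) = cd A}"

definition flats :: "'a set \<Rightarrow> ('a set \<Rightarrow> nat) \<Rightarrow> 'a set gorder" where
  "flats E cd = \<lparr>carrier = {A. A \<subseteq> E \<and> pm_closure E cd A = A}, eq = (=), le = (\<subseteq>)\<rparr>"

definition max_elements :: "'a set set \<Rightarrow> 'a set set" where
  "max_elements X = {x\<in>X. \<not> (\<exists>y\<in>X. x \<subset> y)}"

definition factors :: "'a set set \<Rightarrow> 'a set \<Rightarrow> 'a set set" where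
  "factors G x = max_elements {y\<in>G. y \<subseteq> x}"

definition interval_lattice :: "'a gorder \<Rightarrow> 'a \<Rightarrow> 'a \<Rightarrow> 'a gorder" where
  "interval_lattice L a b = L\<lparr>carrier := \<lbrace>a..b\<rbrace>\<^bsub>L\<^esub>\<rparr>"

definition product_lattice :: "'i set \<Rightarrow> ('i \<Rightarrow> 'a gorder) \<Rightarrow> ('i \<Rightarrow> 'a) gorder" where
  "product_lattice I L = \<lparr>carrier = \<Pi>\<^sub>E i\<in>I. carrier (L i), eq = (=),
     le = (\<lambda>x y. \<forall>i\<in>I. x i \<sqsubseteq>\<^bsub>L i\<^esub> y i)\<rparr>"

definition lattice_iso :: "'a gorder \<Rightarrow> 'b gorder \<Rightarrow> ('a \<Rightarrow> 'b) \<Rightarrow> bool" where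
  "lattice_iso L M f \<longleftrightarrow> bij_betw f (carrier L) (carrier M) \<and> join_pres L M f \<and> meet_pres L M f"

definition building_set :: "'a set \<Rightarrow> ('a set \<Rightarrow> nat) \<Rightarrow> 'a set set \<Rightarrow> bool" where
  "building_set E cd G \<longleftrightarrow>
     (let L = flats E cd in
        G \<subseteq> carrier L - {\<bottom>\<^bsub>L\<^esub>} \<and>
        (\<forall>x\<in>carrier L.
           lattice_iso (product_lattice (factors G x) (\<lambda>y. interval_lattice L \<bottom>\<^bsub>L\<^esub> y))
             (interval_lattice L \<bottom>\<^bsub>L\<^esub> x) (\<lambda>z. \<Squnion>\<^bsub>L\<^esub> (z ` factors G x)) \<and>
           cd x = (\<Sum>y\<in>factors G x. cd y)))"

definition nested_sets :: "'a set \<Rightarrow> ('a set \<Rightarrow> nat) \<Rightarrow> 'a set set \<Rightarrow> 'a set set set" where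
  "nested_sets E cd G = {S. S \<subseteq> G \<and>
     (\<forall>A\<subseteq>S. card A \<ge> 2 \<and> (\<forall>g\<in>A. \<forall>h\<in>A. g \<noteq> h \<longrightarrow> \<not> g \<subseteq> h) \<longrightarrow> \<Squnion>\<^bsub>flats E cd\<^esub> A \<notin> G)}"

text \<open>The complex \<open>n((0,g), G)\<close>.\<close>

definition nested_below ::
    "'a set \<Rightarrow> ('a set \<Rightarrow> nat) \<Rightarrow> 'a set set \<Rightarrow> 'a set \<Rightarrow> 'a set set set" where
  "nested_below E cd G g = {S \<in> nested_sets E cd G. S \<subseteq> {h\<in>G. h \<subset> g}}"


section \<open>The Leray model\<close>

text \<open>
  The algebra \<open>\<Lambda>[e\<^sub>g] \<otimes> \<rat>[x\<^sub>g]\<close> is the free \<open>\<rat>[x\<^sub>g]\<close>-module on the monomials \<open>e\<^sub>T\<close> for \<open>T \<subseteq> G\<close>, so an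
  element maps \<open>T\<close> to the coefficient of \<open>e\<^sub>T\<close>. A polynomial in turn maps exponent vectors to rational
  coefficients. The product is determined by \<open>e\<^sub>S e\<^sub>T = \<plusminus>e\<^bsub>S \<union> T\<^esub>\<close> if \<open>S\<close> and \<open>T\<close> are disjoint and
  \<open>e\<^sub>S e\<^sub>T = 0\<close> otherwise, where the sign counts the transpositions that sort the product.
\<close>

type_synonym 'g polynomial = "('g \<Rightarrow>\<^sub>0 nat) \<Rightarrow>\<^sub>0 rat"
type_synonym 'g leray = "'g set \<Rightarrow>\<^sub>0 'g polynomial"

definition xvar :: "'g \<Rightarrow> 'g polynomial" where
  "xvar g = Poly_Mapping.single (Poly_Mapping.single g 1) 1"

definition xprod :: "'g set \<Rightarrow> 'g polynomial" where
  "xprod S = (\<Prod>s\<in>S. xvar s)"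

definition leray_mult :: "'g rel \<Rightarrow> 'g leray \<Rightarrow> 'g leray \<Rightarrow> 'g leray" where
  "leray_mult r \<omega> \<eta> = (\<Sum>S\<in>Poly_Mapping.keys \<omega>. \<Sum>T\<in>Poly_Mapping.keys \<eta>.
     if S \<inter> T = {}
     then Poly_Mapping.single (S \<union> T)
            ((-1) ^ card {(s, t). s \<in> S \<and> t \<in> T \<and> (t, s) \<in> r}
              * Poly_Mapping.lookup \<omega> S * Poly_Mapping.lookup \<eta> T)
     else 0)"

definition leray_algebra :: "'g set \<Rightarrow> 'g rel \<Rightarrow> (rat, 'g leray) module" where
  "leray_algebra G r = \<lparr>
     carrier = {\<omega>. \<forall>T\<in>Poly_Mapping.keys \<omega>. T \<subseteq> G \<and>
       (\<forall>m\<in>Poly_Mapping.keys (Poly_Mapping.lookup \<omega> T). Poly_Mapping.keys m \<subseteq> G)},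
     mult = leray_mult r, one = Poly_Mapping.single {} 1, zero = 0, add = (+),
     smult = (\<lambda>c. Poly_Mapping.map ((*) (Poly_Mapping.single 0 c)))\<rparr>"

text \<open>The graded derivation with \<open>d e\<^sub>g = x\<^sub>g\<close> and \<open>d x\<^sub>g = 0\<close>, expanded on the monomials \<open>e\<^sub>T\<close> by the
  graded Leibniz rule.\<close>

definition leray_d :: "'g rel \<Rightarrow> 'g leray \<Rightarrow> 'g leray" where
  "leray_d r \<omega> = (\<Sum>T\<in>Poly_Mapping.keys \<omega>. \<Sum>t\<in>T.
     Poly_Mapping.single (T - {t}) ((-1) ^ card (preceding r T t) * xvar t * Poly_Mapping.lookup \<omega> T))"

definition c_elem :: "'a set set \<Rightarrow> 'a set \<Rightarrow> 'a set polynomial" where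
  "c_elem G g = (\<Sum>h\<in>{h\<in>G. g \<subseteq> h}. xvar h)"

text \<open>The relations \<open>e\<^sub>T x\<^sub>S\<close> and \<open>e\<^sub>T x\<^sub>S c\<^sub>g\<^sup>b\<close>; the bound on \<open>b\<close> is written without natural number
  subtraction.\<close>

definition leray_relations ::
    "'a set \<Rightarrow> ('a set \<Rightarrow> nat) \<Rightarrow> 'a set set \<Rightarrow> 'a set leray set" where
  "leray_relations E cd G =
     {Poly_Mapping.single T (xprod S) | S T.
        S \<subseteq> G \<and> T \<subseteq> G \<and> S \<union> T \<notin> nested_sets E cd G}
   \<union> {Poly_Mapping.single T (xprod S * c_elem G g ^ b) | S T g b.
        S \<subseteq> G \<and> T \<subseteq> G \<and> g \<in> G \<and> cd g \<le> b + cd (\<Squnion>\<^bsub>flats E cd\<^esub> {h \<in> S \<union> T. h \<subset> g})}"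

definition leray_ideal ::
    "'a set \<Rightarrow> ('a set \<Rightarrow> nat) \<Rightarrow> 'a set set \<Rightarrow> 'a set rel \<Rightarrow> 'a set leray set" where
  "leray_ideal E cd G r = Idl\<^bsub>leray_algebra G r\<^esub> (leray_relations E cd G)"

definition leray_model ::
    "'a set \<Rightarrow> ('a set \<Rightarrow> nat) \<Rightarrow> 'a set set \<Rightarrow> 'a set rel \<Rightarrow> (rat, 'a set leray set) module" where
  "leray_model E cd G r = quot_module (leray_algebra G r) (leray_ideal E cd G r)"

text \<open>The differential induced by \<^const>\<open>leray_d\<close> on cosets.\<close>

definition leray_model_d ::
    "'a set \<Rightarrow> ('a set \<Rightarrow> nat) \<Rightarrow> 'a set set \<Rightarrow> 'a set rel \<Rightarrow> 'a set leray set \<Rightarrow> 'a set leray set"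
  where
  "leray_model_d E cd G r W =
     (\<Union>\<omega>\<in>W. leray_ideal E cd G r +>\<^bsub>leray_algebra G r\<^esub> leray_d r \<omega>)"

text \<open>For a set \<open>D\<close> of bidegrees, the sum of the homogeneous components of the quotient whose bidegree lies in \<open>D\<close>.\<close>

definition leray_model_part ::
    "'a set \<Rightarrow> ('a set \<Rightarrow> nat) \<Rightarrow> 'a set set \<Rightarrow> 'a set rel \<Rightarrow> (int \<times> int) set \<Rightarrow> 'a set leray set set"
  where
  "leray_model_part E cd G r D =
     (\<lambda>\<omega>. leray_ideal E cd G r +>\<^bsub>leray_algebra G r\<^esub> \<omega>) `
       {\<omega> \<in> carrier (leray_algebra G r).
          \<forall>T\<in>Poly_Mapping.keys \<omega>. \<forall>m\<in>Poly_Mapping.keys (Poly_Mapping.lookup \<omega> T).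
          (2 * int (\<Sum>g\<in>Poly_Mapping.keys m. Poly_Mapping.lookup m g), int (card T)) \<in> D}"


section \<open>The complex CM\<close>

definition CM_space ::
    "'a set \<Rightarrow> ('a set \<Rightarrow> nat) \<Rightarrow> 'a set set \<Rightarrow> (rat, 'a set set \<Rightarrow>\<^sub>0 rat) module" where
  "CM_space E cd G = free_module (nested_sets E cd G)"

definition CM_d :: "'a set rel \<Rightarrow> ('a set set \<Rightarrow>\<^sub>0 rat) \<Rightarrow> ('a set set \<Rightarrow>\<^sub>0 rat)" where
  "CM_d r v = (\<Sum>T\<in>Poly_Mapping.keys v. \<Sum>t\<in>T - max_elements T.
     Poly_Mapping.single (T - {t}) ((-1) ^ card (preceding r T t) * Poly_Mapping.lookup v T))"

definition CM_part ::
    "'a set \<Rightarrow> ('a set \<Rightarrow> nat) \<Rightarrow> 'a set set \<Rightarrow> (int \<times> int) set \<Rightarrow> ('a set set \<Rightarrow>\<^sub>0 rat) set" where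
  "CM_part E cd G D = {v \<in> carrier (CM_space E cd G). \<forall>T\<in>Poly_Mapping.keys v.
     (2 * (int (cd (\<Squnion>\<^bsub>flats E cd\<^esub> T)) - int (card T)), int (card T)) \<in> D}"


section \<open>The cohomology groups\<close>

text \<open>Both differentials have bidegree \<open>(2, -1)\<close>, hence total degree \<open>1\<close>.\<close>

definition total_degree :: "int \<Rightarrow> (int \<times> int) set" where
  "total_degree k = {(p, q). p + q = k}"

definition H_leray ::
    "'a set \<Rightarrow> ('a set \<Rightarrow> nat) \<Rightarrow> 'a set set \<Rightarrow> 'a set rel \<Rightarrow> int \<Rightarrow> (rat, 'a set leray set set) module"
  where
  "H_leray E cd G r k = homology_at (leray_model E cd G r) (leray_model_d E cd G r)
     (leray_model_part E cd G r (total_degree (k - 1)))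
     (leray_model_part E cd G r (total_degree k))"

definition bi_H_leray ::
    "'a set \<Rightarrow> ('a set \<Rightarrow> nat) \<Rightarrow> 'a set set \<Rightarrow> 'a set rel \<Rightarrow> int \<times> int \<Rightarrow>
     (rat, 'a set leray set set) module" where
  "bi_H_leray E cd G r pq = homology_at (leray_model E cd G r) (leray_model_d E cd G r)
     (leray_model_part E cd G r {pq - (2, -1)}) (leray_model_part E cd G r {pq})"

definition H_CM ::
    "'a set \<Rightarrow> ('a set \<Rightarrow> nat) \<Rightarrow> 'a set set \<Rightarrow> 'a set rel \<Rightarrow> int \<Rightarrow>
     (rat, ('a set set \<Rightarrow>\<^sub>0 rat) set) module" where
  "H_CM E cd G r k = homology_at (CM_space E cd G) (CM_d r)
     (CM_part E cd G (total_degree (k - 1))) (CM_part E cd G (total_degree k))"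

definition bi_H_CM ::
    "'a set \<Rightarrow> ('a set \<Rightarrow> nat) \<Rightarrow> 'a set set \<Rightarrow> 'a set rel \<Rightarrow> int \<times> int \<Rightarrow>
     (rat, ('a set set \<Rightarrow>\<^sub>0 rat) set) module" where
  "bi_H_CM E cd G r pq = homology_at (CM_space E cd G) (CM_d r)
     (CM_part E cd G {pq - (2, -1)}) (CM_part E cd G {pq})"

text \<open>The graded and bigraded vector spaces attached to \<open>g \<in> G\<close>: the former has
  \<open>H\<^bsub>2 cd g - 2 - k\<^esub>\<close> in degree \<open>k\<close>, the latter has \<open>H\<^sub>i\<close> in bidegree \<open>(2 (cd g - 2 - i), 2 + i)\<close>, and
  zero in the remaining bidegrees.\<close>

definition local_homology ::
    "'a set \<Rightarrow> ('a set \<Rightarrow> nat) \<Rightarrow> 'a set set \<Rightarrow> 'a set rel \<Rightarrow> 'a set \<Rightarrow> int \<Rightarrow>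
     (rat, ('a set set \<Rightarrow>\<^sub>0 rat) set) module" where
  "local_homology E cd G r g k =
     reduced_homology r (nested_below E cd G g) (2 * int (cd g) - 2 - k)"

definition bi_local_homology ::
    "'a set \<Rightarrow> ('a set \<Rightarrow> nat) \<Rightarrow> 'a set set \<Rightarrow> 'a set rel \<Rightarrow> 'a set \<Rightarrow> int \<times> int \<Rightarrow>
     (rat, int \<Rightarrow> ('a set set \<Rightarrow>\<^sub>0 rat) set) module" where
  "bi_local_homology E cd G r g pq =
     direct_sum {i. (2 * (int (cd g) - 2 - i), 2 + i) = pq}
       (\<lambda>i. reduced_homology r (nested_below E cd G g) i)"

end

theory Submission
  imports Defs
begin

text \<open>
  Grade the Leray algebra by \<open>e\<^sub>T\<close>: the ideal is a direct sum of ideals \<open>J\<^sub>T\<close> of the polynomial ring. For a nested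
  set \<open>T\<close> with join \<open>f\<close>, multiplying by the variables of the non-maximal elements of \<open>T\<close> and taking the degree in the
  Chow ring of \<open>[0, f]\<close> gives a functional \<open>deg\<^sub>T\<close> that kills \<open>J\<^sub>T\<close>. The degree map is described combinatorially:
  in the variables \<open>c\<^sub>g\<close> a monomial has degree 1 or 0 according to a Hall-Rado condition, and Moebius
  inversion extends this to products of variables \<open>x\<^sub>s\<close>. The functionals \<open>deg\<^sub>T\<close> assemble to a surjective chain map
  \<open>\<psi>\<close> from the Leray model to \<open>CM\<close>. Its kernel is acyclic: modulo monomials of smaller weight, the differential on
  standard monomials \<open>e\<^sub>T x\<^sup>m\<close> is a sum of Koszul differentials indexed by the vertices whose exponent in \<open>e\<^sub>T x\<^sup>m\<close>
  is not the maximal one, and is exact whenever there is such a vertex.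

  The complex \<open>CM\<close> splits over the joins \<open>f\<close> of nested sets, and the part of \<open>f\<close> is, up to sign and shift, the chain complex of the
  join of the complexes \<open>n((0, g), G)\<close> over the factors \<open>g\<close> of \<open>f\<close>. Contracting each of these onto its homology by Gaussian
  elimination contracts the join, so all spaces in question have bases indexed by the same nested sets.
\<close>

section \<open>Flats and factors\<close>

text \<open>The obstacle is linear independence. Rewriting with the relations shows that standard
  monomials span \<open>PG\<close> modulo \<open>JI T\<close>, but the acyclicity argument also
  needs that no nontrivial combination of them lies in \<open>JI T\<close>. In place of a confluence
  check, functionals that vanish on \<open>JI T\<close> separate them. All of these come from
  \<open>dg\<close>: to read off the coefficient of a standard e_T x^m, enlarge T by the support of
  m, multiply by the complementary monomial and apply \<open>dg\<close>. So the hard input is one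
  functional per nested set that kills the ideal and is nonzero on the top monomial. It is defined
  in the coordinates c_g because there vanishing is an inequality for \<open>cd\<close>; the price
  is to understand the x_s, the Moebius inverses of the c_g, and this is where submodularity enters,
  through the uncrossing of tight flats.

  The weight is chosen so that x_g^b leads c_g^b; acyclicity is proved by clearing one weight at a
  time.

  Only isomorphisms of vector spaces are claimed, so no natural map to the tensor products is built:
  every space receives a basis indexed by the same finite set \<open>critical\<close> of nested
  sets, cut down to the degree in question.\<close>

context polymatroid
begin

abbreviation Fl :: "'a set set" where "Fl \<equiv> carrier (flats E cd)"
abbreviation cl :: "'a set \<Rightarrow> 'a set" where "cl \<equiv> pm_closure E cd"
abbreviation jn :: "'a set set \<Rightarrow> 'a set" where "jn A \<equiv> cl (\<Union>A)"

lemma closure_subset: "cl A \<subseteq> E"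
  by (auto simp: pm_closure_def)

lemma subset_closure: "A \<subseteq> E \<Longrightarrow> A \<subseteq> cl A"
  by (auto simp: pm_closure_def insert_absorb)

text \<open>Closure points are added one at a time: submodularity for \<open>A \<union> B\<close>
  and \<open>insert b A\<close> bounds the increase by that of adding \<open>b\<close> to
  \<open>A\<close> alone, which is zero. This makes \<open>cl\<close> a closure operator that
  preserves \<open>cd\<close>.\<close>

lemma cd_union_closure:
  assumes "A \<subseteq> E" "finite B" "B \<subseteq> cl A"
  shows "cd (A \<union> B) = cd A"
  using assms(2,3)
proof (induction B rule: finite_induct)
  case (insert b B)
  have sub: "A \<union> B \<subseteq> E" "insert b A \<subseteq> E"
    using assms(1) insert.prems closure_subset[of A] by auto
  have "cd ((A \<union> B) \<union> insert b A) + cd ((A \<union> B) \<inter> insert b A) \<le> cd (A \<union> B) + cd (insert b A)"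
    using sub by (rule cd_submodular)
  moreover have "cd A \<le> cd ((A \<union> B) \<inter> insert b A)"
    using sub by (intro cd_mono) auto
  moreover have "cd (insert b A) = cd A" using insert.prems by (auto simp: pm_closure_def)
  moreover have "cd A \<le> cd (A \<union> insert b B)" using sub by (intro cd_mono) auto
  moreover have "(A \<union> B) \<union> insert b A = A \<union> insert b B" by auto
  ultimately show ?case using insert by auto
qed auto

lemma cd_closure: "A \<subseteq> E \<Longrightarrow> cd (cl A) = cd A"
  using cd_union_closure[of A "cl A"] subset_closure[of A] closure_subset[of A] finite_ground
  by (metis Un_absorb1 finite_subset order_refl)

lemma closure_mono: "A \<subseteq> B \<Longrightarrow> B \<subseteq> E \<Longrightarrow> cl A \<subseteq> cl B"
proof
  fix x assume AB: "A \<subseteq> B" "B \<subseteq> E" and x: "x \<in> cl A"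
  have xE: "x \<in> E" and cx: "cd (A \<union> {x}) = cd A" using x by (auto simp: pm_closure_def)
  have "cd (B \<union> (A \<union> {x})) + cd (B \<inter> (A \<union> {x})) \<le> cd B + cd (A \<union> {x})"
    using AB xE by (intro cd_submodular) auto
  moreover have "cd A \<le> cd (B \<inter> (A \<union> {x}))" using AB xE by (intro cd_mono) auto
  moreover have "cd B \<le> cd (B \<union> {x})" using AB xE by (intro cd_mono) auto
  moreover have "B \<union> (A \<union> {x}) = B \<union> {x}" using AB by auto
  ultimately show "x \<in> cl B" using cx xE by (auto simp: pm_closure_def)
qed

lemma closure_idem: "A \<subseteq> E \<Longrightarrow> cl (cl A) = cl A"
proof
  assume A: "A \<subseteq> E"
  show "cl A \<subseteq> cl (cl A)" using subset_closure closure_subset by blast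
  show "cl (cl A) \<subseteq> cl A"
  proof
    fix x assume x: "x \<in> cl (cl A)"
    then have xE: "x \<in> E" and "cd (cl A \<union> {x}) = cd (cl A)" by (auto simp: pm_closure_def)
    then have "cd (cl A \<union> {x}) = cd A" using cd_closure A by simp
    moreover have "cd (A \<union> {x}) \<le> cd (cl A \<union> {x})"
      using subset_closure[OF A] closure_subset[of A] xE by (intro cd_mono) auto
    moreover have "cd A \<le> cd (A \<union> {x})" using A xE by (intro cd_mono) auto
    ultimately show "x \<in> cl A" using xE by (auto simp: pm_closure_def)
  qed
qed

lemma Fl_iff: "x \<in> Fl \<longleftrightarrow> x \<subseteq> E \<and> cl x = x"
  by (auto simp: flats_def)

lemma Fl_subset: "x \<in> Fl \<Longrightarrow> x \<subseteq> E"
  by (simp add: Fl_iff)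

lemma Fl_closure: "A \<subseteq> E \<Longrightarrow> cl A \<in> Fl"
  by (simp add: Fl_iff closure_idem closure_subset)

lemma finite_Fl: "finite Fl"
  by (rule finite_subset[of _ "Pow E"]) (auto simp: Fl_iff finite_ground)

lemma closure_least: "A \<subseteq> y \<Longrightarrow> y \<in> Fl \<Longrightarrow> cl A \<subseteq> y"
  using closure_mono[of A y] by (simp add: Fl_iff)

lemma Fl_Int: "x \<in> Fl \<Longrightarrow> y \<in> Fl \<Longrightarrow> x \<inter> y \<in> Fl"
proof -
  assume x: "x \<in> Fl" and y: "y \<in> Fl"
  have "cl (x \<inter> y) \<subseteq> x \<inter> y" using closure_least[of "x \<inter> y" x] closure_least[of "x \<inter> y" y] x y by auto
  moreover have "x \<inter> y \<subseteq> E" using x Fl_subset by blast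
  ultimately show ?thesis using subset_closure[of "x \<inter> y"] by (auto simp: Fl_iff)
qed

text \<open>A point of \<open>y\<close> outside the flat \<open>x\<close> must raise
  \<open>cd\<close>, since otherwise it would lie in \<open>cl x\<close>. The positivity of
  \<open>dgap\<close> rests on this.\<close>

lemma cd_strict: "x \<in> Fl \<Longrightarrow> y \<in> Fl \<Longrightarrow> x \<subset> y \<Longrightarrow> cd x < cd y"
proof (rule ccontr)
  assume x: "x \<in> Fl" and y: "y \<in> Fl" and xy: "x \<subset> y" and n: "\<not> cd x < cd y"
  obtain a where a: "a \<in> y" "a \<notin> x" using xy by auto
  have "cd x \<le> cd (x \<union> {a})" "cd (x \<union> {a}) \<le> cd y" using a xy Fl_subset[OF y] by (auto intro!: cd_mono)
  then have "a \<in> cl x" using n a Fl_subset[OF y] by (auto simp: pm_closure_def)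
  then show False using a x by (simp add: Fl_iff)
qed

lemma cd_le: "x \<subseteq> y \<Longrightarrow> y \<in> Fl \<Longrightarrow> cd x \<le> cd y"
  using cd_mono Fl_subset by blast

lemma Union_Fl_subset: "A \<subseteq> Fl \<Longrightarrow> \<Union>A \<subseteq> E"
  using Fl_subset by blast

lemma jn_Fl: "A \<subseteq> Fl \<Longrightarrow> jn A \<in> Fl"
  using Fl_closure Union_Fl_subset by blast

lemma jn_upper: "A \<subseteq> Fl \<Longrightarrow> x \<in> A \<Longrightarrow> x \<subseteq> jn A"
  using subset_closure[OF Union_Fl_subset[of A]] by auto

lemma jn_least: "(\<And>x. x \<in> A \<Longrightarrow> x \<subseteq> y) \<Longrightarrow> y \<in> Fl \<Longrightarrow> jn A \<subseteq> y"
  by (rule closure_least) auto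

lemma jn_mono: "A \<subseteq> B \<Longrightarrow> B \<subseteq> Fl \<Longrightarrow> jn A \<subseteq> jn B"
  by (meson closure_mono Union_Fl_subset Union_mono)

lemma jn_singleton: "x \<in> Fl \<Longrightarrow> jn {x} = x"
  by (simp add: Fl_iff)

lemma bot_least: "x \<in> Fl \<Longrightarrow> cl {} \<subseteq> x"
  by (rule closure_least) auto

lemma bot_Fl: "cl {} \<in> Fl"
  by (rule Fl_closure) auto

lemma cd_bot: "cd (cl {}) = 0"
  using cd_closure[of "{}"] cd_empty by simp

text \<open>\<open>sup\<close> is a choice among least upper bounds, so its value is pinned down by
  uniqueness. Inside the proof every join is the concrete set \<open>jn A\<close>.\<close>

lemma sup_flats: "A \<subseteq> Fl \<Longrightarrow> \<Squnion>\<^bsub>flats E cd\<^esub> A = jn A"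
proof -
  assume A: "A \<subseteq> Fl"
  have le: "le (flats E cd) = (\<subseteq>)" by (simp add: flats_def)
  have U: "z \<in> Upper (flats E cd) A \<longleftrightarrow> z \<in> Fl \<and> (\<forall>x\<in>A. x \<subseteq> z)" for z
    using A by (auto simp: Upper_def le)
  have "jn A \<in> Upper (flats E cd) A" unfolding U using jn_Fl[OF A] jn_upper[OF A] by blast
  moreover have "jn A \<subseteq> z" if "z \<in> Upper (flats E cd) A" for z
    using that unfolding U by (intro jn_least) auto
  moreover have "Upper (flats E cd) A \<subseteq> Fl" using U by blast
  ultimately have "least (flats E cd) (jn A) (Upper (flats E cd) A)" unfolding least_def le by blast
  moreover have "z = jn A" if "least (flats E cd) z (Upper (flats E cd) A)" for z
    using that calculation unfolding least_def le by (meson subset_antisym)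
  ultimately show ?thesis unfolding sup_def by (rule some_equality)
qed

lemma bottom_flats: "\<bottom>\<^bsub>flats E cd\<^esub> = cl {}"
proof -
  have le: "le (flats E cd) = (\<subseteq>)" by (simp add: flats_def)
  have l: "least (flats E cd) (cl {}) Fl"
    unfolding least_def le using bot_Fl bot_least by auto
  moreover have "z = cl {}" if "least (flats E cd) z Fl" for z
    using that l unfolding least_def le by (meson subset_antisym)
  ultimately show ?thesis unfolding bottom_def by (rule some_equality)
qed

lemma cd_join_meet: "x \<in> Fl \<Longrightarrow> y \<in> Fl \<Longrightarrow> cd (jn {x, y}) + cd (x \<inter> y) \<le> cd x + cd y"
  using cd_submodular[of x y] cd_closure[of "x \<union> y"] Fl_subset by auto

end

section \<open>Building sets and the product decomposition of intervals\<close>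

locale building_polymatroid = polymatroid E cd for E :: "'a set" and cd :: "'a set \<Rightarrow> nat" +
  fixes G :: "'a set set" and r :: "'a set rel"
  assumes building: "building_set E cd G"
    and linear: "strict_linear_order_on G r"
    and extends: "g \<in> G \<Longrightarrow> h \<in> G \<Longrightarrow> g \<subset> h \<Longrightarrow> (g, h) \<in> r"
begin

abbreviation Fc :: "'a set \<Rightarrow> 'a set set" where "Fc \<equiv> factors G"
abbreviation NS :: "'a set set set" where "NS \<equiv> nested_sets E cd G"

lemma G_Fl: "G \<subseteq> Fl" and bot_notin_G: "cl {} \<notin> G"
  using building by (auto simp: building_set_def Let_def bottom_flats)

lemma G_FlD: "g \<in> G \<Longrightarrow> g \<in> Fl"
  using G_Fl by blast

lemma finite_G: "finite G"
  using finite_Fl G_Fl finite_subset by blast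

lemma G_not_bot: "g \<in> G \<Longrightarrow> x \<in> Fl \<Longrightarrow> g \<subseteq> x \<Longrightarrow> x \<noteq> cl {}"
  using bot_notin_G bot_least G_FlD by (metis subset_antisym)

lemma Fc_G: "Fc x \<subseteq> G" and Fc_le: "y \<in> Fc x \<Longrightarrow> y \<subseteq> x"
  by (auto simp: factors_def max_elements_def)

lemma Fc_Fl: "Fc x \<subseteq> Fl"
  using Fc_G G_Fl by blast

lemma Fc_mem_iff: "y \<in> Fc x \<longleftrightarrow> y \<in> G \<and> y \<subseteq> x \<and> (\<forall>y'\<in>G. y' \<subseteq> x \<longrightarrow> \<not> y \<subset> y')"
  by (auto simp: factors_def max_elements_def)

lemma Fc_FlD: "y \<in> Fc x \<Longrightarrow> y \<in> Fl"
  using Fc_Fl by blast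

lemma finite_Fc: "finite (Fc x)"
  using Fc_G finite_G finite_subset by blast

lemma Fc_above_ex:
  assumes "h \<in> G" "h \<subseteq> x" shows "\<exists>y\<in>Fc x. h \<subseteq> y"
proof -
  let ?A = "{y \<in> G. y \<subseteq> x \<and> h \<subseteq> y}"
  have "finite ?A" "?A \<noteq> {}" using finite_G assms by auto
  then obtain m where m: "m \<in> ?A" "\<forall>b\<in>?A. m \<subseteq> b \<longrightarrow> m = b" using finite_has_maximal[of ?A] by auto
  have "\<not> m \<subset> y" if "y \<in> G" "y \<subseteq> x" for y
    using m(1) m(2)[rule_format, of y] that by auto
  then have "m \<in> Fc x" using m(1) by (auto simp: factors_def max_elements_def)
  then show ?thesis using m by blast
qed

text \<open>The form in which the product decomposition is used: injectivity compares tuples after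
  joining, surjectivity gives every flat below \<open>x\<close> its coordinates.\<close>

lemma factor_bij:
  assumes "x \<in> Fl"
  shows "bij_betw (\<lambda>z. jn (z ` Fc x)) (\<Pi>\<^sub>E y\<in>Fc x. {u \<in> Fl. u \<subseteq> y}) {u \<in> Fl. u \<subseteq> x}"
proof -
  have le: "le (flats E cd) = (\<subseteq>)" by (simp add: flats_def)
  have ivl: "carrier (interval_lattice (flats E cd) \<bottom>\<^bsub>flats E cd\<^esub> y) = {u \<in> Fl. u \<subseteq> y}" for y
    by (auto simp: interval_lattice_def at_least_at_most_def le bottom_flats dest: bot_least)
  have "bij_betw (\<lambda>z. \<Squnion>\<^bsub>flats E cd\<^esub> (z ` Fc x)) (\<Pi>\<^sub>E y\<in>Fc x. {u \<in> Fl. u \<subseteq> y}) {u \<in> Fl. u \<subseteq> x}"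
    using building assms unfolding building_set_def Let_def lattice_iso_def
    by (auto simp: product_lattice_def ivl)
  moreover have "\<Squnion>\<^bsub>flats E cd\<^esub> (z ` Fc x) = jn (z ` Fc x)" if "z \<in> (\<Pi>\<^sub>E y\<in>Fc x. {u \<in> Fl. u \<subseteq> y})" for z
    by (rule sup_flats) (use that in auto)
  ultimately show ?thesis by (simp cong: bij_betw_cong)
qed

lemma cd_factors: "x \<in> Fl \<Longrightarrow> cd x = (\<Sum>y\<in>Fc x. cd y)"
  using building by (auto simp: building_set_def Let_def)

text \<open>Placing \<open>y1 \<inter> y2\<close> at coordinate \<open>y1\<close> or at coordinate
  \<open>y2\<close>, with the bottom elsewhere, gives two tuples with the same join. Injectivity
  makes them equal, so the common entry is the bottom.\<close>

lemma Fc_disjoint: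
  assumes x: "x \<in> Fl" and y: "y1 \<in> Fc x" "y2 \<in> Fc x" "y1 \<noteq> y2"
  shows "y1 \<inter> y2 = cl {}"
proof -
  define z where "z y = (\<lambda>u\<in>Fc x. if u = y then y1 \<inter> y2 else cl {})" for y
  have Fl: "y1 \<inter> y2 \<in> Fl" using y Fc_Fl Fl_Int by blast
  have zin: "z y \<in> (\<Pi>\<^sub>E y\<in>Fc x. {u \<in> Fl. u \<subseteq> y})" if "y = y1 \<or> y = y2" for y
  proof -
    have "cl {} \<subseteq> u" if "u \<in> Fc x" for u using bot_least[OF Fc_FlD[OF that]] .
    then have "z y u \<in> Fl \<and> z y u \<subseteq> u" if "u \<in> Fc x" for u
      using that \<open>y = y1 \<or> y = y2\<close> Fl bot_Fl by (cases "u = y") (auto simp: z_def)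
    then show ?thesis by (auto simp: z_def)
  qed
  have j: "jn (z y ` Fc x) = y1 \<inter> y2" if "y \<in> Fc x" for y
  proof
    show "jn (z y ` Fc x) \<subseteq> y1 \<inter> y2"
      using Fl bot_least[OF Fl] by (intro jn_least) (auto simp: z_def split: if_splits)
    have "z y ` Fc x \<subseteq> Fl" using Fl bot_Fl by (auto simp: z_def)
    moreover have "y1 \<inter> y2 \<in> z y ` Fc x" using that by (auto simp: z_def)
    ultimately show "y1 \<inter> y2 \<subseteq> jn (z y ` Fc x)" by (rule jn_upper)
  qed
  have "z y1 = z y2"
    by (rule inj_onD[OF bij_betw_imp_inj_on[OF factor_bij[OF x]]]) (use zin j y in auto)
  then have "z y1 y1 = z y2 y1" by simp
  then show ?thesis using y by (simp add: z_def)
qed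

lemma Fc_unique:
  assumes "x \<in> Fl" "y1 \<in> Fc x" "y2 \<in> Fc x" "h \<in> G" "h \<subseteq> y1" "h \<subseteq> y2"
  shows "y1 = y2"
proof (rule ccontr)
  assume "y1 \<noteq> y2"
  then have "h \<subseteq> cl {}" using Fc_disjoint assms by blast
  then show False using G_not_bot[OF assms(4) bot_Fl] by blast
qed

text \<open>The tuple of meets of the join with the factors lies above \<open>z\<close> and below
  the join, so it has the same join as \<open>z\<close>; injectivity identifies the two. Coordinates
  are therefore computed by meeting with the factors.\<close>

lemma factor_join_meet:
  assumes x: "x \<in> Fl" and z: "\<And>y. y \<in> Fc x \<Longrightarrow> z y \<in> Fl \<and> z y \<subseteq> y" and y: "y \<in> Fc x"
  shows "jn (z ` Fc x) \<inter> y = z y"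
proof -
  let ?j = "jn (z ` Fc x)"
  define z' where "z' = (\<lambda>y\<in>Fc x. ?j \<inter> y)"
  define z1 where "z1 = restrict z (Fc x)"
  have sub: "z ` Fc x \<subseteq> Fl" using z by auto
  have up: "z y \<subseteq> ?j" if "y \<in> Fc x" for y using jn_upper[OF sub] that by auto
  have jFl: "?j \<in> Fl" using jn_Fl sub by blast
  have im: "z1 ` Fc x = z ` Fc x" by (auto simp: z1_def)
  have sub': "z' ` Fc x \<subseteq> Fl" using Fl_Int[OF jFl Fc_FlD] by (auto simp: z'_def)
  have "jn (z' ` Fc x) = ?j"
  proof
    show "jn (z' ` Fc x) \<subseteq> ?j" using jFl by (intro jn_least) (auto simp: z'_def)
    show "?j \<subseteq> jn (z' ` Fc x)"
    proof (rule jn_least)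
      fix u assume "u \<in> z ` Fc x"
      then obtain y where y: "y \<in> Fc x" "u = z y" by auto
      then have "u \<subseteq> z' y" using up z by (auto simp: z'_def)
      also have "\<dots> \<subseteq> jn (z' ` Fc x)" using jn_upper[OF sub'] y by auto
      finally show "u \<subseteq> jn (z' ` Fc x)" .
    qed (use jn_Fl sub' in blast)
  qed
  then have "jn (z' ` Fc x) = jn (z1 ` Fc x)" using im by simp
  moreover have "z' \<in> (\<Pi>\<^sub>E y\<in>Fc x. {u \<in> Fl. u \<subseteq> y})" using sub' by (auto simp: z'_def)
  moreover have "z1 \<in> (\<Pi>\<^sub>E y\<in>Fc x. {u \<in> Fl. u \<subseteq> y})" using z by (auto simp: z1_def)
  ultimately have "z' = z1" by (rule inj_onD[OF bij_betw_imp_inj_on[OF factor_bij[OF x]]])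
  then have "z' y = z1 y" by simp
  then show ?thesis using y by (simp add: z'_def z1_def)
qed

lemma factor_decomp:
  assumes x: "x \<in> Fl" and u: "u \<in> Fl" "u \<subseteq> x"
  shows "jn ((\<lambda>y. u \<inter> y) ` Fc x) = u"
proof
  have sub: "(\<lambda>y. u \<inter> y) ` Fc x \<subseteq> Fl" using Fl_Int[OF u(1) Fc_FlD] by auto
  show "jn ((\<lambda>y. u \<inter> y) ` Fc x) \<subseteq> u" using u by (intro jn_least) auto
  have "u \<in> (\<lambda>z. jn (z ` Fc x)) ` (\<Pi>\<^sub>E y\<in>Fc x. {u \<in> Fl. u \<subseteq> y})"
    using factor_bij[OF x] u unfolding bij_betw_def by simp
  then obtain z where z: "z \<in> (\<Pi>\<^sub>E y\<in>Fc x. {u \<in> Fl. u \<subseteq> y})" "u = jn (z ` Fc x)" by auto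
  have zs: "z ` Fc x \<subseteq> Fl" using z(1) by auto
  show "u \<subseteq> jn ((\<lambda>y. u \<inter> y) ` Fc x)"
    unfolding z(2)
  proof (rule jn_least)
    fix v assume "v \<in> z ` Fc x"
    then obtain y where y: "y \<in> Fc x" "v = z y" by auto
    then have "v \<subseteq> u \<inter> y" using z jn_upper[OF zs, of v] by auto
    also have "\<dots> \<subseteq> jn ((\<lambda>y. u \<inter> y) ` Fc x)" using jn_upper[OF sub] y by blast
    finally show "v \<subseteq> jn ((\<lambda>y. jn (z ` Fc x) \<inter> y) ` Fc x)" by (simp add: z(2))
  qed (use jn_Fl[OF sub] z(2) in simp)
qed

text \<open>An element of \<open>G\<close> below \<open>u\<close> that contains an element of
  \<open>G\<close> below \<open>y\<close> is itself below \<open>y\<close>, because the factor of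
  \<open>x\<close> above the smaller one is unique. So maximality below \<open>u\<close> and below
  \<open>u \<inter> y\<close> agree for elements below \<open>y\<close>.\<close>

lemma Fc_meet:
  assumes x: "x \<in> Fl" and u: "u \<in> Fl" "u \<subseteq> x" and y: "y \<in> Fc x"
  shows "Fc (u \<inter> y) = {g \<in> Fc u. g \<subseteq> y}"
proof -
  have yx: "y \<subseteq> x" using y Fc_le by blast
  have yy: "g' \<subseteq> y" if H: "g \<in> G" "g \<subseteq> y" "g' \<in> G" "g \<subseteq> g'" "g' \<subseteq> u" for g g'
  proof -
    have "g' \<subseteq> x" using H u by blast
    then obtain y' where y': "y' \<in> Fc x" "g' \<subseteq> y'" using Fc_above_ex[of g' x] H u by auto
    then have "y' = y" using Fc_unique[OF x y'(1) y that(1)] that by auto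
    then show ?thesis using y' by simp
  qed
  show ?thesis
  proof (intro equalityI subsetI)
    fix g assume g: "g \<in> Fc (u \<inter> y)"
    have "\<not> g \<subset> g'" if "g' \<in> G" "g' \<subseteq> u" for g'
      using g yy[of g g'] that unfolding Fc_mem_iff by blast
    then show "g \<in> {g \<in> Fc u. g \<subseteq> y}" using g unfolding Fc_mem_iff by blast
  next
    fix g assume "g \<in> {g \<in> Fc u. g \<subseteq> y}"
    then show "g \<in> Fc (u \<inter> y)" unfolding Fc_mem_iff by blast
  qed
qed

text \<open>The building set axiom gives additivity along the factors of \<open>u\<close>. These are
  distributed among the factors of \<open>x\<close>, and the share of \<open>y\<close> is the factor
  set of \<open>u \<inter> y\<close>.\<close>

lemma cd_meet_sum:
  assumes x: "x \<in> Fl" and u: "u \<in> Fl" "u \<subseteq> x"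
  shows "cd u = (\<Sum>y\<in>Fc x. cd (u \<inter> y))"
proof -
  have "(\<Sum>y\<in>Fc x. cd (u \<inter> y)) = (\<Sum>y\<in>Fc x. \<Sum>g\<in>{g \<in> Fc u. g \<subseteq> y}. cd g)"
  proof (rule sum.cong)
    fix y assume y: "y \<in> Fc x"
    then have "u \<inter> y \<in> Fl" using u Fc_Fl Fl_Int by blast
    then show "cd (u \<inter> y) = (\<Sum>g\<in>{g \<in> Fc u. g \<subseteq> y}. cd g)"
      using cd_factors Fc_meet[OF x u y] by simp
  qed auto
  also have "\<dots> = (\<Sum>g\<in>(\<Union>y\<in>Fc x. {g \<in> Fc u. g \<subseteq> y}). cd g)"
  proof (rule sum.UNION_disjoint[symmetric])
    show "\<forall>i\<in>Fc x. \<forall>j\<in>Fc x. i \<noteq> j \<longrightarrow> {g \<in> Fc u. g \<subseteq> i} \<inter> {g \<in> Fc u. g \<subseteq> j} = {}"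
      using Fc_unique[OF x] Fc_G by blast
  qed (auto simp: finite_Fc)
  also have "(\<Union>y\<in>Fc x. {g \<in> Fc u. g \<subseteq> y}) = Fc u"
  proof
    show "Fc u \<subseteq> (\<Union>y\<in>Fc x. {g \<in> Fc u. g \<subseteq> y})"
    proof
      fix g assume g: "g \<in> Fc u"
      then have "g \<in> G" "g \<subseteq> x" using Fc_G Fc_le u by (blast, blast)
      then show "g \<in> (\<Union>y\<in>Fc x. {g \<in> Fc u. g \<subseteq> y})" using Fc_above_ex[of g x] g by blast
    qed
  qed auto
  also have "(\<Sum>g\<in>Fc u. cd g) = cd u" using cd_factors u by simp
  finally show ?thesis by simp
qed

lemma jn_Fc: "x \<in> Fl \<Longrightarrow> jn (Fc x) = x"
proof -
  assume x: "x \<in> Fl"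
  have "(\<lambda>y. x \<inter> y) ` Fc x = (\<lambda>y. y) ` Fc x" using Fc_le by (intro image_cong) auto
  then have "(\<lambda>y. x \<inter> y) ` Fc x = Fc x" by simp
  then show ?thesis using factor_decomp[OF x x order_refl] by (simp only:)
qed

section \<open>Nested sets\<close>

lemma max_subset: "max_elements T \<subseteq> T"
  by (auto simp: max_elements_def)

lemma max_above: "finite T \<Longrightarrow> t \<in> T \<Longrightarrow> \<exists>m\<in>max_elements T. t \<subseteq> m"
proof -
  assume "finite T" "t \<in> T"
  then obtain m where m: "m \<in> {u \<in> T. t \<subseteq> u}" "\<forall>b\<in>{u \<in> T. t \<subseteq> u}. m \<subseteq> b \<longrightarrow> m = b"
    using finite_has_maximal[of "{u \<in> T. t \<subseteq> u}"] by auto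
  then have "\<not> m \<subset> b" if "b \<in> T" for b using that m(2)[rule_format, of b] by auto
  then have "m \<in> max_elements T" using m(1) by (auto simp: max_elements_def)
  then show ?thesis using m(1) by auto
qed

lemma NS_G: "T \<in> NS \<Longrightarrow> T \<subseteq> G"
  by (auto simp: nested_sets_def)

lemma NS_Fl: "T \<in> NS \<Longrightarrow> T \<subseteq> Fl"
  using NS_G G_Fl by blast

lemma NS_finite: "T \<in> NS \<Longrightarrow> finite T"
  using NS_G finite_G finite_subset by blast

lemma finite_NS: "finite NS"
  by (rule finite_subset[of _ "Pow G"]) (use NS_G finite_G in auto)

lemma NS_subset: "T \<in> NS \<Longrightarrow> S \<subseteq> T \<Longrightarrow> S \<in> NS"
  by (auto simp: nested_sets_def)

lemma NS_I:
  assumes "T \<subseteq> G"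
    and "\<And>A. A \<subseteq> T \<Longrightarrow> 2 \<le> card A \<Longrightarrow> (\<And>g h. g \<in> A \<Longrightarrow> h \<in> A \<Longrightarrow> g \<subseteq> h \<Longrightarrow> g = h) \<Longrightarrow> jn A \<in> G \<Longrightarrow> False"
  shows "T \<in> NS"
proof -
  have "\<Squnion>\<^bsub>flats E cd\<^esub> A = jn A" if "A \<subseteq> T" for A using that assms(1) G_Fl sup_flats by blast
  then have "\<Squnion>\<^bsub>flats E cd\<^esub> A \<notin> G"
    if "A \<subseteq> T" "2 \<le> card A" "\<forall>g\<in>A. \<forall>h\<in>A. g \<noteq> h \<longrightarrow> \<not> g \<subseteq> h" for A
    using that assms(2)[of A] by metis
  then show ?thesis using assms(1) unfolding nested_sets_def by blast
qed

lemma NS_D: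
  assumes "T \<in> NS" "A \<subseteq> T" "2 \<le> card A" "\<And>g h. g \<in> A \<Longrightarrow> h \<in> A \<Longrightarrow> g \<subseteq> h \<Longrightarrow> g = h"
  shows "jn A \<notin> G"
proof -
  have "\<Squnion>\<^bsub>flats E cd\<^esub> A = jn A" using assms(1,2) NS_Fl sup_flats by blast
  moreover have "\<Squnion>\<^bsub>flats E cd\<^esub> A \<notin> G"
  proof -
    have "\<forall>g\<in>A. \<forall>h\<in>A. g \<noteq> h \<longrightarrow> \<not> g \<subseteq> h" using assms(4) by blast
    then show ?thesis using assms(1-3) unfolding nested_sets_def by blast
  qed
  ultimately show ?thesis by simp
qed

lemma NS_empty: "{} \<in> NS"
  by (rule NS_I) auto

lemma jn_max: "T \<in> NS \<Longrightarrow> jn (max_elements T) = jn T"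
proof
  assume T: "T \<in> NS"
  have m: "max_elements T \<subseteq> Fl" using T NS_Fl max_subset by blast
  show "jn (max_elements T) \<subseteq> jn T" using jn_mono max_subset NS_Fl[OF T] by blast
  show "jn T \<subseteq> jn (max_elements T)"
  proof (rule jn_least)
    fix t assume "t \<in> T"
    then obtain u where "u \<in> max_elements T" "t \<subseteq> u" using max_above NS_finite[OF T] by blast
    then show "t \<subseteq> jn (max_elements T)" using jn_upper[OF m] by blast
  qed (use m jn_Fl in blast)
qed

lemma card_ge2: "a \<in> A \<Longrightarrow> b \<in> A \<Longrightarrow> a \<noteq> b \<Longrightarrow> finite A \<Longrightarrow> 2 \<le> card A"
proof -
  assume "a \<in> A" "b \<in> A" "a \<noteq> b" "finite A"
  then have "card {a, b} \<le> card A" by (intro card_mono) auto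
  then show ?thesis using \<open>a \<noteq> b\<close> by simp
qed

text \<open>Group the maximal elements of \<open>T\<close> by the factor above them. The product
  decomposition forces each group to join to its factor, which lies in \<open>G\<close>; nestedness
  then allows one element per group. This is the bridge between nested sets and factors.\<close>

lemma NS_factors:
  assumes T: "T \<in> NS"
  shows "Fc (jn T) = max_elements T"
proof -
  let ?M = "max_elements T" and ?f = "jn T"
  have MT: "?M \<subseteq> T" by (rule max_subset)
  have MFl: "?M \<subseteq> Fl" and MG: "?M \<subseteq> G" using T NS_Fl NS_G MT by blast+
  have fFl: "?f \<in> Fl" using T NS_Fl jn_Fl by blast
  have anti: "g = h" if "g \<in> ?M" "h \<in> ?M" "g \<subseteq> h" for g h using that by (auto simp: max_elements_def)
  define z where "z y = jn {m \<in> ?M. m \<subseteq> y}" for y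
  have zp: "z y \<in> Fl \<and> z y \<subseteq> y" if "y \<in> Fc ?f" for y
  proof
    show "z y \<in> Fl" unfolding z_def by (rule jn_Fl) (use MFl in blast)
    show "z y \<subseteq> y" unfolding z_def by (rule jn_least) (use Fc_FlD[OF that] in auto)
  qed
  have "jn (z ` Fc ?f) = ?f"
  proof
    show "jn (z ` Fc ?f) \<subseteq> ?f" using zp Fc_le fFl by (intro jn_least) blast+
    have zs: "z ` Fc ?f \<subseteq> Fl" using zp by auto
    have "jn ?M \<subseteq> jn (z ` Fc ?f)"
    proof (rule jn_least)
      fix m assume m: "m \<in> ?M"
      then have "m \<subseteq> ?f" using jn_upper NS_Fl[OF T] MT by blast
      then obtain y where y: "y \<in> Fc ?f" "m \<subseteq> y" using Fc_above_ex m MG by blast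
      have "m \<subseteq> z y" unfolding z_def by (rule jn_upper) (use m y MFl in auto)
      also have "z y \<subseteq> jn (z ` Fc ?f)" using jn_upper[OF zs] y by blast
      finally show "m \<subseteq> jn (z ` Fc ?f)" .
    qed (use zs jn_Fl in blast)
    then show "?f \<subseteq> jn (z ` Fc ?f)" using jn_max[OF T] by simp
  qed
  then have zy: "z y = y" if "y \<in> Fc ?f" for y
    using factor_join_meet[OF fFl zp that] Fc_le[OF that] by auto
  have sub: "Fc ?f \<subseteq> ?M"
  proof
    fix y assume y: "y \<in> Fc ?f"
    let ?A = "{m \<in> ?M. m \<subseteq> y}"
    have yG: "y \<in> G" using y Fc_G by blast
    have "\<not> 2 \<le> card ?A"
    proof
      assume "2 \<le> card ?A"
      then have "jn ?A \<notin> G" using MT anti by (intro NS_D[OF T]) auto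
      then show False using zy[OF y] yG by (simp add: z_def)
    qed
    then have u: "a = b" if "a \<in> ?A" "b \<in> ?A" for a b
      using card_ge2[of a ?A b] that NS_finite[OF T] MT finite_subset by fastforce
    have "?A \<noteq> {}"
    proof
      assume e: "?A = {}"
      have "jn ?A = y" using zy[OF y] by (simp only: z_def)
      then show False using bot_notin_G yG unfolding e by simp
    qed
    then obtain m where m: "m \<in> ?A" by blast
    then have "?A = {m}" using u by blast
    then have "y = jn {m}" using zy[OF y] by (simp add: z_def)
    then show "y \<in> ?M" using m MFl jn_singleton by auto
  qed
  show ?thesis
  proof
    show "?M \<subseteq> Fc ?f"
    proof
      fix m assume m: "m \<in> ?M"
      then have "m \<subseteq> ?f" using jn_upper NS_Fl[OF T] MT by blast
      then obtain y where y: "y \<in> Fc ?f" "m \<subseteq> y" using Fc_above_ex m MG by blast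
      then have "m = y" using sub anti m by blast
      then show "m \<in> Fc ?f" using y by simp
    qed
  qed (rule sub)
qed

text \<open>A two-element antichain in a nested set is the factor set of its join, and distinct
  factors meet in the bottom. Consequently a nested set is a forest under inclusion.\<close>

lemma NS_incomparable:
  assumes T: "T \<in> NS" and st: "s \<in> T" "t \<in> T" "\<not> s \<subseteq> t" "\<not> t \<subseteq> s"
  shows "s \<inter> t = cl {}"
proof -
  have N: "{s, t} \<in> NS" using NS_subset[OF T] st by auto
  have "max_elements {s, t} = {s, t}" using st by (auto simp: max_elements_def)
  then have "Fc (jn {s, t}) = {s, t}" using NS_factors[OF N] by simp
  then show ?thesis using Fc_disjoint[of "jn {s, t}" s t] jn_Fl[OF NS_Fl[OF N]] st by auto
qed

lemma NS_common_below:
  assumes "T \<in> NS" "s \<in> T" "t \<in> T" "k \<in> G" "k \<subseteq> s" "k \<subseteq> t"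
  shows "s \<subseteq> t \<or> t \<subseteq> s"
proof (rule ccontr)
  assume "\<not> ?thesis"
  then have "s \<inter> t = cl {}" using NS_incomparable assms by blast
  then have "k \<subseteq> cl {}" using assms by auto
  then show False using G_not_bot[OF assms(4) bot_Fl] by blast
qed

text \<open>An antichain with join in \<open>G\<close> lies below a single factor \<open>y\<close>.
  A factor of \<open>f\<close> in it would have to be \<open>y\<close> itself and leave no room for
  a second element, so the antichain already lies in \<open>S\<close>.\<close>

lemma NS_Un_factors:
  assumes f: "f \<in> Fl" and S: "S \<in> NS" "\<And>s. s \<in> S \<Longrightarrow> s \<subseteq> f"
  shows "S \<union> Fc f \<in> NS"
proof (rule NS_I)
  show "S \<union> Fc f \<subseteq> G" using NS_G[OF S(1)] Fc_G by blast
next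
  fix A assume A: "A \<subseteq> S \<union> Fc f" "2 \<le> card A" "\<And>g h. g \<in> A \<Longrightarrow> h \<in> A \<Longrightarrow> g \<subseteq> h \<Longrightarrow> g = h"
    and j: "jn A \<in> G"
  have AFl: "A \<subseteq> Fl" using A(1) NS_Fl[OF S(1)] Fc_Fl by blast
  have "jn A \<subseteq> f" using A(1) S(2) Fc_le f by (intro jn_least) blast+
  then obtain y where y: "y \<in> Fc f" "jn A \<subseteq> y" using Fc_above_ex j by blast
  have le: "a \<subseteq> y" if "a \<in> A" for a using jn_upper[OF AFl that] y by blast
  have "A \<subseteq> S"
  proof
    fix a assume a: "a \<in> A"
    show "a \<in> S"
    proof (rule ccontr)
      assume "a \<notin> S"
      then have aF: "a \<in> Fc f" using a A(1) by blast
      then have "a = y" using le[OF a] y Fc_mem_iff[of a f] Fc_mem_iff[of y f] by blast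
      then have "A = {a}" using le A(3) a by blast
      then show False using A(2) by simp
    qed
  qed
  then show False using NS_D[OF S(1) _ A(2)] A(3) j by blast
qed

section \<open>Gaps of a nested set and the dimension formula\<close>

definition blw :: "'a set set \<Rightarrow> 'a set \<Rightarrow> 'a set set" where
  "blw T g = {t \<in> T. t \<subset> g}"

lemma blw_subset: "blw T g \<subseteq> T"
  by (auto simp: blw_def)

text \<open>The least exponent of \<open>c_g\<close> allowed in the second kind of relation when
  \<open>T\<close> is the set of vertices present. For a flat \<open>g\<close> the subtraction does
  not truncate, since the join lies below \<open>g\<close>.\<close>

definition dgap :: "'a set set \<Rightarrow> 'a set \<Rightarrow> nat" where
  "dgap T g = cd g - cd (jn (blw T g))"

lemma jn_blw_le: "g \<in> Fl \<Longrightarrow> jn (blw T g) \<subseteq> g"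
  by (rule jn_least) (auto simp: blw_def)

lemma cd_jn_blw_le: "g \<in> Fl \<Longrightarrow> cd (jn (blw T g)) \<le> cd g"
  using cd_le jn_blw_le by blast

lemma jn_blw_Fl: "T \<subseteq> G \<Longrightarrow> jn (blw T g) \<in> Fl"
  using blw_subset G_Fl jn_Fl by (meson subset_trans)

lemma below_jn_blw:
  assumes T: "T \<in> NS" and k: "k \<in> G" "k \<subseteq> jn (blw T g)"
  shows "\<exists>t\<in>blw T g. k \<subseteq> t"
proof -
  have N: "blw T g \<in> NS" using NS_subset[OF T blw_subset] .
  then obtain y where "y \<in> Fc (jn (blw T g))" "k \<subseteq> y" using Fc_above_ex k by blast
  then show ?thesis using NS_factors[OF N] max_subset by blast
qed

lemma jn_blw_psubset:
  assumes T: "T \<in> NS" and g: "g \<in> G"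
  shows "jn (blw T g) \<subset> g"
proof -
  have "jn (blw T g) \<noteq> g"
    using below_jn_blw[OF T g, of g] by (auto simp: blw_def)
  then show ?thesis using jn_blw_le[OF G_FlD[OF g]] by blast
qed

lemma dgap_pos: "T \<in> NS \<Longrightarrow> g \<in> G \<Longrightarrow> dgap T g > 0"
  using jn_blw_psubset[of T g] cd_strict[of "jn (blw T g)" g] jn_blw_Fl[OF NS_G] G_FlD
  by (auto simp: dgap_def)

text \<open>Telescoping: removing a maximal \<open>m\<close> replaces the factor \<open>m\<close> of
  the join by \<open>jn (blw T m)\<close> and leaves the other factors alone, so \<open>cd\<close>
  drops by \<open>dgap T m\<close> while the other gaps are unchanged. This is the degree count
  behind the top monomial \<open>topm\<close>.\<close>

lemma sum_dgap: "T \<in> NS \<Longrightarrow> (\<Sum>t\<in>T. dgap T t) = cd (jn T)"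
proof (induction "card T" arbitrary: T rule: less_induct)
  case less
  have fin: "finite T" using NS_finite less.prems by blast
  show ?case
  proof (cases "T = {}")
    case True
    then show ?thesis by (simp add: cd_bot)
  next
    case False
    then obtain m where m: "m \<in> max_elements T" using max_above[OF fin] by blast
    then have mT: "m \<in> T" using max_subset by blast
    let ?T' = "T - {m}" and ?x = "jn T"
    have N': "?T' \<in> NS" using NS_subset less.prems by blast
    have xFl: "?x \<in> Fl" and x'Fl: "jn ?T' \<in> Fl" using NS_Fl N' less.prems jn_Fl by blast+
    have x'x: "jn ?T' \<subseteq> ?x" using jn_mono NS_Fl less.prems by blast
    have Fx: "Fc ?x = max_elements T" using NS_factors less.prems by blast
    have mG: "m \<in> G" using mT NS_G less.prems by blast
    \<comment> \<open>The expected coordinates of \<open>jn (T - {m})\<close> in the decomposition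
      of \<open>jn T\<close>.\<close>
    define z where "z y = (if y = m then jn (blw T m) else y)" for y
    have zp: "z y \<in> Fl \<and> z y \<subseteq> y" if "y \<in> Fc ?x" for y
      using that Fc_Fl jn_blw_Fl[OF NS_G[OF less.prems]] jn_blw_le[OF G_FlD[OF mG]] by (auto simp: z_def)
    have zs: "z ` Fc ?x \<subseteq> Fl" using zp by auto
    have jz: "jn (z ` Fc ?x) = jn ?T'"
    proof
      show "jn (z ` Fc ?x) \<subseteq> jn ?T'"
      proof (rule jn_least)
        fix u assume "u \<in> z ` Fc ?x"
        then obtain y where y: "y \<in> max_elements T" "u = z y" using Fx by auto
        show "u \<subseteq> jn ?T'"
        proof (cases "y = m")
          case True
          have "blw T m \<subseteq> ?T'" by (auto simp: blw_def)
          then show ?thesis using y True jn_mono NS_Fl[OF N'] by (simp add: z_def)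
        next
          case False
          then have "u \<in> ?T'" using y max_subset by (auto simp: z_def)
          then show ?thesis using jn_upper[OF NS_Fl[OF N']] by blast
        qed
      qed (rule x'Fl)
      show "jn ?T' \<subseteq> jn (z ` Fc ?x)"
      proof (rule jn_least)
        fix t assume t: "t \<in> ?T'"
        then obtain y where y: "y \<in> max_elements T" "t \<subseteq> y" using max_above[OF fin] by blast
        have "t \<subseteq> z y"
        proof (cases "y = m")
          case True
          then have "t \<in> blw T m" using t y by (auto simp: blw_def)
          then show ?thesis using True jn_upper[of "blw T m" t] NS_Fl[OF less.prems] blw_subset by (fastforce simp: z_def)
        qed (use y in \<open>simp add: z_def\<close>)
        also have "\<dots> \<subseteq> jn (z ` Fc ?x)" using jn_upper[OF zs] y Fx by blast
        finally show "t \<subseteq> jn (z ` Fc ?x)" .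
      qed (use zs jn_Fl in blast)
    qed
    have "cd (jn ?T') = (\<Sum>y\<in>Fc ?x. cd (jn ?T' \<inter> y))" by (rule cd_meet_sum[OF xFl x'Fl x'x])
    also have "\<dots> = (\<Sum>y\<in>Fc ?x. cd (z y))"
      using factor_join_meet[OF xFl zp] jz by (intro sum.cong) auto
    also have "\<dots> = cd (z m) + (\<Sum>y\<in>Fc ?x - {m}. cd y)"
      using sum.remove[OF finite_Fc[of ?x], of m "\<lambda>y. cd (z y)"] Fx m by (simp add: z_def)
    finally have 1: "cd (jn ?T') = cd (jn (blw T m)) + (\<Sum>y\<in>Fc ?x - {m}. cd y)" by (simp add: z_def)
    have 2: "cd ?x = cd m + (\<Sum>y\<in>Fc ?x - {m}. cd y)"
      using cd_factors[OF xFl] sum.remove[OF finite_Fc[of ?x], of m cd] Fx m by simp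
    have "dgap ?T' t = dgap T t" if "t \<in> ?T'" for t
    proof -
      have "blw ?T' t = blw T t" using m that by (auto simp: blw_def max_elements_def)
      then show ?thesis by (simp add: dgap_def)
    qed
    then have "(\<Sum>t\<in>?T'. dgap T t) = cd (jn ?T')"
      using less.hyps[OF _ N'] mT fin by (metis (no_types, lifting) card_Diff1_less sum.cong)
    then have "(\<Sum>t\<in>T. dgap T t) = dgap T m + cd (jn ?T')" using mT fin by (simp add: sum.remove)
    also have "\<dots> = cd ?x" using 1 2 cd_jn_blw_le[OF G_FlD[OF mG], of T] by (simp add: dgap_def)
    finally show ?thesis .
  qed
qed

end

context building_polymatroid
begin

section \<open>Tight flats\<close>

text \<open>As in a transversal problem, \<open>cd x\<close> is the room in \<open>x\<close> and the
  sum counts the demands placed inside \<open>x\<close>. Integer valued, because the demands may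
  exceed the room.\<close>

definition wt :: "('a set \<Rightarrow> nat) \<Rightarrow> 'a set \<Rightarrow> int" where
  "wt a x = int (cd x) - (\<Sum>k\<in>{k\<in>G. k \<subseteq> x}. int (a k))"

definition gap :: "'a set set \<Rightarrow> ('a set \<Rightarrow> nat) \<Rightarrow> 'a set \<Rightarrow> 'a set \<Rightarrow> int" where
  "gap S a t x = wt a x - wt a (jn (blw S t))"

definition gap_pos :: "'a set set \<Rightarrow> ('a set \<Rightarrow> nat) \<Rightarrow> 'a set \<Rightarrow> bool" where
  "gap_pos S a t \<longleftrightarrow> (\<forall>x\<in>Fl. jn (blw S t) \<subset> x \<longrightarrow> x \<subseteq> t \<longrightarrow> 1 \<le> gap S a t x)"

text \<open>On the interval from \<open>jn (blw S t)\<close> to \<open>t\<close> this is the dragon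
  variant of the Hall-Rado condition: exactly one unit is left over at the top, and at least one at
  every flat strictly above the lower end.\<close>

definition local_sat :: "'a set set \<Rightarrow> ('a set \<Rightarrow> nat) \<Rightarrow> 'a set \<Rightarrow> bool" where
  "local_sat S a t \<longleftrightarrow> gap S a t t = 1 \<and> gap_pos S a t"

text \<open>A Hall-Rado condition: the product of \<open>x\<^sub>s\<close> for \<open>s \<in> S\<close> with the monomial of exponents \<open>a\<close> in the \<open>c\<^sub>g\<close> has nonzero
  degree in the Chow ring of \<open>[0, f]\<close>.\<close>

definition sat :: "'a set set \<Rightarrow> 'a set \<Rightarrow> ('a set \<Rightarrow> nat) \<Rightarrow> bool" where
  "sat S f a \<longleftrightarrow> S \<in> NS \<and> (\<forall>t\<in>S \<union> Fc f. local_sat S a t)"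

lemma wt_bot: "wt a (cl {}) = 0"
proof -
  have "{k \<in> G. k \<subseteq> cl {}} = {}" using G_not_bot[OF _ bot_Fl] by blast
  then show ?thesis by (simp add: wt_def cd_bot del: Collect_empty_eq)
qed

lemma jn2_upper1: "x \<in> Fl \<Longrightarrow> y \<in> Fl \<Longrightarrow> x \<subseteq> jn {x, y}"
  by (rule jn_upper) auto

lemma jn2_upper2: "x \<in> Fl \<Longrightarrow> y \<in> Fl \<Longrightarrow> y \<subseteq> jn {x, y}"
  by (rule jn_upper) auto

lemma jn2_Fl: "x \<in> Fl \<Longrightarrow> y \<in> Fl \<Longrightarrow> jn {x, y} \<in> Fl"
  by (rule jn_Fl) auto

lemma jn2_least: "x \<subseteq> u \<Longrightarrow> y \<subseteq> u \<Longrightarrow> u \<in> Fl \<Longrightarrow> jn {x, y} \<subseteq> u"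
  by (rule jn_least) auto

text \<open>\<open>cd\<close> is submodular, and the demands inside a join include those inside
  either flat, so the subtracted sum is supermodular. All uncrossing arguments use this.\<close>

lemma wt_submodular:
  assumes "x \<in> Fl" "y \<in> Fl"
  shows "wt a (jn {x, y}) + wt a (x \<inter> y) \<le> wt a x + wt a y"
proof -
  let ?s = "\<lambda>A. \<Sum>k\<in>A. int (a k)" and ?G = "\<lambda>x. {k \<in> G. k \<subseteq> x}"
  have "?s (?G x) + ?s (?G y) = ?s (?G x \<union> ?G y) + ?s (?G x \<inter> ?G y)"
    using finite_G by (intro sum.union_inter[symmetric]) auto
  also have "?G x \<inter> ?G y = ?G (x \<inter> y)" by auto
  also have "?s (?G x \<union> ?G y) \<le> ?s (?G (jn {x, y}))"
  proof (rule sum_mono2)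
    show "?G x \<union> ?G y \<subseteq> ?G (jn {x, y})" using jn2_upper1[OF assms] jn2_upper2[OF assms] by blast
  qed (use finite_G in auto)
  finally show ?thesis using cd_join_meet[OF assms] by (simp add: wt_def)
qed

text \<open>Each \<open>k\<close> below \<open>u\<close> lies below exactly one factor of
  \<open>x\<close>, so the demands split in the same way as \<open>cd\<close>.\<close>

lemma wt_factors:
  assumes x: "x \<in> Fl" and u: "u \<in> Fl" "u \<subseteq> x"
  shows "wt a u = (\<Sum>y\<in>Fc x. wt a (u \<inter> y))"
proof -
  have "{k \<in> G. k \<subseteq> u} = (\<Union>y\<in>Fc x. {k \<in> G. k \<subseteq> u \<inter> y})"
  proof (intro equalityI subsetI)
    fix k assume k: "k \<in> {k \<in> G. k \<subseteq> u}"
    then have "k \<subseteq> x" using u by blast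
    then show "k \<in> (\<Union>y\<in>Fc x. {k \<in> G. k \<subseteq> u \<inter> y})" using Fc_above_ex[of k x] k by auto
  qed auto
  also have "(\<Sum>k\<in>\<dots>. int (a k)) = (\<Sum>y\<in>Fc x. \<Sum>k\<in>{k \<in> G. k \<subseteq> u \<inter> y}. int (a k))"
  proof (rule sum.UNION_disjoint)
    show "\<forall>i\<in>Fc x. \<forall>j\<in>Fc x. i \<noteq> j \<longrightarrow> {k \<in> G. k \<subseteq> u \<inter> i} \<inter> {k \<in> G. k \<subseteq> u \<inter> j} = {}"
      using Fc_unique[OF x] by blast
  qed (auto simp: finite_Fc finite_G)
  finally show ?thesis using cd_meet_sum[OF x u] by (simp add: wt_def sum_subtractf)
qed

lemma wt_incr:
  assumes "k \<in> G"
  shows "wt (a(k := Suc (a k))) x = wt a x - (if k \<subseteq> x then 1 else 0)"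
proof (cases "k \<subseteq> x")
  case True
  then have "(\<Sum>k'\<in>{k'\<in>G. k' \<subseteq> x}. int ((a(k := Suc (a k))) k')) = int (Suc (a k)) + (\<Sum>k'\<in>{k'\<in>G. k' \<subseteq> x} - {k}. int (a k'))"
    using assms finite_G by (subst sum.remove[of _ k]) auto
  moreover have "(\<Sum>k'\<in>{k'\<in>G. k' \<subseteq> x}. int (a k')) = int (a k) + (\<Sum>k'\<in>{k'\<in>G. k' \<subseteq> x} - {k}. int (a k'))"
    using assms finite_G True by (subst sum.remove[of _ k]) auto
  ultimately show ?thesis using True by (simp add: wt_def)
next
  case False
  then have "(\<Sum>k'\<in>{k'\<in>G. k' \<subseteq> x}. int ((a(k := Suc (a k))) k')) = (\<Sum>k'\<in>{k'\<in>G. k' \<subseteq> x}. int (a k'))"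
    by (intro sum.cong) auto
  then show ?thesis using False by (simp add: wt_def)
qed

lemma Fc_NS: "x \<in> Fl \<Longrightarrow> Fc x \<in> NS"
  using NS_Un_factors[of x "{}"] NS_empty by simp

lemma Fc_jn_subset:
  assumes x: "x \<in> Fl" and A: "A \<subseteq> Fc x" shows "Fc (jn A) = A"
proof -
  have "\<not> y \<subset> y'" if "y \<in> A" "y' \<in> A" for y y'
    using that A Fc_mem_iff[of y x] Fc_mem_iff[of y' x] by blast
  then have "max_elements A = A" unfolding max_elements_def by blast
  then show ?thesis using NS_factors[OF NS_subset[OF Fc_NS[OF x] A]] by simp
qed

text \<open>Since a nested set is a forest, its members above an element \<open>k\<close> of
  \<open>G\<close> form a chain. The root is the least of them, and its interval is the only one
  that notices a change of the exponent of \<open>k\<close>.\<close>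

definition is_root :: "'a set set \<Rightarrow> 'a set \<Rightarrow> 'a set \<Rightarrow> bool" where
  "is_root N k s \<longleftrightarrow> s \<in> N \<and> k \<subseteq> s \<and> (\<forall>t\<in>N. k \<subseteq> t \<longrightarrow> s \<subseteq> t)"

lemma root_ex:
  assumes N: "N \<in> NS" and k: "k \<in> G" and t: "t \<in> N" "k \<subseteq> t"
  shows "\<exists>s. is_root N k s"
proof -
  let ?A = "{t \<in> N. k \<subseteq> t}"
  have "finite ?A" "?A \<noteq> {}" using NS_finite[OF N] t by auto
  then obtain s where s: "s \<in> ?A" "\<forall>b\<in>?A. b \<subseteq> s \<longrightarrow> s = b" using finite_has_minimal[of ?A] by auto
  have "s \<subseteq> t" if "t \<in> N" "k \<subseteq> t" for t
    using NS_common_below[OF N, of s t k] that s k by blast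
  then show ?thesis using s unfolding is_root_def by blast
qed

section \<open>Raising one exponent: defects and tight flats\<close>

context
  fixes f S and a :: "'a set \<Rightarrow> nat"
  assumes f: "f \<in> Fl" and S: "S \<in> NS" and Sf: "\<And>s. s \<in> S \<Longrightarrow> s \<subseteq> f" and SF: "S \<inter> Fc f = {}"
begin

private abbreviation (input) "N \<equiv> S \<union> Fc f"
private abbreviation (input) "z t \<equiv> jn (blw S t)"

lemma N_NS: "N \<in> NS"
  by (rule NS_Un_factors[OF f S Sf])

lemma N_G: "N \<subseteq> G"
  using N_NS NS_G by blast

lemma N_le: "t \<in> N \<Longrightarrow> t \<subseteq> f"
  using Sf Fc_le by blast

lemma S_Fl: "blw S t \<subseteq> Fl"
  using NS_Fl[OF S] blw_subset by blast

lemma z_Fl: "z t \<in> Fl"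
  using S_Fl jn_Fl by blast

lemma S_le_z: "t' \<in> S \<Longrightarrow> t' \<subset> t \<Longrightarrow> t' \<subseteq> z t"
  using jn_upper[OF S_Fl] by (auto simp: blw_def)

lemma below_z: "k \<in> G \<Longrightarrow> k \<subseteq> z t \<Longrightarrow> \<exists>t'\<in>S. t' \<subset> t \<and> k \<subseteq> t'"
proof -
  assume "k \<in> G" "k \<subseteq> z t"
  then obtain t' where "t' \<in> blw S t" "k \<subseteq> t'" using below_jn_blw[OF S, of k t] by auto
  then show ?thesis by (auto simp: blw_def)
qed

lemma z_psub: "t \<in> N \<Longrightarrow> z t \<subset> t"
  using jn_blw_psubset[OF S] N_G by blast

lemma N_psub_S: "s \<in> N \<Longrightarrow> t \<in> N \<Longrightarrow> s \<subset> t \<Longrightarrow> s \<in> S"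
proof (rule ccontr)
  assume H: "s \<in> N" "t \<in> N" "s \<subset> t" "s \<notin> S"
  then have "s \<in> Fc f" "t \<in> G" "t \<subseteq> f" using N_G N_le[OF H(2)] by auto
  then show False using H(3) Fc_mem_iff[of s f] by auto
qed

lemma root_ex': "k \<in> G \<Longrightarrow> k \<subseteq> f \<Longrightarrow> \<exists>s. is_root N k s"
  using root_ex[OF N_NS] Fc_above_ex by blast

lemma root_not_below_z: "is_root N k s \<Longrightarrow> k \<in> G \<Longrightarrow> \<not> k \<subseteq> z s"
  using below_z[of k s] unfolding is_root_def by blast

lemma root_below:
  assumes "is_root N k s" "t \<in> N" "k \<subseteq> t" "t \<noteq> s"
  shows "s \<in> S" "s \<subset> t" "s \<subseteq> z t"
proof -
  have sN: "s \<in> N" and "s \<subseteq> t" using assms(1-3) unfolding is_root_def by auto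
  then show st: "s \<subset> t" using assms(4) by auto
  show "s \<in> S" by (rule N_psub_S[OF sN assms(2) st])
  then show "s \<subseteq> z t" using S_le_z st by simp
qed

text \<open>For \<open>t\<close> other than the root, either \<open>k\<close> is not below
  \<open>t\<close>, or it is already below the lower end \<open>z t\<close>. In both cases the
  change cancels in every gap.\<close>

lemma local_sat_incr_other:
  assumes k: "k \<in> G" and s: "is_root N k s" and t: "t \<in> N" "t \<noteq> s"
  shows "local_sat S (a(k := Suc (a k))) t \<longleftrightarrow> local_sat S a t"
proof -
  have "gap S (a(k := Suc (a k))) t x = gap S a t x" if "z t \<subseteq> x" "x \<subseteq> t" for x
  proof (cases "k \<subseteq> t")
    case True
    then have "k \<subseteq> z t" using root_below(3)[OF s t(1) True t(2)] s unfolding is_root_def by blast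
    then show ?thesis using that by (auto simp: gap_def wt_incr[OF k])
  next
    case False
    then have "\<not> k \<subseteq> x" "\<not> k \<subseteq> z t" using that by auto
    then show ?thesis by (auto simp: gap_def wt_incr[OF k])
  qed
  moreover have "z t \<subseteq> t" using z_psub t by blast
  ultimately show ?thesis unfolding local_sat_def gap_pos_def by (auto simp: psubset_imp_subset)
qed

text \<open>\<open>k\<close> is not below \<open>z s\<close>, so the gap falls by one exactly at the
  flats containing \<open>k\<close>. These include \<open>s\<close>, which must fall from 2 to 1,
  and none of them may have had gap 1.\<close>

lemma local_sat_incr_root:
  assumes k: "k \<in> G" and s: "is_root N k s"
  shows "local_sat S (a(k := Suc (a k))) s \<longleftrightarrow>
    gap S a s s = 2 \<and> gap_pos S a s \<and> (\<forall>x\<in>Fl. z s \<subset> x \<longrightarrow> x \<subseteq> s \<longrightarrow> gap S a s x = 1 \<longrightarrow> \<not> k \<subseteq> x)"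
proof -
  have g: "gap S (a(k := Suc (a k))) s x = gap S a s x - (if k \<subseteq> x then 1 else 0)" for x
    using root_not_below_z[OF s k] by (auto simp: gap_def wt_incr[OF k])
  have ks: "k \<subseteq> s" using s by (simp add: is_root_def)
  have "1 \<le> gap S a s x - (if k \<subseteq> x then 1 else 0) \<longleftrightarrow> 1 \<le> gap S a s x \<and> (gap S a s x = 1 \<longrightarrow> \<not> k \<subseteq> x)" for x
    by auto
  then show ?thesis unfolding local_sat_def gap_pos_def g using ks by auto
qed

text \<open>The states from which raising a single exponent can reach \<open>sat\<close>: at
  \<open>s\<close> one more unit has to be spent, and nothing is wrong elsewhere.\<close>

definition defect :: "'a set \<Rightarrow> bool" where
  "defect s \<longleftrightarrow> s \<in> N \<and> (\<forall>t\<in>N. t \<noteq> s \<longrightarrow> local_sat S a t) \<and> gap S a s s = 2 \<and> gap_pos S a s"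

text \<open>The flats that would fall to gap zero if the exponent of some \<open>k\<close> inside
  them were raised.\<close>

definition tight :: "'a set \<Rightarrow> 'a set set" where
  "tight s = {x \<in> Fl. z s \<subset> x \<and> x \<subseteq> s \<and> gap S a s x = 1}"

lemma defect_unique: "defect s \<Longrightarrow> defect t \<Longrightarrow> s = t"
  unfolding defect_def local_sat_def by (metis numeral_eq_one_iff semiring_norm(85))

lemma sat_incr:
  assumes k: "k \<in> G" and s: "is_root N k s"
  shows "sat S f (a(k := Suc (a k))) \<longleftrightarrow> defect s \<and> (\<forall>x\<in>tight s. \<not> k \<subseteq> x)"
proof -
  have sN: "s \<in> N" using s unfolding is_root_def by blast
  have "sat S f (a(k := Suc (a k))) \<longleftrightarrow> (\<forall>t\<in>N. local_sat S (a(k := Suc (a k))) t)"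
    unfolding sat_def using S by simp
  also have "\<dots> \<longleftrightarrow> local_sat S (a(k := Suc (a k))) s \<and> (\<forall>t\<in>N. t \<noteq> s \<longrightarrow> local_sat S (a(k := Suc (a k))) t)"
    using sN by metis
  also have "\<dots> \<longleftrightarrow> local_sat S (a(k := Suc (a k))) s \<and> (\<forall>t\<in>N. t \<noteq> s \<longrightarrow> local_sat S a t)"
    using local_sat_incr_other[OF k s] by simp
  also have "\<dots> \<longleftrightarrow> defect s \<and> (\<forall>x\<in>tight s. \<not> k \<subseteq> x)"
    unfolding local_sat_incr_root[OF k s] defect_def tight_def using sN by auto
  finally show ?thesis .
qed

lemma wt_split:
  assumes x: "x \<in> Fl" and zz: "zz \<in> Fl" and F: "Fc x = insert h (Fc zz)" "h \<notin> Fc zz"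
    and u: "u \<in> Fl" "zz \<subseteq> u" "u \<subseteq> x"
  shows "wt a u = wt a (u \<inter> h) + wt a zz"
proof -
  have "wt a u = wt a (u \<inter> h) + (\<Sum>y\<in>Fc zz. wt a (u \<inter> y))"
    using wt_factors[OF x u(1,3)] F finite_Fc by simp
  also have "(\<Sum>y\<in>Fc zz. wt a (u \<inter> y)) = (\<Sum>y\<in>Fc zz. wt a (zz \<inter> y))"
  proof (rule sum.cong)
    fix y assume "y \<in> Fc zz"
    then have "y \<subseteq> zz" by (rule Fc_le)
    then have "u \<inter> y = zz \<inter> y" using u(2) by blast
    then show "wt a (u \<inter> y) = wt a (zz \<inter> y)" by simp
  qed simp
  also have "\<dots> = wt a zz" using wt_factors[OF zz zz order_refl] by simp
  finally show ?thesis .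
qed

lemma bot_meet_collapse:
  assumes x: "x \<in> Fl" and zz: "zz \<in> Fl" and F: "Fc x = insert h (Fc zz)"
    and u: "u \<in> Fl" "u \<subseteq> x" "u \<inter> h = cl {}"
  shows "u \<subseteq> zz"
proof -
  have "jn ((\<lambda>y. u \<inter> y) ` Fc x) \<subseteq> zz"
  proof (rule jn_least)
    fix v assume "v \<in> (\<lambda>y. u \<inter> y) ` Fc x"
    then show "v \<subseteq> zz" using F u(3) bot_least[OF zz] by (auto dest: Fc_le)
  qed (rule zz)
  then show ?thesis using factor_decomp[OF x u(1,2)] by simp
qed

text \<open>Uncrossing: if the meet were strictly above \<open>z s\<close>, then meet and join would
  both have gap at least 1, and submodularity would make the join tight, against maximality.\<close>

lemma tight_max_meet:
  assumes d: "defect s" and x: "x1 \<in> max_elements (tight s)" "x2 \<in> max_elements (tight s)" "x1 \<noteq> x2"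
  shows "x1 \<inter> x2 = z s"
proof (rule ccontr)
  assume ne: "x1 \<inter> x2 \<noteq> z s"
  have t: "x1 \<in> tight s" "x2 \<in> tight s" using x max_subset by blast+
  then have Fl: "x1 \<in> Fl" "x2 \<in> Fl" and zs: "z s \<subset> x1 \<inter> x2" and le: "x1 \<subseteq> s" "x2 \<subseteq> s"
    and g: "gap S a s x1 = 1" "gap S a s x2 = 1" using ne by (auto simp: tight_def)
  have sFl: "s \<in> Fl" using d N_G G_FlD unfolding defect_def by blast
  let ?J = "jn {x1, x2}"
  have J: "?J \<in> Fl" and up: "x1 \<subseteq> ?J" "x2 \<subseteq> ?J" and Js: "?J \<subseteq> s"
    using jn2_Fl jn2_upper1 jn2_upper2 jn2_least Fl le sFl by auto
  have pos: "1 \<le> gap S a s y" if "y \<in> Fl" "z s \<subset> y" "y \<subseteq> s" for y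
    using d that unfolding defect_def gap_pos_def by simp
  have zJ: "z s \<subset> ?J" using zs up(1) by auto
  have "1 \<le> gap S a s (x1 \<inter> x2)" using pos[OF Fl_Int[OF Fl] zs] le by auto
  moreover have "1 \<le> gap S a s ?J" using pos[OF J zJ Js] .
  ultimately have "gap S a s ?J = 1" using wt_submodular[OF Fl, of a] g by (simp add: gap_def)
  then have "?J \<in> tight s" using J Js zJ by (simp add: tight_def)
  then have "\<not> x1 \<subset> ?J" "\<not> x2 \<subset> ?J" using x by (auto simp only: max_elements_def)
  then have "x1 = ?J" "x2 = ?J" using up by auto
  then show False using x by simp
qed

section \<open>Inserting a vertex that has no old vertex strictly below it\<close>

context
  fixes h s
  assumes h: "h \<in> G" "h \<subseteq> f" "h \<notin> Fc f" "h \<notin> S" and hmin: "\<And>t. t \<in> S \<Longrightarrow> \<not> t \<subset> h" and s: "is_root N h s"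
begin

lemma sN: "s \<in> N" and hs: "h \<subset> s"
proof -
  show "s \<in> N" using s by (simp add: is_root_def)
  moreover have "h \<subseteq> s" using s by (simp add: is_root_def)
  ultimately show "h \<subset> s" using h(3,4) by auto
qed

lemma s_G: "s \<in> G"
  using sN N_G by blast

lemma blw_insert_root: "blw (insert h S) s = insert h (blw S s)"
  using hs by (auto simp: blw_def)

lemma blw_insert_new: "jn (blw (insert h S) h) = cl {}"
proof -
  have "blw (insert h S) h = {}" using hmin by (auto simp: blw_def)
  then show ?thesis by simp
qed

text \<open>If \<open>h\<close> is strictly below \<open>t\<close>, then so is its root
  \<open>s\<close>, which belongs to \<open>S\<close> and already contains \<open>h\<close>. So the
  join does not see the insertion.\<close>

lemma jn_blw_insert_other:
  assumes t: "t \<in> N" "t \<noteq> s"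
  shows "jn (blw (insert h S) t) = z t"
proof (cases "h \<subset> t")
  case True
  have "s \<in> blw S t" using root_below[OF s t(1) _ t(2)] True by (auto simp: blw_def)
  then have "\<Union>(insert h (blw S t)) = \<Union>(blw S t)" using hs by blast
  moreover have "blw (insert h S) t = insert h (blw S t)" using True by (auto simp: blw_def)
  ultimately show ?thesis by (simp only:)
next
  case False
  then have "blw (insert h S) t = blw S t" by (auto simp: blw_def)
  then show ?thesis by simp
qed

lemma local_sat_insert_other: "t \<in> N \<Longrightarrow> t \<noteq> s \<Longrightarrow> local_sat (insert h S) a t \<longleftrightarrow> local_sat S a t"
  by (simp add: local_sat_def gap_pos_def gap_def jn_blw_insert_other)

lemma h_Fl: "h \<in> Fl"
  using h G_FlD by blast

lemma not_h_le_z: "\<not> h \<subseteq> z s"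
  using root_not_below_z[OF s h(1)] .

lemma insert_Fl: "insert h (blw S s) \<subseteq> Fl"
  using S_Fl h_Fl by blast

text \<open>The required tight flat is \<open>jn (insert h (blw S s))\<close>. Its factors are
  \<open>h\<close> and those of \<open>z s\<close>, so its gap is the weight of \<open>h\<close>,
  which the condition at \<open>h\<close> fixes to 1. The new condition at \<open>s\<close> makes
  every larger flat have gap at least 2, hence maximality.\<close>

lemma sat_insert_imp:
  assumes sa: "sat (insert h S) f a"
  shows "defect s \<and> (\<exists>x\<in>max_elements (tight s). h \<in> Fc x)"
proof -
  let ?x = "jn (insert h (blw S s))"
  have N': "insert h S \<in> NS" using sa by (simp add: sat_def)
  have ls: "local_sat (insert h S) a t" if "t \<in> insert h N" for t
    using sa that by (auto simp: sat_def)
  have xFl: "?x \<in> Fl" using jn_Fl[OF insert_Fl] .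
  have hx: "h \<subseteq> ?x" using jn_upper[OF insert_Fl] by blast
  have zx: "z s \<subseteq> ?x" using jn_mono[OF _ insert_Fl] by blast
  have xs: "?x \<subseteq> s" using hs G_FlD[OF s_G] by (intro jn_least) (auto simp: blw_def)
  have B: "insert h (blw S s) \<in> NS" by (rule NS_subset[OF N']) (auto simp: blw_def)
  have inc: "\<not> h \<subset> t" if "t \<in> blw S s" for t
    using that s unfolding is_root_def blw_def by blast
  have "\<not> t \<subset> h" if "t \<in> blw S s" for t
    using hmin that blw_subset by auto
  then have "max_elements (insert h (blw S s)) = insert h (max_elements (blw S s))"
    using inc unfolding max_elements_def by auto
  then have F: "Fc ?x = insert h (Fc (z s))"
    using NS_factors[OF B] NS_factors[OF NS_subset[OF S blw_subset]] by simp
  have hF: "h \<notin> Fc (z s)" using not_h_le_z Fc_le by blast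
  note split = wt_split[OF xFl z_Fl F hF]
  have "local_sat (insert h S) a h" by (rule ls) blast
  then have lh: "wt a h = 1" and lhp': "\<forall>y\<in>Fl. cl {} \<subset> y \<longrightarrow> y \<subseteq> h \<longrightarrow> 1 \<le> wt a y"
    unfolding local_sat_def gap_pos_def gap_def blw_insert_new wt_bot by simp_all
  have lhp: "1 \<le> wt a y" if "y \<in> Fl" "cl {} \<subset> y" "y \<subseteq> h" for y using lhp' that by blast
  have gsp: "1 \<le> wt a y - wt a ?x" if "y \<in> Fl" "?x \<subset> y" "y \<subseteq> s" for y
    using ls[of s] sN that
    unfolding local_sat_def gap_pos_def gap_def blw_insert_root by blast
  have gs: "wt a s - wt a ?x = 1"
    using ls[of s] sN unfolding local_sat_def gap_pos_def gap_def blw_insert_root by blast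
  have wx: "wt a ?x = 1 + wt a (z s)"
    using split[OF xFl zx order_refl] hx lh by (simp add: Int_absorb1)
  have meeth: "0 \<le> wt a (y \<inter> h)" "y \<inter> h \<noteq> cl {} \<Longrightarrow> 1 \<le> wt a (y \<inter> h)" if "y \<in> Fl" for y
  proof -
    have i: "y \<inter> h \<in> Fl" using Fl_Int[OF that h_Fl] .
    show p: "1 \<le> wt a (y \<inter> h)" if "y \<inter> h \<noteq> cl {}"
      using lhp[OF i] bot_least[OF i] that by blast
    show "0 \<le> wt a (y \<inter> h)" using p wt_bot by (cases "y \<inter> h = cl {}") auto
  qed
  have pos: "gap_pos S a s"
    unfolding gap_pos_def
  proof (intro ballI impI)
    fix y assume y: "y \<in> Fl" "z s \<subset> y" "y \<subseteq> s"
    \<comment> \<open>Below \<open>?x\<close> the gap of \<open>y\<close> is the weight of its part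
      inside \<open>h\<close>. Otherwise \<open>y\<close> is compared with its join with
      \<open>?x\<close> by submodularity.\<close>
    show "1 \<le> gap S a s y"
    proof (cases "y \<subseteq> ?x")
      case True
      then have "y \<inter> h \<noteq> cl {}" using bot_meet_collapse[OF xFl z_Fl F y(1) True] y by blast
      then show ?thesis using split[OF y(1) _ True] y meeth(2)[OF y(1)] by (auto simp: gap_def)
    next
      case False
      let ?J = "jn {y, ?x}"
      have "?J \<in> Fl" using jn2_Fl[OF y(1) xFl] .
      moreover have "?x \<subset> ?J" using jn2_upper1[OF y(1) xFl] jn2_upper2[OF y(1) xFl] False by blast
      moreover have "?J \<subseteq> s" using jn2_least[OF y(3) xs G_FlD[OF s_G]] .
      ultimately have "1 \<le> wt a ?J - wt a ?x" by (rule gsp)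
      moreover have "wt a (y \<inter> ?x) = wt a (y \<inter> ?x \<inter> h) + wt a (z s)"
        by (rule split) (use y zx Fl_Int[OF y(1) xFl] in auto)
      moreover have "0 \<le> wt a (y \<inter> ?x \<inter> h)" by (rule meeth) (rule Fl_Int[OF y(1) xFl])
      ultimately show ?thesis using wt_submodular[OF y(1) xFl, of a] by (simp add: gap_def)
    qed
  qed
  have "gap S a s s = 2" using gs wx by (simp add: gap_def)
  moreover have "\<forall>t\<in>N. t \<noteq> s \<longrightarrow> local_sat S a t" using ls local_sat_insert_other by blast
  ultimately have d: "defect s" using pos sN by (simp add: defect_def)
  have "z s \<subset> ?x" using zx hx not_h_le_z by blast
  then have "?x \<in> tight s" using xFl xs wx unfolding tight_def gap_def by simp
  moreover have "\<not> ?x \<subset> y" if "y \<in> tight s" for y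
    using gsp[of y] that wx unfolding tight_def gap_def by force
  ultimately have "?x \<in> max_elements (tight s)" unfolding max_elements_def by blast
  then show ?thesis using d F by blast
qed

text \<open>Split the factors of the maximal tight flat \<open>x\<close> into \<open>h\<close> and
  the rest. Since \<open>h\<close> has weight at least 1, gap 1 leaves nothing for the rest beyond
  \<open>z s\<close>. So \<open>x\<close> is the join of \<open>h\<close> and
  \<open>blw S s\<close>, and the new conditions at \<open>h\<close> and \<open>s\<close> are read
  off from tightness and maximality of \<open>x\<close>.\<close>

lemma sat_insert_if:
  assumes d: "defect s" and x: "x \<in> max_elements (tight s)" and hx: "h \<in> Fc x"
  shows "sat (insert h S) f a"
proof -
  let ?x' = "jn (Fc x - {h})"
  have xt: "x \<in> tight s" using x max_subset by blast
  then have xFl: "x \<in> Fl" and zx: "z s \<subset> x" and xs: "x \<subseteq> s" and gx: "gap S a s x = 1"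
    by (auto simp: tight_def)
  have pos: "1 \<le> gap S a s y" if "y \<in> Fl" "z s \<subset> y" "y \<subseteq> s" for y
    using d that unfolding defect_def gap_pos_def by blast
  have hlex: "h \<subseteq> x" using hx Fc_le by blast
  have FFl: "Fc x - {h} \<subseteq> Fl" using Fc_Fl by blast
  have x'Fl: "?x' \<in> Fl" using jn_Fl FFl by blast
  have x'x: "?x' \<subseteq> x" using Fc_le xFl by (intro jn_least) auto
  \<comment> \<open>Each element of \<open>blw S s\<close> lies below a factor of \<open>x\<close>.
    This factor is not \<open>h\<close>, because no element of \<open>S\<close> is equal to
    \<open>h\<close> or strictly below it.\<close>
  have zx': "z s \<subseteq> ?x'"
  proof (rule jn_least)
    fix t assume t: "t \<in> blw S s"
    then have tS: "t \<in> S" and tG: "t \<in> G" using blw_subset NS_G[OF S] by blast+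
    have "t \<subseteq> x" using jn_upper[OF S_Fl t] zx by blast
    then obtain y where y: "y \<in> Fc x" "t \<subseteq> y" using Fc_above_ex tG by blast
    have "y \<noteq> h" using hmin[OF tS] y h(4) tS by blast
    then show "t \<subseteq> ?x'" using y jn_upper[OF FFl, of y] by blast
  qed (rule x'Fl)
  \<comment> \<open>The coordinates of \<open>?x'\<close> in the decomposition of \<open>x\<close>:
    the bottom at \<open>h\<close>, the full factor elsewhere.\<close>
  define zf where "zf y = (if y = h then cl {} else y)" for y :: "'a set"
  have zfp: "zf y \<in> Fl \<and> zf y \<subseteq> y" if "y \<in> Fc x" for y
    using Fc_FlD[OF that] bot_Fl bot_least[of y] by (auto simp: zf_def)
  have "zf ` Fc x \<subseteq> insert (cl {}) (Fc x - {h})" by (auto simp: zf_def)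
  have jzf: "jn (zf ` Fc x) = ?x'"
  proof
    show "jn (zf ` Fc x) \<subseteq> ?x'"
      using bot_least[OF x'Fl] jn_upper[OF FFl] x'Fl by (intro jn_least) (auto simp: zf_def)
    have "Fc x - {h} \<subseteq> zf ` Fc x" by (auto simp: zf_def)
    then show "?x' \<subseteq> jn (zf ` Fc x)" using zfp by (intro jn_mono) auto
  qed
  have meet: "?x' \<inter> y = zf y" if "y \<in> Fc x" for y
    using factor_join_meet[OF xFl zfp that] jzf by simp
  have "wt a ?x' = (\<Sum>y\<in>Fc x. wt a (zf y))" using wt_factors[OF xFl x'Fl x'x] meet by simp
  also have "\<dots> = (\<Sum>y\<in>Fc x - {h}. wt a y)"
    using sum.remove[OF finite_Fc[of x] hx, of "\<lambda>y. wt a (zf y)"] by (simp add: zf_def wt_bot)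
  finally have wx': "wt a ?x' = (\<Sum>y\<in>Fc x - {h}. wt a y)" .
  have "wt a x = (\<Sum>y\<in>Fc x. wt a y)"
    using wt_factors[OF xFl xFl order_refl] Fc_le by (metis (no_types, lifting) inf.absorb2 sum.cong)
  then have wx: "wt a x = wt a h + wt a ?x'"
    using sum.remove[OF finite_Fc[of x] hx, of "wt a"] wx' by simp
  have hz: "h \<inter> z s = cl {}"
  proof
    have "h \<inter> z s \<subseteq> h \<inter> ?x'" using zx' by blast
    also have "\<dots> = cl {}" using meet[OF hx] by (auto simp: zf_def)
    finally show "h \<inter> z s \<subseteq> cl {}" .
  qed (use bot_least Fl_Int h_Fl z_Fl in blast)
  have join_ge: "1 \<le> wt a y" if y: "y \<in> Fl" "y \<subseteq> h" "y \<noteq> cl {}" for y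
  proof -
    have b: "y \<inter> z s = cl {}" using hz y(2) bot_least[OF Fl_Int[OF y(1) z_Fl]] by blast
    then have "\<not> y \<subseteq> z s" using y(3) by blast
    then have "z s \<subset> jn {y, z s}" using jn2_upper1[OF y(1) z_Fl] jn2_upper2[OF y(1) z_Fl, of s] by blast
    moreover have "jn {y, z s} \<subseteq> s"
      by (rule jn2_least) (use y(2) hs z_psub[OF sN] G_FlD[OF s_G] in auto)
    ultimately have "1 \<le> gap S a s (jn {y, z s})" using pos jn2_Fl[OF y(1) z_Fl] by blast
    then show ?thesis using wt_submodular[OF y(1) z_Fl[of s], of a] b wt_bot by (simp add: gap_def)
  qed
  have hb: "h \<noteq> cl {}" using G_not_bot h bot_Fl bot_notin_G by blast
  \<comment> \<open>Otherwise both \<open>h\<close> and \<open>?x'\<close> would contribute at least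
    1 to the gap of \<open>x\<close>, which is 1.\<close>
  have x'z: "?x' = z s"
  proof (rule ccontr)
    assume "?x' \<noteq> z s"
    then have "1 \<le> gap S a s ?x'" using pos[OF x'Fl] zx' x'x xs by blast
    then show False using gx wx join_ge[OF h_Fl order_refl hb] by (simp add: gap_def)
  qed
  have wh: "wt a h = 1" using gx wx x'z by (simp add: gap_def)
  have F: "Fc (z s) = Fc x - {h}" using Fc_jn_subset[OF xFl, of "Fc x - {h}"] x'z by auto
  have Fz: "Fc (z s) \<subseteq> blw S s"
    using NS_factors[OF NS_subset[OF S blw_subset]] max_subset by blast
  have xeq: "jn (insert h (blw S s)) = x"
  proof
    show "jn (insert h (blw S s)) \<subseteq> x"
    proof (rule jn_least)
      fix t assume "t \<in> insert h (blw S s)"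
      then show "t \<subseteq> x" using hlex jn_upper[OF S_Fl] zx by blast
    qed (rule xFl)
    have "Fc x \<subseteq> insert h (blw S s)" using F Fz by blast
    then show "x \<subseteq> jn (insert h (blw S s))" using jn_mono[OF _ insert_Fl] jn_Fc[OF xFl] by blast
  qed
  have lh: "local_sat (insert h S) a h"
    unfolding local_sat_def gap_pos_def gap_def blw_insert_new wt_bot
    using wh join_ge by auto
  have lsat: "local_sat (insert h S) a s"
    unfolding local_sat_def gap_pos_def gap_def blw_insert_root xeq
  proof (intro conjI ballI impI)
    show "wt a s - wt a x = 1" using d gx by (simp add: defect_def gap_def)
    fix y assume y: "y \<in> Fl" "x \<subset> y" "y \<subseteq> s"
    have "1 \<le> gap S a s y" using pos[OF y(1)] y zx by blast
    moreover have "gap S a s y \<noteq> 1"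
    proof
      assume "gap S a s y = 1"
      then have "y \<in> tight s" using y zx by (auto simp: tight_def)
      then show False using x y by (auto simp: max_elements_def)
    qed
    ultimately show "1 \<le> wt a y - wt a x" using gx by (simp add: gap_def)
  qed
  \<comment> \<open>Consider an antichain through \<open>h\<close> with join in \<open>G\<close>. If
    its other elements lie in \<open>blw S s\<close>, the join is below the factor \<open>h\<close>
    of \<open>x\<close>; if not, the join is below a member of \<open>insert s (A - {h})\<close>.
    Neither is possible for an antichain with two elements.\<close>
  have "insert h S \<in> NS"
  proof (rule NS_I)
    show "insert h S \<subseteq> G" using h NS_G[OF S] by blast
  next
    fix A assume A: "A \<subseteq> insert h S" "2 \<le> card A" "\<And>g h. g \<in> A \<Longrightarrow> h \<in> A \<Longrightarrow> g \<subseteq> h \<Longrightarrow> g = h" and j: "jn A \<in> G"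
    have AFl: "A \<subseteq> Fl" using A(1) NS_Fl[OF S] h_Fl by blast
    have hA: "h \<in> A"
    proof (rule ccontr)
      assume "h \<notin> A"
      then have "A \<subseteq> S" using A(1) by blast
      then show False using NS_D[OF S _ A(2)] A(3) j by blast
    qed
    have hj: "h \<subseteq> jn A" using jn_upper[OF AFl hA] .
    show False
    proof (cases "A - {h} \<subseteq> blw S s")
      case True
      then have "jn A \<subseteq> x" using jn_mono[OF _ insert_Fl, of A] xeq by blast
      then obtain y where y: "y \<in> Fc x" "jn A \<subseteq> y" using Fc_above_ex j by blast
      then have "y = h" using Fc_unique[OF xFl y(1) hx h(1)] hj by blast
      then have "A \<subseteq> {h}" using A(3)[OF _ hA] jn_upper[OF AFl] y by blast
      then have "card A \<le> card {h}" by (intro card_mono) auto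
      then show False using A(2) by simp
    next
      case False
      then obtain b where b: "b \<in> A" "b \<noteq> h" "b \<notin> blw S s" by blast
      let ?M = "insert s (A - {h})"
      have M: "?M \<in> NS" using NS_subset[OF N_NS, of ?M] sN A(1) by blast
      have "jn A \<subseteq> jn ?M"
      proof (rule jn_least)
        fix t assume "t \<in> A"
        then show "t \<subseteq> jn ?M" using jn_upper[OF NS_Fl[OF M]] hs by blast
      qed (use jn_Fl NS_Fl[OF M] in blast)
      then obtain p where p: "p \<in> max_elements ?M" "jn A \<subseteq> p"
        using Fc_above_ex[OF j] NS_factors[OF M] by blast
      have bp: "b \<subseteq> p" using jn_upper[OF AFl b(1)] p by blast
      have pM: "p \<in> ?M" using p(1) max_subset by blast
      show False
      proof (cases "p = s")
        case True
        then have "b = s" using b A(1) bp by (auto simp: blw_def)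
        then show False using A(3)[OF hA b(1)] hs by blast
      next
        case False
        then show False using A(3)[OF hA, of p] hj p(2) pM by blast
      qed
    qed
  qed
  moreover have "local_sat (insert h S) a t" if "t \<in> insert h S \<union> Fc f" for t
  proof -
    consider "t = h" | "t = s" | "t \<in> N" "t \<noteq> s" using \<open>t \<in> insert h S \<union> Fc f\<close> by blast
    then show ?thesis
    proof cases
      case 3
      then show ?thesis using d local_sat_insert_other by (simp add: defect_def)
    qed (use lh lsat in auto)
  qed
  ultimately show ?thesis by (simp add: sat_def)
qed

end

text \<open>At most one factor of \<open>x\<close> contains \<open>k\<close>, and one does exactly
  if \<open>k\<close> is below \<open>x\<close>. So the indicator of the factors of \<open>x\<close>
  is the Moebius inverse of the indicator of the elements below \<open>x\<close>.\<close>

lemma sum_factor_indicator: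
  assumes x: "x \<in> Fl" "x \<subseteq> f" and k: "k \<in> G"
  shows "(\<Sum>k'\<in>{k'\<in>G. k' \<subseteq> f \<and> k \<subseteq> k'}. if k' \<in> Fc x then 1 else 0 :: int) = (if k \<subseteq> x then 1 else 0)"
proof (cases "k \<subseteq> x")
  case True
  then obtain y where y: "y \<in> Fc x" "k \<subseteq> y" using Fc_above_ex[OF k True] by auto
  have "y \<in> G" "y \<subseteq> f" using y Fc_G[of x] Fc_le[OF y(1)] x by auto
  have "(\<Sum>k'\<in>{k'\<in>G. k' \<subseteq> f \<and> k \<subseteq> k'}. if k' \<in> Fc x then 1 else 0 :: int)
      = (\<Sum>k'\<in>{k'\<in>G. k' \<subseteq> f \<and> k \<subseteq> k'}. if k' = y then 1 else 0)"
    using Fc_unique[OF x(1) _ y(1) k _ y(2)] y(1) by (intro sum.cong) auto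
  then show ?thesis using finite_G True \<open>y \<in> G\<close> \<open>y \<subseteq> f\<close> y(2) by (simp add: sum.delta)
next
  case False
  then have "k' \<notin> Fc x" if "k \<subseteq> k'" for k' using that Fc_le by auto
  then show ?thesis using False by simp
qed

lemma finite_tight: "finite (tight s)"
  by (rule finite_subset[OF _ finite_Fl]) (auto simp: tight_def)

lemma tight_maxD:
  assumes "x \<in> max_elements (tight s)"
  shows "x \<in> Fl" "z s \<subset> x" "x \<subseteq> s"
  using assms max_subset[of "tight s"] by (auto simp: tight_def)

text \<open>A root other than \<open>s\<close> would be a member of \<open>S\<close> below
  \<open>x\<close> that contains \<open>h\<close>, against \<open>h\<close> being a factor of
  \<open>x\<close> outside \<open>S\<close>.\<close>

lemma root_tight:
  assumes h: "h \<in> G" "h \<subseteq> f" "h \<notin> Fc f" "h \<notin> S" and d: "defect s" and x: "x \<in> max_elements (tight s)" "h \<in> Fc x"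
  shows "is_root N h s"
proof -
  have hx: "h \<subseteq> x" "x \<subseteq> s" using Fc_le[OF x(2)] tight_maxD[OF x(1)] by auto
  obtain t where t: "is_root N h t" using root_ex'[OF h(1,2)] by auto
  have sN: "s \<in> N" using d by (simp add: defect_def)
  have "t = s"
  proof (rule ccontr)
    assume ne: "t \<noteq> s"
    have tz: "t \<in> S" "t \<subseteq> z s" using root_below[OF t sN _ ne[symmetric]] hx by auto
    have "t \<in> G" "t \<subseteq> x" using tz NS_G[OF S] tight_maxD[OF x(1)] by auto
    moreover have "h \<subseteq> t" using t by (simp add: is_root_def)
    ultimately have "h = t" using x(2) Fc_mem_iff[of h x] by auto
    then show False using h(4) tz(1) by simp
  qed
  then show ?thesis using t by simp
qed

lemma tight_max_unique:
  assumes h: "h \<in> G" "h \<notin> S" and d: "defect s"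
    and x: "x1 \<in> max_elements (tight s)" "h \<in> Fc x1" "x2 \<in> max_elements (tight s)" "h \<in> Fc x2"
  shows "x1 = x2"
proof (rule ccontr)
  assume "x1 \<noteq> x2"
  then have "x1 \<inter> x2 = z s" using tight_max_meet[OF d x(1,3)] by simp
  moreover have "h \<subseteq> x1 \<inter> x2" using Fc_le[OF x(2)] Fc_le[OF x(4)] by auto
  ultimately have "h \<subseteq> z s" by simp
  then obtain t where t: "t \<in> S" "t \<subset> s" "h \<subseteq> t" using below_z[OF h(1), of s] by auto
  have "t \<in> G" "t \<subseteq> x1" using t S_le_z[OF t(1,2)] NS_G[OF S] tight_maxD[OF x(1)] by auto
  then have "h = t" using x(2) Fc_mem_iff[of h x1] t(3) by auto
  then show False using h(2) t(1) by simp
qed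

text \<open>Raising \<open>k\<close> gives \<open>sat\<close> iff \<open>k\<close> is below
  \<open>s\<close>, not below \<open>z s\<close>, and below no tight flat. Distinct maximal tight
  flats meet in \<open>z s\<close>, so inclusion-exclusion writes this as [k below s], minus the sum
  of [k below x] over maximal tight \<open>x\<close>, plus (their number minus 1) times
  [k below z s]. \<open>v\<close> inverts this term by term, and at a new \<open>h\<close> only the
  middle term survives.\<close>

lemma moebius_defect:
  assumes d: "defect s"
  defines "v \<equiv> \<lambda>h. (if h = s then 1 else 0) - (\<Sum>x\<in>max_elements (tight s). if h \<in> Fc x then 1 else 0)
      + (int (card (max_elements (tight s))) - 1) * (if h \<in> Fc (z s) then 1 else 0)"
  shows "\<forall>k\<in>G. k \<subseteq> f \<longrightarrow> (\<Sum>k'\<in>{k'\<in>G. k' \<subseteq> f \<and> k \<subseteq> k'}. v k') = (if sat S f (a(k := Suc (a k))) then 1 else 0)"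
    and "\<forall>h\<in>G. h \<subseteq> f \<longrightarrow> h \<notin> Fc f \<longrightarrow> h \<notin> S \<longrightarrow> (\<forall>t\<in>S. \<not> t \<subset> h) \<longrightarrow> v h = (if sat (insert h S) f a then - 1 else 0)"
proof -
  let ?M = "max_elements (tight s)"
  have finM: "finite ?M" using finite_tight max_subset finite_subset by metis
  have sN: "s \<in> N" using d by (simp add: defect_def)
  have sG: "s \<in> G" and sf: "s \<subseteq> f" using sN N_G N_le by auto
  have zs: "z s \<subset> s" by (rule z_psub[OF sN])
  have Mle: "x \<in> Fl" "x \<subseteq> f" "z s \<subset> x" if "x \<in> ?M" for x using tight_maxD[OF that] sf by auto
  show "\<forall>k\<in>G. k \<subseteq> f \<longrightarrow> (\<Sum>k'\<in>{k'\<in>G. k' \<subseteq> f \<and> k \<subseteq> k'}. v k') = (if sat S f (a(k := Suc (a k))) then 1 else 0)"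
  proof (intro ballI impI)
    fix k assume k: "k \<in> G" "k \<subseteq> f"
    let ?K = "{k'\<in>G. k' \<subseteq> f \<and> k \<subseteq> k'}"
    have finK: "finite ?K" using finite_G by simp
    have e1: "(\<Sum>k'\<in>?K. if k' = s then 1 else 0 :: int) = (if k \<subseteq> s then 1 else 0)"
      using finK sG sf by (simp add: sum.delta)
    have "(\<Sum>k'\<in>?K. \<Sum>x\<in>?M. if k' \<in> Fc x then 1 else 0 :: int) = (\<Sum>x\<in>?M. \<Sum>k'\<in>?K. if k' \<in> Fc x then 1 else 0)"
      by (rule sum.swap)
    also have "\<dots> = (\<Sum>x\<in>?M. if k \<subseteq> x then 1 else 0)"
      using sum_factor_indicator[OF Mle(1,2) k(1)] by (intro sum.cong) auto
    finally have e2: "(\<Sum>k'\<in>?K. \<Sum>x\<in>?M. if k' \<in> Fc x then 1 else 0 :: int) = (\<Sum>x\<in>?M. if k \<subseteq> x then 1 else 0)" .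
    have "z s \<subseteq> f" using zs sf by auto
    then have e3: "(\<Sum>k'\<in>?K. if k' \<in> Fc (z s) then 1 else 0 :: int) = (if k \<subseteq> z s then 1 else 0)"
      using sum_factor_indicator[OF z_Fl _ k(1)] by simp
    have sumv: "(\<Sum>k'\<in>?K. v k') = (if k \<subseteq> s then 1 else 0) - (\<Sum>x\<in>?M. if k \<subseteq> x then 1 else 0)
        + (int (card ?M) - 1) * (if k \<subseteq> z s then 1 else 0)"
      unfolding v_def sum.distrib sum_subtractf e1 e2 sum_distrib_left[symmetric] e3 ..
    obtain t where t: "is_root N k t" using root_ex'[OF k] by auto
    have S1: "sat S f (a(k := Suc (a k))) \<longleftrightarrow> t = s \<and> (\<forall>x\<in>tight s. \<not> k \<subseteq> x)"
      using sat_incr[OF k(1) t] d defect_unique[OF d, of t] by auto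
    show "(\<Sum>k'\<in>?K. v k') = (if sat S f (a(k := Suc (a k))) then 1 else 0)"
    proof (cases "k \<subseteq> z s")
      case True
      have "t \<noteq> s" using root_not_below_z[OF t k(1)] True by auto
      moreover have "k \<subseteq> x" if "x \<in> ?M" for x using Mle(3)[OF that] True by auto
      then have "(\<Sum>x\<in>?M. if k \<subseteq> x then 1 else 0 :: int) = (\<Sum>x\<in>?M. 1)" by (intro sum.cong) auto
      moreover have "k \<subseteq> s" using True zs by auto
      ultimately show ?thesis unfolding sumv S1 using True by simp
    next
      case nz: False
      show ?thesis
      proof (cases "k \<subseteq> s")
        case False
        then have "\<not> k \<subseteq> x" if "x \<in> ?M" for x using tight_maxD(3)[OF that] by auto
        then have "(\<Sum>x\<in>?M. if k \<subseteq> x then 1 else 0 :: int) = 0" by (intro sum.neutral) auto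
        moreover have "t \<noteq> s" using t False by (auto simp: is_root_def)
        ultimately show ?thesis unfolding sumv S1 using False nz by simp
      next
        case True
        have ts: "t = s"
        proof (rule ccontr)
          assume "t \<noteq> s"
          then have "t \<subseteq> z s" using root_below(3)[OF t sN True] by auto
          then show False using nz t by (auto simp: is_root_def)
        qed
        show ?thesis
        proof (cases "\<exists>x\<in>tight s. k \<subseteq> x")
          case ex: True
          then obtain x where "x \<in> tight s" "k \<subseteq> x" by auto
          then obtain y where y: "y \<in> ?M" "k \<subseteq> y" using max_above[OF finite_tight, of x s] by auto
          have "(\<Sum>x\<in>?M. if k \<subseteq> x then 1 else 0 :: int) = (\<Sum>x\<in>?M. if x = y then 1 else 0)"
          proof (rule sum.cong)
            fix x assume x: "x \<in> ?M"
            have "x = y" if "k \<subseteq> x"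
            proof (rule ccontr)
              assume "x \<noteq> y"
              then have "x \<inter> y = z s" using tight_max_meet[OF d x y(1)] by simp
              then show False using nz y(2) that by auto
            qed
            then have "(k \<subseteq> x) = (x = y)" using y(2) by blast
            then show "(if k \<subseteq> x then 1 else 0 :: int) = (if x = y then 1 else 0)" by (simp only:)
          qed simp
          also have "\<dots> = 1" using finM y(1) by (simp add: sum.delta)
          finally have M1: "(\<Sum>x\<in>?M. if k \<subseteq> x then 1 else 0 :: int) = 1" .
          have "\<not> sat S f (a(k := Suc (a k)))" unfolding S1 using ex by metis
          then show ?thesis unfolding sumv M1 using True nz by simp
        next
          case nex: False
          have "\<not> k \<subseteq> x" if "x \<in> ?M" for x using nex that max_subset[of "tight s"] by auto
          then have "(\<Sum>x\<in>?M. if k \<subseteq> x then 1 else 0 :: int) = 0" by (intro sum.neutral) auto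
          then show ?thesis unfolding sumv S1 using True nz nex ts by simp
        qed
      qed
    qed
  qed
  show "\<forall>h\<in>G. h \<subseteq> f \<longrightarrow> h \<notin> Fc f \<longrightarrow> h \<notin> S \<longrightarrow> (\<forall>t\<in>S. \<not> t \<subset> h) \<longrightarrow> v h = (if sat (insert h S) f a then - 1 else 0)"
  proof (intro ballI impI)
    fix h assume h: "h \<in> G" "h \<subseteq> f" "h \<notin> Fc f" "h \<notin> S" and hmin: "\<forall>t\<in>S. \<not> t \<subset> h"
    have "h \<noteq> s" using sN h by auto
    moreover have "Fc (z s) \<subseteq> S"
      unfolding NS_factors[OF NS_subset[OF S blw_subset]] by (rule subset_trans[OF max_subset blw_subset])
    then have "h \<notin> Fc (z s)" using h(4) by auto
    ultimately have vh: "v h = - (\<Sum>x\<in>?M. if h \<in> Fc x then 1 else 0)" by (simp add: v_def)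
    show "v h = (if sat (insert h S) f a then - 1 else 0)"
    proof (cases "\<exists>x\<in>?M. h \<in> Fc x")
      case True
      then obtain y where y: "y \<in> ?M" "h \<in> Fc y" by auto
      have root: "is_root N h s" by (rule root_tight[OF h d y])
      have "sat (insert h S) f a" by (rule sat_insert_if[OF h _ root d y]) (use hmin in auto)
      moreover have "(\<Sum>x\<in>?M. if h \<in> Fc x then 1 else 0 :: int) = (\<Sum>x\<in>?M. if x = y then 1 else 0)"
      proof (rule sum.cong)
        fix x assume x: "x \<in> ?M"
        have "(h \<in> Fc x) = (x = y)" using tight_max_unique[OF h(1,4) d x _ y] y(2) by blast
        then show "(if h \<in> Fc x then 1 else 0 :: int) = (if x = y then 1 else 0)" by (simp only:)
      qed simp
      moreover have "\<dots> = 1" using finM y(1) by (simp add: sum.delta)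
      ultimately show ?thesis unfolding vh by simp
    next
      case False
      obtain t where t: "is_root N h t" using root_ex'[OF h(1,2)] by auto
      have "\<not> sat (insert h S) f a"
      proof
        assume sa: "sat (insert h S) f a"
        have "defect t \<and> (\<exists>x\<in>max_elements (tight t). h \<in> Fc x)"
          by (rule sat_insert_imp[OF h _ t sa]) (use hmin in auto)
        then show False using defect_unique[OF d, of t] False by auto
      qed
      moreover have "(\<Sum>x\<in>?M. if h \<in> Fc x then 1 else 0 :: int) = 0" using False by (intro sum.neutral) auto
      ultimately show ?thesis unfolding vh by simp
    qed
  qed
qed

lemma no_defect:
  assumes nd: "\<nexists>s. defect s" and k: "k \<in> G" "k \<subseteq> f"
  shows "\<not> sat S f (a(k := Suc (a k)))"
    and "k \<notin> Fc f \<Longrightarrow> k \<notin> S \<Longrightarrow> \<forall>t\<in>S. \<not> t \<subset> k \<Longrightarrow> \<not> sat (insert k S) f a"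
proof -
  obtain t where t: "is_root N k t" using root_ex'[OF k] by auto
  show "\<not> sat S f (a(k := Suc (a k)))" using sat_incr[OF k(1) t] nd by simp
  assume h: "k \<notin> Fc f" "k \<notin> S" and m: "\<forall>t\<in>S. \<not> t \<subset> k"
  show "\<not> sat (insert k S) f a"
  proof
    assume sa: "sat (insert k S) f a"
    have "defect t \<and> (\<exists>x\<in>max_elements (tight t). k \<in> Fc x)"
      by (rule sat_insert_imp[OF k h _ t sa]) (use m in auto)
    then show False using nd by simp
  qed
qed

end

text \<open>Raising one coordinate of the weight turns the condition \<^const>\<open>sat\<close> for \<open>S\<close> into the zeta
  transform of the same condition for the sets \<open>insert h S\<close>.\<close>

lemma sat_moebius:
  assumes f: "f \<in> Fl" and SG: "S \<subseteq> G" and Sf: "\<And>s. s \<in> S \<Longrightarrow> s \<subseteq> f" and SF: "S \<inter> Fc f = {}"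
  shows "\<exists>v::'a set \<Rightarrow> int.
    (\<forall>k\<in>G. k \<subseteq> f \<longrightarrow> (\<Sum>k'\<in>{k'\<in>G. k' \<subseteq> f \<and> k \<subseteq> k'}. v k') = (if sat S f (a(k := Suc (a k))) then 1 else 0)) \<and>
    (\<forall>h\<in>G. h \<subseteq> f \<longrightarrow> h \<notin> Fc f \<longrightarrow> h \<notin> S \<longrightarrow> (\<forall>t\<in>S. \<not> t \<subset> h) \<longrightarrow> v h = (if sat (insert h S) f a then - 1 else 0))"
proof (cases "S \<in> NS")
  case False
  have "insert h S \<notin> NS" for h using False NS_subset[of "insert h S" S] by auto
  then have "\<not> sat S f b" "\<not> sat (insert h S) f b" for h b using False by (auto simp: sat_def)
  then show ?thesis by (intro exI[of _ "\<lambda>_. 0"]) simp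
next
  case S: True
  show ?thesis
  proof (cases "\<exists>s. defect f S a s")
    case True
    then obtain s where d: "defect f S a s" by auto
    show ?thesis
      by (rule exI, rule conjI, rule moebius_defect(1)[OF f S Sf SF d], assumption, rule moebius_defect(2)[OF f S Sf SF d], assumption)
  next
    case False
    show ?thesis
      by (rule exI[of _ "\<lambda>_. 0"]) (use no_defect[OF f S Sf SF False] in auto)
  qed
qed

end

section \<open>Additive maps on finitely supported functions\<close>

abbreviation "lookup \<equiv> Poly_Mapping.lookup"
abbreviation "keys \<equiv> Poly_Mapping.keys"
abbreviation "single \<equiv> Poly_Mapping.single"

definition ksum :: "('k \<Rightarrow> 'c::zero \<Rightarrow> 'd::comm_monoid_add) \<Rightarrow> ('k \<Rightarrow>\<^sub>0 'c) \<Rightarrow> 'd" where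
  "ksum \<Phi> p = (\<Sum>k\<in>keys p. \<Phi> k (lookup p k))"

definition additive_family :: "('k \<Rightarrow> 'c::comm_monoid_add \<Rightarrow> 'd::comm_monoid_add) \<Rightarrow> bool" where
  "additive_family \<Phi> \<longleftrightarrow> (\<forall>k. \<Phi> k 0 = 0) \<and> (\<forall>k a b. \<Phi> k (a + b) = \<Phi> k a + \<Phi> k b)"

lemma additive_familyI: "(\<And>k. \<Phi> k 0 = 0) \<Longrightarrow> (\<And>k a b. \<Phi> k (a + b) = \<Phi> k a + \<Phi> k b) \<Longrightarrow> additive_family \<Phi>"
  by (simp add: additive_family_def)

lemma ksum_superset:
  assumes "additive_family \<Phi>" "finite A" "keys p \<subseteq> A"
  shows "ksum \<Phi> p = (\<Sum>k\<in>A. \<Phi> k (lookup p k))"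
  unfolding ksum_def using assms
  by (intro sum.mono_neutral_left) (auto simp: additive_family_def in_keys_iff)

lemma ksum_add:
  assumes "additive_family \<Phi>" shows "ksum \<Phi> (p + q) = ksum \<Phi> p + ksum \<Phi> q"
proof -
  let ?A = "keys p \<union> keys q"
  have "ksum \<Phi> (p + q) = (\<Sum>k\<in>?A. \<Phi> k (lookup (p + q) k))"
    using assms keys_add[of p q] by (intro ksum_superset) auto
  also have "\<dots> = (\<Sum>k\<in>?A. \<Phi> k (lookup p k)) + (\<Sum>k\<in>?A. \<Phi> k (lookup q k))"
    using assms by (simp add: lookup_add additive_family_def sum.distrib)
  finally show ?thesis using ksum_superset[OF assms, of ?A] by simp
qed

lemma ksum_zero [simp]: "ksum \<Phi> 0 = 0"
  by (simp add: ksum_def)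

lemma ksum_single: "additive_family \<Phi> \<Longrightarrow> ksum \<Phi> (single k c) = \<Phi> k c"
  using ksum_superset[of \<Phi> "{k}" "single k c"] by simp

lemma ksum_sum: "additive_family \<Phi> \<Longrightarrow> ksum \<Phi> (\<Sum>i\<in>I. p i) = (\<Sum>i\<in>I. ksum \<Phi> (p i))"
  by (induction I rule: infinite_finite_induct) (simp_all add: ksum_add)

lemma poly_mapping_sum: "p = (\<Sum>k\<in>keys p. single k (lookup p k))"
proof (rule poly_mapping_eqI)
  fix k
  have "lookup (\<Sum>k\<in>keys p. single k (lookup p k)) k = (\<Sum>k'\<in>keys p. if k' = k then lookup p k' else 0)"
    by (auto simp: lookup_sum lookup_single when_def intro!: sum.cong)
  also have "\<dots> = lookup p k" by (simp add: sum.delta in_keys_iff)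
  finally show "lookup p k = lookup (\<Sum>k\<in>keys p. single k (lookup p k)) k" ..
qed

lemma ksum_eqI:
  fixes F :: "('k \<Rightarrow>\<^sub>0 'c::comm_monoid_add) \<Rightarrow> 'd::comm_monoid_add"
  assumes F: "\<And>p q. F (p + q) = F p + F q" "F 0 = 0"
    and S: "\<And>k. k \<in> keys p \<Longrightarrow> F (single k (lookup p k)) = \<Phi> k (lookup p k)"
  shows "F p = ksum \<Phi> p"
proof -
  have "F (\<Sum>k\<in>A. single k (lookup p k)) = (\<Sum>k\<in>A. F (single k (lookup p k)))" for A
    by (induction A rule: infinite_finite_induct) (simp_all add: F)
  then have "F p = (\<Sum>k\<in>keys p. F (single k (lookup p k)))" by (subst poly_mapping_sum) simp
  then show ?thesis unfolding ksum_def using S by simp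
qed

section \<open>Polynomials\<close>

definition monprod :: "('g \<Rightarrow> 'p::comm_ring_1) \<Rightarrow> ('g \<Rightarrow>\<^sub>0 nat) \<Rightarrow> 'p" where
  "monprod y m = (\<Prod>g\<in>keys m. y g ^ lookup m g)"

definition subst_hom :: "('g \<Rightarrow> 'h polynomial) \<Rightarrow> 'g polynomial \<Rightarrow> 'h polynomial" where
  "subst_hom y = ksum (\<lambda>m c. single 0 c * monprod y m)"

lemma monprod_superset: "finite A \<Longrightarrow> keys m \<subseteq> A \<Longrightarrow> monprod y m = (\<Prod>g\<in>A. y g ^ lookup m g)"
  unfolding monprod_def by (intro prod.mono_neutral_left) (auto simp: in_keys_iff)

lemma monprod_add: "monprod y (m + n) = monprod y m * monprod y n"
proof -
  let ?A = "keys m \<union> keys n"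
  have "monprod y (m + n) = (\<Prod>g\<in>?A. y g ^ lookup (m + n) g)"
    using keys_add[of m n] by (intro monprod_superset) auto
  then show ?thesis
    using monprod_superset[of ?A m y] monprod_superset[of ?A n y]
    by (simp add: lookup_add power_add prod.distrib)
qed

lemma monprod_zero [simp]: "monprod y 0 = 1"
  by (simp add: monprod_def)

lemma monprod_single: "monprod y (single g b) = y g ^ b"
  using monprod_superset[of "{g}" "single g b" y] by simp

lemma subst_family: "additive_family (\<lambda>m c. single 0 c * monprod y m :: 'h polynomial)"
  by (rule additive_familyI) (simp_all add: single_add distrib_right)

lemma subst_add: "subst_hom y (p + q) = subst_hom y p + subst_hom y q"
  unfolding subst_hom_def by (rule ksum_add[OF subst_family])

lemma subst_zero [simp]: "subst_hom y 0 = 0"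
  by (simp add: subst_hom_def)

lemma subst_single: "subst_hom y (single m c) = single 0 c * monprod y m"
  unfolding subst_hom_def by (rule ksum_single[OF subst_family])

lemma subst_sum: "subst_hom y (\<Sum>i\<in>I. p i) = (\<Sum>i\<in>I. subst_hom y (p i))"
  unfolding subst_hom_def by (rule ksum_sum[OF subst_family])

lemma subst_mult:
  fixes y :: "'g \<Rightarrow> 'h polynomial"
  shows "subst_hom y (p * q) = subst_hom y p * subst_hom y q"
proof -
  have "p * q = (\<Sum>k\<in>keys p. \<Sum>l\<in>keys q. single k (lookup p k) * single l (lookup q l))"
    unfolding sum_product[symmetric] poly_mapping_sum[symmetric] ..
  also have "subst_hom y \<dots> = (\<Sum>k\<in>keys p. \<Sum>l\<in>keys q. subst_hom y (single k (lookup p k)) * subst_hom y (single l (lookup q l)))"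
  proof -
    have "subst_hom y (single k c * single l d) = subst_hom y (single k c) * subst_hom y (single l d)" for k l c d
    proof -
      have e: "single 0 (c * d) = (single 0 c * single 0 d :: ('h \<Rightarrow>\<^sub>0 nat) \<Rightarrow>\<^sub>0 rat)" by (simp add: mult_single)
      have "subst_hom y (single k c * single l d) = single 0 (c * d) * (monprod y k * monprod y l)"
        unfolding mult_single subst_single monprod_add ..
      then show ?thesis unfolding e subst_single by (simp only: mult_ac)
    qed
    then show ?thesis by (simp add: subst_sum)
  qed
  also have "\<dots> = (\<Sum>k\<in>keys p. subst_hom y (single k (lookup p k))) * (\<Sum>l\<in>keys q. subst_hom y (single l (lookup q l)))"
    by (simp add: sum_product)
  also have "\<dots> = subst_hom y p * subst_hom y q"
    unfolding subst_sum[symmetric] poly_mapping_sum[symmetric] ..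
  finally show ?thesis .
qed

lemma subst_one [simp]: "subst_hom y 1 = 1"
  using subst_single[of y 0 1] by simp

lemma subst_power: "subst_hom y (p ^ n) = subst_hom y p ^ n"
  by (induction n) (simp_all add: subst_mult)

lemma subst_prod: "subst_hom y (\<Prod>i\<in>I. p i) = (\<Prod>i\<in>I. subst_hom y (p i))"
  by (induction I rule: infinite_finite_induct) (simp_all add: subst_mult)

lemma subst_xvar: "subst_hom y (xvar g) = y g"
  by (simp add: xvar_def subst_single monprod_single)

lemma xprod_empty [simp]: "xprod {} = 1"
  by (simp add: xprod_def)

lemma xprod_insert: "finite S \<Longrightarrow> h \<notin> S \<Longrightarrow> xprod (insert h S) = xvar h * xprod S"
  by (simp add: xprod_def)

lemma xprod_Un_Int: "finite A \<Longrightarrow> finite B \<Longrightarrow> xprod (A \<union> B) * xprod (A \<inter> B) = xprod A * xprod B"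
  unfolding xprod_def by (rule prod.union_inter)

lemma xprod_Un: "finite A \<Longrightarrow> finite B \<Longrightarrow> A \<inter> B = {} \<Longrightarrow> xprod (A \<union> B) = xprod A * xprod B"
  using xprod_Un_Int[of A B] by simp

abbreviation mon :: "('g \<Rightarrow>\<^sub>0 nat) \<Rightarrow> 'g polynomial" where "mon m \<equiv> single m 1"

lemma xvar_power: "xvar g ^ b = mon (single g b)"
  by (induction b) (simp_all add: xvar_def mult_single single_add[symmetric])

section \<open>Moebius inversion\<close>

text \<open>A minimal \<open>k0\<close> occurs in no equation but its own, so the system without it
  is solved first and the equation of \<open>k0\<close> then defines its value. The subgroup
  \<open>A\<close> keeps track of the form of the solution; it will consist of linear forms.\<close>

lemma moebius_ex:
  fixes u :: "'a set \<Rightarrow> 'b::ab_group_add"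
  assumes "finite X" and A: "0 \<in> A" "\<And>p q. p \<in> A \<Longrightarrow> q \<in> A \<Longrightarrow> p + q \<in> A" "\<And>p. p \<in> A \<Longrightarrow> - p \<in> A"
    and u: "\<And>k. k \<in> X \<Longrightarrow> u k \<in> A"
  shows "\<exists>v. (\<forall>k\<in>X. (\<Sum>h\<in>{h\<in>X. k \<subseteq> h}. v h) = u k) \<and> (\<forall>h. v h \<in> A) \<and> (\<forall>h. h \<notin> X \<longrightarrow> v h = 0)"
  using assms(1) u
proof (induction X rule: finite_psubset_induct)
  case (psubset X)
  show ?case
  proof (cases "X = {}")
    case True
    then show ?thesis using A(1) by (intro exI[of _ "\<lambda>_. 0"]) auto
  next
    case False
    then obtain k0 where k0: "k0 \<in> X" "\<forall>b\<in>X. b \<subseteq> k0 \<longrightarrow> k0 = b"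
      using finite_has_minimal[OF psubset.hyps(1)] by auto
    let ?X = "X - {k0}"
    have "?X \<subset> X" using k0 by auto
    then obtain v where v: "\<forall>k\<in>?X. (\<Sum>h\<in>{h\<in>?X. k \<subseteq> h}. v h) = u k" "\<forall>h. v h \<in> A" "\<forall>h. h \<notin> ?X \<longrightarrow> v h = 0"
      using psubset.IH[of ?X] psubset.prems by auto
    define c where "c = u k0 - (\<Sum>h\<in>{h\<in>?X. k0 \<subseteq> h}. v h)"
    have sA: "(\<Sum>h\<in>B. v h) \<in> A" for B
      by (induction B rule: infinite_finite_induct) (use A v(2) in auto)
    have cA: "c \<in> A" unfolding c_def using A(2)[OF psubset.prems[OF k0(1)] A(3)[OF sA]] by simp
    have "(\<Sum>h\<in>{h\<in>X. k \<subseteq> h}. (v(k0 := c)) h) = u k" if k: "k \<in> X" for k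
    proof (cases "k = k0")
      case True
      then have "{h\<in>X. k \<subseteq> h} = insert k0 {h\<in>?X. k0 \<subseteq> h}" using k0 by auto
      then have "(\<Sum>h\<in>{h\<in>X. k \<subseteq> h}. (v(k0 := c)) h) = c + (\<Sum>h\<in>{h\<in>?X. k0 \<subseteq> h}. (v(k0 := c)) h)"
        using psubset.hyps(1) by simp
      also have "(\<Sum>h\<in>{h\<in>?X. k0 \<subseteq> h}. (v(k0 := c)) h) = (\<Sum>h\<in>{h\<in>?X. k0 \<subseteq> h}. v h)"
        by (intro sum.cong) auto
      finally show ?thesis using True by (simp add: c_def)
    next
      case False
      have "\<not> k \<subseteq> k0" using k0(2) k False by auto
      then have "(\<Sum>h\<in>{h\<in>X. k \<subseteq> h}. (v(k0 := c)) h) = (\<Sum>h\<in>{h\<in>?X. k \<subseteq> h}. v h)"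
        by (intro sum.cong) auto
      then show ?thesis using v(1) k False by simp
    qed
    then show ?thesis using v cA k0 by (intro exI[of _ "v(k0 := c)"]) auto
  qed
qed

text \<open>At a maximal element where the two functions differ, the equation contains no other
  differing term.\<close>

lemma moebius_unique:
  fixes v v' :: "'a set \<Rightarrow> 'b::ab_group_add"
  assumes "finite X" and eq: "\<And>k. k \<in> X \<Longrightarrow> (\<Sum>h\<in>{h\<in>X. k \<subseteq> h}. v h) = (\<Sum>h\<in>{h\<in>X. k \<subseteq> h}. v' h)"
    and "h \<in> X"
  shows "v h = v' h"
proof (rule ccontr)
  assume "v h \<noteq> v' h"
  let ?B = "{h\<in>X. v h \<noteq> v' h}"
  have "finite ?B" "?B \<noteq> {}" using assms \<open>v h \<noteq> v' h\<close> by auto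
  then obtain m where m: "m \<in> ?B" "\<forall>b\<in>?B. m \<subseteq> b \<longrightarrow> m = b" using finite_has_maximal[of ?B] by auto
  have s: "{h\<in>X. m \<subseteq> h} = insert m {h\<in>X. m \<subset> h}" using m by auto
  have "(\<Sum>h\<in>{h\<in>X. m \<subset> h}. v h) = (\<Sum>h\<in>{h\<in>X. m \<subset> h}. v' h)"
    using m(2) by (intro sum.cong) auto
  then have "v m = v' m" using eq[of m] m(1) assms(1) unfolding s by simp
  then show False using m by simp
qed

context building_polymatroid
begin

section \<open>Integration\<close>

definition linear_forms :: "'a set \<Rightarrow> 'a set polynomial set" where
  "linear_forms f = {p. \<forall>m\<in>keys p. \<exists>k\<in>G. k \<subseteq> f \<and> m = single k 1}"

text \<open>The change of coordinates \<open>x\<^sub>h \<mapsto> y\<^sub>h\<close> that sends \<open>c\<^sub>k\<close> to the variable of \<open>k\<close> if \<open>k \<subseteq> f\<close>, and to zero otherwise.\<close>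

definition yvar :: "'a set \<Rightarrow> 'a set \<Rightarrow> 'a set polynomial" where
  "yvar f = (SOME v. (\<forall>k\<in>{g\<in>G. g \<subseteq> f}. (\<Sum>h\<in>{h\<in>{g\<in>G. g \<subseteq> f}. k \<subseteq> h}. v h) = xvar k)
     \<and> (\<forall>h. v h \<in> linear_forms f) \<and> (\<forall>h. h \<notin> {g\<in>G. g \<subseteq> f} \<longrightarrow> v h = 0))"

lemma yvar_ex: "\<exists>v. (\<forall>k\<in>{g\<in>G. g \<subseteq> f}. (\<Sum>h\<in>{h\<in>{g\<in>G. g \<subseteq> f}. k \<subseteq> h}. v h) = xvar k)
     \<and> (\<forall>h. v h \<in> linear_forms f) \<and> (\<forall>h. h \<notin> {g\<in>G. g \<subseteq> f} \<longrightarrow> v h = 0)"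
proof (rule moebius_ex)
  show "finite {g\<in>G. g \<subseteq> f}" using finite_G by simp
  show "0 \<in> linear_forms f" by (simp add: linear_forms_def)
  show "p + q \<in> linear_forms f" if "p \<in> linear_forms f" "q \<in> linear_forms f" for p q
    using that keys_add[of p q] unfolding linear_forms_def by blast
  show "- p \<in> linear_forms f" if "p \<in> linear_forms f" for p
    using that by (simp add: linear_forms_def in_keys_iff)
  show "xvar k \<in> linear_forms f" if "k \<in> {g\<in>G. g \<subseteq> f}" for k
    using that by (auto simp: linear_forms_def xvar_def)
qed

lemma yvar_sum: "k \<in> G \<Longrightarrow> k \<subseteq> f \<Longrightarrow> (\<Sum>h\<in>{h\<in>G. h \<subseteq> f \<and> k \<subseteq> h}. yvar f h) = xvar k"
  and yvar_linear: "yvar f h \<in> linear_forms f"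
  and yvar_zero: "\<not> (h \<in> G \<and> h \<subseteq> f) \<Longrightarrow> yvar f h = 0"
  using someI_ex[OF yvar_ex[of f]] unfolding yvar_def[symmetric] by (auto simp: conj_assoc)

abbreviation homf :: "'a set \<Rightarrow> 'a set polynomial \<Rightarrow> 'a set polynomial" where
  "homf f \<equiv> subst_hom (yvar f)"

lemma homf_c_elem:
  assumes "g \<in> G" shows "homf f (c_elem G g) = (if g \<subseteq> f then xvar g else 0)"
proof -
  have "homf f (c_elem G g) = (\<Sum>h\<in>{h\<in>G. g \<subseteq> h}. yvar f h)"
    by (simp add: c_elem_def subst_sum subst_xvar)
  also have "\<dots> = (\<Sum>h\<in>{h\<in>G. h \<subseteq> f \<and> g \<subseteq> h}. yvar f h)"
    using finite_G yvar_zero by (intro sum.mono_neutral_right) auto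
  also have "\<dots> = (if g \<subseteq> f then xvar g else 0)"
  proof (cases "g \<subseteq> f")
    case False
    then have "{h\<in>G. h \<subseteq> f \<and> g \<subseteq> h} = {}" by auto
    then show ?thesis using False by (simp only: sum.empty if_False)
  qed (simp add: yvar_sum assms)
  finally show ?thesis .
qed

text \<open>The degree map in the coordinates \<open>c_g\<close>: the variable of \<open>k\<close>
  stands for \<open>c_k\<close>. Its values on monomials are imposed; what has to be proved is that
  they respect the relations.\<close>

definition dfun :: "'a set \<Rightarrow> 'a set polynomial \<Rightarrow> rat" where
  "dfun f = ksum (\<lambda>a c. c * of_bool (sat {} f (lookup a)))"

lemma dfun_family: "additive_family (\<lambda>a c. c * of_bool (P a) :: rat)"
  by (rule additive_familyI) (simp_all add: distrib_right)

lemma dfun_add: "dfun f (p + q) = dfun f p + dfun f q"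
  unfolding dfun_def by (rule ksum_add[OF dfun_family])

lemma dfun_zero [simp]: "dfun f 0 = 0"
  by (simp add: dfun_def)

lemma dfun_sum: "dfun f (\<Sum>i\<in>I. p i) = (\<Sum>i\<in>I. dfun f (p i))"
  unfolding dfun_def by (rule ksum_sum[OF dfun_family])

lemma dfun_single: "dfun f (single a c) = c * of_bool (sat {} f (lookup a))"
  unfolding dfun_def by (rule ksum_single[OF dfun_family])

lemma dfun_scale: "dfun f (single 0 c * p) = c * dfun f p"
proof -
  have "dfun f (single 0 c * p) = ksum (\<lambda>a d. c * (d * of_bool (sat {} f (lookup a)))) p"
    by (rule ksum_eqI) (simp_all add: distrib_left dfun_add mult_single dfun_single)
  then show ?thesis unfolding dfun_def ksum_def sum_distrib_left .
qed

text \<open>Induction that removes a minimal \<open>h\<close>. With \<open>x_h\<close> replaced by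
  the various \<open>c_k\<close>, the induction hypothesis is the zeta transform of the wanted
  values. \<open>sat_moebius\<close> supplies a function with the same transform up to sign, and
  Moebius inversion is unique. Its value at \<open>h\<close> is -1 or 0, whence one sign per
  vertex.\<close>

lemma integral_xprod:
  assumes f: "f \<in> Fl"
  shows "S \<subseteq> G \<Longrightarrow> (\<And>s. s \<in> S \<Longrightarrow> s \<subseteq> f) \<Longrightarrow> S \<inter> Fc f = {} \<Longrightarrow>
    dfun f (homf f (xprod S) * mon a) = (-1) ^ card S * of_bool (sat S f (lookup a))"
proof (induction "card S" arbitrary: S a)
  case 0
  then have "S = {}" using finite_subset[OF 0(2) finite_G] by simp
  then show ?case by (simp add: dfun_single)
next
  case (Suc n)
  have fin: "finite S" using finite_subset[OF Suc.prems(1) finite_G] .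
  have "S \<noteq> {}" using Suc.hyps(2) by auto
  then obtain h where h: "h \<in> S" "\<forall>b\<in>S. b \<subseteq> h \<longrightarrow> h = b" using finite_has_minimal[OF fin] by auto
  define S0 where "S0 = S - {h}"
  have S: "S = insert h S0" "h \<notin> S0" "finite S0" using h fin by (auto simp: S0_def)
  have S0: "S0 \<subseteq> G" "\<And>s. s \<in> S0 \<Longrightarrow> s \<subseteq> f" "S0 \<inter> Fc f = {}" "n = card S0"
    using Suc.prems Suc.hyps(2) S by auto
  let ?B = "homf f (xprod S0) * mon a" and ?X = "{g\<in>G. g \<subseteq> f}"
  have IH: "dfun f (xvar k * ?B) = (-1) ^ n * of_bool (sat S0 f ((lookup a)(k := Suc (lookup a k))))" for k
  proof -
    have "xvar k * mon a = mon (a + single k 1)" by (simp add: xvar_def mult_single add.commute)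
    then have "xvar k * ?B = homf f (xprod S0) * mon (a + single k 1)"
      using mult.left_commute[of "xvar k" "homf f (xprod S0)" "mon a"] by simp
    moreover have "lookup (a + single k 1) = (lookup a)(k := Suc (lookup a k))"
      by (auto simp: lookup_add lookup_single when_def)
    ultimately show ?thesis using Suc.hyps(1)[OF S0(4) S0(1,2,3), of "a + single k 1"] S0(4) by simp
  qed
  obtain v0 :: "'a set \<Rightarrow> int" where v0:
    "\<forall>k\<in>G. k \<subseteq> f \<longrightarrow> (\<Sum>k'\<in>{k'\<in>G. k' \<subseteq> f \<and> k \<subseteq> k'}. v0 k') = (if sat S0 f ((lookup a)(k := Suc (lookup a k))) then 1 else 0)"
    "\<forall>h\<in>G. h \<subseteq> f \<longrightarrow> h \<notin> Fc f \<longrightarrow> h \<notin> S0 \<longrightarrow> (\<forall>t\<in>S0. \<not> t \<subset> h) \<longrightarrow> v0 h = (if sat (insert h S0) f (lookup a) then - 1 else 0)"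
  proof -
    have ex: "\<exists>v::'a set \<Rightarrow> int.
      (\<forall>k\<in>G. k \<subseteq> f \<longrightarrow> (\<Sum>k'\<in>{k'\<in>G. k' \<subseteq> f \<and> k \<subseteq> k'}. v k') = (if sat S0 f ((lookup a)(k := Suc (lookup a k))) then 1 else 0)) \<and>
      (\<forall>h\<in>G. h \<subseteq> f \<longrightarrow> h \<notin> Fc f \<longrightarrow> h \<notin> S0 \<longrightarrow> (\<forall>t\<in>S0. \<not> t \<subset> h) \<longrightarrow> v h = (if sat (insert h S0) f (lookup a) then - 1 else 0))"
      by (rule sat_moebius[OF f S0(1)]) (fact S0(2), fact S0(3))
    show ?thesis by (rule exE[OF ex], erule conjE, rule that)
  qed
  \<comment> \<open>The forms \<open>yvar f h\<close> with \<open>h\<close> above \<open>k\<close>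
    add up to the variable of \<open>k\<close>, so the zeta transform of \<open>v\<close> is given
    by \<open>IH\<close>.\<close>
  define v where "v k = dfun f (yvar f k * ?B)" for k
  have hX: "h \<in> ?X" using h Suc.prems by auto
  have "v h = (-1) ^ n * of_int (v0 h)"
  proof (rule moebius_unique[OF _ _ hX])
    show "finite ?X" using finite_G by simp
    fix k assume k: "k \<in> ?X"
    have e: "{h \<in> ?X. k \<subseteq> h} = {h\<in>G. h \<subseteq> f \<and> k \<subseteq> h}" by auto
    have "(\<Sum>h\<in>{h\<in>G. h \<subseteq> f \<and> k \<subseteq> h}. v h) = dfun f ((\<Sum>h\<in>{h\<in>G. h \<subseteq> f \<and> k \<subseteq> h}. yvar f h) * ?B)"
      by (simp add: v_def dfun_sum[symmetric] sum_distrib_right)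
    also have "\<dots> = dfun f (xvar k * ?B)" using k yvar_sum by simp
    also have "\<dots> = (-1) ^ n * of_int (\<Sum>k'\<in>{k'\<in>G. k' \<subseteq> f \<and> k \<subseteq> k'}. v0 k')"
      unfolding IH using v0(1) k by simp
    finally show "(\<Sum>h\<in>{h \<in> ?X. k \<subseteq> h}. v h) = (\<Sum>h\<in>{h \<in> ?X. k \<subseteq> h}. (-1) ^ n * of_int (v0 h))"
      unfolding e by (simp add: sum_distrib_left)
  qed
  also have "v0 h = (if sat S f (lookup a) then - 1 else 0)"
  proof -
    have "\<not> t \<subset> h" if "t \<in> S0" for t using h(2) that S by auto
    then show ?thesis using v0(2) h Suc.prems S by auto
  qed
  finally have "v h = (-1) ^ card S * of_bool (sat S f (lookup a))"
    using Suc.hyps(2)[symmetric] by simp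
  moreover have "homf f (xprod S) * mon a = yvar f h * ?B"
    using S by (simp add: xprod_insert subst_mult subst_xvar mult.assoc)
  ultimately show ?case by (simp add: v_def)
qed

lemma dfun_eq_zeroI:
  assumes "\<And>a. dfun f (p * mon a) = 0" shows "dfun f (p * q) = 0"
proof -
  have "p * q = (\<Sum>k\<in>keys q. p * single k (lookup q k))"
    unfolding sum_distrib_left[symmetric] poly_mapping_sum[symmetric] ..
  also have "\<dots> = (\<Sum>k\<in>keys q. single 0 (lookup q k) * (p * mon k))"
    by (intro sum.cong) (simp_all add: mult.left_commute mult_single)
  finally show ?thesis by (simp add: dfun_sum dfun_scale assms)
qed

section \<open>The degree functional of a nested set\<close>

definition dg :: "'a set set \<Rightarrow> 'a set polynomial \<Rightarrow> rat" where
  "dg T p = dfun (jn T) (homf (jn T) (p * xprod (T - Fc (jn T))))"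

lemma dg_add: "dg T (p + q) = dg T p + dg T q"
  by (simp add: dg_def distrib_right subst_add dfun_add)

lemma dg_zero [simp]: "dg T 0 = 0"
  by (simp add: dg_def)

lemma dg_sum: "dg T (\<Sum>i\<in>I. p i) = (\<Sum>i\<in>I. dg T (p i))"
  by (simp add: dg_def sum_distrib_right subst_sum dfun_sum)

lemma dg_scale: "dg T (single 0 c * p) = c * dg T p"
  by (simp add: dg_def mult.assoc subst_mult subst_single[of _ 0] dfun_scale)

lemma homf_xprod_zero:
  assumes "s \<in> S" "finite S" "\<not> s \<subseteq> f" shows "homf f (xprod S) = 0"
proof -
  have "xprod S = xvar s * xprod (S - {s})" using assms xprod_insert[of "S - {s}" s] by (simp add: insert_absorb)
  then show ?thesis using yvar_zero assms by (simp add: subst_mult subst_xvar)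
qed

text \<open>Repeated variables and those of the factors are collected in \<open>q\<close>. What
  remains is a squarefree product over \<open>S'\<close>, disjoint from the factors, as
  \<open>integral_xprod\<close> requires.\<close>

lemma dg_xprod_split:
  assumes T: "T \<in> NS" and S: "S \<subseteq> G"
  defines "S' \<equiv> (S \<union> T) - Fc (jn T)"
  shows "\<exists>q. \<forall>p. dg T (p * xprod S) = dfun (jn T) (homf (jn T) (xprod S') * homf (jn T) (p * q))"
proof -
  let ?F = "Fc (jn T)" and ?f = "jn T"
  have fin: "finite S" "finite T" using rev_finite_subset[OF finite_G, of S] S NS_finite[OF T] by auto
  have "xprod S * xprod (T - ?F) = xprod (S \<union> (T - ?F)) * xprod (S \<inter> (T - ?F))"
    using xprod_Un_Int[of S "T - ?F"] fin by simp
  also have "S \<union> (T - ?F) = S' \<union> (S \<inter> ?F)" by (auto simp: S'_def)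
  also have "xprod \<dots> = xprod S' * xprod (S \<inter> ?F)"
    using fin by (intro xprod_Un) (auto simp: S'_def)
  finally have eq: "xprod S * xprod (T - ?F) = xprod S' * xprod (S \<inter> ?F) * xprod (S \<inter> (T - ?F))" .
  have "p * xprod S * xprod (T - ?F) = xprod S' * (p * (xprod (S \<inter> ?F) * xprod (S \<inter> (T - ?F))))" for p
    unfolding mult.assoc[of p] eq by (simp only: mult_ac)
  then show ?thesis by (intro exI[of _ "xprod (S \<inter> ?F) * xprod (S \<inter> (T - ?F))"]) (simp add: dg_def subst_mult)
qed

text \<open>Either some variable not below \<open>jn T\<close> is sent to zero, or \<open>S'\<close>
  is not nested: adding the factors of \<open>jn T\<close> to a nested \<open>S'\<close> would give
  a nested set containing \<open>S \<union> T\<close>.\<close>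

lemma dg_xprod_zero:
  assumes T: "T \<in> NS" and S: "S \<subseteq> G" "S \<union> T \<notin> NS"
  shows "dg T (p * xprod S) = 0"
proof -
  let ?F = "Fc (jn T)" and ?f = "jn T"
  let ?S' = "(S \<union> T) - ?F"
  have fFl: "?f \<in> Fl" using jn_Fl NS_Fl T by blast
  have fin: "finite S" "finite T" using rev_finite_subset[OF finite_G, of S] S NS_finite[OF T] by auto
  obtain q where q: "\<forall>p. dg T (p * xprod S) = dfun ?f (homf ?f (xprod ?S') * homf ?f (p * q))"
    using dg_xprod_split[OF T S(1)] by blast
  have SG: "?S' \<subseteq> G" using S NS_G[OF T] by auto
  show ?thesis
  proof (cases "\<forall>s\<in>?S'. s \<subseteq> ?f")
    case False
    then obtain s where "s \<in> ?S'" "\<not> s \<subseteq> ?f" by auto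
    then have "homf ?f (xprod ?S') = 0" using fin by (intro homf_xprod_zero[of s]) auto
    then show ?thesis using q by simp
  next
    case True
    have "?S' \<notin> NS"
    proof
      assume "?S' \<in> NS"
      then have "?S' \<union> ?F \<in> NS" using True by (intro NS_Un_factors[OF fFl]) auto
      moreover have "S \<union> T \<subseteq> ?S' \<union> ?F" by auto
      ultimately show False using S(2) NS_subset by metis
    qed
    then have "\<not> sat ?S' ?f b" for b by (simp add: sat_def)
    then have "dfun ?f (homf ?f (xprod ?S') * mon a) = 0" for a
      using integral_xprod[OF fFl SG, of a] True by auto
    then show ?thesis using q dfun_eq_zeroI by simp
  qed
qed

text \<open>Let \<open>s\<close> be the root of \<open>g\<close>, \<open>?z\<close> the join of the
  elements of \<open>S\<close> strictly below \<open>s\<close>, and \<open>?x\<close> the join of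
  \<open>?z\<close> and \<open>g\<close>. The gap of \<open>?x\<close> is at most
  \<open>cd ?x - cd ?z - a g\<close>, and submodularity bounds this by
  \<open>cd g - cd (?z \<inter> g) - a g\<close>, which the assumption makes nonpositive.\<close>

lemma sat_bound:
  assumes f: "f \<in> Fl" and SG: "S \<subseteq> G" and Sf: "\<And>s. s \<in> S \<Longrightarrow> s \<subseteq> f" and SF: "S \<inter> Fc f = {}"
    and g: "g \<in> G" "g \<subseteq> f" and b: "cd g \<le> a g + cd (jn (blw S g))"
  shows "\<not> sat S f a"
proof
  assume sa: "sat S f a"
  then have S: "S \<in> NS" by (simp add: sat_def)
  have "\<exists>s. is_root (S \<union> Fc f) g s"
    by (rule root_ex'[OF f S _ SF g]) (fact Sf)
  then obtain s where s: "is_root (S \<union> Fc f) g s" by (rule exE)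
  then have sN: "s \<in> S \<union> Fc f" and gs: "g \<subseteq> s" by (auto simp: is_root_def)
  let ?z = "jn (blw S s)"
  have zFl: "?z \<in> Fl" by (rule z_Fl[OF f S _ SF]) (fact Sf)
  have gFl: "g \<in> Fl" by (rule G_FlD[OF g(1)])
  have sG: "s \<in> G" using SG Fc_G[of f] sN by auto
  have ngz: "\<not> g \<subseteq> ?z" by (rule root_not_below_z[OF f S _ SF s g(1)]) (fact Sf)
  let ?x = "jn {?z, g}"
  have xFl: "?x \<in> Fl" and zx: "?z \<subseteq> ?x" and gx: "g \<subseteq> ?x"
    using jn2_Fl[OF zFl gFl] jn2_upper1[OF zFl gFl] jn2_upper2[OF zFl gFl] by auto
  have xs: "?x \<subseteq> s" by (rule jn2_least[OF jn_blw_le[OF G_FlD[OF sG]] gs G_FlD[OF sG]])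
  have psub: "?z \<subset> ?x" using zx gx ngz by auto
  have "local_sat S a s" using sa sN by (simp add: sat_def)
  then have ge1: "1 \<le> wt a ?x - wt a ?z"
    using xFl psub xs unfolding local_sat_def gap_pos_def gap_def by metis
  have "(\<Sum>k\<in>{k\<in>G. k \<subseteq> ?z}. int (a k)) + int (a g) = (\<Sum>k\<in>insert g {k\<in>G. k \<subseteq> ?z}. int (a k))"
    using finite_G ngz by simp
  also have "\<dots> \<le> (\<Sum>k\<in>{k\<in>G. k \<subseteq> ?x}. int (a k))"
    by (rule sum_mono2) (use finite_G g gx zx in auto)
  finally have "wt a ?x - wt a ?z \<le> int (cd ?x) - int (cd ?z) - int (a g)" by (simp add: wt_def)
  moreover have "cd ?x + cd (?z \<inter> g) \<le> cd ?z + cd g" by (rule cd_join_meet[OF zFl gFl])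
  moreover have "cd (jn (blw S g)) \<le> cd (?z \<inter> g)"
  proof (rule cd_le)
    have "jn (blw S g) \<subseteq> ?z"
      by (rule jn_mono) (use gs NS_Fl[OF S] in \<open>auto simp: blw_def\<close>)
    moreover have "jn (blw S g) \<subseteq> g" by (rule jn_blw_le[OF gFl])
    ultimately show "jn (blw S g) \<subseteq> ?z \<inter> g" by simp
  qed (rule Fl_Int[OF zFl gFl])
  ultimately show False using b ge1 by linarith
qed

text \<open>In the coordinates of \<open>homf\<close> the power of \<open>c_elem G g\<close> is
  either zero or a power of one variable, so the relation turns into the exponent bound of
  \<open>sat_bound\<close>.\<close>

lemma dg_c_elem_zero:
  assumes T: "T \<in> NS" and S: "S \<subseteq> G" and g: "g \<in> G" and b: "cd g \<le> b + cd (jn (blw (S \<union> T) g))"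
  shows "dg T (p * (xprod S * c_elem G g ^ b)) = 0"
proof (cases "S \<union> T \<in> NS")
  case False
  then have "dg T (p * c_elem G g ^ b * xprod S) = 0" by (rule dg_xprod_zero[OF T S])
  moreover have "p * (xprod S * c_elem G g ^ b) = p * c_elem G g ^ b * xprod S" by (simp only: mult_ac)
  ultimately show ?thesis by (simp only:)
next
  case ST: True
  let ?F = "Fc (jn T)" and ?f = "jn T"
  let ?S' = "(S \<union> T) - ?F"
  have fFl: "?f \<in> Fl" using jn_Fl NS_Fl T by blast
  have fin: "finite S" "finite T" using rev_finite_subset[OF finite_G, of S] S NS_finite[OF T] by auto
  \<comment> \<open>For \<open>g\<close> not below \<open>jn T\<close> the form
    \<open>c_elem G g\<close> is sent to zero, but its power vanishes only for a positive exponent.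
    Positivity of the gap provides this.\<close>
  have b0: "b > 0" using dgap_pos[OF ST g] b by (cases b) (auto simp: dgap_def)
  obtain q where q: "\<forall>p. dg T (p * xprod S) = dfun ?f (homf ?f (xprod ?S') * homf ?f (p * q))"
    using dg_xprod_split[OF T S(1)] by blast
  have "p * (xprod S * c_elem G g ^ b) = p * c_elem G g ^ b * xprod S" by (simp only: mult_ac)
  then have "dg T (p * (xprod S * c_elem G g ^ b)) = dg T (p * c_elem G g ^ b * xprod S)" by (simp only:)
  also have "\<dots> = dfun ?f (homf ?f (xprod ?S') * homf ?f (p * c_elem G g ^ b * q))" using q by blast
  also have "\<dots> = dfun ?f (homf ?f (xprod ?S') * homf ?f (c_elem G g) ^ b * homf ?f (p * q))"
    unfolding subst_mult subst_power by (simp only: mult_ac)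
  also have "\<dots> = 0"
  proof (cases "g \<subseteq> ?f \<and> (\<forall>s\<in>?S'. s \<subseteq> ?f)")
    case False
    have "homf ?f (xprod ?S') = 0" if "s \<in> ?S'" "\<not> s \<subseteq> ?f" for s
      using fin that by (intro homf_xprod_zero[of s]) auto
    then have "homf ?f (c_elem G g) ^ b = 0 \<or> homf ?f (xprod ?S') = 0"
      using homf_c_elem[OF g] b0 False by (auto simp: zero_power)
    then show ?thesis by auto
  next
    case True
    have SG: "?S' \<subseteq> G" using S NS_G[OF T] by auto
    have hc: "homf ?f (c_elem G g) ^ b = mon (single g b)" using True homf_c_elem[OF g] by (simp add: xvar_power)
    have "dfun ?f (homf ?f (xprod ?S') * homf ?f (c_elem G g) ^ b * mon a) = 0" for a
    proof -
      \<comment> \<open>A vertex strictly below \<open>g\<close> is not a factor of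
        \<open>jn T\<close>, because \<open>g\<close> itself lies below \<open>jn T\<close>. So
        discarding the factors does not change the bound.\<close>
      have "blw (S \<union> T) g \<subseteq> blw ?S' g"
      proof
        fix t assume t: "t \<in> blw (S \<union> T) g"
        then have t': "t \<in> S \<union> T" "t \<subset> g" by (simp_all add: blw_def)
        have "t \<notin> ?F" unfolding Fc_mem_iff using t'(2) g True by blast
        then show "t \<in> blw ?S' g" using t' by (simp add: blw_def)
      qed
      moreover have "blw ?S' g \<subseteq> blw (S \<union> T) g" unfolding blw_def by blast
      ultimately have e: "blw ?S' g = blw (S \<union> T) g" by simp
      have "\<not> sat ?S' ?f (lookup (single g b + a))"
        by (rule sat_bound[OF fFl SG _ _ g]) (use True b e in \<open>auto simp: lookup_add\<close>)
      then show ?thesis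
        unfolding hc mult.assoc mult_single using integral_xprod[OF fFl SG, of "single g b + a"] True by auto
    qed
    then show ?thesis by (rule dfun_eq_zeroI)
  qed
  finally show ?thesis .
qed

end

section \<open>Weights of monomials\<close>

definition mdeg :: "('g \<Rightarrow>\<^sub>0 nat) \<Rightarrow> nat" where
  "mdeg m = (\<Sum>g\<in>keys m. lookup m g)"

definition indm :: "'g set \<Rightarrow> 'g \<Rightarrow>\<^sub>0 nat" where
  "indm S = (\<Sum>s\<in>S. single s 1)"

lemma mdeg_ksum: "mdeg m = ksum (\<lambda>g c. c) m"
  by (simp add: mdeg_def ksum_def)

lemma mdeg_add: "mdeg (m + n) = mdeg m + mdeg n"
  unfolding mdeg_ksum by (rule ksum_add) (rule additive_familyI, auto)

lemma mdeg_zero [simp]: "mdeg 0 = 0"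
  by (simp add: mdeg_def)

lemma mdeg_single [simp]: "mdeg (single g c) = c"
  unfolding mdeg_ksum by (rule ksum_single) (rule additive_familyI, auto)

lemma mdeg_superset: "finite A \<Longrightarrow> keys m \<subseteq> A \<Longrightarrow> mdeg m = (\<Sum>g\<in>A. lookup m g)"
  unfolding mdeg_ksum by (rule ksum_superset) (rule additive_familyI, auto)

lemma lookup_indm: "finite S \<Longrightarrow> lookup (indm S) g = of_bool (g \<in> S)"
  by (simp add: indm_def lookup_sum lookup_single when_def sum.delta)

lemma keys_indm: "finite S \<Longrightarrow> keys (indm S) = S"
  by (auto simp: in_keys_iff lookup_indm)

lemma mdeg_indm: "finite S \<Longrightarrow> mdeg (indm S) = card S"
  by (simp add: mdeg_def keys_indm lookup_indm)

lemma mon_add: "mon (m + n) = mon m * mon n"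
  by (simp add: mult_single)

lemma mon_indm: "finite S \<Longrightarrow> mon (indm S) = xprod S"
  by (induction S rule: finite_induct)
    (simp_all add: indm_def xprod_insert mon_add xvar_def)

lemma keys_add_nat: "keys (m + n :: 'g \<Rightarrow>\<^sub>0 nat) = keys m \<union> keys n"
  by (auto simp: in_keys_iff lookup_add)

lemma monomial_split:
  assumes "\<And>g. lookup n g \<le> lookup (m :: 'g \<Rightarrow>\<^sub>0 nat) g"
  shows "(m - n) + n = m" and "keys (m - n) \<subseteq> keys m"
  using assms by (auto simp: lookup_add lookup_minus in_keys_iff intro!: poly_mapping_eqI)

lemma xprod_dvd_mon:
  assumes "S \<subseteq> keys m" shows "mon m = mon (m - indm S) * xprod S" "keys (m - indm S) \<subseteq> keys m"
proof -
  have f: "finite S" using assms finite_subset[OF _ finite_keys] by auto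
  have "lookup (indm S) g \<le> lookup m g" for g
    using assms by (cases "g \<in> S") (auto simp: lookup_indm[OF f] in_keys_iff Suc_le_eq)
  from monomial_split[OF this] show "mon m = mon (m - indm S) * xprod S" "keys (m - indm S) \<subseteq> keys m"
    by (auto simp flip: mon_indm[OF f] mon_add)
qed

context building_polymatroid
begin

text \<open>For these weights \<open>c\<^sub>s\<^sup>b - x\<^sub>s\<^sup>b\<close> has smaller weight than \<open>x\<^sub>s\<^sup>b\<close>.\<close>

definition height :: "'a set \<Rightarrow> nat" where
  "height g = card {h\<in>G. g \<subset> h}"

definition mwt :: "('a set \<Rightarrow>\<^sub>0 nat) \<Rightarrow> nat" where
  "mwt = ksum (\<lambda>g c. c * height g)"

lemma mwt_family: "additive_family (\<lambda>g c::nat. c * height g)"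
  by (rule additive_familyI) (auto simp: distrib_right)

lemma mwt_add: "mwt (m + n) = mwt m + mwt n"
  unfolding mwt_def by (rule ksum_add[OF mwt_family])

lemma mwt_single: "mwt (single g c) = c * height g"
  unfolding mwt_def by (rule ksum_single[OF mwt_family])

lemma height_less: "h \<in> G \<Longrightarrow> g \<subset> h \<Longrightarrow> height h < height g"
  unfolding height_def by (rule psubset_card_mono) (use finite_G in auto)

text \<open>The polynomial type has a variable for every set; these are the polynomials in the
  variables of \<open>G\<close>.\<close>

definition PG :: "'a set polynomial set" where
  "PG = {p. \<forall>m\<in>keys p. keys m \<subseteq> G}"

lemma PG_add: "p \<in> PG \<Longrightarrow> q \<in> PG \<Longrightarrow> p + q \<in> PG"
  using keys_add[of p q] unfolding PG_def by blast

lemma PG_mult: "p \<in> PG \<Longrightarrow> q \<in> PG \<Longrightarrow> p * q \<in> PG"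
  using keys_mult[of p q] unfolding PG_def by (fastforce simp: keys_add_nat)

lemma PG_zero: "0 \<in> PG" and PG_one: "1 \<in> PG"
  by (auto simp: PG_def)

lemma PG_single: "keys m \<subseteq> G \<Longrightarrow> single m c \<in> PG"
  by (simp add: PG_def)

lemma PG_sum: "(\<And>i. i \<in> I \<Longrightarrow> p i \<in> PG) \<Longrightarrow> (\<Sum>i\<in>I. p i) \<in> PG"
  by (induction I rule: infinite_finite_induct) (auto simp: PG_zero PG_add)

lemma PG_power: "p \<in> PG \<Longrightarrow> p ^ n \<in> PG"
  by (induction n) (auto simp: PG_one PG_mult)

lemma PG_xvar: "g \<in> G \<Longrightarrow> xvar g \<in> PG"
  by (simp add: xvar_def PG_single)

lemma PG_xprod: "S \<subseteq> G \<Longrightarrow> xprod S \<in> PG"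
  using finite_subset[OF _ finite_G] by (simp add: mon_indm[symmetric] PG_single keys_indm)

lemma PG_c_elem: "c_elem G g \<in> PG"
  unfolding c_elem_def by (rule PG_sum) (simp add: PG_xvar)

definition lower :: "('a set \<Rightarrow>\<^sub>0 nat) \<Rightarrow> 'a set polynomial set" where
  "lower m0 = {p. \<forall>m\<in>keys p. keys m \<subseteq> G \<and> mdeg m = mdeg m0 \<and> mwt m < mwt m0}"

definition leading :: "('a set \<Rightarrow>\<^sub>0 nat) \<Rightarrow> 'a set polynomial set" where
  "leading m0 = {p. p - mon m0 \<in> lower m0}"

lemma lower_zero: "0 \<in> lower m"
  by (simp add: lower_def)

lemma lower_add: "p \<in> lower m \<Longrightarrow> q \<in> lower m \<Longrightarrow> p + q \<in> lower m"
  using keys_add[of p q] unfolding lower_def by blast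

lemma lower_sum: "(\<And>i. i \<in> I \<Longrightarrow> p i \<in> lower m) \<Longrightarrow> (\<Sum>i\<in>I. p i) \<in> lower m"
  by (induction I rule: infinite_finite_induct) (auto simp: lower_zero lower_add)

lemma lower_mult:
  assumes "\<forall>m'\<in>keys p. keys m' \<subseteq> G \<and> mdeg m' = mdeg m \<and> mwt m' \<le> mwt m" "q \<in> lower n"
  shows "p * q \<in> lower (m + n)"
  unfolding lower_def
proof (rule CollectI, rule ballI)
  fix k assume "k \<in> keys (p * q)"
  then obtain a b where ab: "k = a + b" "a \<in> keys p" "b \<in> keys q" using keys_mult[of p q] by blast
  have "keys b \<subseteq> G" "mdeg b = mdeg n" "mwt b < mwt n" using assms(2) ab(3) unfolding lower_def by auto
  then show "keys k \<subseteq> G \<and> mdeg k = mdeg (m + n) \<and> mwt k < mwt (m + n)"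
    using assms(1) ab by (auto simp: keys_add_nat mdeg_add mwt_add add_le_less_mono)
qed

lemma mon_lower_mult: "keys m \<subseteq> G \<Longrightarrow> q \<in> lower n \<Longrightarrow> mon m * q \<in> lower (m + n)"
  by (rule lower_mult) auto

lemma leading_mult:
  assumes p: "p \<in> leading m" and q: "q \<in> leading n" and k: "keys m \<subseteq> G" "keys n \<subseteq> G"
  shows "p * q \<in> leading (m + n)"
proof -
  have "(p - mon m) * (q - mon n) \<in> lower (m + n)"
    by (rule lower_mult) (use p q in \<open>auto simp: leading_def lower_def\<close>)
  moreover have "mon m * (q - mon n) \<in> lower (m + n)"
    by (rule mon_lower_mult) (use q k in \<open>auto simp: leading_def\<close>)
  moreover have "mon n * (p - mon m) \<in> lower (n + m)"
    by (rule mon_lower_mult) (use p k in \<open>auto simp: leading_def\<close>)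
  ultimately have "(p - mon m) * (q - mon n) + (mon m * (q - mon n) + mon n * (p - mon m)) \<in> lower (m + n)"
    by (simp add: lower_add add.commute)
  also have "(p - mon m) * (q - mon n) + (mon m * (q - mon n) + mon n * (p - mon m)) = p * q - mon (m + n)"
    by (simp add: mon_add algebra_simps)
  finally show ?thesis by (simp add: leading_def)
qed

lemma leading_one: "1 \<in> leading 0"
  by (simp add: leading_def lower_zero)

text \<open>Every \<open>h\<close> strictly above \<open>g\<close> has smaller height, so all
  summands other than \<open>x_g\<close> have smaller weight.\<close>

lemma leading_c_elem: "g \<in> G \<Longrightarrow> c_elem G g \<in> leading (single g 1)"
proof -
  assume g: "g \<in> G"
  have "{h\<in>G. g \<subseteq> h} = insert g {h\<in>G. g \<subset> h}" using g by auto
  then have "c_elem G g - mon (single g 1) = (\<Sum>h\<in>{h\<in>G. g \<subset> h}. xvar h)"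
    using finite_G by (simp add: c_elem_def xvar_def)
  also have "\<dots> \<in> lower (single g 1)"
    by (rule lower_sum) (auto simp: xvar_def lower_def mwt_single height_less)
  finally show ?thesis by (simp add: leading_def)
qed

lemma leading_c_power: "g \<in> G \<Longrightarrow> c_elem G g ^ b \<in> leading (single g b)"
proof (induction b)
  case (Suc b)
  have "c_elem G g * c_elem G g ^ b \<in> leading (single g 1 + single g b)"
    by (rule leading_mult) (use Suc leading_c_elem in auto)
  then show ?case by (simp add: single_add[symmetric])
qed (simp add: leading_one)

lemma leading_c_prod:
  "finite T \<Longrightarrow> T \<subseteq> G \<Longrightarrow> (\<Prod>t\<in>T. c_elem G t ^ b t) \<in> leading (\<Sum>t\<in>T. single t (b t)) \<and> keys (\<Sum>t\<in>T. single t (b t)) \<subseteq> G"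
proof (induction T rule: finite_induct)
  case (insert t T)
  have "c_elem G t ^ b t * (\<Prod>t\<in>T. c_elem G t ^ b t) \<in> leading (single t (b t) + (\<Sum>t\<in>T. single t (b t)))"
    by (rule leading_mult) (use insert leading_c_power in auto)
  then show ?case using insert by (auto simp: keys_add_nat split: if_splits)
qed (simp add: leading_one)

section \<open>The ideals of coefficients\<close>

definition rels :: "'a set set \<Rightarrow> 'a set polynomial set" where
  "rels T = {xprod S | S. S \<subseteq> G \<and> S \<union> T \<notin> NS}
    \<union> {xprod S * c_elem G g ^ b | S g b. S \<subseteq> G \<and> g \<in> G \<and> cd g \<le> b + cd (jn (blw (S \<union> T) g))}"

text \<open>The ideal of \<open>PG\<close> generated by \<open>rels T\<close>, presented by sums of
  multiples of relations, so that linear facts follow by induction.\<close>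

inductive_set JI :: "'a set set \<Rightarrow> 'a set polynomial set" for T where
  JI_zero: "0 \<in> JI T"
| JI_step: "p \<in> JI T \<Longrightarrow> \<rho> \<in> rels T \<Longrightarrow> q \<in> PG \<Longrightarrow> p + q * \<rho> \<in> JI T"

lemma rels_PG: "\<rho> \<in> rels T \<Longrightarrow> \<rho> \<in> PG"
  by (auto simp: rels_def PG_xprod PG_mult PG_power PG_c_elem)

lemma JI_rel: "\<rho> \<in> rels T \<Longrightarrow> q \<in> PG \<Longrightarrow> q * \<rho> \<in> JI T"
  using JI_step[OF JI_zero] by simp

lemma JI_add: "q \<in> JI T \<Longrightarrow> p \<in> JI T \<Longrightarrow> p + q \<in> JI T"
  by (induction q rule: JI.induct) (auto simp: add.assoc[symmetric] intro: JI_step)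

lemma JI_mult: "p \<in> JI T \<Longrightarrow> q \<in> PG \<Longrightarrow> q * p \<in> JI T"
proof (induction p rule: JI.induct)
  case (JI_step p \<rho> q')
  have "q * p + (q * q') * \<rho> \<in> JI T" using JI_step by (intro JI.JI_step) (auto simp: PG_mult)
  then show ?case by (simp add: distrib_left mult.assoc)
qed (simp add: JI_zero)

lemma JI_scale: "p \<in> JI T \<Longrightarrow> single 0 c * p \<in> JI T"
  by (rule JI_mult) (simp_all add: PG_single)

lemma JI_uminus: "p \<in> JI T \<Longrightarrow> - p \<in> JI T"
  using JI_scale[of p T "-1"] by (simp add: single_uminus)

lemma JI_diff: "p \<in> JI T \<Longrightarrow> q \<in> JI T \<Longrightarrow> p - q \<in> JI T"
  using JI_add[OF JI_uminus, of q T p] by simp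

lemma JI_sum: "(\<And>i. i \<in> I \<Longrightarrow> p i \<in> JI T) \<Longrightarrow> (\<Sum>i\<in>I. p i) \<in> JI T"
  by (induction I rule: infinite_finite_induct) (auto simp: JI_zero JI_add)

lemma JI_PG: "p \<in> JI T \<Longrightarrow> p \<in> PG"
  by (induction p rule: JI.induct) (auto simp: PG_zero PG_add PG_mult rels_PG)

text \<open>Enlarging \<open>T\<close> keeps unions non-nested and enlarges the join below
  \<open>g\<close>, so fewer powers of \<open>c_g\<close> are required.\<close>

lemma rels_mono:
  assumes "T \<subseteq> T'" "T' \<subseteq> G" shows "rels T \<subseteq> rels T'"
proof
  fix \<rho> assume "\<rho> \<in> rels T"
  then consider S where "\<rho> = xprod S" "S \<subseteq> G" "S \<union> T \<notin> NS"
    | S g b where "\<rho> = xprod S * c_elem G g ^ b" "S \<subseteq> G" "g \<in> G" "cd g \<le> b + cd (jn (blw (S \<union> T) g))"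
    unfolding rels_def by blast
  then show "\<rho> \<in> rels T'"
  proof cases
    case 1
    have "S \<union> T \<subseteq> S \<union> T'" using assms(1) by auto
    then have "S \<union> T' \<notin> NS" using 1(3) NS_subset by metis
    then show ?thesis using 1 unfolding rels_def by blast
  next
    case 2
    have sub: "S \<union> T' \<subseteq> G" using 2(2) assms(2) by auto
    have "jn (blw (S \<union> T) g) \<subseteq> jn (blw (S \<union> T') g)"
    proof (rule jn_mono)
      show "blw (S \<union> T) g \<subseteq> blw (S \<union> T') g" using assms(1) by (auto simp: blw_def)
      show "blw (S \<union> T') g \<subseteq> Fl" using sub G_Fl blw_subset by (meson subset_trans)
    qed
    then have "cd (jn (blw (S \<union> T) g)) \<le> cd (jn (blw (S \<union> T') g))"
      using cd_le jn_blw_Fl[OF sub] by blast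
    then have "cd g \<le> b + cd (jn (blw (S \<union> T') g))" using 2(4) by linarith
    then show ?thesis using 2 unfolding rels_def by blast
  qed
qed

lemma JI_mono: "p \<in> JI T \<Longrightarrow> T \<subseteq> T' \<Longrightarrow> T' \<subseteq> G \<Longrightarrow> p \<in> JI T'"
  by (induction p rule: JI.induct) (auto intro: JI_zero JI_step dest: rels_mono)

lemma dg_JI: "p \<in> JI T \<Longrightarrow> T \<in> NS \<Longrightarrow> dg T p = 0"
proof (induction p rule: JI.induct)
  case (JI_step p \<rho> q)
  from JI_step(2) consider S where "\<rho> = xprod S" "S \<subseteq> G" "S \<union> T \<notin> NS"
    | S g b where "\<rho> = xprod S * c_elem G g ^ b" "S \<subseteq> G" "g \<in> G" "cd g \<le> b + cd (jn (blw (S \<union> T) g))"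
    unfolding rels_def by blast
  then have "dg T (q * \<rho>) = 0"
    by cases (use dg_xprod_zero dg_c_elem_zero JI_step(5) in auto)
  then show ?case using JI_step by (simp add: dg_add)
qed simp

section \<open>Standard monomials\<close>

text \<open>The monomials divisible by no leading monomial of a relation, hence the candidates for a
  basis of \<open>PG\<close> modulo \<open>JI T\<close>.\<close>

definition std :: "'a set set \<Rightarrow> ('a set \<Rightarrow>\<^sub>0 nat) \<Rightarrow> bool" where
  "std T m \<longleftrightarrow> T \<union> keys m \<in> NS \<and> (\<forall>s\<in>keys m. lookup m s < dgap (T \<union> keys m) s)"

lemma std_G: "std T m \<Longrightarrow> T \<subseteq> G \<and> keys m \<subseteq> G"
  using NS_G[of "T \<union> keys m"] by (auto simp: std_def)

lemma std_less: "std T m \<Longrightarrow> s \<in> T \<union> keys m \<Longrightarrow> lookup m s < dgap (T \<union> keys m) s"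
  using dgap_pos[of "T \<union> keys m" s] NS_G[of "T \<union> keys m"]
  by (cases "s \<in> keys m") (auto simp: std_def in_keys_iff)

definition std_below :: "'a set set \<Rightarrow> ('a set \<Rightarrow>\<^sub>0 nat) \<Rightarrow> 'a set polynomial \<Rightarrow> bool" where
  "std_below T m p \<longleftrightarrow> (\<forall>m'\<in>keys p. std T m' \<and> mdeg m' = mdeg m \<and> mwt m' < mwt m)"

lemma std_below_add: "std_below T m p \<Longrightarrow> std_below T m q \<Longrightarrow> std_below T m (p + q)"
  using keys_add[of p q] unfolding std_below_def by blast

lemma std_below_sum: "(\<And>i. i \<in> I \<Longrightarrow> std_below T m (p i)) \<Longrightarrow> std_below T m (\<Sum>i\<in>I. p i)"
proof (induction I rule: infinite_finite_induct)
  case (insert i I)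
  then show ?case by (auto simp: std_below_add)
qed (auto simp: std_below_def)

lemma keys_scale: "keys (single 0 c * p :: 'k::comm_monoid_add \<Rightarrow>\<^sub>0 'c::comm_semiring_1) \<subseteq> keys p"
  using keys_mult[of "single 0 c" p] by (auto split: if_splits)

text \<open>If the support together with \<open>T\<close> is not nested, the monomial lies in the
  ideal. Otherwise some exponent reaches the gap \<open>b\<close>, and the relation with
  \<open>c_s^b\<close> trades \<open>x_s^b\<close> for terms of smaller weight, to which the
  induction applies.\<close>

lemma reduce_monomial:
  "T \<subseteq> G \<Longrightarrow> keys m \<subseteq> G \<Longrightarrow> \<not> std T m \<Longrightarrow> \<exists>p. mon m - p \<in> JI T \<and> std_below T m p"
proof (induction "mwt m" arbitrary: m rule: less_induct)
  case less
  let ?N = "T \<union> keys m"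
  show ?case
  proof (cases "?N \<in> NS")
    case False
    have "mon m = mon (m - indm (keys m)) * xprod (keys m)" "keys (m - indm (keys m)) \<subseteq> keys m"
      using xprod_dvd_mon[of "keys m" m] by auto
    moreover have "xprod (keys m) \<in> rels T" using less.prems False unfolding rels_def by (auto simp: Un_commute)
    ultimately have "mon m \<in> JI T" using JI_rel[of "xprod (keys m)" T] less.prems PG_single by auto
    then show ?thesis by (intro exI[of _ 0]) (simp add: std_below_def)
  next
    case True
    then obtain s where s: "s \<in> keys m" "dgap ?N s \<le> lookup m s" using less.prems by (auto simp: std_def not_less)
    define b where "b = dgap ?N s"
    \<comment> \<open>\<open>s\<close> is left out, so that all of \<open>x_s^b\<close> can be
      absorbed by the power of \<open>c_s\<close>. The gap is unaffected, since \<open>s\<close> is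
      not strictly below itself.\<close>
    define S where "S = keys m - {s}"
    define n where "n = m - single s b"
    have sG: "s \<in> G" and SG: "S \<subseteq> G" using s less.prems by (auto simp: S_def)
    have nm: "n + single s b = m" "keys n \<subseteq> keys m"
      unfolding n_def by (rule monomial_split; use s in \<open>auto simp: b_def lookup_single when_def\<close>)+
    have Sn: "S \<subseteq> keys n"
    proof
      fix x assume "x \<in> S"
      then have "x \<in> keys m" "s \<noteq> x" by (auto simp only: S_def Diff_iff singleton_iff)
      then show "x \<in> keys n" by (simp add: n_def in_keys_iff lookup_minus lookup_single when_def)
    qed
    have "blw (S \<union> T) s = blw ?N s" by (auto simp: S_def blw_def)
    then have "cd s \<le> b + cd (jn (blw (S \<union> T) s))" using cd_jn_blw_le[OF G_FlD[OF sG], of ?N] by (simp add: b_def dgap_def)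
    then have "xprod S * c_elem G s ^ b \<in> rels T" using sG SG unfolding rels_def by blast
    then have J: "mon (n - indm S) * (xprod S * c_elem G s ^ b) \<in> JI T"
      by (rule JI_rel) (use xprod_dvd_mon(2)[OF Sn] nm less.prems PG_single in auto)
    have J': "mon n * c_elem G s ^ b \<in> JI T"
      using J xprod_dvd_mon(1)[OF Sn] by (simp add: mult.assoc)
    define l where "l = c_elem G s ^ b - mon (single s b)"
    have "l \<in> lower (single s b)" using leading_c_power[OF sG, of b] by (simp add: l_def leading_def)
    then have low: "mon n * l \<in> lower m"
      using mon_lower_mult[of n l "single s b"] nm less.prems by auto
    have mm: "mon m + mon n * l \<in> JI T"
    proof -
      have "mon m + mon n * l = mon n * c_elem G s ^ b"
        unfolding l_def by (subst nm(1)[symmetric], subst mon_add) (simp add: algebra_simps)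
      then show ?thesis using J' by simp
    qed
    have "\<exists>p. mon k - p \<in> JI T \<and> std_below T m p" if "k \<in> keys (mon n * l)" for k
    proof -
      have k: "keys k \<subseteq> G" "mdeg k = mdeg m" "mwt k < mwt m" using low that unfolding lower_def by auto
      show ?thesis
      proof (cases "std T k")
        case True
        then show ?thesis using k by (intro exI[of _ "mon k"]) (simp add: std_below_def JI_zero)
      next
        case False
        then obtain p where "mon k - p \<in> JI T" "std_below T k p" using less.hyps[OF k(3) less.prems(1) k(1)] by auto
        then show ?thesis using k by (intro exI[of _ p]) (auto simp: std_below_def)
      qed
    qed
    then obtain P where P: "\<And>k. k \<in> keys (mon n * l) \<Longrightarrow> mon k - P k \<in> JI T \<and> std_below T m (P k)"
      by metis
    define p where "p = (\<Sum>k\<in>keys (mon n * l). single 0 (lookup (mon n * l) k) * P k)"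
    have "mon n * l - p = (\<Sum>k\<in>keys (mon n * l). single 0 (lookup (mon n * l) k) * (mon k - P k))"
      unfolding p_def right_diff_distrib sum_subtractf
      by (simp add: mult_single) (rule poly_mapping_sum)
    also have "\<dots> \<in> JI T" using P by (intro JI_sum JI_scale) auto
    finally have "(mon m + mon n * l) - (mon n * l - p) \<in> JI T" using mm JI_diff by blast
    then have "mon m - (- p) \<in> JI T" by simp
    moreover have "std_below T m p"
      unfolding p_def
    proof (rule std_below_sum)
      fix k assume "k \<in> keys (mon n * l)"
      then have "std_below T m (P k)" using P by blast
      then show "std_below T m (single 0 (lookup (mon n * l) k) * P k)"
        using keys_scale unfolding std_below_def by blast
    qed
    then have "std_below T m (- p)" by (simp add: std_below_def in_keys_iff)
    ultimately show ?thesis by blast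
  qed
qed

section \<open>Degrees and evaluation on standard monomials\<close>

lemma homogeneous_hom:
  "a \<in> keys (monprod (yvar f) n) \<Longrightarrow> mdeg a = mdeg n \<and> keys a \<subseteq> {g\<in>G. g \<subseteq> f}"
proof -
  define H where "H d = {p :: 'a set polynomial. \<forall>a\<in>keys p. mdeg a = d \<and> keys a \<subseteq> {g\<in>G. g \<subseteq> f}}" for d
  have H1: "1 \<in> H 0" by (simp add: H_def)
  have Hm: "p * q \<in> H (d + e)" if "p \<in> H d" "q \<in> H e" for p q d e
    unfolding H_def
  proof (rule CollectI, rule ballI)
    fix k assume "k \<in> keys (p * q)"
    then obtain a b where ab: "k = a + b" "a \<in> keys p" "b \<in> keys q" using keys_mult[of p q] by blast
    then show "mdeg k = d + e \<and> keys k \<subseteq> {g\<in>G. g \<subseteq> f}"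
      using that unfolding H_def by (auto simp: mdeg_add keys_add_nat)
  qed
  have Hy: "yvar f g \<in> H 1" for g
    using yvar_linear[of f g] unfolding linear_forms_def H_def by fastforce
  have Hp: "yvar f g ^ b \<in> H b" for g b
    by (induction b) (use H1 Hm[OF Hy] in auto)
  have "(\<Prod>g\<in>A. yvar f g ^ lookup n g) \<in> H (\<Sum>g\<in>A. lookup n g)" for A
    by (induction A rule: infinite_finite_induct) (use H1 Hm[OF Hp] in auto)
  then have "monprod (yvar f) n \<in> H (mdeg n)" unfolding monprod_def mdeg_def .
  then show "a \<in> keys (monprod (yvar f) n) \<Longrightarrow> mdeg a = mdeg n \<and> keys a \<subseteq> {g\<in>G. g \<subseteq> f}"
    unfolding H_def by auto
qed

text \<open>The weight is 1 at each factor, hence at \<open>f\<close> it is the number of factors.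
  The resulting degree is the sum of \<open>cd y - 1\<close> over the factors \<open>y\<close>, the
  top degree of the Chow ring of [0, f].\<close>

lemma sat_degree:
  assumes f: "f \<in> Fl" and sa: "sat {} f (lookup a)" and k: "keys a \<subseteq> {g\<in>G. g \<subseteq> f}"
  shows "mdeg a + card (Fc f) = cd f"
proof -
  have w1: "wt (lookup a) y = 1" if "y \<in> Fc f" for y
  proof -
    have "local_sat {} (lookup a) y" using sa that by (simp add: sat_def)
    then show ?thesis by (simp add: local_sat_def gap_def blw_def wt_bot)
  qed
  have "wt (lookup a) f = (\<Sum>y\<in>Fc f. wt (lookup a) (f \<inter> y))" by (rule wt_factors[OF f f order_refl])
  also have "\<dots> = (\<Sum>y\<in>Fc f. 1)" using w1 Fc_le by (intro sum.cong) (auto simp: Int_absorb1)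
  finally have "wt (lookup a) f = int (card (Fc f))" by simp
  moreover have "mdeg a = (\<Sum>k\<in>{k\<in>G. k \<subseteq> f}. lookup a k)" by (rule mdeg_superset) (use finite_G k in auto)
  then have "int (mdeg a) = (\<Sum>k\<in>{k\<in>G. k \<subseteq> f}. int (lookup a k))" by simp
  ultimately show ?thesis unfolding wt_def by linarith
qed

text \<open>\<open>homf\<close> is homogeneous and sends variables not below \<open>jn T\<close> to
  zero, and \<open>sat\<close> fixes the degree of a monomial.\<close>

lemma dg_monomial:
  assumes T: "T \<in> NS" and nz: "dg T (mon m) \<noteq> 0"
  shows "mdeg m + card T = cd (jn T)" and "\<And>g. g \<in> keys m \<Longrightarrow> g \<in> G \<and> g \<subseteq> jn T"
proof -
  let ?f = "jn T" and ?R = "T - Fc (jn T)"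
  have fFl: "?f \<in> Fl" using jn_Fl NS_Fl T by blast
  have fin: "finite T" "finite ?R" using NS_finite[OF T] by auto
  have FT: "Fc ?f \<subseteq> T" using NS_factors[OF T] max_subset by blast
  let ?n = "m + indm ?R"
  have "dg T (mon m) = dfun ?f (monprod (yvar ?f) ?n)"
    by (simp add: dg_def mon_indm[OF fin(2), symmetric] mult_single subst_single)
  also have "\<dots> = (\<Sum>a\<in>keys (monprod (yvar ?f) ?n). lookup (monprod (yvar ?f) ?n) a * of_bool (sat {} ?f (lookup a)))"
    by (simp add: dfun_def ksum_def)
  finally have eq: "dg T (mon m) = (\<Sum>a\<in>keys (monprod (yvar ?f) ?n). lookup (monprod (yvar ?f) ?n) a * of_bool (sat {} ?f (lookup a)))" .
  have "\<exists>a\<in>keys (monprod (yvar ?f) ?n). sat {} ?f (lookup a)"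
  proof (rule ccontr)
    assume "\<not> ?thesis"
    then have "dg T (mon m) = 0" unfolding eq by (intro sum.neutral) auto
    then show False using nz by simp
  qed
  then obtain a where a: "a \<in> keys (monprod (yvar ?f) ?n)" "sat {} ?f (lookup a)" by (elim bexE)
  have "mdeg a = mdeg ?n" "keys a \<subseteq> {g\<in>G. g \<subseteq> ?f}" using homogeneous_hom[OF a(1)] by auto
  then have "mdeg ?n + card (Fc ?f) = cd ?f" using sat_degree[OF fFl a(2)] by auto
  moreover have "card ?R + card (Fc ?f) = card T"
    using card_Diff_subset[OF finite_Fc FT] card_mono[OF fin(1) FT] by simp
  ultimately show "mdeg m + card T = cd ?f" by (simp add: mdeg_add mdeg_indm[OF fin(2)])
  fix g assume g: "g \<in> keys m"
  show "g \<in> G \<and> g \<subseteq> ?f"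
  proof (rule ccontr)
    assume "\<not> ?thesis"
    then have "yvar ?f g ^ lookup ?n g = 0" using yvar_zero g by (simp add: lookup_add in_keys_iff zero_power)
    moreover have "g \<in> keys ?n" using g by (simp add: keys_add_nat)
    ultimately have "monprod (yvar ?f) ?n = 0" unfolding monprod_def by (intro prod_zero) auto
    then show False using a(1) by simp
  qed
qed

text \<open>Every exponent is the largest standard one, the gap minus one. By
  \<open>sum_dgap\<close> the degree is \<open>cd (jn T) - card T\<close>, which is the degree that
  \<open>dg T\<close> detects.\<close>

definition topm :: "'a set set \<Rightarrow> 'a set \<Rightarrow>\<^sub>0 nat" where
  "topm T = (\<Sum>t\<in>T. single t (dgap T t - 1))"

lemma lookup_topm: "finite T \<Longrightarrow> lookup (topm T) s = (if s \<in> T then dgap T s - 1 else 0)"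
  by (simp add: topm_def lookup_sum lookup_single when_def sum.delta)

lemma keys_topm: "finite T \<Longrightarrow> keys (topm T) \<subseteq> T"
  by (auto simp: in_keys_iff lookup_topm split: if_splits)

text \<open>Counting degrees: standardness bounds the sum of the exponents plus one, taken over the
  whole support, by the sum of the gaps, which is \<open>cd (jn T)\<close>. Nonvanishing says that
  the degree plus \<open>card T\<close> is this same number. So the support adds nothing to
  \<open>T\<close>, and every bound is attained.\<close>

lemma dg_std:
  assumes T: "T \<in> NS" and st: "std T m" and nz: "dg T (mon m) \<noteq> 0"
  shows "m = topm T"
proof -
  let ?N = "T \<union> keys m"
  have N: "?N \<in> NS" using st by (simp add: std_def)
  have fin: "finite ?N" "finite T" using NS_finite N T by auto
  have fFl: "jn T \<in> Fl" using jn_Fl NS_Fl T by blast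
  have "jn ?N = jn T"
  proof
    show "jn ?N \<subseteq> jn T"
    proof (rule jn_least)
      fix x assume "x \<in> ?N"
      then show "x \<subseteq> jn T" using jn_upper[OF NS_Fl[OF T]] dg_monomial(2)[OF T nz] by auto
    qed (rule fFl)
    show "jn T \<subseteq> jn ?N" by (rule jn_mono) (use NS_Fl[OF N] in auto)
  qed
  then have sd: "(\<Sum>s\<in>?N. dgap ?N s) = cd (jn T)" using sum_dgap[OF N] by simp
  have le: "lookup m s + 1 \<le> dgap ?N s" if "s \<in> ?N" for s using std_less[OF st that] by simp
  have sl: "(\<Sum>s\<in>?N. lookup m s + 1) = mdeg m + card ?N"
    using mdeg_superset[OF fin(1), of m] by (simp only: sum.distrib) simp
  have "(\<Sum>s\<in>?N. lookup m s + 1) \<le> (\<Sum>s\<in>?N. dgap ?N s)" using le by (intro sum_mono)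
  then have "card ?N \<le> card T" using sd sl dg_monomial(1)[OF T nz] by simp
  then have NT: "?N = T" using card_seteq[OF fin(1), of T] by auto
  then have "(\<Sum>s\<in>T. lookup m s + 1) = (\<Sum>s\<in>T. dgap T s)" using sd sl dg_monomial(1)[OF T nz] by simp
  then have eq: "lookup m s + 1 = dgap T s" if "s \<in> T" for s
    using sum_mono_inv[of "\<lambda>s. lookup m s + 1" T "dgap T" s] le that fin NT by auto
  show ?thesis
  proof (rule poly_mapping_eqI)
    fix s show "lookup m s = lookup (topm T) s"
    proof (cases "s \<in> T")
      case True
      then show ?thesis using eq[OF True] by (simp add: lookup_topm[OF fin(2)])
    next
      case False
      then have "s \<notin> keys m" using NT by auto
      then show ?thesis using False by (simp add: lookup_topm[OF fin(2)] in_keys_iff)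
    qed
  qed
qed

lemma dg_expand: "dg T p = (\<Sum>m\<in>keys p. lookup p m * dg T (mon m))"
proof -
  have "dg T p = ksum (\<lambda>m c. c * dg T (mon m)) p"
  proof (rule ksum_eqI)
    fix k show "dg T (single k (lookup p k)) = lookup p k * dg T (mon k)"
      using dg_scale[of T "lookup p k" "mon k"] by (simp add: mult_single)
  qed (simp_all add: dg_add)
  then show ?thesis by (simp add: ksum_def)
qed

text \<open>Reduction of a nonstandard monomial strictly lowers the weight, and among standard
  monomials \<open>dg T\<close> sees only \<open>topm T\<close>.\<close>

lemma dg_lower:
  assumes T: "T \<in> NS" and m: "keys m \<subseteq> G" and nz: "dg T (mon m) \<noteq> 0"
  shows "m = topm T \<or> mwt (topm T) < mwt m"
proof (cases "std T m")
  case True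
  then show ?thesis using dg_std[OF T True nz] by simp
next
  case False
  then obtain p where p: "mon m - p \<in> JI T" "std_below T m p" using reduce_monomial[OF NS_G[OF T] m] by auto
  have "dg T (mon m) = dg T (mon m - p) + dg T p" by (simp add: dg_add[symmetric])
  then have "dg T p \<noteq> 0" using nz dg_JI[OF p(1) T] by simp
  then obtain m' where "m' \<in> keys p" "dg T (mon m') \<noteq> 0"
    unfolding dg_expand[of T p] by (metis (no_types, lifting) mult_zero_right sum.neutral)
  then show ?thesis using p(2) dg_std[OF T, of m'] unfolding std_below_def by auto
qed

text \<open>In the interval from \<open>jn (blw T t)\<close> to \<open>t\<close>, the only new
  demand is that of \<open>t\<close> itself, its gap minus one. At the flats short of
  \<open>t\<close> the gap is the increase of \<open>cd\<close>, which is strict on flats.\<close>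

lemma sat_topm:
  assumes T: "T \<in> NS"
  shows "sat (T - Fc (jn T)) (jn T) (lookup (topm T))"
  unfolding sat_def
proof (intro conjI ballI)
  let ?F = "Fc (jn T)"
  have FT: "?F = max_elements T" using NS_factors[OF T] .
  show "T - ?F \<in> NS" using NS_subset[OF T] by auto
  fix t assume "t \<in> (T - ?F) \<union> ?F"
  then have t: "t \<in> T" using FT max_subset by blast
  have tG: "t \<in> G" using t NS_G[OF T] by auto
  have tFl: "t \<in> Fl" by (rule G_FlD[OF tG])
  have b: "blw (T - ?F) t = blw T t" using t by (auto simp: FT blw_def max_elements_def)
  let ?z = "jn (blw T t)" and ?a = "lookup (topm T)"
  have fin: "finite T" using NS_finite[OF T] .
  have zFl: "?z \<in> Fl" by (rule jn_blw_Fl[OF NS_G[OF T]])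
  have zt: "?z \<subset> t" by (rule jn_blw_psubset[OF T tG])
  have s: "(\<Sum>k\<in>{k\<in>G. k \<subseteq> x}. int (?a k)) = (\<Sum>k\<in>{k\<in>T. k \<subseteq> x}. int (?a k))" for x
    using finite_G NS_G[OF T] by (intro sum.mono_neutral_right) (auto simp: lookup_topm[OF fin])
  have below: "{k\<in>T. k \<subseteq> x} = blw T t" if "?z \<subseteq> x" "x \<subset> t" for x
  proof
    show "{k\<in>T. k \<subseteq> x} \<subseteq> blw T t" using that by (auto simp: blw_def)
    show "blw T t \<subseteq> {k\<in>T. k \<subseteq> x}"
    proof
      fix k assume k: "k \<in> blw T t"
      have "k \<subseteq> ?z" by (rule jn_upper[OF subset_trans[OF blw_subset NS_Fl[OF T]] k])
      then show "k \<in> {k\<in>T. k \<subseteq> x}" using that k by (auto simp: blw_def)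
    qed
  qed
  have wx: "wt ?a x = int (cd x) - (\<Sum>k\<in>blw T t. int (?a k))" if "?z \<subseteq> x" "x \<subset> t" for x
    using s[of x] below[OF that] by (simp add: wt_def)
  have "{k\<in>T. k \<subseteq> t} = insert t (blw T t)" using t by (auto simp: blw_def)
  then have "(\<Sum>k\<in>{k\<in>T. k \<subseteq> t}. int (?a k)) = int (?a t) + (\<Sum>k\<in>blw T t. int (?a k))"
    using fin finite_subset[OF blw_subset fin] by (simp add: blw_def)
  then have wtt: "wt ?a t = int (cd t) - int (?a t) - (\<Sum>k\<in>blw T t. int (?a k))"
    using s[of t] by (simp add: wt_def)
  have "int (?a t) = int (cd t) - int (cd ?z) - 1"
    using dgap_pos[OF T tG] t by (simp add: lookup_topm[OF fin] dgap_def)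
  then have g1: "gap (T - ?F) ?a t t = 1" using wtt wx[OF order_refl zt] by (simp add: gap_def b)
  moreover have "gap_pos (T - ?F) ?a t"
    unfolding gap_pos_def b
  proof (intro ballI impI)
    fix x assume x: "x \<in> Fl" "?z \<subset> x" "x \<subseteq> t"
    show "1 \<le> gap (T - ?F) ?a t x"
    proof (cases "x = t")
      case False
      then have xt: "x \<subset> t" using x by auto
      have "cd ?z < cd x" by (rule cd_strict[OF zFl x(1,2)])
      then show ?thesis using wx[OF order_refl zt] wx[OF _ xt] x(2) by (simp add: gap_def b)
    qed (use g1 in simp)
  qed
  ultimately show "local_sat (T - ?F) ?a t" by (simp add: local_sat_def)
qed

lemma keys_topm_G: "T \<in> NS \<Longrightarrow> keys (topm T) \<subseteq> G"
  using keys_topm[OF NS_finite] NS_G by blast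

text \<open>Compare with the product of the powers of \<open>c_t\<close> with the same exponents.
  The difference has smaller weight, where \<open>dg T\<close> vanishes, and \<open>homf\<close>
  turns the product into one monomial, whose value is plus or minus 1 by
  \<open>integral_xprod\<close> and \<open>sat_topm\<close>.\<close>

lemma dg_topm:
  assumes T: "T \<in> NS" shows "dg T (mon (topm T)) \<noteq> 0"
proof -
  let ?f = "jn T" and ?F = "Fc (jn T)"
  have fFl: "?f \<in> Fl" using jn_Fl NS_Fl T by blast
  have fin: "finite T" using NS_finite[OF T] .
  have up: "t \<subseteq> ?f" if "t \<in> T" for t by (rule jn_upper[OF NS_Fl[OF T] that])
  define C where "C = (\<Prod>t\<in>T. c_elem G t ^ (dgap T t - 1))"
  have "C \<in> leading (topm T)" unfolding C_def topm_def by (rule conjunct1[OF leading_c_prod[OF fin NS_G[OF T]]])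
  then have low: "C - mon (topm T) \<in> lower (topm T)" by (simp add: leading_def)
  have "dg T (C - mon (topm T)) = 0"
    unfolding dg_expand[of T "C - mon (topm T)"]
  proof (rule sum.neutral, rule ballI)
    fix m assume "m \<in> keys (C - mon (topm T))"
    then have "keys m \<subseteq> G" "mwt m < mwt (topm T)" using low unfolding lower_def by auto
    then have "dg T (mon m) = 0" using dg_lower[OF T, of m] by auto
    then show "lookup (C - mon (topm T)) m * dg T (mon m) = 0" by simp
  qed
  then have "dg T (mon (topm T)) = dg T C" using dg_add[of T "C - mon (topm T)" "mon (topm T)"] by simp
  also have "homf ?f C = mon (topm T)"
  proof -
    have "homf ?f C = (\<Prod>t\<in>T. mon (single t (dgap T t - 1)))"
      unfolding C_def subst_prod subst_power
      by (intro prod.cong) (use up NS_G[OF T] in \<open>auto simp: homf_c_elem xvar_power\<close>)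
    also have "\<dots> = mon (\<Sum>t\<in>T. single t (dgap T t - 1))"
    proof -
      have "(\<Prod>t\<in>T. mon (single t (b t))) = mon (\<Sum>t\<in>T. single t (b t))" for b :: "'a set \<Rightarrow> nat"
        using fin by (induction T rule: finite_induct) (simp_all add: mult_single)
      then show ?thesis .
    qed
    finally show ?thesis by (simp add: topm_def)
  qed
  then have "dg T C = dfun ?f (homf ?f (xprod (T - ?F)) * mon (topm T))"
    by (simp add: dg_def subst_mult mult.commute)
  also have "\<dots> = (-1) ^ card (T - ?F)"
    using integral_xprod[OF fFl, of "T - ?F" "topm T"] NS_G[OF T] up sat_topm[OF T] by auto
  finally show ?thesis by simp
qed

text \<open>Extracts the leading coefficient at a standard monomial: multiplication by the
  complement of \<open>m\<close> in the top monomial of \<open>T \<union> keys m\<close> moves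
  \<open>m\<close> to the one standard monomial that \<open>dg\<close> detects.\<close>

definition std_coeff :: "'a set set \<Rightarrow> ('a set \<Rightarrow>\<^sub>0 nat) \<Rightarrow> 'a set polynomial \<Rightarrow> rat" where
  "std_coeff T m p = dg (T \<union> keys m) (p * mon (topm (T \<union> keys m) - m)) / dg (T \<union> keys m) (mon (topm (T \<union> keys m)))"

lemma std_coeff_add: "std_coeff T m (p + q) = std_coeff T m p + std_coeff T m q"
  by (simp add: std_coeff_def distrib_right dg_add add_divide_distrib)

lemma std_coeff_scale: "std_coeff T m (single 0 c * p) = c * std_coeff T m p"
  by (simp add: std_coeff_def mult.assoc dg_scale)

lemma std_coeff_expand: "std_coeff T m p = (\<Sum>k\<in>keys p. lookup p k * std_coeff T m (mon k))"
proof -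
  have "std_coeff T m p = ksum (\<lambda>k c. c * std_coeff T m (mon k)) p"
  proof (rule ksum_eqI)
    fix k show "std_coeff T m (single k (lookup p k)) = lookup p k * std_coeff T m (mon k)"
      using std_coeff_scale[of T m "lookup p k" "mon k"] by (simp add: mult_single)
    show "std_coeff T m 0 = 0" by (simp add: std_coeff_def)
  qed (simp add: std_coeff_add)
  then show ?thesis by (simp add: ksum_def)
qed

context
  fixes T m assumes st: "std T m"
begin

private abbreviation (input) "NN \<equiv> T \<union> keys m"

lemma std_N: "NN \<in> NS"
  using st by (simp add: std_def)

lemma topm_minus: "(topm NN - m) + m = topm NN" "keys (topm NN - m) \<subseteq> keys (topm NN)"
proof -
  have "lookup m g \<le> lookup (topm NN) g" for g
  proof (cases "g \<in> NN")
    case True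
    then show ?thesis using std_less[OF st True] by (simp add: lookup_topm[OF NS_finite[OF std_N]])
  qed (auto simp: in_keys_iff)
  from monomial_split[OF this] show "(topm NN - m) + m = topm NN" "keys (topm NN - m) \<subseteq> keys (topm NN)" by auto
qed

text \<open>The functional belongs to the larger nested set \<open>T \<union> keys m\<close>; it
  applies because the ideals grow with the set.\<close>

lemma std_coeff_JI: "p \<in> JI T \<Longrightarrow> std_coeff T m p = 0"
proof -
  assume "p \<in> JI T"
  then have "p \<in> JI NN" by (rule JI_mono) (use NS_G[OF std_N] in auto)
  moreover have "mon (topm NN - m) \<in> PG" using topm_minus(2) keys_topm_G[OF std_N] PG_single by blast
  ultimately have "mon (topm NN - m) * p \<in> JI NN" by (rule JI_mult)
  then show ?thesis using dg_JI[OF _ std_N] by (simp add: std_coeff_def mult.commute)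
qed

lemma std_coeff_self: "std_coeff T m (mon m) = 1"
  using topm_minus(1) dg_topm[OF std_N] by (simp add: std_coeff_def mult_single add.commute)

text \<open>Triangularity with respect to the weight. Together with \<open>std_coeff_self\<close>
  and \<open>std_coeff_JI\<close> it makes the standard monomials linearly independent modulo
  \<open>JI T\<close>.\<close>

lemma std_coeff_mon:
  assumes "keys k \<subseteq> G" "std_coeff T m (mon k) \<noteq> 0" shows "k = m \<or> mwt m < mwt k"
proof -
  have "dg NN (mon (k + (topm NN - m))) \<noteq> 0" using assms(2) by (auto simp: std_coeff_def mult_single)
  moreover have "keys (k + (topm NN - m)) \<subseteq> G"
    using assms(1) topm_minus(2) keys_topm_G[OF std_N] by (auto simp: keys_add_nat)
  ultimately have "k + (topm NN - m) = topm NN \<or> mwt (topm NN) < mwt (k + (topm NN - m))"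
    using dg_lower[OF std_N] by blast
  moreover have "mwt (topm NN) = mwt m + mwt (topm NN - m)"
    by (subst topm_minus(1)[symmetric]) (simp only: mwt_add add.commute)
  ultimately show ?thesis using topm_minus(1) by (auto simp: mwt_add) (metis add.commute add_left_cancel)
qed

end

end

section \<open>Boundary operators\<close>

definition psign :: "'v rel \<Rightarrow> 'v set \<Rightarrow> 'v \<Rightarrow> 'b::ring_1" where
  "psign r T t = (-1) ^ card (preceding r T t)"

text \<open>A common form of the three differentials, so that they share their sign calculus:
  \<open>P\<close> selects the removable vertices and \<open>c\<close> gives the
  coefficients.\<close>

definition bdry :: "'v rel \<Rightarrow> ('v set \<Rightarrow> 'v set) \<Rightarrow> ('v \<Rightarrow> 'b) \<Rightarrow> ('v set \<Rightarrow>\<^sub>0 'b::comm_ring_1) \<Rightarrow> 'v set \<Rightarrow>\<^sub>0 'b" where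
  "bdry r P c = ksum (\<lambda>T x. \<Sum>t\<in>P T. single (T - {t}) (psign r T t * c t * x))"

lemma leray_d_bdry: "leray_d r \<omega> = bdry r (\<lambda>T. T) xvar \<omega>"
  by (simp add: leray_d_def bdry_def ksum_def psign_def)

lemma CM_d_bdry: "CM_d r \<omega> = bdry r (\<lambda>T. T - max_elements T) (\<lambda>_. 1) \<omega>"
  by (simp add: CM_d_def bdry_def ksum_def psign_def)

lemma simplicial_boundary_bdry: "simplicial_boundary r \<omega> = bdry r (\<lambda>T. T) (\<lambda>_. 1) \<omega>"
  by (simp add: simplicial_boundary_def bdry_def ksum_def psign_def)

lemma bdry_family: "additive_family (\<lambda>T x. \<Sum>t\<in>P T. single (T - {t}) (psign r T t * c t * x :: 'b::comm_ring_1))"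
  by (rule additive_familyI) (simp_all add: distrib_left single_add sum.distrib)

lemma bdry_add: "bdry r P c (v + w) = bdry r P c v + bdry r P c w"
  unfolding bdry_def by (rule ksum_add[OF bdry_family])

lemma bdry_zero [simp]: "bdry r P c 0 = 0"
  by (simp add: bdry_def)

lemma bdry_uminus: "bdry r P c (- v) = - bdry r P c v"
  using bdry_add[of r P c "- v" v] by (simp add: eq_neg_iff_add_eq_0)

lemma bdry_diff: "bdry r P c (v - w) = bdry r P c v - bdry r P c w"
  using bdry_add[of r P c v "- w"] by (simp add: bdry_uminus)

lemma bdry_single: "bdry r P c (single T x) = (\<Sum>t\<in>P T. single (T - {t}) (psign r T t * c t * x))"
  unfolding bdry_def by (rule ksum_single[OF bdry_family])

text \<open>Transposes the sum: the coefficient at \<open>U\<close> collects the sets that arise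
  from \<open>U\<close> by adding one vertex.\<close>

lemma lookup_bdry:
  fixes v :: "'v set \<Rightarrow>\<^sub>0 'b::comm_ring_1"
  assumes G: "finite G" and v: "keys v \<subseteq> Pow G" and P: "\<And>T. P T \<subseteq> T"
  shows "lookup (bdry r P c v) U = (\<Sum>t\<in>G - U. if t \<in> P (insert t U)
      then psign r (insert t U) t * c t * lookup v (insert t U) else 0)"
proof -
  let ?X = "\<lambda>T t. psign r T t * c t * lookup v T"
  have inner: "(\<Sum>t\<in>P T. if T - {t} = U then ?X T t else 0)
      = (\<Sum>t\<in>G - U. if insert t U = T then (if t \<in> P T then ?X T t else 0) else 0)" if T: "T \<in> keys v" for T
  proof -
    have TG: "T \<subseteq> G" using T v by auto
    have fin: "finite (P T)" using G TG P[of T] by (meson finite_subset subset_trans)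
    have "(\<Sum>t\<in>P T. if T - {t} = U then ?X T t else 0) = (\<Sum>t\<in>{t\<in>P T. T - {t} = U}. ?X T t)"
      using fin by (rule sum.inter_filter[symmetric])
    also have "{t\<in>P T. T - {t} = U} = {t\<in>G - U. insert t U = T \<and> t \<in> P T}"
      using TG P[of T] by auto
    also have "(\<Sum>t\<in>\<dots>. ?X T t) = (\<Sum>t\<in>G - U. if insert t U = T \<and> t \<in> P T then ?X T t else 0)"
      using G by (intro sum.inter_filter) auto
    also have "\<dots> = (\<Sum>t\<in>G - U. if insert t U = T then (if t \<in> P T then ?X T t else 0) else 0)"
      by (intro sum.cong) auto
    finally show ?thesis .
  qed
  have "lookup (bdry r P c v) U = (\<Sum>T\<in>keys v. \<Sum>t\<in>P T. if T - {t} = U then ?X T t else 0)"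
    by (simp add: bdry_def ksum_def lookup_sum lookup_single when_def)
  also have "\<dots> = (\<Sum>T\<in>keys v. \<Sum>t\<in>G - U. if insert t U = T then (if t \<in> P T then ?X T t else 0) else 0)"
    by (rule sum.cong[OF refl]) (rule inner)
  also have "\<dots> = (\<Sum>t\<in>G - U. \<Sum>T\<in>keys v. if insert t U = T then (if t \<in> P T then ?X T t else 0) else 0)"
    by (rule sum.swap)
  also have "\<dots> = (\<Sum>t\<in>G - U. if t \<in> P (insert t U) then ?X (insert t U) t else 0)"
    by (intro sum.cong refl) (simp add: sum.delta' in_keys_iff)
  finally show ?thesis .
qed

lemma psign_insert_other:
  assumes "finite A" "s \<notin> A"
  shows "psign r (insert s A) t = (if (s, t) \<in> r then - psign r A t else psign r A t)"
proof (cases "(s, t) \<in> r")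
  case True
  then have "preceding r (insert s A) t = insert s (preceding r A t)" by (auto simp: preceding_def)
  moreover have "s \<notin> preceding r A t" "finite (preceding r A t)" using assms by (auto simp: preceding_def)
  ultimately show ?thesis using True by (simp add: psign_def)
next
  case False
  then have "preceding r (insert s A) t = preceding r A t" by (auto simp: preceding_def)
  then show ?thesis using False by (simp add: psign_def)
qed

lemma psign_insert_self: "irrefl r \<Longrightarrow> psign r (insert t A) t = psign r A t"
proof -
  assume "irrefl r"
  then have "preceding r (insert t A) t = preceding r A t" by (auto simp: preceding_def irrefl_def)
  then show ?thesis by (simp add: psign_def)
qed

lemma psign_square: "psign r T t * (psign r T t * x) = (x :: 'b::ring_1)"
  by (simp add: psign_def mult.assoc[symmetric] power_add[symmetric] flip: mult_2)

text \<open>Exactly one of \<open>s\<close> and \<open>t\<close> precedes the other, so the two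
  orders of removal differ by one transposition.\<close>

lemma psign_swap:
  assumes r: "strict_linear_order_on G r" and U: "finite U" "U \<subseteq> G" and st: "s \<in> G - U" "t \<in> G - U" "s \<noteq> t"
  shows "psign r (insert s (insert t U)) t * psign r (insert s U) s
       = - (psign r (insert s (insert t U)) s * psign r (insert t U) t :: 'b::comm_ring_1)"
proof -
  have ir: "irrefl r" and tr: "trans r" and tot: "total_on G r" using r by (auto simp: strict_linear_order_on_def)
  have self: "psign r (insert t A) t = (psign r A t :: 'b)" for t A by (rule psign_insert_self[OF ir])
  have other: "psign r (insert x A) y = (if (x, y) \<in> r then - psign r A y else psign r A y :: 'b)"
    if "finite A" "x \<notin> A" for x y A by (rule psign_insert_other[OF that])
  have x: "(s, t) \<in> r \<longleftrightarrow> (t, s) \<notin> r" using ir tr tot st unfolding irrefl_def trans_def total_on_def by blast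
  have "psign r (insert s (insert t U)) t = (if (s, t) \<in> r then - psign r U t else psign r U t :: 'b)"
    using other[of "insert t U" s t] U st self by simp
  moreover have "psign r (insert s (insert t U)) s = (if (t, s) \<in> r then - psign r U s else psign r U s :: 'b)"
    using other[of "insert s U" t s] U st self by (simp add: insert_commute)
  ultimately show ?thesis using x self[of s U] self[of t U] by simp
qed

lemma antisymmetric_sum:
  fixes f :: "'v \<Rightarrow> 'v \<Rightarrow> 'b::ab_group_add"
  assumes "\<And>s t. s \<in> A \<Longrightarrow> t \<in> A \<Longrightarrow> f s t = - f t s" "\<And>s. f s s = 0"
  shows "(\<Sum>s\<in>A. \<Sum>t\<in>A. f s t) = 0"
  using assms
proof (induction A rule: infinite_finite_induct)
  case (insert a A)
  have "(\<Sum>t\<in>A. f a t) = (\<Sum>s\<in>A. - f s a)"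
    by (rule sum.cong[OF refl], rule insert.prems(1)) simp_all
  then have 1: "(\<Sum>t\<in>A. f a t) + (\<Sum>s\<in>A. f s a) = 0" by (simp add: sum_negf)
  have 2: "(\<Sum>s\<in>A. \<Sum>t\<in>A. f s t) = 0" by (rule insert.IH, rule insert.prems(1)) (simp_all add: insert.prems(2))
  have "(\<Sum>s\<in>insert a A. \<Sum>t\<in>insert a A. f s t)
      = f a a + ((\<Sum>t\<in>A. f a t) + (\<Sum>s\<in>A. f s a)) + (\<Sum>s\<in>A. \<Sum>t\<in>A. f s t)"
    using insert.hyps by (simp add: sum.distrib add.assoc)
  then show ?case unfolding 1 2 insert.prems(2) by simp
next
  case (infinite A)
  show ?case by (rule sum.infinite[OF infinite.hyps])
next
  case empty
  show ?case by (rule sum.empty)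
qed

lemma keys_bdry_subset:
  fixes v :: "'v set \<Rightarrow>\<^sub>0 'b::comm_ring_1"
  assumes v: "keys v \<subseteq> Pow G" shows "keys (bdry r P c v) \<subseteq> Pow G"
proof -
  have "keys (\<Sum>t\<in>P T. single (T - {t}) (psign r T t * c t * lookup v T)) \<subseteq> Pow G" if "T \<in> keys v" for T
    using keys_sum[of "\<lambda>t. single (T - {t}) (psign r T t * c t * lookup v T)" "P T"] that v
    by (fastforce split: if_splits)
  then show ?thesis unfolding bdry_def ksum_def using keys_sum by fastforce
qed

lemma bdry_bdry:
  fixes v :: "'v set \<Rightarrow>\<^sub>0 'b::comm_ring_1"
  assumes r: "strict_linear_order_on G r" and G: "finite G" and v: "keys v \<subseteq> Pow G"
  shows "bdry r (\<lambda>T. T) c (bdry r (\<lambda>T. T) c v) = 0"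
proof (rule poly_mapping_eqI)
  fix U
  let ?d = "bdry r (\<lambda>T. T) c"
  have L: "lookup (?d w) U = (\<Sum>t\<in>G - U. psign r (insert t U) t * c t * lookup w (insert t U))"
    if "keys w \<subseteq> Pow G" for w :: "'v set \<Rightarrow>\<^sub>0 'b" and U
    using lookup_bdry[OF G that, of "\<lambda>T. T" r c U] by simp
  have k2: "keys (?d v) \<subseteq> Pow G" by (rule keys_bdry_subset[OF v])
  show "lookup (?d (?d v)) U = lookup 0 U"
  proof (cases "U \<subseteq> G")
    case False
    then have "U \<notin> keys (?d (?d v))" using keys_bdry_subset[OF k2, of r "\<lambda>T. T" c] by blast
    then show ?thesis by (simp add: in_keys_iff)
  next
    case True
    then have fU: "finite U" using G finite_subset by metis
    \<comment> \<open>The diagonal is set to zero, so that both summations run over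
      \<open>G - U\<close> and the antisymmetry applies.\<close>
    define f where "f t s = (if s = t then 0 else psign r (insert t U) t * c t * (psign r (insert s (insert t U)) s * c s * lookup v (insert s (insert t U))))" for t s
    have "lookup (?d (?d v)) U = (\<Sum>t\<in>G - U. \<Sum>s\<in>G - insert t U. f t s)"
      unfolding L[OF k2] L[OF v] f_def sum_distrib_left by (intro sum.cong) auto
    also have "\<dots> = (\<Sum>t\<in>G - U. \<Sum>s\<in>G - U. f t s)"
    proof (rule sum.cong)
      fix t assume t: "t \<in> G - U"
      have GU: "insert t (G - insert t U) = G - U" using t by auto
      have "(\<Sum>s\<in>insert t (G - insert t U). f t s) = f t t + (\<Sum>s\<in>G - insert t U. f t s)" using G by simp
      then show "(\<Sum>s\<in>G - insert t U. f t s) = (\<Sum>s\<in>G - U. f t s)" unfolding GU by (simp add: f_def)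
    qed simp
    also have "\<dots> = 0"
    proof (rule antisymmetric_sum)
      fix s t assume st: "s \<in> G - U" "t \<in> G - U"
      show "f s t = - f t s"
      proof (cases "s = t")
        case False
        let ?V = "insert s (insert t U)"
        have fts: "f t s = (psign r ?V s * psign r (insert t U) t) * (c s * c t * lookup v ?V)"
        proof -
          have "f t s = psign r (insert t U) t * c t * (psign r ?V s * c s * lookup v ?V)"
            unfolding f_def using False by auto
          then show ?thesis by (simp only: mult_ac)
        qed
        have e: "insert t (insert s U) = ?V" by auto
        have fst: "f s t = (psign r ?V t * psign r (insert s U) s) * (c s * c t * lookup v ?V)"
        proof -
          have "f s t = psign r (insert s U) s * c s * (psign r ?V t * c t * lookup v ?V)"
            unfolding f_def e using False by auto
          then show ?thesis by (simp only: mult_ac)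
        qed
        have ps: "psign r ?V t * psign r (insert s U) s = - (psign r ?V s * psign r (insert t U) t :: 'b)"
          by (rule psign_swap[OF r fU True st False])
        show ?thesis unfolding fst fts ps by simp
      qed (simp add: f_def)
    qed (simp add: f_def)
    finally show ?thesis by simp
  qed
qed

lemma lookup_ksum_single:
  assumes "h T 0 = 0" shows "lookup (ksum (\<lambda>T x. single T (h T x)) v) T = h T (lookup v T)"
proof -
  have "lookup (ksum (\<lambda>T x. single T (h T x)) v) T = (\<Sum>T'\<in>keys v. if T = T' then h T' (lookup v T') else 0)"
    by (auto simp: ksum_def lookup_sum lookup_single when_def intro!: sum.cong)
  then show ?thesis using assms by (simp add: sum.delta' in_keys_iff)
qed

section \<open>The comparison map\<close>

lemma lookup_xvar_mult: "lookup (xvar t * p) m = (if t \<in> keys m then lookup p (m - single t 1) else 0)"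
proof -
  have "lookup (xvar t * p) m = ksum (\<lambda>k c. if t \<in> keys m \<and> k = m - single t 1 then c else 0) p"
  proof (rule ksum_eqI)
    fix k
    have "single t 1 + k = m \<longleftrightarrow> t \<in> keys m \<and> k = m - single t 1"
    proof
      assume "single t 1 + k = m"
      then show "t \<in> keys m \<and> k = m - single t 1" by (auto simp: in_keys_iff lookup_add)
    next
      assume H: "t \<in> keys m \<and> k = m - single t 1"
      have "lookup (single t (1::nat)) g \<le> lookup m g" for g
        using H by (auto simp: lookup_single when_def in_keys_iff)
      from monomial_split(1)[OF this] show "single t 1 + k = m" using H by (simp add: add.commute)
    qed
    then show "lookup (xvar t * single k (lookup p k)) m = (if t \<in> keys m \<and> k = m - single t 1 then lookup p k else 0)"
      by (simp add: xvar_def mult_single lookup_single when_def)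
  qed (simp_all add: distrib_left lookup_add)
  also have "\<dots> = (if t \<in> keys m then lookup p (m - single t 1) else 0)"
    unfolding ksum_def by (cases "t \<in> keys m") (auto simp: sum.delta' in_keys_iff)
  finally show ?thesis .
qed

lemma lookup_psign_mult: "lookup (psign r T t * p) m = psign r T t * lookup (p :: 'g polynomial) m"
  by (cases "even (card (preceding r T t))") (simp_all add: psign_def)

text \<open>The bidegrees from which the differential arrives in \<open>D\<close>. Working with
  arbitrary sets of bidegrees treats the total grading and the bigrading together.\<close>

definition shift :: "(int \<times> int) set \<Rightarrow> (int \<times> int) set" where
  "shift D = {x. x + (2, -1) \<in> D}"

context building_polymatroid
begin

definition LC :: "'a set leray set" where
  "LC = {\<omega>. \<forall>T\<in>keys \<omega>. T \<subseteq> G \<and> lookup \<omega> T \<in> PG}"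

definition LI :: "'a set leray set" where
  "LI = {\<omega>\<in>LC. \<forall>T. lookup \<omega> T \<in> JI T}"

definition LD :: "(int \<times> int) set \<Rightarrow> 'a set leray set" where
  "LD D = {\<omega>\<in>LC. \<forall>T\<in>keys \<omega>. \<forall>m\<in>keys (lookup \<omega> T). (2 * int (mdeg m), int (card T)) \<in> D}"

definition psi :: "'a set leray \<Rightarrow> 'a set set \<Rightarrow>\<^sub>0 rat" where
  "psi = ksum (\<lambda>T x. single T (if T \<in> NS then dg T x else 0))"

lemma LC_carrier: "LC = carrier (leray_algebra G r)"
  by (auto simp: LC_def PG_def leray_algebra_def)

lemma LC_lookup: "\<omega> \<in> LC \<Longrightarrow> lookup \<omega> T \<in> PG"
  by (cases "T \<in> keys \<omega>") (auto simp: LC_def in_keys_iff PG_zero)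

lemma LC_add: "\<omega> \<in> LC \<Longrightarrow> \<eta> \<in> LC \<Longrightarrow> \<omega> + \<eta> \<in> LC"
  using keys_add[of \<omega> \<eta>] LC_lookup[of \<omega>] LC_lookup[of \<eta>]
  unfolding LC_def by (auto simp: lookup_add PG_add)

lemma LC_keys: "\<omega> \<in> LC \<Longrightarrow> keys \<omega> \<subseteq> Pow G"
  by (auto simp: LC_def)

lemma LC_I: "keys \<omega> \<subseteq> Pow G \<Longrightarrow> (\<And>T. lookup \<omega> T \<in> PG) \<Longrightarrow> \<omega> \<in> LC"
  by (auto simp: LC_def)

lemma PG_psign: "p \<in> PG \<Longrightarrow> psign r T t * p \<in> PG"
  by (simp add: psign_def PG_def minus_one_power_iff in_keys_iff)

lemma lookup_leray_d:
  "\<omega> \<in> LC \<Longrightarrow> lookup (leray_d r \<omega>) U = (\<Sum>t\<in>G - U. psign r (insert t U) t * (xvar t * lookup \<omega> (insert t U)))"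
  using lookup_bdry[OF finite_G LC_keys, of \<omega> "\<lambda>T. T" r xvar U] by (simp add: leray_d_bdry mult.assoc)

lemma leray_d_LC: "\<omega> \<in> LC \<Longrightarrow> leray_d r \<omega> \<in> LC"
proof (rule LC_I)
  assume \<omega>: "\<omega> \<in> LC"
  show "keys (leray_d r \<omega>) \<subseteq> Pow G" unfolding leray_d_bdry by (rule keys_bdry_subset[OF LC_keys[OF \<omega>]])
  show "lookup (leray_d r \<omega>) T \<in> PG" for T
    unfolding lookup_leray_d[OF \<omega>] by (intro PG_sum PG_psign PG_mult PG_xvar LC_lookup[OF \<omega>]) auto
qed

lemma leray_d_square: "\<omega> \<in> LC \<Longrightarrow> leray_d r (leray_d r \<omega>) = 0"
  unfolding leray_d_bdry by (rule bdry_bdry[OF linear finite_G LC_keys])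

lemma LI_LC: "\<omega> \<in> LI \<Longrightarrow> \<omega> \<in> LC"
  by (simp add: LI_def)

lemma LI_zero: "0 \<in> LI"
  by (simp add: LI_def LC_def JI_zero)

lemma LC_uminus: "\<omega> \<in> LC \<Longrightarrow> - \<omega> \<in> LC"
  by (auto simp: LC_def PG_def in_keys_iff)

lemma LC_diff: "\<omega> \<in> LC \<Longrightarrow> \<eta> \<in> LC \<Longrightarrow> \<omega> - \<eta> \<in> LC"
  using LC_add[OF _ LC_uminus, of \<omega> \<eta>] by simp

lemma LI_add: "\<omega> \<in> LI \<Longrightarrow> \<eta> \<in> LI \<Longrightarrow> \<omega> + \<eta> \<in> LI"
  by (simp add: LI_def LC_add lookup_add JI_add)

lemma LI_uminus: "\<omega> \<in> LI \<Longrightarrow> - \<omega> \<in> LI"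
  by (simp add: LI_def LC_uminus JI_uminus)

lemma LI_diff: "\<omega> \<in> LI \<Longrightarrow> \<eta> \<in> LI \<Longrightarrow> \<omega> - \<eta> \<in> LI"
  using LI_add[OF _ LI_uminus, of \<omega> \<eta>] by simp

lemma psi_family: "additive_family (\<lambda>T x. single T (if T \<in> NS then dg T x else 0))"
  by (rule additive_familyI) (simp_all add: dg_add single_add)

lemma psi_add: "psi (\<omega> + \<eta>) = psi \<omega> + psi \<eta>"
  unfolding psi_def by (rule ksum_add[OF psi_family])

lemma psi_zero [simp]: "psi 0 = 0"
  by (simp add: psi_def)

lemma psi_diff: "psi (\<omega> - \<eta>) = psi \<omega> - psi \<eta>"
  using psi_add[of "\<omega> - \<eta>" \<eta>] by simp

lemma psi_sum: "psi (\<Sum>i\<in>I. p i) = (\<Sum>i\<in>I. psi (p i))"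
  unfolding psi_def by (rule ksum_sum[OF psi_family])

lemma psi_single: "psi (single T p) = single T (if T \<in> NS then dg T p else 0)"
  unfolding psi_def by (rule ksum_single[OF psi_family])

lemma lookup_psi: "lookup (psi \<omega>) T = (if T \<in> NS then dg T (lookup \<omega> T) else 0)"
  unfolding psi_def by (rule lookup_ksum_single) simp

lemma keys_psi: "keys (psi \<omega>) \<subseteq> NS"
  by (auto simp: in_keys_iff lookup_psi split: if_splits)

lemma psi_LI: "\<omega> \<in> LI \<Longrightarrow> psi \<omega> = 0"
  by (rule poly_mapping_eqI) (simp add: lookup_psi LI_def dg_JI)

lemma dg_psign: "dg T (psign r U t * p) = psign r U t * dg T p"
  using dg_scale[of T "-1" p] by (simp add: psign_def minus_one_power_iff single_uminus)

text \<open>The reason why \<open>psi\<close> is a chain map. If \<open>insert t U\<close> is not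
  nested, the product is a relation. If \<open>t\<close> is maximal in it, then \<open>t\<close> is
  not below \<open>jn U\<close> and \<open>x_t\<close> is sent to zero; these are the vertices that
  the differential of \<open>CM\<close> omits. Otherwise the join is unchanged and
  \<open>x_t\<close> is the additional variable in \<open>dg (insert t U)\<close>.\<close>

lemma dg_xvar:
  assumes U: "U \<in> NS" and t: "t \<in> G - U"
  shows "dg U (xvar t * p) = (if insert t U \<in> NS \<and> t \<notin> max_elements (insert t U) then dg (insert t U) p else 0)"
proof -
  let ?T = "insert t U"
  have FU: "Fc (jn U) \<subseteq> U" unfolding NS_factors[OF U] by (rule max_subset)
  consider "?T \<notin> NS" | "?T \<in> NS" "t \<in> max_elements ?T" | "?T \<in> NS" "t \<notin> max_elements ?T" by blast
  then show ?thesis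
  proof cases
    case 1
    have "dg U (p * xprod {t}) = 0" by (rule dg_xprod_zero[OF U]) (use t 1 in auto)
    then show ?thesis using 1 by (simp add: xprod_def mult.commute)
  next
    case 2
    have "\<not> t \<subseteq> jn U"
    proof
      assume "t \<subseteq> jn U"
      then obtain u where u: "u \<in> Fc (jn U)" "t \<subseteq> u" using Fc_above_ex[of t "jn U"] t by auto
      then have "u \<in> U" using FU by auto
      then have "t \<subset> u" using t u by auto
      then show False using 2(2) \<open>u \<in> U\<close> by (auto simp: max_elements_def)
    qed
    then have "yvar (jn U) t = 0" using yvar_zero by auto
    then show ?thesis using 2 by (simp add: dg_def subst_mult subst_xvar)
  next
    case 3
    have tT: "t \<in> ?T" by simp
    obtain u where u: "u \<in> max_elements ?T" "t \<subseteq> u" using max_above[OF NS_finite[OF 3(1)] tT] by auto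
    have "u \<in> ?T" by (rule subsetD[OF max_subset u(1)])
    then have uU: "u \<in> U" using 3(2) u(1) by auto
    have "jn ?T = jn U"
    proof
      show "jn ?T \<subseteq> jn U"
      proof (rule jn_least)
        fix x assume "x \<in> ?T"
        then consider "x = t" | "x \<in> U" by auto
        then show "x \<subseteq> jn U"
        proof cases
          case 1
          then show ?thesis using u(2) jn_upper[OF NS_Fl[OF U] uU] by simp
        qed (rule jn_upper[OF NS_Fl[OF U]])
      qed (use jn_Fl NS_Fl[OF U] in blast)
      show "jn U \<subseteq> jn ?T" by (rule jn_mono) (use NS_Fl[OF 3(1)] in auto)
    qed
    moreover have "t \<notin> Fc (jn U)" using FU t by auto
    then have "?T - Fc (jn U) = insert t (U - Fc (jn U))" "t \<notin> U - Fc (jn U)" using t by auto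
    ultimately show ?thesis using 3 NS_finite[OF U] by (simp add: dg_def xprod_insert mult_ac)
  qed
qed

lemma lookup_CM_d:
  assumes "keys v \<subseteq> NS"
  shows "lookup (CM_d r v) U = (\<Sum>t\<in>G - U. if t \<notin> max_elements (insert t U)
      then psign r (insert t U) t * lookup v (insert t U) else 0)"
proof -
  have "keys v \<subseteq> Pow G" using assms NS_G by blast
  then show ?thesis using lookup_bdry[OF finite_G, of v "\<lambda>T. T - max_elements T" r "\<lambda>_. 1" U]
    by (simp add: CM_d_bdry cong: if_cong)
qed

lemma psi_chain:
  assumes \<omega>: "\<omega> \<in> LC" shows "CM_d r (psi \<omega>) = psi (leray_d r \<omega>)"
proof (rule poly_mapping_eqI)
  fix U
  show "lookup (CM_d r (psi \<omega>)) U = lookup (psi (leray_d r \<omega>)) U"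
  proof (cases "U \<in> NS")
    case False
    then have "insert t U \<notin> NS" for t using NS_subset[of "insert t U" U] by auto
    then show ?thesis using False by (simp add: lookup_CM_d[OF keys_psi] lookup_psi cong: if_cong)
  next
    case True
    then show ?thesis
      by (simp add: lookup_CM_d[OF keys_psi] lookup_psi lookup_leray_d[OF \<omega>] dg_sum dg_psign)
        (intro sum.cong, simp_all add: dg_xvar[OF True] lookup_psi)
  qed
qed

text \<open>Multiplication by \<open>x_t\<close> moves the vertex \<open>t\<close> from the exterior
  part into \<open>S\<close> without changing the union. So a relation for \<open>insert t U\<close>
  gives one for \<open>U\<close>, and the differential preserves the ideal.\<close>

lemma xvar_rels:
  assumes t: "t \<in> G" and \<rho>: "\<rho> \<in> rels (insert t U)"
  shows "xvar t * \<rho> \<in> JI U"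
proof -
  have ins: "xvar t * xprod S = xprod (insert t S) \<or> t \<in> S" if "S \<subseteq> G" for S
    using xprod_insert[of S t] finite_subset[OF that finite_G] by (cases "t \<in> S") auto
  from \<rho> consider S where "\<rho> = xprod S" "S \<subseteq> G" "S \<union> insert t U \<notin> NS"
    | S g b where "\<rho> = xprod S * c_elem G g ^ b" "S \<subseteq> G" "g \<in> G" "cd g \<le> b + cd (jn (blw (S \<union> insert t U) g))"
    unfolding rels_def by blast
  then have "xvar t * \<rho> \<in> rels U \<or> \<rho> \<in> rels U"
  proof cases
    case 1
    show ?thesis
    proof (cases "t \<in> S")
      case True
      then have "S \<union> U = S \<union> insert t U" by auto
      then have "\<rho> \<in> rels U" using 1 unfolding rels_def by (metis (mono_tags, lifting) UnI1 mem_Collect_eq)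
      then show ?thesis by simp
    next
      case False
      then have "xvar t * \<rho> = xprod (insert t S)" "insert t S \<union> U = S \<union> insert t U" using ins[OF 1(2)] 1 by auto
      then have "xvar t * \<rho> \<in> {xprod S | S. S \<subseteq> G \<and> S \<union> U \<notin> NS}"
        using 1 t by (intro CollectI exI[of _ "insert t S"]) auto
      then show ?thesis unfolding rels_def by blast
    qed
  next
    case 2
    show ?thesis
    proof (cases "t \<in> S")
      case True
      then have "S \<union> U = S \<union> insert t U" by auto
      then have "\<rho> \<in> {xprod S * c_elem G g ^ b | S g b. S \<subseteq> G \<and> g \<in> G \<and> cd g \<le> b + cd (jn (blw (S \<union> U) g))}"
        using 2 by (intro CollectI exI[of _ S] exI[of _ g] exI[of _ b]) auto
      then show ?thesis unfolding rels_def by blast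
    next
      case False
      then have "xvar t * \<rho> = xprod (insert t S) * c_elem G g ^ b" "insert t S \<union> U = S \<union> insert t U"
        using ins[OF 2(2)] 2 by (auto simp: mult.assoc[symmetric])
      then have "xvar t * \<rho> \<in> {xprod S * c_elem G g ^ b | S g b. S \<subseteq> G \<and> g \<in> G \<and> cd g \<le> b + cd (jn (blw (S \<union> U) g))}"
        using 2 t by (intro CollectI exI[of _ "insert t S"] exI[of _ g] exI[of _ b]) auto
      then show ?thesis unfolding rels_def by blast
    qed
  qed
  then show ?thesis using JI_rel[OF _ PG_one] JI_rel[OF _ PG_xvar[OF t]] by force
qed

lemma xvar_JI: "p \<in> JI (insert t U) \<Longrightarrow> t \<in> G \<Longrightarrow> xvar t * p \<in> JI U"
proof (induction p rule: JI.induct)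
  case (JI_step p \<rho> q)
  have "q * (xvar t * \<rho>) \<in> JI U" using JI_step by (intro JI_mult xvar_rels) auto
  then have "xvar t * p + q * (xvar t * \<rho>) \<in> JI U" using JI_step JI_add by blast
  then show ?case by (simp add: distrib_left mult.left_commute)
qed (simp add: JI_zero)

lemma JI_psign: "p \<in> JI T \<Longrightarrow> psign r U t * p \<in> JI T"
  by (simp add: psign_def minus_one_power_iff JI_uminus)

lemma leray_d_LI: "\<omega> \<in> LI \<Longrightarrow> leray_d r \<omega> \<in> LI"
proof -
  assume \<omega>: "\<omega> \<in> LI"
  have "lookup (leray_d r \<omega>) U \<in> JI U" for U
    unfolding lookup_leray_d[OF LI_LC[OF \<omega>]]
    by (intro JI_sum JI_psign xvar_JI) (use \<omega> in \<open>auto simp: LI_def\<close>)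
  then show ?thesis using leray_d_LC[OF LI_LC[OF \<omega>]] by (simp add: LI_def)
qed

lemma LD_LC: "\<omega> \<in> LD D \<Longrightarrow> \<omega> \<in> LC"
  by (simp add: LD_def)

lemma LD_iff: "\<omega> \<in> LD D \<longleftrightarrow> \<omega> \<in> LC \<and> (\<forall>T m. lookup (lookup \<omega> T) m \<noteq> 0 \<longrightarrow> (2 * int (mdeg m), int (card T)) \<in> D)"
proof -
  have "T \<in> keys \<omega> \<and> m \<in> keys (lookup \<omega> T) \<longleftrightarrow> lookup (lookup \<omega> T) m \<noteq> 0" for T m
    by (auto simp: in_keys_iff)
  then show ?thesis unfolding LD_def by blast
qed

lemma LD_add: "\<omega> \<in> LD D \<Longrightarrow> \<eta> \<in> LD D \<Longrightarrow> \<omega> + \<eta> \<in> LD D"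
  unfolding LD_iff proof (intro conjI allI impI)
  fix T m
  assume "\<omega> \<in> LC \<and> (\<forall>T m. lookup (lookup \<omega> T) m \<noteq> 0 \<longrightarrow> (2 * int (mdeg m), int (card T)) \<in> D)"
    "\<eta> \<in> LC \<and> (\<forall>T m. lookup (lookup \<eta> T) m \<noteq> 0 \<longrightarrow> (2 * int (mdeg m), int (card T)) \<in> D)"
    "lookup (lookup (\<omega> + \<eta>) T) m \<noteq> 0"
  moreover from this have "lookup (lookup \<omega> T) m \<noteq> 0 \<or> lookup (lookup \<eta> T) m \<noteq> 0" by (auto simp: lookup_add)
  ultimately show "(2 * int (mdeg m), int (card T)) \<in> D" by blast
qed (simp add: LC_add)

lemma LD_zero: "0 \<in> LD D"
  by (simp add: LD_def LC_def)

lemma LD_sum: "(\<And>i. i \<in> I \<Longrightarrow> p i \<in> LD D) \<Longrightarrow> (\<Sum>i\<in>I. p i) \<in> LD D"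
  by (induction I rule: infinite_finite_induct) (auto simp: LD_zero LD_add)

lemma LD_uminus: "\<omega> \<in> LD D \<Longrightarrow> - \<omega> \<in> LD D"
  unfolding LD_iff by (simp add: LC_uminus)

lemma LD_diff: "\<omega> \<in> LD D \<Longrightarrow> \<eta> \<in> LD D \<Longrightarrow> \<omega> - \<eta> \<in> LD D"
  using LD_add[OF _ LD_uminus, of \<omega> D \<eta>] by simp

lemma LD_single: "T \<subseteq> G \<Longrightarrow> keys m \<subseteq> G \<Longrightarrow> (2 * int (mdeg m), int (card T)) \<in> D \<Longrightarrow> single T (single m c) \<in> LD D"
  by (auto simp: LD_def LC_def PG_single)

lemma lookup2_leray_d:
  assumes \<omega>: "\<omega> \<in> LC"
  shows "lookup (lookup (leray_d r \<omega>) T) m = (\<Sum>t\<in>G - T. if t \<in> keys m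
    then psign r (insert t T) t * lookup (lookup \<omega> (insert t T)) (m - single t 1) else 0)"
  unfolding lookup_leray_d[OF \<omega>] by (simp add: lookup_sum lookup_psign_mult lookup_xvar_mult) (intro sum.cong, auto)

lemma mdeg_minus_single: "t \<in> keys m \<Longrightarrow> mdeg m = mdeg (m - single t 1) + 1"
proof -
  assume "t \<in> keys m"
  then have "lookup (single t (1::nat)) g \<le> lookup m g" for g by (auto simp: lookup_single when_def in_keys_iff)
  from monomial_split(1)[OF this] have "mdeg m = mdeg ((m - single t 1) + single t 1)" by simp
  then show ?thesis by (simp only: mdeg_add mdeg_single)
qed

lemma leray_d_LD: "\<omega> \<in> LD (shift D) \<Longrightarrow> leray_d r \<omega> \<in> LD D"
proof -
  assume \<omega>: "\<omega> \<in> LD (shift D)"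
  have "(2 * int (mdeg m), int (card T)) \<in> D" if nz: "lookup (lookup (leray_d r \<omega>) T) m \<noteq> 0" for T m
  proof -
    have "\<exists>t\<in>G - T. t \<in> keys m \<and> lookup (lookup \<omega> (insert t T)) (m - single t 1) \<noteq> 0"
    proof (rule ccontr)
      assume "\<not> ?thesis"
      then have "lookup (lookup (leray_d r \<omega>) T) m = 0"
        unfolding lookup2_leray_d[OF LD_LC[OF \<omega>]] by (intro sum.neutral) auto
      then show False using nz by simp
    qed
    then obtain t where t: "t \<in> G - T" "t \<in> keys m" "lookup (lookup \<omega> (insert t T)) (m - single t 1) \<noteq> 0" by blast
    have "insert t T \<in> keys \<omega>" using t(3) by (auto simp: in_keys_iff)
    then have "finite T" using LC_keys[OF LD_LC[OF \<omega>]] finite_G by (meson PowD finite_insert finite_subset subsetD)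
    then have "card (insert t T) = card T + 1" using t by simp
    moreover have "(2 * int (mdeg (m - single t 1)), int (card (insert t T))) \<in> shift D"
      using \<omega> t(3) unfolding LD_iff by blast
    ultimately show ?thesis using mdeg_minus_single[OF t(2)] by (simp add: shift_def algebra_simps)
  qed
  then show ?thesis using leray_d_LC[OF LD_LC[OF \<omega>]] unfolding LD_iff by blast
qed

end

context building_polymatroid
begin

section \<open>Acyclicity of the kernel of the comparison map\<close>

text \<open>\<open>e_t\<close> weighs as much as \<open>x_t\<close>, so trading one for the other,
  as the differential does, keeps the weight.\<close>

definition wtot :: "'a set set \<Rightarrow> ('a set \<Rightarrow>\<^sub>0 nat) \<Rightarrow> nat" where
  "wtot T m = mwt (m + indm T)"

text \<open>\<open>\<mu>\<close> is the exponent vector \<open>m + indm T\<close> of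
  \<open>e_T x^m\<close>. For a standard monomial it is at most the gap at each vertex; where it
  equals the gap, \<open>e_t\<close> must occur, and elsewhere either choice is standard. So the
  standard monomials with given \<open>\<mu>\<close> form a cube over
  \<open>fre \<mu>\<close>.\<close>

definition fre :: "('a set \<Rightarrow>\<^sub>0 nat) \<Rightarrow> 'a set set" where
  "fre \<mu> = {s\<in>keys \<mu>. lookup \<mu> s < dgap (keys \<mu>) s}"

text \<open>Depends on \<open>\<mu>\<close> only, hence is the same for all monomials in one
  cube.\<close>

definition pick :: "('a set \<Rightarrow>\<^sub>0 nat) \<Rightarrow> 'a set" where
  "pick \<mu> = (SOME s. s \<in> fre \<mu>)"

lemma pick_fre: "fre \<mu> \<noteq> {} \<Longrightarrow> pick \<mu> \<in> fre \<mu>"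
  unfolding pick_def by (rule someI_ex) auto

lemma single_le: "t \<in> keys m \<Longrightarrow> lookup (single t (1::nat)) g \<le> lookup m g"
  by (auto simp: lookup_single when_def in_keys_iff)

lemma minus_single_add: "t \<in> keys m \<Longrightarrow> (m - single t (1::nat)) + single t 1 = m"
  using monomial_split(1)[OF single_le] .

lemma indm_insert: "finite T \<Longrightarrow> t \<notin> T \<Longrightarrow> indm (insert t T) = single t 1 + indm T"
  by (simp add: indm_def)

lemma mu_move:
  assumes "finite T" "t \<notin> T" "t \<in> keys m"
  shows "(m - single t 1) + indm (insert t T) = m + indm T"
  unfolding indm_insert[OF assms(1,2)] add.assoc[symmetric] minus_single_add[OF assms(3)] ..

lemma keys_mu: "finite T \<Longrightarrow> keys (m + indm T) = T \<union> keys m"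
  by (auto simp: keys_add_nat keys_indm)

lemma lookup_mu: "finite T \<Longrightarrow> lookup (m + indm T) s = lookup m s + of_bool (s \<in> T)"
  by (simp add: lookup_add lookup_indm)

lemma std_finite: "std T m \<Longrightarrow> finite T"
  using std_G finite_G finite_subset by metis

lemma std_move:
  assumes st: "std T m" and t: "t \<in> keys m" "t \<notin> T"
  shows "std (insert t T) (m - single t 1)"
proof -
  have f: "finite T" by (rule std_finite[OF st])
  have "insert t T \<union> keys (m - single t 1) = T \<union> keys m"
    using arg_cong[OF mu_move[OF f t(2,1)], of keys] keys_mu[OF f] keys_mu[of "insert t T"] f by simp
  moreover have "lookup (m - single t 1) s \<le> lookup m s" for s by (simp add: lookup_minus)
  ultimately show ?thesis using st std_less[OF st] unfolding std_def
    by (metis UnCI le_less_trans)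
qed

lemma std_unmove:
  assumes st: "std T m" and t: "t \<in> T" "t \<in> fre (m + indm T)"
  shows "std (T - {t}) (m + single t 1)"
proof -
  have f: "finite T" by (rule std_finite[OF st])
  have N: "(T - {t}) \<union> keys (m + single t 1) = T \<union> keys m" using t(1) by (auto simp: keys_add_nat)
  have "lookup m t + 1 < dgap (T \<union> keys m) t" using t f by (simp add: fre_def keys_mu lookup_mu)
  moreover have "lookup m s < dgap (T \<union> keys m) s" if "s \<in> T \<union> keys m" for s using std_less[OF st that] .
  ultimately have "lookup (m + single t 1) s < dgap (T \<union> keys m) s" if "s \<in> T \<union> keys m" for s
    using that by (cases "s = t") (auto simp: lookup_add lookup_single when_def)
  then show ?thesis using st N t(1) unfolding std_def by (auto simp: keys_add_nat split: if_splits)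
qed

lemma mu_unmove: "finite T \<Longrightarrow> t \<in> T \<Longrightarrow> (m + single t 1) + indm (T - {t}) = m + indm T"
  using indm_insert[of "T - {t}" t] by (simp add: insert_absorb add.assoc)

text \<open>Without free vertices the cube is a point, and that point is the monomial that
  \<open>psi\<close> detects.\<close>

lemma no_free_topm:
  assumes st: "std T m" and "fre (m + indm T) = {}"
  shows "T \<in> NS" "m = topm T"
proof -
  have f: "finite T" by (rule std_finite[OF st])
  have e: "s \<in> T \<and> lookup m s = dgap (T \<union> keys m) s - 1" if "s \<in> T \<union> keys m" for s
  proof -
    have "\<not> lookup (m + indm T) s < dgap (T \<union> keys m) s" using assms(2) that f by (auto simp: fre_def keys_mu)
    then show ?thesis using std_less[OF st that] f by (cases "s \<in> T") (auto simp: lookup_mu)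
  qed
  then have N: "T \<union> keys m = T" by auto
  then show T: "T \<in> NS" using st by (simp add: std_def)
  show "m = topm T"
  proof (rule poly_mapping_eqI)
    fix s show "lookup m s = lookup (topm T) s"
    proof (cases "s \<in> T")
      case False
      then have "s \<notin> keys m" using N by auto
      then show ?thesis using False f by (simp add: lookup_topm in_keys_iff)
    qed (use e N f in \<open>simp add: lookup_topm\<close>)
  qed
qed

text \<open>For a free \<open>t\<close> in \<open>T\<close> the exponent of \<open>x_t\<close> is at
  most the gap minus two, since \<open>e_t\<close> takes one unit; in \<open>topm T\<close> it is
  the gap minus one.\<close>

lemma free_not_top:
  assumes st: "std T m" and T: "T \<in> NS" and t: "t \<in> T" "t \<in> fre (m + indm T)"
  shows "dg T (mon m) = 0"
proof (rule ccontr)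
  assume "dg T (mon m) \<noteq> 0"
  then have m: "m = topm T" by (rule dg_std[OF T st])
  have f: "finite T" by (rule std_finite[OF st])
  have "T \<union> keys m = T" using keys_topm[OF f] m by auto
  moreover have "0 < dgap T t" using dgap_pos[OF T] t(1) NS_G[OF T] by auto
  ultimately show False using t f m by (auto simp: fre_def keys_mu lookup_mu lookup_topm)
qed

text \<open>Each nonstandard term is replaced by its standard reduction. Reduction strictly lowers
  the weight, so nonstandard terms of weight exactly \<open>n\<close> are harmless.\<close>

lemma reduce_step:
  assumes \<omega>: "\<omega> \<in> LD D"
    and b: "\<And>T m. lookup (lookup \<omega> T) m \<noteq> 0 \<Longrightarrow> wtot T m < n \<or> (wtot T m = n \<and> \<not> std T m)"
  shows "\<exists>\<omega>'\<in>LD D. \<omega> - \<omega>' \<in> LI \<and> (\<forall>T m. lookup (lookup \<omega>' T) m \<noteq> 0 \<longrightarrow> std T m \<and> wtot T m < n)"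
proof -
  have "\<forall>T m. \<exists>P. lookup (lookup \<omega> T) m \<noteq> 0 \<longrightarrow> mon m - P \<in> JI T \<and>
    (\<forall>m'\<in>keys P. std T m' \<and> mdeg m' = mdeg m \<and> wtot T m' < n)"
  proof (intro allI)
    fix T m
    show "\<exists>P. lookup (lookup \<omega> T) m \<noteq> 0 \<longrightarrow> mon m - P \<in> JI T \<and>
      (\<forall>m'\<in>keys P. std T m' \<and> mdeg m' = mdeg m \<and> wtot T m' < n)"
    proof (cases "lookup (lookup \<omega> T) m = 0")
      case nz: False
      show ?thesis
      proof (cases "std T m")
        case True
        then show ?thesis using b[OF nz] by (intro exI[of _ "mon m"]) (auto simp: JI_zero)
      next
        case False
        have "T \<in> keys \<omega>" "m \<in> keys (lookup \<omega> T)" using nz by (auto simp: in_keys_iff)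
        then have TG: "T \<subseteq> G" "keys m \<subseteq> G"
          using LC_keys[OF LD_LC[OF \<omega>]] LC_lookup[OF LD_LC[OF \<omega>], of T] by (auto simp: PG_def)
        obtain P where P: "mon m - P \<in> JI T" "std_below T m P" using reduce_monomial[OF TG False] by auto
        have "wtot T m' < n" if "mwt m' < mwt m" for m'
          using that b[OF nz] by (auto simp: wtot_def mwt_add)
        then show ?thesis using P by (intro exI[of _ P]) (auto simp: std_below_def)
      qed
    qed auto
  qed
  then obtain P where P: "\<And>T m. lookup (lookup \<omega> T) m \<noteq> 0 \<Longrightarrow> mon m - P T m \<in> JI T \<and>
    (\<forall>m'\<in>keys (P T m). std T m' \<and> mdeg m' = mdeg m \<and> wtot T m' < n)"
    by metis
  define q where "q T = (\<Sum>m\<in>keys (lookup \<omega> T). single 0 (lookup (lookup \<omega> T) m) * P T m)" for T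
  define \<omega>' where "\<omega>' = (\<Sum>T\<in>keys \<omega>. single T (q T))"
  have l': "lookup \<omega>' T = q T" for T
  proof (cases "T \<in> keys \<omega>")
    case True
    have "lookup \<omega>' T = (\<Sum>T'\<in>keys \<omega>. if T = T' then q T' else 0)"
      by (auto simp: \<omega>'_def lookup_sum lookup_single when_def intro!: sum.cong)
    then show ?thesis using True by (simp add: sum.delta')
  next
    case False
    then have "lookup \<omega>' T = 0"
      unfolding \<omega>'_def lookup_sum by (intro sum.neutral) (auto simp: lookup_single when_def)
    then show ?thesis using False by (simp add: q_def in_keys_iff)
  qed
  have ex: "\<exists>m. lookup (lookup \<omega> T) m \<noteq> 0 \<and> m' \<in> keys (P T m)" if "m' \<in> keys (q T)" for T m'
  proof -
    have "m' \<in> (\<Union>m\<in>keys (lookup \<omega> T). keys (single 0 (lookup (lookup \<omega> T) m) * P T m))"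
      by (rule subsetD[OF keys_sum that[unfolded q_def]])
    then obtain m where "m \<in> keys (lookup \<omega> T)" "m' \<in> keys (single 0 (lookup (lookup \<omega> T) m) * P T m)" by auto
    moreover from this have "m' \<in> keys (P T m)" by (blast intro: subsetD[OF keys_scale])
    ultimately show ?thesis by (auto simp: in_keys_iff)
  qed
  have kq: "std T m' \<and> wtot T m' < n \<and> (2 * int (mdeg m'), int (card T)) \<in> D" if k: "m' \<in> keys (q T)" for T m'
  proof -
    obtain m where m: "lookup (lookup \<omega> T) m \<noteq> 0" "m' \<in> keys (P T m)" using ex[OF k] by auto
    have "(2 * int (mdeg m), int (card T)) \<in> D" using \<omega> m(1) unfolding LD_iff by blast
    then show ?thesis using P[OF m(1)] m(2) by auto
  qed
  have LC': "\<omega>' \<in> LC"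
  proof (rule LC_I)
    show "keys \<omega>' \<subseteq> Pow G"
    proof
      fix T assume "T \<in> keys \<omega>'"
      then have "q T \<noteq> 0" by (simp add: in_keys_iff l')
      then have "\<exists>m'. m' \<in> keys (q T)" by (simp add: ex_in_conv)
      then obtain m' where "m' \<in> keys (q T)" by (rule exE)
      then show "T \<in> Pow G" using kq[of m' T] std_G[of T m'] by auto
    qed
    show "lookup \<omega>' T \<in> PG" for T
      unfolding l' PG_def
    proof (rule CollectI, rule ballI)
      fix m assume "m \<in> keys (q T)"
      then show "keys m \<subseteq> G" using kq[of m T] std_G[of T m] by auto
    qed
  qed
  have "\<omega>' \<in> LD D" unfolding LD_iff using LC' kq by (auto simp: l' in_keys_iff)
  moreover have "lookup (\<omega> - \<omega>') T \<in> JI T" for T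
  proof -
    have "lookup \<omega> T - q T = (\<Sum>m\<in>keys (lookup \<omega> T). single 0 (lookup (lookup \<omega> T) m) * (mon m - P T m))"
      unfolding q_def right_diff_distrib sum_subtractf
      by (simp add: mult_single) (rule poly_mapping_sum)
    also have "\<dots> \<in> JI T" using P by (intro JI_sum JI_scale) (auto simp: in_keys_iff)
    finally show ?thesis by (simp add: lookup_minus l')
  qed
  then have "\<omega> - \<omega>' \<in> LI" using LC_diff[OF LD_LC[OF \<omega>] LC'] by (simp add: LI_def)
  moreover have "\<forall>T m. lookup (lookup \<omega>' T) m \<noteq> 0 \<longrightarrow> std T m \<and> wtot T m < n"
    using kq by (auto simp: l' in_keys_iff)
  ultimately show ?thesis by blast
qed

section \<open>The Koszul homotopy in a fixed weight\<close>

definition active :: "nat \<Rightarrow> 'a set set \<Rightarrow> ('a set \<Rightarrow>\<^sub>0 nat) \<Rightarrow> bool" where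
  "active n T m \<longleftrightarrow> wtot T m = n \<and> fre (m + indm T) \<noteq> {}"

text \<open>The Koszul homotopy for the chosen vertex, on the monomials \<open>e\<^sub>T x\<^sup>m\<close> of weight exactly \<open>n\<close>.\<close>

definition contr :: "nat \<Rightarrow> 'a set set \<Rightarrow> ('a set \<Rightarrow>\<^sub>0 nat) \<Rightarrow> rat \<Rightarrow> 'a set leray" where
  "contr n T m c = (let t = pick (m + indm T) in if active n T m \<and> t \<notin> T
     then single (insert t T) (single (m - single t 1) (psign r (insert t T) t * c)) else 0)"

lemma pick_in: "active n T m \<Longrightarrow> finite T \<Longrightarrow> pick (m + indm T) \<in> T \<union> keys m"
  using pick_fre[of "m + indm T"] by (auto simp: active_def fre_def keys_mu)

text \<open>The homotopy keeps \<open>\<mu>\<close> and hence the picked vertex, so source and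
  target determine each other; this describes the source in terms of the target.\<close>

lemma lookup_contr:
  assumes T: "finite T" and T': "finite T'"
  shows "lookup (lookup (contr n T m c) T') m' =
    (let t = pick (m' + indm T') in if active n T' m' \<and> t \<in> T' \<and> T = T' - {t} \<and> m = m' + single t 1
     then psign r T' t * c else 0)"
proof -
  let ?t = "pick (m + indm T)" and ?t' = "pick (m' + indm T')"
  have eqv: "(active n T m \<and> ?t \<notin> T \<and> insert ?t T = T' \<and> m - single ?t 1 = m')
    \<longleftrightarrow> (active n T' m' \<and> ?t' \<in> T' \<and> T = T' - {?t'} \<and> m = m' + single ?t' 1)"
  proof
    assume H: "active n T m \<and> ?t \<notin> T \<and> insert ?t T = T' \<and> m - single ?t 1 = m'"
    then have k: "?t \<in> keys m" using pick_in[OF _ T, of n m] by auto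
    have mu: "m' + indm T' = m + indm T" using mu_move[OF T _ k] H by auto
    then have t: "?t' = ?t" by simp
    have "active n T' m'" using H mu by (simp add: active_def wtot_def)
    moreover have "m' + single ?t 1 = m" using minus_single_add[OF k] H by auto
    ultimately show "active n T' m' \<and> ?t' \<in> T' \<and> T = T' - {?t'} \<and> m = m' + single ?t' 1"
      unfolding t using H by auto
  next
    assume H: "active n T' m' \<and> ?t' \<in> T' \<and> T = T' - {?t'} \<and> m = m' + single ?t' 1"
    then have mu: "m + indm T = m' + indm T'" using mu_unmove[OF T'] by auto
    then have t: "?t = ?t'" by simp
    have "active n T m" using H mu by (simp add: active_def wtot_def)
    then show "active n T m \<and> ?t \<notin> T \<and> insert ?t T = T' \<and> m - single ?t 1 = m'"
      unfolding t using H by auto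
  qed
  have val: "lookup (lookup (contr n T m c) T') m' =
    (if active n T m \<and> ?t \<notin> T \<and> insert ?t T = T' \<and> m - single ?t 1 = m' then psign r (insert ?t T) ?t * c else 0)"
    by (auto simp: contr_def Let_def lookup_single when_def)
  have tt: "insert ?t T = T' \<Longrightarrow> ?t \<notin> T \<Longrightarrow> m - single ?t 1 = m' \<Longrightarrow> active n T m \<Longrightarrow> ?t' = ?t"
    using mu_move[OF T, of ?t m] pick_in[OF _ T, of n m] by auto
  show ?thesis
  proof (cases "active n T m \<and> ?t \<notin> T \<and> insert ?t T = T' \<and> m - single ?t 1 = m'")
    case True
    then have "?t' = ?t" using tt by blast
    then show ?thesis unfolding val Let_def eqv[symmetric] using True by auto
  next
    case False
    then show ?thesis unfolding val Let_def eqv[symmetric] by (simp only: if_False)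
  qed
qed

text \<open>The result contains the picked vertex in its exterior part although it is free, so it is
  not a top monomial and \<open>psi\<close> vanishes on it: the homotopy stays inside the
  kernel.\<close>

lemma contr_props:
  assumes st: "std T m" and D: "(2 * int (mdeg m), int (card T)) \<in> D"
  shows "contr n T m c \<in> LD (shift D)" "psi (contr n T m c) = 0"
    "lookup (lookup (contr n T m c) T') m' \<noteq> 0 \<Longrightarrow> wtot T' m' \<le> n"
proof -
  let ?t = "pick (m + indm T)" 
  have f: "finite T" by (rule std_finite[OF st])
  have *: "contr n T m c \<in> LD (shift D) \<and> psi (contr n T m c) = 0 \<and> (lookup (lookup (contr n T m c) T') m' \<noteq> 0 \<longrightarrow> wtot T' m' \<le> n)"
  proof (cases "active n T m \<and> ?t \<notin> T")
    case True
    then have k: "?t \<in> keys m" using pick_in[OF _ f, of n m] by auto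
    have c: "contr n T m c = single (insert ?t T) (single (m - single ?t 1) (psign r (insert ?t T) ?t * c))"
      using True by (simp add: contr_def Let_def)
    have st': "std (insert ?t T) (m - single ?t 1)" using std_move[OF st k] True by auto
    have mu: "(m - single ?t 1) + indm (insert ?t T) = m + indm T" using mu_move[OF f _ k] True by auto
    have "contr n T m c \<in> LD (shift D)"
      unfolding c by (rule LD_single) (use std_G[OF st'] D mdeg_minus_single[OF k] f True in \<open>auto simp: shift_def algebra_simps\<close>)
    moreover have "psi (contr n T m c) = 0"
    proof (cases "insert ?t T \<in> NS")
      case ns: True
      have "?t \<in> fre ((m - single ?t 1) + indm (insert ?t T))"
        using True pick_fre unfolding mu active_def by auto
      then have "dg (insert ?t T) (mon (m - single ?t 1)) = 0" by (intro free_not_top[OF st' ns]) auto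
      then have "dg (insert ?t T) (single (m - single ?t 1) d) = 0" for d
        using dg_scale[of "insert ?t T" d "mon (m - single ?t 1)"] by (simp add: mult_single)
      then show ?thesis unfolding c psi_single by simp
    qed (simp add: c psi_single)
    moreover have "wtot (insert ?t T) (m - single ?t 1) = n" using True mu by (simp add: wtot_def active_def)
    then have "lookup (lookup (contr n T m c) T') m' \<noteq> 0 \<longrightarrow> wtot T' m' \<le> n"
      unfolding c by (auto simp: lookup_single when_def split: if_splits)
    ultimately show ?thesis by blast
  next
    case False
    then have "contr n T m c = 0" by (auto simp: contr_def Let_def)
    then show ?thesis by (simp add: LD_zero)
  qed
  show "contr n T m c \<in> LD (shift D)" "psi (contr n T m c) = 0"
    "lookup (lookup (contr n T m c) T') m' \<noteq> 0 \<Longrightarrow> wtot T' m' \<le> n" using * by auto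
qed

text \<open>Here linear independence enters. The differential of \<open>\<omega>\<close> vanishes
  only modulo the ideal; \<open>std_coeff T m\<close> vanishes on \<open>JI T\<close> and on every
  monomial other than \<open>m\<close> that the weight bound allows, which turns the congruence into
  an equation between leading coefficients.\<close>

lemma cycle_leading:
  assumes \<omega>: "\<omega> \<in> LC" and cyc: "leray_d r \<omega> \<in> LI"
    and w: "\<And>T m. lookup (lookup \<omega> T) m \<noteq> 0 \<Longrightarrow> wtot T m \<le> n"
    and st: "std T m" and n: "wtot T m = n"
  shows "(\<Sum>t\<in>keys m - T. psign r (insert t T) t * lookup (lookup \<omega> (insert t T)) (m - single t 1)) = 0"
proof -
  have f: "finite T" by (rule std_finite[OF st])
  let ?p = "lookup (leray_d r \<omega>) T"
  have "?p \<in> JI T" using cyc by (simp add: LI_def)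
  then have "0 = std_coeff T m ?p" using std_coeff_JI[OF st] by simp
  also have "\<dots> = (\<Sum>k\<in>keys ?p. if k = m then lookup ?p k else 0)"
    unfolding std_coeff_expand[of T m ?p]
  proof (rule sum.cong[OF refl])
    fix k assume k: "k \<in> keys ?p"
    have kG: "keys k \<subseteq> G" using LC_lookup[OF leray_d_LC[OF \<omega>], of T] k by (auto simp: PG_def)
    have "\<exists>t\<in>G - T. t \<in> keys k \<and> lookup (lookup \<omega> (insert t T)) (k - single t 1) \<noteq> 0"
    proof (rule ccontr)
      assume "\<not> ?thesis"
      then have "lookup ?p k = 0" unfolding lookup2_leray_d[OF \<omega>] by (intro sum.neutral) auto
      then show False using k by (simp add: in_keys_iff)
    qed
    then obtain t where t: "t \<in> G - T" "t \<in> keys k" "lookup (lookup \<omega> (insert t T)) (k - single t 1) \<noteq> 0" by blast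
    have "wtot T k = wtot (insert t T) (k - single t 1)" using mu_move[OF f _ t(2)] t(1) by (simp add: wtot_def)
    then have "wtot T k \<le> wtot T m" using w[OF t(3)] n by simp
    then have "mwt k \<le> mwt m" by (simp add: wtot_def mwt_add)
    then have "k \<noteq> m \<Longrightarrow> std_coeff T m (mon k) = 0" using std_coeff_mon[OF st kG] by auto
    then show "lookup ?p k * std_coeff T m (mon k) = (if k = m then lookup ?p k else 0)"
      using std_coeff_self[OF st] by auto
  qed
  also have "\<dots> = lookup ?p m" by (simp add: sum.delta' in_keys_iff)
  also have "\<dots> = (\<Sum>t\<in>keys m - T. psign r (insert t T) t * lookup (lookup \<omega> (insert t T)) (m - single t 1))"
    unfolding lookup2_leray_d[OF \<omega>] using std_G[OF st] finite_G
    by (intro sum.mono_neutral_cong_right) auto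
  finally show ?thesis ..
qed

text \<open>Koszul exactness in weight \<open>n\<close>. Without free vertices the coefficient is
  zero because \<open>psi\<close> vanishes. If the picked vertex is not in \<open>T\<close>, a
  single term of the differential of \<open>y\<close> contributes and gives the coefficient. If it
  is in \<open>T\<close>, the cycle equation converts the sum of the terms into the
  coefficient.\<close>

lemma acyclic_leading:
  assumes \<omega>: "\<omega> \<in> LD D" and cyc: "leray_d r \<omega> \<in> LI" and psi0: "psi \<omega> = 0"
    and w: "\<And>T m. lookup (lookup \<omega> T) m \<noteq> 0 \<Longrightarrow> std T m \<and> wtot T m \<le> n"
  shows "\<exists>y\<in>LD (shift D). psi y = 0 \<and> (\<forall>T m. lookup (lookup (\<omega> - leray_d r y) T) m \<noteq> 0 \<longrightarrow>
    wtot T m < n \<or> (wtot T m = n \<and> \<not> std T m))"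
proof -
  define z where "z T m = lookup (lookup \<omega> T) m" for T m
  define y where "y = (\<Sum>T\<in>keys \<omega>. \<Sum>m\<in>keys (lookup \<omega> T). contr n T m (z T m))"
  have props: "contr n T m (z T m) \<in> LD (shift D)" "psi (contr n T m (z T m)) = 0"
    "lookup (lookup (contr n T m (z T m)) T') m' \<noteq> 0 \<Longrightarrow> wtot T' m' \<le> n"
    if "m \<in> keys (lookup \<omega> T)" for T m T' m'
  proof -
    have "std T m" "(2 * int (mdeg m), int (card T)) \<in> D"
      using w[of T m] \<omega> that unfolding LD_iff by (auto simp: in_keys_iff)
    from contr_props[OF this] show "contr n T m (z T m) \<in> LD (shift D)" "psi (contr n T m (z T m)) = 0"
      "lookup (lookup (contr n T m (z T m)) T') m' \<noteq> 0 \<Longrightarrow> wtot T' m' \<le> n" by auto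
  qed
  have yLD: "y \<in> LD (shift D)" unfolding y_def using props(1) by (intro LD_sum) auto
  have psiy: "psi y = 0" unfolding y_def psi_sum using props(2) by (intro sum.neutral) auto
  have yw: "wtot T' m' \<le> n" if nz: "lookup (lookup y T') m' \<noteq> 0" for T' m'
  proof (rule ccontr)
    assume H: "\<not> wtot T' m' \<le> n"
    have "lookup (lookup y T') m' = 0"
      unfolding y_def lookup_sum using props(3)[of _ _ T' m'] H by (intro sum.neutral ballI) blast
    then show False using nz by simp
  qed
  have ly: "lookup (lookup y T') m' = (let t = pick (m' + indm T') in
      if active n T' m' \<and> t \<in> T' then psign r T' t * z (T' - {t}) (m' + single t 1) else 0)" if T': "T' \<subseteq> G" for T' m'
  proof -
    let ?t = "pick (m' + indm T')" and ?C = "active n T' m' \<and> pick (m' + indm T') \<in> T'"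
    have f': "finite T'" using finite_subset[OF T' finite_G] .
    have "lookup (lookup y T') m' = (\<Sum>T\<in>keys \<omega>. \<Sum>m\<in>keys (lookup \<omega> T).
        if T = T' - {?t} then (if m = m' + single ?t 1 then (if ?C then psign r T' ?t * z T m else 0) else 0) else 0)"
      unfolding y_def lookup_sum
    proof (intro sum.cong refl)
      fix T m assume T: "T \<in> keys \<omega>" and "m \<in> keys (lookup \<omega> T)"
      have "finite T" using T LC_keys[OF LD_LC[OF \<omega>]] finite_G by (meson PowD finite_subset subsetD)
      then show "lookup (lookup (contr n T m (z T m)) T') m' =
        (if T = T' - {?t} then (if m = m' + single ?t 1 then (if ?C then psign r T' ?t * z T m else 0) else 0) else 0)"
        unfolding lookup_contr[OF \<open>finite T\<close> f'] by (auto simp: Let_def)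
    qed
    also have "\<dots> = (\<Sum>T\<in>keys \<omega>. if T = T' - {?t} then \<Sum>m\<in>keys (lookup \<omega> T).
        (if m = m' + single ?t 1 then (if ?C then psign r T' ?t * z T m else 0) else 0) else 0)"
      by (intro sum.cong) auto
    also have "\<dots> = (if ?C then psign r T' ?t * z (T' - {?t}) (m' + single ?t 1) else 0)"
      by (auto simp: sum.delta' in_keys_iff z_def)
    finally show ?thesis by (simp add: Let_def)
  qed
  have yLC: "y \<in> LC" by (rule LD_LC[OF yLD])
  have key: "lookup (lookup (leray_d r y) T) m = z T m" if st: "std T m" and n: "wtot T m = n" for T m
  proof -
    have f: "finite T" by (rule std_finite[OF st])
    have TG: "T \<subseteq> G" "keys m \<subseteq> G" using std_G[OF st] by auto
    let ?t0 = "pick (m + indm T)"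
    have dy: "lookup (lookup (leray_d r y) T) m =
      (\<Sum>t\<in>keys m - T. psign r (insert t T) t * lookup (lookup y (insert t T)) (m - single t 1))"
      unfolding lookup2_leray_d[OF yLC] using TG finite_G by (intro sum.mono_neutral_cong_right) auto
    have ly': "lookup (lookup y (insert t T)) (m - single t 1) =
      (if fre (m + indm T) \<noteq> {} \<and> ?t0 \<in> insert t T
       then psign r (insert t T) ?t0 * z (insert t T - {?t0}) (m - single t 1 + single ?t0 1) else 0)"
      if t: "t \<in> keys m - T" for t
    proof -
      have mu: "(m - single t 1) + indm (insert t T) = m + indm T" using mu_move[OF f] t by auto
      have sub: "insert t T \<subseteq> G" using t TG by auto
      have act: "active n (insert t T) (m - single t 1) \<longleftrightarrow> fre (m + indm T) \<noteq> {}"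
        using n mu by (simp add: active_def wtot_def)
      show ?thesis unfolding ly[OF sub] Let_def mu act ..
    qed
    show ?thesis
    proof (cases "fre (m + indm T) = {}")
      case True
      then have T: "T \<in> NS" and m: "m = topm T" using no_free_topm[OF st] by auto
      have "0 = dg T (lookup \<omega> T)" using psi0 lookup_psi[of \<omega> T] T by simp
      also have "\<dots> = (\<Sum>k\<in>keys (lookup \<omega> T). if k = m then lookup (lookup \<omega> T) k * dg T (mon m) else 0)"
        unfolding dg_expand[of T "lookup \<omega> T"]
      proof (rule sum.cong[OF refl])
        fix k assume "k \<in> keys (lookup \<omega> T)"
        then have "std T k" using w by (simp add: in_keys_iff)
        then have "k \<noteq> m \<Longrightarrow> dg T (mon k) = 0" using dg_std[OF T] m by auto
        then show "lookup (lookup \<omega> T) k * dg T (mon k) = (if k = m then lookup (lookup \<omega> T) k * dg T (mon m) else 0)" by auto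
      qed
      also have "\<dots> = z T m * dg T (mon m)" by (auto simp: sum.delta' in_keys_iff z_def)
      finally have "z T m = 0" using dg_topm[OF T] m by simp
      moreover have "lookup (lookup (leray_d r y) T) m = 0"
        unfolding dy using ly' True by (intro sum.neutral) auto
      ultimately show ?thesis by simp
    next
      case fr: False
      have t0: "?t0 \<in> fre (m + indm T)" by (rule pick_fre[OF fr])
      then have t0N: "?t0 \<in> T \<union> keys m" using f by (simp add: fre_def keys_mu)
      show ?thesis
      proof (cases "?t0 \<in> T")
        case False
        then have tk: "?t0 \<in> keys m - T" using t0N by auto
        have "lookup (lookup (leray_d r y) T) m = (\<Sum>t\<in>keys m - T. if t = ?t0 then z T m else 0)"
          unfolding dy
        proof (rule sum.cong[OF refl])
          fix t assume t: "t \<in> keys m - T"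
          show "psign r (insert t T) t * lookup (lookup y (insert t T)) (m - single t 1) = (if t = ?t0 then z T m else 0)"
          proof (cases "t = ?t0")
            case True
            have "insert ?t0 T - {?t0} = T" using False by auto
            then show ?thesis unfolding ly'[OF t] using True fr minus_single_add[of ?t0 m] tk
              by (simp add: psign_square)
          qed (use ly'[OF t] False in auto)
        qed
        also have "\<dots> = z T m" using tk by (simp add: sum.delta')
        finally show ?thesis .
      next
        case True
        \<comment> \<open>The cycle equation is used at the neighbour in the cube where the picked
          vertex occurs as a variable \<open>x\<close> and not as a generator \<open>e\<close>. It
          is again standard because the vertex is free.\<close>
        let ?U = "T - {?t0}" and ?m = "m + single ?t0 1"
        have stU: "std ?U ?m" by (rule std_unmove[OF st True t0])
        have "wtot ?U ?m = n" using mu_unmove[OF f True, of m] n by (simp add: wtot_def)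
        then have c: "(\<Sum>t\<in>keys ?m - ?U. psign r (insert t ?U) t * z (insert t ?U) (?m - single t 1)) = 0"
          unfolding z_def by (intro cycle_leading[OF LD_LC[OF \<omega>] cyc _ stU]) (use w in auto)
        have ks: "keys ?m - ?U = insert ?t0 (keys m - T)" by (auto simp: keys_add_nat)
        have iU: "insert ?t0 ?U = T" using True by auto
        have nt: "?t0 \<notin> keys m - T" using True by auto
        have "(\<Sum>t\<in>insert ?t0 (keys m - T). psign r (insert t ?U) t * z (insert t ?U) (?m - single t 1))
          = psign r (insert ?t0 ?U) ?t0 * z (insert ?t0 ?U) (?m - single ?t0 1)
            + (\<Sum>t\<in>keys m - T. psign r (insert t ?U) t * z (insert t ?U) (?m - single t 1))"
          by (rule sum.insert) (use nt in auto)
        moreover have "?m - single ?t0 1 = m" by simp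
        ultimately have "psign r T ?t0 * z T m + (\<Sum>t\<in>keys m - T. psign r (insert t ?U) t * z (insert t ?U) (?m - single t 1)) = 0"
          using c unfolding ks iU by (simp only:)
        then have zT: "psign r T ?t0 * z T m = - (\<Sum>t\<in>keys m - T. psign r (insert t ?U) t * z (insert t ?U) (?m - single t 1))"
          by (simp add: eq_neg_iff_add_eq_0)
        have "lookup (lookup (leray_d r y) T) m = (\<Sum>t\<in>keys m - T. - psign r T ?t0 * (psign r (insert t ?U) t * z (insert t ?U) (?m - single t 1)))"
          unfolding dy
        proof (rule sum.cong[OF refl])
          fix t assume t: "t \<in> keys m - T"
          have ne: "t \<noteq> ?t0" using t True by auto
          have tG: "t \<in> G - ?U" "?t0 \<in> G - ?U" using t TG True by auto
          have sets: "insert t T - {?t0} = insert t ?U" "insert t T = insert t (insert ?t0 ?U)" using ne iU by auto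
          have "lookup (single t (1::nat)) g \<le> lookup m g" for g using single_le[of t m g] t by auto
          then have mm: "m - single t 1 + single ?t0 1 = ?m - single t 1"
            by (intro poly_mapping_eqI) (simp add: lookup_add lookup_minus)
          have "psign r (insert t (insert ?t0 ?U)) ?t0 * psign r (insert t ?U) t
            = - (psign r (insert t (insert ?t0 ?U)) t * psign r (insert ?t0 ?U) ?t0 :: rat)"
            by (rule psign_swap[OF linear _ _ tG(1,2) ne]) (use f TG in auto)
          then have ps: "psign r (insert t T) ?t0 * psign r (insert t ?U) t = - (psign r (insert t T) t * psign r T ?t0 :: rat)"
            unfolding iU .
          have "psign r (insert t T) t * psign r (insert t T) ?t0 = - psign r T ?t0 * (psign r (insert t ?U) t :: rat)"
          proof -
            let ?x = "psign r (insert t T) t :: rat" and ?a = "psign r (insert t T) ?t0 :: rat" and ?b = "psign r (insert t ?U) t :: rat" and ?e = "psign r T ?t0 :: rat"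
            have sq: "?b * ?b = 1" "?x * ?x = 1" using psign_square[of r "insert t ?U" t 1] psign_square[of r "insert t T" t 1] by auto
            have "?x * ?a = ?x * (?a * ?b) * ?b" using sq(1) by (simp add: mult.assoc)
            also have "\<dots> = - (?x * ?x) * ?e * ?b" unfolding ps by simp
            finally show ?thesis using sq(2) by simp
          qed
          then show "psign r (insert t T) t * lookup (lookup y (insert t T)) (m - single t 1) =
            - psign r T ?t0 * (psign r (insert t ?U) t * z (insert t ?U) (?m - single t 1))"
            unfolding ly'[OF t] sets(1) mm using fr True by (simp add: mult.assoc[symmetric])
        qed
        also have "\<dots> = psign r T ?t0 * (psign r T ?t0 * z T m)"
          unfolding zT sum_distrib_left[symmetric] by simp
        finally show ?thesis by (simp add: psign_square)
      qed
    qed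
  qed
  have "wtot T m < n \<or> (wtot T m = n \<and> \<not> std T m)" if nz: "lookup (lookup (\<omega> - leray_d r y) T) m \<noteq> 0" for T m
  proof -
    have "wtot T m \<le> n"
    proof (cases "z T m = 0")
      case True
      then have nz': "lookup (lookup (leray_d r y) T) m \<noteq> 0" using nz by (simp add: lookup_minus z_def)
      have TG: "T \<subseteq> G"
      proof -
        have "T \<in> keys (leray_d r y)" using nz' by (auto simp: in_keys_iff)
        then show ?thesis using LC_keys[OF leray_d_LC[OF yLC]] by auto
      qed
      have "\<exists>t\<in>G - T. t \<in> keys m \<and> lookup (lookup y (insert t T)) (m - single t 1) \<noteq> 0"
      proof (rule ccontr)
        assume "\<not> ?thesis"
        then have "lookup (lookup (leray_d r y) T) m = 0" unfolding lookup2_leray_d[OF yLC] by (intro sum.neutral) auto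
        then show False using nz' by simp
      qed
      then obtain t where t: "t \<in> G - T" "t \<in> keys m" "lookup (lookup y (insert t T)) (m - single t 1) \<noteq> 0" by blast
      have "wtot T m = wtot (insert t T) (m - single t 1)"
        using mu_move[OF finite_subset[OF TG finite_G] _ t(2)] t(1) by (simp add: wtot_def)
      then show ?thesis using yw[OF t(3)] by simp
    qed (use w in \<open>simp add: z_def\<close>)
    moreover have "wtot T m = n \<Longrightarrow> \<not> std T m"
      using key[of T m] nz by (auto simp: lookup_minus z_def)
    ultimately show ?thesis by linarith
  qed
  then show ?thesis using yLD psiy by blast
qed

lemma leray_d_add: "leray_d r (\<omega> + \<eta>) = leray_d r \<omega> + leray_d r \<eta>"
  unfolding leray_d_bdry by (rule bdry_add)

lemma leray_d_diff: "leray_d r (\<omega> - \<eta>) = leray_d r \<omega> - leray_d r \<eta>"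
  unfolding leray_d_bdry by (rule bdry_diff)

lemma CM_d_zero: "CM_d r 0 = 0"
  by (simp add: CM_d_bdry)

text \<open>Clear weight \<open>n\<close> by the homotopy, rewrite the rest in standard monomials of
  weight less than \<open>n\<close>, and continue. Boundaries of kernel elements and elements of the
  ideal preserve both the cycle condition and the vanishing of \<open>psi\<close>.\<close>

lemma acyclic_std:
  "\<omega> \<in> LD D \<Longrightarrow> leray_d r \<omega> \<in> LI \<Longrightarrow> psi \<omega> = 0 \<Longrightarrow>
    (\<And>T m. lookup (lookup \<omega> T) m \<noteq> 0 \<Longrightarrow> std T m \<and> wtot T m < n) \<Longrightarrow>
    \<exists>y\<in>LD (shift D). psi y = 0 \<and> \<omega> - leray_d r y \<in> LI"
proof (induction n arbitrary: \<omega>)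
  case 0
  have "lookup (lookup \<omega> T) m = 0" for T m using 0(4)[of T m] by auto
  then have "lookup \<omega> T = 0" for T by (intro poly_mapping_eqI) simp
  then have "\<omega> = 0" by (intro poly_mapping_eqI) simp
  then show ?case by (intro bexI[of _ 0]) (auto simp: LD_zero LI_zero leray_d_bdry)
next
  case (Suc n)
  have w: "std T m \<and> wtot T m \<le> n" if "lookup (lookup \<omega> T) m \<noteq> 0" for T m
    using Suc.prems(4)[OF that] by auto
  obtain y where y: "y \<in> LD (shift D)" "psi y = 0"
    "\<forall>T m. lookup (lookup (\<omega> - leray_d r y) T) m \<noteq> 0 \<longrightarrow> wtot T m < n \<or> (wtot T m = n \<and> \<not> std T m)"
    using acyclic_leading[OF Suc.prems(1-3) w] by blast
  have yLC: "y \<in> LC" by (rule LD_LC[OF y(1)])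
  let ?\<omega>1 = "\<omega> - leray_d r y"
  have "?\<omega>1 \<in> LD D" by (rule LD_diff[OF Suc.prems(1) leray_d_LD[OF y(1)]])
  then obtain \<omega>2 where \<omega>2: "\<omega>2 \<in> LD D" "?\<omega>1 - \<omega>2 \<in> LI" "\<forall>T m. lookup (lookup \<omega>2 T) m \<noteq> 0 \<longrightarrow> std T m \<and> wtot T m < n"
    using reduce_step[of ?\<omega>1 D n] y(3) by blast
  have d1: "leray_d r ?\<omega>1 \<in> LI" using Suc.prems(2) leray_d_square[OF yLC] by (simp add: leray_d_diff)
  have p1: "psi ?\<omega>1 = 0" using Suc.prems(3) psi_chain[OF yLC] y(2) CM_d_zero by (simp add: psi_diff)
  have "leray_d r ?\<omega>1 - leray_d r \<omega>2 \<in> LI" using leray_d_LI[OF \<omega>2(2)] by (simp add: leray_d_diff)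
  then have "leray_d r \<omega>2 \<in> LI" using LI_diff[OF d1] by fastforce
  moreover have "psi \<omega>2 = 0" using psi_LI[OF \<omega>2(2)] p1 by (simp add: psi_diff)
  ultimately obtain y2 where y2: "y2 \<in> LD (shift D)" "psi y2 = 0" "\<omega>2 - leray_d r y2 \<in> LI"
    using Suc.IH[OF \<omega>2(1)] \<omega>2(3) by blast
  have "(?\<omega>1 - \<omega>2) + (\<omega>2 - leray_d r y2) \<in> LI" by (rule LI_add[OF \<omega>2(2) y2(3)])
  then have "\<omega> - leray_d r (y + y2) \<in> LI" by (simp add: leray_d_add algebra_simps)
  then show ?case using LD_add[OF y(1) y2(1)] y(2) y2(2) by (intro bexI[of _ "y + y2"]) (auto simp: psi_add)
qed

lemma acyclic:
  assumes \<omega>: "\<omega> \<in> LD D" and d: "leray_d r \<omega> \<in> LI" and p: "psi \<omega> = 0"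
  shows "\<exists>y\<in>LD (shift D). psi y = 0 \<and> \<omega> - leray_d r y \<in> LI"
proof -
  let ?A = "\<Union>T\<in>keys \<omega>. (\<lambda>m. wtot T m) ` keys (lookup \<omega> T)"
  obtain n where n: "\<forall>x\<in>?A. x < n"
    using finite_nat_set_iff_bounded[of ?A] by auto
  have "wtot T m < n" if "lookup (lookup \<omega> T) m \<noteq> 0" for T m
  proof -
    have "T \<in> keys \<omega>" "m \<in> keys (lookup \<omega> T)" using that by (auto simp: in_keys_iff)
    then show ?thesis using n by blast
  qed
  then obtain \<omega>2 where \<omega>2: "\<omega>2 \<in> LD D" "\<omega> - \<omega>2 \<in> LI" "\<forall>T m. lookup (lookup \<omega>2 T) m \<noteq> 0 \<longrightarrow> std T m \<and> wtot T m < n"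
    using reduce_step[OF \<omega>, of n] by blast
  have "leray_d r \<omega> - leray_d r \<omega>2 \<in> LI" using leray_d_LI[OF \<omega>2(2)] by (simp add: leray_d_diff)
  then have "leray_d r \<omega>2 \<in> LI" using LI_diff[OF d] by fastforce
  moreover have "psi \<omega>2 = 0" using psi_LI[OF \<omega>2(2)] p by (simp add: psi_diff)
  ultimately obtain y where y: "y \<in> LD (shift D)" "psi y = 0" "\<omega>2 - leray_d r y \<in> LI"
    using acyclic_std[OF \<omega>2(1)] \<omega>2(3) by blast
  have "(\<omega> - \<omega>2) + (\<omega>2 - leray_d r y) \<in> LI" by (rule LI_add[OF \<omega>2(2) y(3)])
  then show ?thesis using y(1,2) by (intro bexI[of _ y]) auto
qed

section \<open>The comparison map on homology\<close>

definition CD :: "(int \<times> int) set \<Rightarrow> ('a set set \<Rightarrow>\<^sub>0 rat) set" where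
  "CD D = {v. keys v \<subseteq> NS \<and> (\<forall>T\<in>keys v. (2 * (int (cd (jn T)) - int (card T)), int (card T)) \<in> D)}"

lemma CM_part_CD: "CM_part E cd G D = CD D"
proof -
  have "\<Squnion>\<^bsub>flats E cd\<^esub> T = jn T" if "T \<in> NS" for T by (rule sup_flats[OF NS_Fl[OF that]])
  then show ?thesis unfolding CM_part_def CD_def CM_space_def free_module_def by (auto simp: subset_iff)
qed

text \<open>Multiples of the top monomials are preimages. They have the right degree, because
  \<open>dg\<close> is nonzero on them and so fixes it.\<close>

lemma psi_surj:
  assumes c: "c \<in> CD D" shows "\<exists>z\<in>LD D. psi z = c"
proof -
  define z where "z = (\<Sum>T\<in>keys c. single T (single (topm T) (lookup c T / dg T (mon (topm T)))))"
  have N: "T \<in> NS" and D: "(2 * (int (cd (jn T)) - int (card T)), int (card T)) \<in> D" if "T \<in> keys c" for T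
    using c that by (auto simp: CD_def)
  have "z \<in> LD D" unfolding z_def
  proof (rule LD_sum)
    fix T assume T: "T \<in> keys c"
    have "mdeg (topm T) + card T = cd (jn T)" by (rule dg_monomial(1)[OF N[OF T] dg_topm[OF N[OF T]]])
    then have "2 * int (mdeg (topm T)) = 2 * (int (cd (jn T)) - int (card T))"
      using arg_cong[of _ _ int] by fastforce
    then show "single T (single (topm T) (lookup c T / dg T (mon (topm T)))) \<in> LD D"
      using D[OF T] NS_G[OF N[OF T]] keys_topm_G[OF N[OF T]] by (intro LD_single) auto
  qed
  moreover have "psi z = (\<Sum>T\<in>keys c. single T (lookup c T))"
    unfolding z_def psi_sum
  proof (rule sum.cong[OF refl])
    fix T assume T: "T \<in> keys c"
    have "dg T (single (topm T) (lookup c T / dg T (mon (topm T)))) = lookup c T"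
      using dg_scale[of T "lookup c T / dg T (mon (topm T))" "mon (topm T)"] dg_topm[OF N[OF T]] by (simp add: mult_single)
    then show "psi (single T (single (topm T) (lookup c T / dg T (mon (topm T))))) = single T (lookup c T)"
      using N[OF T] by (simp add: psi_single)
  qed
  then have "psi z = c" using poly_mapping_sum[of c] by simp
  ultimately show ?thesis by blast
qed

text \<open>The differential of any preimage lies in the kernel of \<open>psi\<close>. Acyclicity of
  the kernel, one step further along the complex, corrects the preimage to a cycle.\<close>

lemma psi_homology_surj:
  assumes c: "c \<in> CD D" and d: "CM_d r c = 0"
  shows "\<exists>z\<in>LD D. leray_d r z \<in> LI \<and> psi z = c"
proof -
  \<comment> \<open>\<open>D\<close> moved forward by the bidegree of the differential, so that
    acyclicity in \<open>D'\<close> returns an element of degree in \<open>D\<close>.\<close>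
  define D' where "D' = {x. x - (2, -1) \<in> D}"
  have D: "shift D' = D" by (auto simp: shift_def D'_def)
  obtain z0 where z0: "z0 \<in> LD D" "psi z0 = c" using psi_surj[OF c] by blast
  have z0LC: "z0 \<in> LC" by (rule LD_LC[OF z0(1)])
  have "leray_d r z0 \<in> LD D'" using leray_d_LD[of z0 D'] z0(1) D by simp
  moreover have "psi (leray_d r z0) = 0" using psi_chain[OF z0LC] z0(2) d by simp
  moreover have "leray_d r (leray_d r z0) \<in> LI" using leray_d_square[OF z0LC] LI_zero by simp
  ultimately obtain y where y: "y \<in> LD D" "psi y = 0" "leray_d r z0 - leray_d r y \<in> LI"
    using acyclic[of "leray_d r z0" D'] D by auto
  then show ?thesis using LD_diff[OF z0(1) y(1)] z0(2) by (intro bexI[of _ "z0 - y"]) (auto simp: psi_diff leray_d_diff)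
qed

text \<open>Subtracting the differential of a preimage of \<open>c\<close> leaves a cycle in the
  kernel of \<open>psi\<close>, which is a boundary.\<close>

lemma psi_homology_inj:
  assumes z: "z \<in> LD D" "leray_d r z \<in> LI" and c: "c \<in> CD (shift D)" "psi z = CM_d r c"
  shows "\<exists>y\<in>LD (shift D). z - leray_d r y \<in> LI"
proof -
  obtain y0 where y0: "y0 \<in> LD (shift D)" "psi y0 = c" using psi_surj[OF c(1)] by blast
  have y0LC: "y0 \<in> LC" by (rule LD_LC[OF y0(1)])
  let ?z = "z - leray_d r y0"
  have "?z \<in> LD D" by (rule LD_diff[OF z(1) leray_d_LD[OF y0(1)]])
  moreover have "psi ?z = 0" using psi_chain[OF y0LC] y0(2) c(2) by (simp add: psi_diff)
  moreover have "leray_d r ?z \<in> LI" using z(2) leray_d_square[OF y0LC] by (simp add: leray_d_diff)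
  ultimately obtain y where y: "y \<in> LD (shift D)" "?z - leray_d r y \<in> LI" using acyclic by blast
  have "z - leray_d r (y0 + y) \<in> LI" using y(2) by (simp add: leray_d_add algebra_simps)
  then show ?thesis using LD_add[OF y0(1) y(1)] by blast
qed

end

section \<open>Vector spaces with a basis\<close>

abbreviation smul :: "'c::comm_semiring_1 \<Rightarrow> ('k \<Rightarrow>\<^sub>0 'c) \<Rightarrow> ('k \<Rightarrow>\<^sub>0 'c)" where
  "smul c \<equiv> Poly_Mapping.map ((*) c)"

lemma lookup_smul: "lookup (smul c v) k = c * lookup v k"
  by (simp add: Poly_Mapping.map.rep_eq when_def)

lemma smul_add: "smul c (v + w) = smul c v + smul c w"
  by (rule poly_mapping_eqI) (simp add: lookup_smul lookup_add distrib_left)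

lemma smul_zero [simp]: "smul c 0 = 0"
  by (rule poly_mapping_eqI) (simp add: lookup_smul)

lemma smul_smul: "smul c (smul d v) = smul (c * d) v"
  by (rule poly_mapping_eqI) (simp add: lookup_smul mult.assoc)

lemma smul_one [simp]: "smul 1 v = v"
  by (rule poly_mapping_eqI) (simp add: lookup_smul)

lemma smul_single: "smul c (single k d) = single k (c * d)"
  by (rule poly_mapping_eqI) (simp add: lookup_smul lookup_single when_def)

lemma smul_sum: "smul c (\<Sum>i\<in>I. v i) = (\<Sum>i\<in>I. smul c (v i))"
  by (induction I rule: infinite_finite_induct) (simp_all add: smul_add)

lemma keys_smul: "keys (smul c v) \<subseteq> keys v"
  by (auto simp: in_keys_iff lookup_smul)

lemma smul_uminus: "smul (- 1 :: rat) v = - v"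
  by (rule poly_mapping_eqI) (simp add: lookup_smul)

text \<open>A coordinate isomorphism onto the finitely supported functions on \<open>X\<close>,
  stated on the raw operations of the record. Quotients, direct sums and tensor products can thus be
  handled without a module instance, and equal index sets give isomorphic spaces.\<close>

definition free_on :: "(rat, 'v) module \<Rightarrow> 'x set \<Rightarrow> ('v \<Rightarrow> 'x \<Rightarrow>\<^sub>0 rat) \<Rightarrow> bool" where
  "free_on M X \<phi> \<longleftrightarrow> bij_betw \<phi> (carrier M) {w. keys w \<subseteq> X} \<and>
    (\<forall>u\<in>carrier M. \<forall>v\<in>carrier M. u \<oplus>\<^bsub>M\<^esub> v \<in> carrier M \<and> \<phi> (u \<oplus>\<^bsub>M\<^esub> v) = \<phi> u + \<phi> v) \<and>
    (\<forall>c. \<forall>v\<in>carrier M. c \<odot>\<^bsub>M\<^esub> v \<in> carrier M \<and> \<phi> (c \<odot>\<^bsub>M\<^esub> v) = smul c (\<phi> v)) \<and>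
    \<zero>\<^bsub>M\<^esub> \<in> carrier M \<and> \<phi> \<zero>\<^bsub>M\<^esub> = 0"

lemma free_onI:
  assumes "bij_betw \<phi> (carrier M) {w. keys w \<subseteq> X}"
    "\<And>u v. u \<in> carrier M \<Longrightarrow> v \<in> carrier M \<Longrightarrow> u \<oplus>\<^bsub>M\<^esub> v \<in> carrier M"
    "\<And>u v. u \<in> carrier M \<Longrightarrow> v \<in> carrier M \<Longrightarrow> \<phi> (u \<oplus>\<^bsub>M\<^esub> v) = \<phi> u + \<phi> v"
    "\<And>c v. v \<in> carrier M \<Longrightarrow> c \<odot>\<^bsub>M\<^esub> v \<in> carrier M"
    "\<And>c v. v \<in> carrier M \<Longrightarrow> \<phi> (c \<odot>\<^bsub>M\<^esub> v) = smul c (\<phi> v)"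
    "\<zero>\<^bsub>M\<^esub> \<in> carrier M" "\<phi> \<zero>\<^bsub>M\<^esub> = 0"
  shows "free_on M X \<phi>"
  using assms unfolding free_on_def by blast

lemma free_onD:
  assumes "free_on M X \<phi>"
  shows "bij_betw \<phi> (carrier M) {w. keys w \<subseteq> X}"
    "\<And>u v. u \<in> carrier M \<Longrightarrow> v \<in> carrier M \<Longrightarrow> u \<oplus>\<^bsub>M\<^esub> v \<in> carrier M"
    "\<And>u v. u \<in> carrier M \<Longrightarrow> v \<in> carrier M \<Longrightarrow> \<phi> (u \<oplus>\<^bsub>M\<^esub> v) = \<phi> u + \<phi> v"
    "\<And>c v. v \<in> carrier M \<Longrightarrow> c \<odot>\<^bsub>M\<^esub> v \<in> carrier M"
    "\<And>c v. v \<in> carrier M \<Longrightarrow> \<phi> (c \<odot>\<^bsub>M\<^esub> v) = smul c (\<phi> v)"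
    "\<zero>\<^bsub>M\<^esub> \<in> carrier M" "\<phi> \<zero>\<^bsub>M\<^esub> = 0"
  using assms unfolding free_on_def by blast+

lemma free_on_inj: "free_on M X \<phi> \<Longrightarrow> u \<in> carrier M \<Longrightarrow> v \<in> carrier M \<Longrightarrow> \<phi> u = \<phi> v \<Longrightarrow> u = v"
  using free_onD(1) bij_betw_imp_inj_on inj_onD by metis

lemma free_on_surj: "free_on M X \<phi> \<Longrightarrow> keys w \<subseteq> X \<Longrightarrow> \<exists>v\<in>carrier M. \<phi> v = w"
  using free_onD(1)[of M X \<phi>] unfolding bij_betw_def by (metis (mono_tags, lifting) imageE mem_Collect_eq)

lemma free_on_keys: "free_on M X \<phi> \<Longrightarrow> v \<in> carrier M \<Longrightarrow> keys (\<phi> v) \<subseteq> X"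
  using free_onD(1)[of M X \<phi>] unfolding bij_betw_def by blast

lemma free_on_iso:
  assumes M: "free_on M X \<phi>" and N: "free_on N X \<psi>"
  shows "M \<cong>\<^sub>\<rat> N"
proof -
  define i where "i = inv_into (carrier N) \<psi>"
  note bN = free_onD(1)[OF N]
  have i: "i w \<in> carrier N" "\<psi> (i w) = w" if "keys w \<subseteq> X" for w
    using bij_betw_inv_into_right[OF bN] bij_betwE[OF bij_betw_inv_into[OF bN]] that by (auto simp: i_def)
  have eq: "i w = v" if "v \<in> carrier N" "\<psi> v = w" for v w
    using bij_betw_inv_into_left[OF bN] that by (auto simp: i_def)
  let ?f = "\<lambda>v. i (\<phi> v)"
  have b: "bij_betw ?f (carrier M) (carrier N)"
    using bij_betw_trans[OF free_onD(1)[OF M] bij_betw_inv_into[OF bN]] by (simp add: i_def comp_def)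
  note fk = free_on_keys[OF M]
  have h1: "?f (u \<oplus>\<^bsub>M\<^esub> v) = ?f u \<oplus>\<^bsub>N\<^esub> ?f v" if "u \<in> carrier M" "v \<in> carrier M" for u v
    by (rule eq) (use that i[OF fk] free_onD[OF M] free_onD[OF N] in auto)
  have h2: "?f (c \<odot>\<^bsub>M\<^esub> v) = c \<odot>\<^bsub>N\<^esub> ?f v" if "v \<in> carrier M" for c v
    by (rule eq) (use that i[OF fk] free_onD[OF M] free_onD[OF N] in auto)
  have h3: "?f v \<in> carrier N" if "v \<in> carrier M" for v using i[OF fk[OF that]] by simp
  have "?f \<in> hom (add_monoid M) (add_monoid N)"
    unfolding hom_def mem_Collect_eq
  proof (intro conjI ballI funcsetI)
    show "?f v \<in> carrier (add_monoid N)" if "v \<in> carrier (add_monoid M)" for v using h3 that by simp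
    show "?f (u \<otimes>\<^bsub>add_monoid M\<^esub> v) = ?f u \<otimes>\<^bsub>add_monoid N\<^esub> ?f v"
      if "u \<in> carrier (add_monoid M)" "v \<in> carrier (add_monoid M)" for u v
      using h1 that by simp
  qed
  then have "?f \<in> iso (add_monoid M) (add_monoid N)" using b unfolding iso_def by simp
  then show ?thesis unfolding vs_isomorphic_def by (rule bexI[rotated]) (intro allI ballI h2)
qed

definition rename :: "('x \<Rightarrow> 'y) \<Rightarrow> ('x \<Rightarrow>\<^sub>0 rat) \<Rightarrow> ('y \<Rightarrow>\<^sub>0 rat)" where
  "rename b = ksum (\<lambda>x c. single (b x) c)"

lemma rename_family: "additive_family (\<lambda>x c. single (b x) c)"
  by (rule additive_familyI) (simp_all add: single_add)

lemma rename_add: "rename b (v + w) = rename b v + rename b w"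
  unfolding rename_def by (rule ksum_add[OF rename_family])

lemma keys_rename: "keys (rename b v) \<subseteq> b ` keys v"
proof -
  have "keys (rename b v) \<subseteq> (\<Union>x\<in>keys v. keys (single (b x) (lookup v x)))"
    unfolding rename_def ksum_def by (rule keys_sum)
  then show ?thesis by fastforce
qed

lemma rename_id: "(\<And>x. x \<in> keys v \<Longrightarrow> g (f x) = x) \<Longrightarrow> rename g (rename f v) = v"
proof -
  assume H: "\<And>x. x \<in> keys v \<Longrightarrow> g (f x) = x"
  have "rename g (rename f v) = (\<Sum>x\<in>keys v. rename g (single (f x) (lookup v x)))"
    unfolding rename_def by (subst (2) ksum_def) (rule ksum_sum[OF rename_family])
  also have "\<dots> = (\<Sum>x\<in>keys v. single x (lookup v x))"
    by (rule sum.cong[OF refl]) (simp add: rename_def ksum_single[OF rename_family] H)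
  finally show ?thesis using poly_mapping_sum[of v] by simp
qed

lemma free_on_bij:
  assumes M: "free_on M X \<phi>" and b: "bij_betw b X Y"
  shows "free_on M Y (\<lambda>v. rename b (\<phi> v))"
proof (rule free_onI)
  have R: "bij_betw (rename b) {w. keys w \<subseteq> X} {w. keys w \<subseteq> Y}"
  proof (rule bij_betwI[where g="rename (inv_into X b)"])
    show "rename b \<in> {w. keys w \<subseteq> X} \<rightarrow> {w. keys w \<subseteq> Y}"
      using keys_rename[of b] bij_betw_imp_surj_on[OF b] by fastforce
    show "rename (inv_into X b) \<in> {w. keys w \<subseteq> Y} \<rightarrow> {w. keys w \<subseteq> X}"
      using keys_rename[of "inv_into X b"] bij_betwE[OF bij_betw_inv_into[OF b]] by fastforce
    show "rename (inv_into X b) (rename b w) = w" if "w \<in> {w. keys w \<subseteq> X}" for w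
      using that bij_betw_inv_into_left[OF b] by (intro rename_id) auto
    show "rename b (rename (inv_into X b) w) = w" if "w \<in> {w. keys w \<subseteq> Y}" for w
      using that bij_betw_inv_into_right[OF b] by (intro rename_id) auto
  qed
  show "bij_betw (\<lambda>v. rename b (\<phi> v)) (carrier M) {w. keys w \<subseteq> Y}"
    using bij_betw_trans[OF free_onD(1)[OF M] R] by (simp add: comp_def)
  have sm: "rename b (smul c v) = smul c (rename b v)" for c v
  proof -
    have F: "rename b (single x d) = single (b x) d" for x d by (simp add: rename_def ksum_single[OF rename_family])
    have "rename b (smul c v) = ksum (\<lambda>x d. single (b x) (c * d)) v"
    proof (rule ksum_eqI)
      show "rename b (smul c 0) = 0" by (simp add: rename_def)
    qed (simp_all add: smul_add rename_add smul_single F)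
    then show ?thesis unfolding rename_def ksum_def by (simp add: smul_sum smul_single)
  qed
  show "rename b (\<phi> (c \<odot>\<^bsub>M\<^esub> v)) = smul c (rename b (\<phi> v))" if "v \<in> carrier M" for c v
    using free_onD(5)[OF M that] sm by simp
  show "rename b (\<phi> \<zero>\<^bsub>M\<^esub>) = 0" using free_onD(7)[OF M] by (simp add: rename_def)
qed (use free_onD[OF M] rename_add in auto)

text \<open>\<open>N\<close> is the kernel of \<open>\<phi>\<close>, so its cosets are the fibres
  \<open>F w\<close>, and the operations are computed on fibres. The assumption \<open>sb\<close>
  takes the place of subtraction, for which the record has no operation.\<close>

lemma quot_free:
  fixes M :: "(rat, 'v) module" and \<phi> :: "'v \<Rightarrow> 'x \<Rightarrow>\<^sub>0 rat"
  assumes ad: "\<And>u v. u \<in> carrier M \<Longrightarrow> v \<in> carrier M \<Longrightarrow> u \<oplus>\<^bsub>M\<^esub> v \<in> carrier M \<and> \<phi> (u \<oplus>\<^bsub>M\<^esub> v) = \<phi> u + \<phi> v"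
    and sm: "\<And>c v. v \<in> carrier M \<Longrightarrow> c \<odot>\<^bsub>M\<^esub> v \<in> carrier M \<and> \<phi> (c \<odot>\<^bsub>M\<^esub> v) = smul c (\<phi> v)"
    and sb: "\<And>u v. u \<in> carrier M \<Longrightarrow> v \<in> carrier M \<Longrightarrow> \<exists>h\<in>carrier M. h \<oplus>\<^bsub>M\<^esub> v = u"
    and im: "\<phi> ` carrier M = {w. keys w \<subseteq> X}"
    and ker: "N = {v\<in>carrier M. \<phi> v = 0}"
  shows "free_on (quot_module M N) X (\<lambda>V. \<phi> (SOME v. v \<in> V))"
proof -
  let ?C = "carrier M" and ?Q = "quot_module M N"
  define F where "F w = {v\<in>?C. \<phi> v = w}" for w
  have coset: "N +>\<^bsub>M\<^esub> a = F (\<phi> a)" if a: "a \<in> ?C" for a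
  proof
    show "N +>\<^bsub>M\<^esub> a \<subseteq> F (\<phi> a)" using ad[OF _ a] by (auto simp: a_r_coset_def r_coset_def ker F_def)
    show "F (\<phi> a) \<subseteq> N +>\<^bsub>M\<^esub> a"
    proof
      fix v assume v: "v \<in> F (\<phi> a)"
      then obtain h where h: "h \<in> ?C" "h \<oplus>\<^bsub>M\<^esub> a = v" using sb[of v a] a by (auto simp: F_def)
      then have "\<phi> h = 0" using ad[OF h(1) a] v by (simp add: F_def)
      then show "v \<in> N +>\<^bsub>M\<^esub> a" using h by (auto simp: a_r_coset_def r_coset_def ker)
    qed
  qed
  have ne: "\<exists>v. v \<in> F w" if "keys w \<subseteq> X" for w
  proof -
    have "w \<in> \<phi> ` ?C" using im that by simp
    then show ?thesis by (auto simp: F_def)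
  qed
  have kphi: "keys (\<phi> a) \<subseteq> X" if "a \<in> ?C" for a using im that by blast
  have carr: "carrier ?Q = F ` {w. keys w \<subseteq> X}"
  proof -
    have "carrier ?Q = (\<lambda>a. N +>\<^bsub>M\<^esub> a) ` ?C"
      by (auto simp: quot_module_def FactRing_def A_RCOSETS_def RCOSETS_def a_r_coset_def)
    also have "\<dots> = (\<lambda>a. F (\<phi> a)) ` ?C" using coset by (intro image_cong) auto
    also have "\<dots> = F ` (\<phi> ` ?C)" by auto
    finally show ?thesis unfolding im .
  qed
  have some: "\<phi> (SOME v. v \<in> F w) = w" if "keys w \<subseteq> X" for w
    using someI_ex[OF ne[OF that]] by (simp add: F_def)
  have addQ: "F w \<oplus>\<^bsub>?Q\<^esub> F w' = F (w + w')" if w: "keys w \<subseteq> X" "keys w' \<subseteq> X" for w w'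
  proof
    show "F w \<oplus>\<^bsub>?Q\<^esub> F w' \<subseteq> F (w + w')"
      using ad by (auto simp: quot_module_def FactRing_def set_add_def set_mult_def F_def)
    show "F (w + w') \<subseteq> F w \<oplus>\<^bsub>?Q\<^esub> F w'"
    proof
      fix v assume v: "v \<in> F (w + w')"
      obtain k where k: "k \<in> F w'" using ne[OF w(2)] by auto
      then obtain h where h: "h \<in> ?C" "h \<oplus>\<^bsub>M\<^esub> k = v" using sb[of v k] v by (auto simp: F_def)
      then have "\<phi> h = w" using ad[OF h(1), of k] k v by (simp add: F_def)
      then show "v \<in> F w \<oplus>\<^bsub>?Q\<^esub> F w'"
        using h k by (auto simp: quot_module_def FactRing_def set_add_def set_mult_def F_def)
    qed
  qed
  have smQ: "c \<odot>\<^bsub>?Q\<^esub> F w = F (smul c w)" if w: "keys w \<subseteq> X" for c w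
  proof -
    have "N +>\<^bsub>M\<^esub> (c \<odot>\<^bsub>M\<^esub> v) = F (smul c w)" if "v \<in> F w" for v
      using coset[of "c \<odot>\<^bsub>M\<^esub> v"] sm[of v c] that by (auto simp: F_def)
    then have "(\<Union>v\<in>F w. N +>\<^bsub>M\<^esub> (c \<odot>\<^bsub>M\<^esub> v)) = F (smul c w)" using ne[OF w] by auto
    then show ?thesis by (simp add: quot_module_def)
  qed
  have zQ: "\<zero>\<^bsub>?Q\<^esub> = F 0" by (simp add: quot_module_def FactRing_def ker F_def)
  have kadd: "keys (w + w') \<subseteq> X" if "keys w \<subseteq> X" "keys w' \<subseteq> X" for w w' :: "'x \<Rightarrow>\<^sub>0 rat"
    using keys_add[of w w'] that by blast
  have ksm: "keys (smul c w) \<subseteq> X" if "keys w \<subseteq> X" for c and w :: "'x \<Rightarrow>\<^sub>0 rat"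
    using keys_smul[of c w] that by blast
  show ?thesis
  proof (rule free_onI)
    show "bij_betw (\<lambda>V. \<phi> (SOME v. v \<in> V)) (carrier ?Q) {w. keys w \<subseteq> X}"
      unfolding carr by (rule bij_betwI[where g=F]) (auto simp: some)
  next
    fix U V assume "U \<in> carrier ?Q" "V \<in> carrier ?Q"
    then obtain w w' where w: "U = F w" "V = F w'" "keys w \<subseteq> X" "keys w' \<subseteq> X" unfolding carr by auto
    show "U \<oplus>\<^bsub>?Q\<^esub> V \<in> carrier ?Q" unfolding w(1,2) addQ[OF w(3,4)] carr using kadd[OF w(3,4)] by blast
    show "\<phi> (SOME v. v \<in> U \<oplus>\<^bsub>?Q\<^esub> V) = \<phi> (SOME v. v \<in> U) + \<phi> (SOME v. v \<in> V)"
      unfolding w(1,2) addQ[OF w(3,4)] some[OF w(3)] some[OF w(4)] by (rule some[OF kadd[OF w(3,4)]])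
  next
    fix c V assume "V \<in> carrier ?Q"
    then obtain w where w: "V = F w" "keys w \<subseteq> X" unfolding carr by auto
    show "c \<odot>\<^bsub>?Q\<^esub> V \<in> carrier ?Q" unfolding w(1) smQ[OF w(2)] carr using ksm[OF w(2)] by blast
    show "\<phi> (SOME v. v \<in> c \<odot>\<^bsub>?Q\<^esub> V) = smul c (\<phi> (SOME v. v \<in> V))"
      unfolding w(1) smQ[OF w(2)] some[OF w(2)] by (rule some[OF ksm[OF w(2)]])
  next
    show "\<zero>\<^bsub>?Q\<^esub> \<in> carrier ?Q" unfolding zQ carr by (rule imageI) simp
    show "\<phi> (SOME v. v \<in> \<zero>\<^bsub>?Q\<^esub>) = 0" unfolding zQ by (rule some) simp
  qed
qed

text \<open>\<open>\<phi>\<close> has to be controlled on cycles only, with the boundaries as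
  kernel. In the applications it comes from the projection of a contraction, on the Leray side after
  \<open>psi\<close>.\<close>

lemma homology_free:
  fixes M :: "(rat, 'v) module" and \<phi> :: "'v \<Rightarrow> 'x \<Rightarrow>\<^sub>0 rat"
  assumes "\<And>u v. u \<in> Z \<Longrightarrow> v \<in> Z \<Longrightarrow> d u = \<zero>\<^bsub>M\<^esub> \<Longrightarrow> d v = \<zero>\<^bsub>M\<^esub> \<Longrightarrow>
      u \<oplus>\<^bsub>M\<^esub> v \<in> Z \<and> d (u \<oplus>\<^bsub>M\<^esub> v) = \<zero>\<^bsub>M\<^esub> \<and> \<phi> (u \<oplus>\<^bsub>M\<^esub> v) = \<phi> u + \<phi> v"
    and "\<And>c v. v \<in> Z \<Longrightarrow> d v = \<zero>\<^bsub>M\<^esub> \<Longrightarrow> c \<odot>\<^bsub>M\<^esub> v \<in> Z \<and> d (c \<odot>\<^bsub>M\<^esub> v) = \<zero>\<^bsub>M\<^esub> \<and> \<phi> (c \<odot>\<^bsub>M\<^esub> v) = smul c (\<phi> v)"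
    and "\<And>u v. u \<in> Z \<Longrightarrow> v \<in> Z \<Longrightarrow> d u = \<zero>\<^bsub>M\<^esub> \<Longrightarrow> d v = \<zero>\<^bsub>M\<^esub> \<Longrightarrow> \<exists>h\<in>Z. d h = \<zero>\<^bsub>M\<^esub> \<and> h \<oplus>\<^bsub>M\<^esub> v = u"
    and "\<phi> ` {z\<in>Z. d z = \<zero>\<^bsub>M\<^esub>} = {w. keys w \<subseteq> X}"
    and "d ` B = {v\<in>Z. d v = \<zero>\<^bsub>M\<^esub> \<and> \<phi> v = 0}"
  shows "\<exists>\<psi>. free_on (homology_at M d B Z) X \<psi>"
  unfolding homology_at_def
proof (rule exI, rule quot_free[where \<phi>=\<phi>])
  let ?M = "M\<lparr>carrier := {z\<in>Z. d z = \<zero>\<^bsub>M\<^esub>}\<rparr>"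
  fix u v assume "u \<in> carrier ?M" "v \<in> carrier ?M"
  then show "\<exists>h\<in>carrier ?M. h \<oplus>\<^bsub>?M\<^esub> v = u" using assms(3)[of u v] by (simp add: Bex_def)
qed (use assms in auto)

text \<open>The coordinates of the summands are glued to one function on pairs. It has finite
  support because only finitely many components are nonzero, and the injectivity of
  \<open>\<phi> j\<close> recognises the zero components.\<close>

lemma direct_sum_free:
  fixes M :: "'j \<Rightarrow> (rat, 'v) module" and X :: "'j \<Rightarrow> 'x set"
  assumes M: "\<And>j. j \<in> J \<Longrightarrow> free_on (M j) (X j) (\<phi> j)"
  shows "\<exists>\<psi>. free_on (direct_sum J M) (Sigma J X) \<psi>"
proof -
  let ?S = "direct_sum J M"
  have carr: "v \<in> carrier ?S \<longleftrightarrow> v \<in> (\<Pi>\<^sub>E j\<in>J. carrier (M j)) \<and> finite {j\<in>J. v j \<noteq> \<zero>\<^bsub>M j\<^esub>}" for v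
    by (auto simp: direct_sum_def)
  have z: "v j = \<zero>\<^bsub>M j\<^esub> \<longleftrightarrow> \<phi> j (v j) = 0" if "v \<in> (\<Pi>\<^sub>E j\<in>J. carrier (M j))" "j \<in> J" for v j
  proof
    have vj: "v j \<in> carrier (M j)" by (rule PiE_mem[OF that])
    assume "\<phi> j (v j) = 0"
    then show "v j = \<zero>\<^bsub>M j\<^esub>"
      using free_on_inj[OF M[OF that(2)] vj free_onD(6)[OF M[OF that(2)]]] free_onD(7)[OF M[OF that(2)]] by simp
  qed (simp add: free_onD(7)[OF M[OF that(2)]])
  define l where "l v = (\<lambda>(j, x). if j \<in> J then lookup (\<phi> j (v j)) x else 0)" for v
  define \<psi> where "\<psi> v = Abs_poly_mapping (l v)" for v
  have lk: "lookup (\<psi> v) = l v" if v: "v \<in> carrier ?S" for v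
  proof -
    have "{p. l v p \<noteq> 0} \<subseteq> Sigma {j\<in>J. v j \<noteq> \<zero>\<^bsub>M j\<^esub>} (\<lambda>j. keys (\<phi> j (v j)))"
      using v z by (fastforce simp: l_def carr in_keys_iff split: if_splits)
    moreover have "finite (Sigma {j\<in>J. v j \<noteq> \<zero>\<^bsub>M j\<^esub>} (\<lambda>j. keys (\<phi> j (v j))))"
      using v by (auto simp: carr)
    ultimately have "finite {p. l v p \<noteq> 0}" by (rule finite_subset)
    then show ?thesis unfolding \<psi>_def by simp
  qed
  have lk': "lookup (\<psi> v) (j, x) = (if j \<in> J then lookup (\<phi> j (v j)) x else 0)" if "v \<in> carrier ?S" for v j x
    using lk[OF that] by (simp add: l_def)
  have in_M: "v j \<in> carrier (M j)" if "v \<in> carrier ?S" "j \<in> J" for v j using that by (auto simp: carr)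
  have add: "u \<oplus>\<^bsub>?S\<^esub> v \<in> carrier ?S" "(u \<oplus>\<^bsub>?S\<^esub> v) j = u j \<oplus>\<^bsub>M j\<^esub> v j"
    if u: "u \<in> carrier ?S" and v: "v \<in> carrier ?S" and j: "j \<in> J" for u v j
  proof -
    have a: "u \<oplus>\<^bsub>?S\<^esub> v = (\<lambda>j\<in>J. u j \<oplus>\<^bsub>M j\<^esub> v j)" by (simp add: direct_sum_def)
    have P: "(\<lambda>j\<in>J. u j \<oplus>\<^bsub>M j\<^esub> v j) \<in> (\<Pi>\<^sub>E j\<in>J. carrier (M j))"
      using free_onD(2)[OF M] in_M[OF u] in_M[OF v] by auto
    have "\<phi> j (u j \<oplus>\<^bsub>M j\<^esub> v j) = 0" if "j \<in> J" "u j = \<zero>\<^bsub>M j\<^esub>" "v j = \<zero>\<^bsub>M j\<^esub>" for j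
      using free_onD(3)[OF M[OF that(1)] in_M[OF u that(1)] in_M[OF v that(1)]] free_onD(7)[OF M[OF that(1)]] that by simp
    then have "{j\<in>J. (\<lambda>j\<in>J. u j \<oplus>\<^bsub>M j\<^esub> v j) j \<noteq> \<zero>\<^bsub>M j\<^esub>} \<subseteq> {j\<in>J. u j \<noteq> \<zero>\<^bsub>M j\<^esub>} \<union> {j\<in>J. v j \<noteq> \<zero>\<^bsub>M j\<^esub>}"
      using z[OF P] by auto
    then have "finite {j\<in>J. (\<lambda>j\<in>J. u j \<oplus>\<^bsub>M j\<^esub> v j) j \<noteq> \<zero>\<^bsub>M j\<^esub>}"
      by (rule finite_subset) (use u v in \<open>auto simp: carr\<close>)
    then show "u \<oplus>\<^bsub>?S\<^esub> v \<in> carrier ?S" unfolding a carr using P by blast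
    show "(u \<oplus>\<^bsub>?S\<^esub> v) j = u j \<oplus>\<^bsub>M j\<^esub> v j" unfolding a using j by simp
  qed
  have sm: "c \<odot>\<^bsub>?S\<^esub> v \<in> carrier ?S" "(c \<odot>\<^bsub>?S\<^esub> v) j = c \<odot>\<^bsub>M j\<^esub> v j"
    if v: "v \<in> carrier ?S" and j: "j \<in> J" for c v j
  proof -
    have a: "c \<odot>\<^bsub>?S\<^esub> v = (\<lambda>j\<in>J. c \<odot>\<^bsub>M j\<^esub> v j)" by (simp add: direct_sum_def)
    have P: "(\<lambda>j\<in>J. c \<odot>\<^bsub>M j\<^esub> v j) \<in> (\<Pi>\<^sub>E j\<in>J. carrier (M j))"
      using free_onD(4)[OF M] in_M[OF v] by auto
    have "\<phi> j (c \<odot>\<^bsub>M j\<^esub> v j) = 0" if "j \<in> J" "v j = \<zero>\<^bsub>M j\<^esub>" for j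
      using free_onD(5)[OF M[OF that(1)] in_M[OF v that(1)]] free_onD(7)[OF M[OF that(1)]] that by simp
    then have "{j\<in>J. (\<lambda>j\<in>J. c \<odot>\<^bsub>M j\<^esub> v j) j \<noteq> \<zero>\<^bsub>M j\<^esub>} \<subseteq> {j\<in>J. v j \<noteq> \<zero>\<^bsub>M j\<^esub>}"
      using z[OF P] by auto
    then have "finite {j\<in>J. (\<lambda>j\<in>J. c \<odot>\<^bsub>M j\<^esub> v j) j \<noteq> \<zero>\<^bsub>M j\<^esub>}"
      by (rule finite_subset) (use v in \<open>auto simp: carr\<close>)
    then show "c \<odot>\<^bsub>?S\<^esub> v \<in> carrier ?S" unfolding a carr using P by blast
    show "(c \<odot>\<^bsub>?S\<^esub> v) j = c \<odot>\<^bsub>M j\<^esub> v j" unfolding a using j by simp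
  qed
  have addc: "u \<oplus>\<^bsub>?S\<^esub> v \<in> carrier ?S" if "u \<in> carrier ?S" "v \<in> carrier ?S" for u v
  proof (cases "J = {}")
    case False
    then obtain j where "j \<in> J" by auto
    then show ?thesis by (rule add(1)[OF that])
  qed (simp add: direct_sum_def restrict_def)
  have smc: "c \<odot>\<^bsub>?S\<^esub> v \<in> carrier ?S" if "v \<in> carrier ?S" for c v
  proof (cases "J = {}")
    case False
    then obtain j where "j \<in> J" by auto
    then show ?thesis by (rule sm(1)[OF that])
  qed (simp add: direct_sum_def restrict_def)
  have zero: "\<zero>\<^bsub>?S\<^esub> \<in> carrier ?S" using free_onD(6)[OF M] unfolding carr by (auto simp: direct_sum_def)
  have "free_on ?S (Sigma J X) \<psi>"
  proof (rule free_onI)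
    show "bij_betw \<psi> (carrier ?S) {w. keys w \<subseteq> Sigma J X}"
      unfolding bij_betw_def
    proof
      show "inj_on \<psi> (carrier ?S)"
      proof (rule inj_onI)
        fix u v assume u: "u \<in> carrier ?S" and v: "v \<in> carrier ?S" and e: "\<psi> u = \<psi> v"
        show "u = v"
        proof (rule PiE_ext)
          show "u \<in> (\<Pi>\<^sub>E j\<in>J. carrier (M j))" "v \<in> (\<Pi>\<^sub>E j\<in>J. carrier (M j))" using u v carr by auto
          fix j assume j: "j \<in> J"
          have "\<phi> j (u j) = \<phi> j (v j)"
          proof (rule poly_mapping_eqI)
            fix x show "lookup (\<phi> j (u j)) x = lookup (\<phi> j (v j)) x"
              using lk'[OF u, of j x] lk'[OF v, of j x] e j by simp
          qed
          then show "u j = v j" using free_on_inj[OF M[OF j]] in_M u v j by blast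
        qed
      qed
      show "\<psi> ` carrier ?S = {w. keys w \<subseteq> Sigma J X}"
      proof (intro equalityI subsetI)
        fix w assume "w \<in> \<psi> ` carrier ?S"
        then obtain v where v: "v \<in> carrier ?S" "w = \<psi> v" by auto
        have "p \<in> Sigma J X" if "p \<in> keys w" for p
        proof -
          obtain j x where p: "p = (j, x)" by (cases p)
          have "j \<in> J" "x \<in> keys (\<phi> j (v j))" using that lk'[OF v(1), of j x] v(2) p by (auto simp: in_keys_iff split: if_splits)
          then show ?thesis using free_on_keys[OF M in_M[OF v(1)], of j] p by auto
        qed
        then show "w \<in> {w. keys w \<subseteq> Sigma J X}" by auto
      next
        fix w :: "'j \<times> 'x \<Rightarrow>\<^sub>0 rat" assume "w \<in> {w. keys w \<subseteq> Sigma J X}"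
        then have w: "keys w \<subseteq> Sigma J X" by simp
        define wj where "wj j = (\<Sum>p\<in>{p\<in>keys w. fst p = j}. single (snd p) (lookup w p))" for j
        have lwj: "lookup (wj j) x = lookup w (j, x)" for j x
        proof -
          have "lookup (wj j) x = (\<Sum>p\<in>{p\<in>keys w. fst p = j}. if (j, x) = p then lookup w p else 0)"
            unfolding wj_def lookup_sum lookup_single when_def by (rule sum.cong) auto
          then show ?thesis by (simp add: sum.delta' in_keys_iff)
        qed
        have "keys (wj j) \<subseteq> X j" for j
        proof
          fix x assume "x \<in> keys (wj j)"
          then have "(j, x) \<in> keys w" by (simp add: in_keys_iff lwj)
          then show "x \<in> X j" using w by auto
        qed
        then have "\<forall>j\<in>J. \<exists>v\<in>carrier (M j). \<phi> j v = wj j" using free_on_surj[OF M] by blast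
        then obtain v where v: "\<And>j. j \<in> J \<Longrightarrow> v j \<in> carrier (M j) \<and> \<phi> j (v j) = wj j" by metis
        let ?v = "restrict v J"
        have P: "?v \<in> (\<Pi>\<^sub>E j\<in>J. carrier (M j))" using v by auto
        have "{j\<in>J. ?v j \<noteq> \<zero>\<^bsub>M j\<^esub>} \<subseteq> fst ` keys w"
        proof
          fix j assume j: "j \<in> {j\<in>J. ?v j \<noteq> \<zero>\<^bsub>M j\<^esub>}"
          then have "wj j \<noteq> 0" using z[OF P, of j] v by auto
          then obtain x where "lookup (wj j) x \<noteq> 0" by (metis lookup_zero poly_mapping_eqI)
          then have "(j, x) \<in> keys w" by (simp add: lwj in_keys_iff)
          then show "j \<in> fst ` keys w" by force
        qed
        then have "finite {j\<in>J. ?v j \<noteq> \<zero>\<^bsub>M j\<^esub>}" by (rule finite_subset) simp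
        then have vc: "?v \<in> carrier ?S" using P by (simp add: carr)
        have "\<psi> ?v = w"
        proof (rule poly_mapping_eqI)
          fix p :: "'j \<times> 'x" obtain j x where p: "p = (j, x)" by (cases p)
          have "j \<notin> J \<Longrightarrow> lookup w (j, x) = 0" using w by (auto simp: in_keys_iff)
          then show "lookup (\<psi> ?v) p = lookup w p" unfolding p lk'[OF vc] using v lwj by auto
        qed
        then show "w \<in> \<psi> ` carrier ?S" using vc by blast
      qed
    qed
    show "\<psi> (u \<oplus>\<^bsub>?S\<^esub> v) = \<psi> u + \<psi> v" if u: "u \<in> carrier ?S" and v: "v \<in> carrier ?S" for u v
    proof (rule poly_mapping_eqI)
      fix p :: "'j \<times> 'x" obtain j x where p: "p = (j, x)" by (cases p)
      show "lookup (\<psi> (u \<oplus>\<^bsub>?S\<^esub> v)) p = lookup (\<psi> u + \<psi> v) p"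
        unfolding p lookup_add lk'[OF addc[OF u v]] lk'[OF u] lk'[OF v]
        using add(2)[OF u v] free_onD(3)[OF M in_M[OF u] in_M[OF v], of j] by (simp add: lookup_add)
    qed
    show "\<psi> (c \<odot>\<^bsub>?S\<^esub> v) = smul c (\<psi> v)" if v: "v \<in> carrier ?S" for c v
    proof (rule poly_mapping_eqI)
      fix p :: "'j \<times> 'x" obtain j x where p: "p = (j, x)" by (cases p)
      show "lookup (\<psi> (c \<odot>\<^bsub>?S\<^esub> v)) p = lookup (smul c (\<psi> v)) p"
        unfolding p lookup_smul lk'[OF smc[OF v]] lk'[OF v]
        using sm(2)[OF v] free_onD(5)[OF M in_M[OF v], of j] by (simp add: lookup_smul)
    qed
    show "\<psi> \<zero>\<^bsub>?S\<^esub> = 0"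
    proof (rule poly_mapping_eqI)
      fix p :: "'j \<times> 'x" obtain j x where p: "p = (j, x)" by (cases p)
      show "lookup (\<psi> \<zero>\<^bsub>?S\<^esub>) p = lookup 0 p"
        unfolding p lk'[OF zero] using free_onD(7)[OF M, of j] by (simp add: direct_sum_def)
    qed
  qed (rule addc smc zero; assumption?)+
  then show ?thesis by blast
qed

lemma keys_sum_subset: "(\<And>i. i \<in> I \<Longrightarrow> keys (p i) \<subseteq> A) \<Longrightarrow> keys (\<Sum>i\<in>I. p i) \<subseteq> A"
  using keys_sum[of p I] by blast

section \<open>Free modules and tensor products\<close>

lemma free_module_simps:
  "carrier (free_module X) = {v. keys v \<subseteq> X}" "\<zero>\<^bsub>free_module X\<^esub> = 0"
  "u \<oplus>\<^bsub>free_module X\<^esub> v = u + v" "c \<odot>\<^bsub>free_module X\<^esub> v = smul c v"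
  by (simp_all add: free_module_def)

lemma submodule_free_module:
  assumes K: "K \<subseteq> {v. keys v \<subseteq> X}" "0 \<in> K" "\<And>u v. u \<in> K \<Longrightarrow> v \<in> K \<Longrightarrow> u + v \<in> K" "\<And>c v. v \<in> K \<Longrightarrow> smul c v \<in> K"
  shows "submodule K rat_field (free_module X)"
proof (intro submodule.intro subgroup.intro submodule_axioms.intro)
  fix x assume x: "x \<in> K"
  have nx: "- x \<in> K" using K(4)[OF x, of "-1"] by (simp add: smul_uminus)
  have "m_inv (add_monoid (free_module X)) x = - x"
    unfolding m_inv_def
  proof (rule the_equality)
    show "- x \<in> carrier (add_monoid (free_module X)) \<and> x \<otimes>\<^bsub>add_monoid (free_module X)\<^esub> - x = \<one>\<^bsub>add_monoid (free_module X)\<^esub> \<and>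
      - x \<otimes>\<^bsub>add_monoid (free_module X)\<^esub> x = \<one>\<^bsub>add_monoid (free_module X)\<^esub>"
      using nx x K(1) by (auto simp: free_module_simps)
    fix y assume "y \<in> carrier (add_monoid (free_module X)) \<and> x \<otimes>\<^bsub>add_monoid (free_module X)\<^esub> y = \<one>\<^bsub>add_monoid (free_module X)\<^esub> \<and>
      y \<otimes>\<^bsub>add_monoid (free_module X)\<^esub> x = \<one>\<^bsub>add_monoid (free_module X)\<^esub>"
    then have "x + y = 0" by (simp add: free_module_simps)
    then show "y = - x" using add_eq_0_iff by metis
  qed
  then show "m_inv (add_monoid (free_module X)) x \<in> K" using nx by simp
qed (use K in \<open>auto simp: free_module_simps\<close>)

lemma gen_submodule_free_closed:
  fixes X :: "'x set" and R :: "('x \<Rightarrow>\<^sub>0 rat) set"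
  defines "T \<equiv> free_module X"
  shows "0 \<in> gen_submodule T R" "u \<in> gen_submodule T R \<Longrightarrow> v \<in> gen_submodule T R \<Longrightarrow> u + v \<in> gen_submodule T R"
    "v \<in> gen_submodule T R \<Longrightarrow> smul c v \<in> gen_submodule T R" "R \<subseteq> gen_submodule T R"
proof -
  have sub: "subgroup N (add_monoid T)" "submodule_axioms N rat_field T" if "submodule N rat_field T" for N
    using that by (auto simp: submodule_def)
  have c0: "0 \<in> N" if "submodule N rat_field T" for N
    using subgroup.one_closed[OF sub(1)[OF that]] by (simp add: T_def free_module_simps)
  have ca: "u + v \<in> N" if "submodule N rat_field T" "u \<in> N" "v \<in> N" for N u v
    using subgroup.m_closed[OF sub(1)[OF that(1)] that(2,3)] by (simp add: T_def free_module_simps)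
  have cs: "smul c v \<in> N" if "submodule N rat_field T" "v \<in> N" for N c v
    using sub(2)[OF that(1)] that(2) unfolding submodule_axioms_def by (simp add: T_def free_module_simps rat_field_def)
  show "0 \<in> gen_submodule T R" using c0 by (simp add: gen_submodule_def)
  show "u \<in> gen_submodule T R \<Longrightarrow> v \<in> gen_submodule T R \<Longrightarrow> u + v \<in> gen_submodule T R"
    using ca by (simp add: gen_submodule_def)
  show "v \<in> gen_submodule T R \<Longrightarrow> smul c v \<in> gen_submodule T R" using cs by (simp add: gen_submodule_def)
  show "R \<subseteq> gen_submodule T R" by (auto simp: gen_submodule_def)
qed

lemma gen_submodule_least: "submodule K rat_field M \<Longrightarrow> R \<subseteq> K \<Longrightarrow> gen_submodule M R \<subseteq> K"
  by (auto simp: gen_submodule_def)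

text \<open>\<open>\<Phi>\<close> is the multilinear coordinate map: a tensor has products of
  coordinates as coefficients. It kills the relations, hence \<open>N\<close>. Conversely, modulo
  \<open>N\<close> every element is a combination of the tensors \<open>ev u\<close> of basis
  vectors, on which \<open>\<Phi>\<close> is injective, so \<open>N\<close> is the whole
  kernel.\<close>

lemma tensor_free:
  fixes M :: "'i \<Rightarrow> (rat, 'v) module" and X :: "'i \<Rightarrow> 'x set"
  assumes I: "finite I" and M: "\<And>i. i \<in> I \<Longrightarrow> free_on (M i) (X i) (\<phi> i)" and X: "\<And>i. i \<in> I \<Longrightarrow> finite (X i)"
  shows "\<exists>\<psi>. free_on (tensor I M) (\<Pi>\<^sub>E i\<in>I. X i) \<psi>"
proof -
  define P B where P_def: "P = (\<Pi>\<^sub>E i\<in>I. carrier (M i))" and B_def: "B = (\<Pi>\<^sub>E i\<in>I. X i)"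
  let ?T = "free_module P"
  define R where "R = tensor_relations I M"
  define N where "N = gen_submodule ?T R"
  have finB: "finite B" unfolding B_def using I X by (rule finite_PiE)
  define coef where "coef v u = (\<Prod>i\<in>I. lookup (\<phi> i (v i)) (u i))" for v u
  define tens where "tens v = (\<Sum>u\<in>B. single u (coef v u))" for v
  define \<Phi> where "\<Phi> = ksum (\<lambda>v c. smul c (tens v))"
  have fam: "additive_family (\<lambda>v c. smul c (tens v))"
  proof (rule additive_familyI)
    show "smul 0 (tens k) = 0" for k by (rule poly_mapping_eqI) (simp add: lookup_smul)
    show "smul (a + b) (tens k) = smul a (tens k) + smul b (tens k)" for k a b
      by (rule poly_mapping_eqI) (simp add: lookup_smul lookup_add distrib_right)
  qed
  have Padd: "\<Phi> (p + q) = \<Phi> p + \<Phi> q" for p q unfolding \<Phi>_def by (rule ksum_add[OF fam])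
  have P0: "\<Phi> 0 = 0" by (simp add: \<Phi>_def)
  have Psingle: "\<Phi> (single v c) = smul c (tens v)" for v c unfolding \<Phi>_def by (rule ksum_single[OF fam])
  have Psm: "\<Phi> (smul c p) = smul c (\<Phi> p)" for c p
  proof -
    have "\<Phi> (smul c p) = ksum (\<lambda>v d. smul c (smul d (tens v))) p"
      by (rule ksum_eqI) (simp_all add: smul_add Padd P0 smul_single Psingle smul_smul)
    then show ?thesis unfolding \<Phi>_def ksum_def by (simp add: smul_sum)
  qed
  have Pdiff: "\<Phi> (p - q) = \<Phi> p - \<Phi> q" for p q using Padd[of "p - q" q] by simp
  have ltens: "lookup (tens v) u = (if u \<in> B then coef v u else 0)" for v u
    using finB by (simp add: tens_def lookup_sum lookup_single when_def sum.delta)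
  have ktens: "keys (\<Phi> p) \<subseteq> B" for p
    unfolding \<Phi>_def ksum_def
  proof (rule keys_sum_subset)
    fix v show "keys (smul (lookup p v) (tens v)) \<subseteq> B"
    proof (rule subset_trans[OF keys_smul])
      have "u \<in> B" if "lookup (tens v) u \<noteq> 0" for u using that unfolding ltens by (simp split: if_splits)
      then show "keys (tens v) \<subseteq> B" by (auto simp only: in_keys_iff)
    qed
  qed
  have coef_upd: "coef (v(i := a)) u = lookup (\<phi> i a) (u i) * (\<Prod>j\<in>I - {i}. lookup (\<phi> j (v j)) (u j))" if "i \<in> I" for v i a u
  proof -
    have "coef (v(i := a)) u = lookup (\<phi> i a) (u i) * (\<Prod>j\<in>I - {i}. lookup (\<phi> j ((v(i := a)) j)) (u j))"
      unfolding coef_def using prod.remove[OF I that, of "\<lambda>j. lookup (\<phi> j ((v(i := a)) j)) (u j)"] by simp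
    also have "(\<Prod>j\<in>I - {i}. lookup (\<phi> j ((v(i := a)) j)) (u j)) = (\<Prod>j\<in>I - {i}. lookup (\<phi> j (v j)) (u j))"
      by (rule prod.cong) auto
    finally show ?thesis .
  qed
  define K where "K = {p. keys p \<subseteq> P \<and> \<Phi> p = 0}"
  have upd: "v(i := a) \<in> P" if "v \<in> P" "i \<in> I" "a \<in> carrier (M i)" for v i a
    using that unfolding P_def by (auto simp: PiE_iff extensional_def)
  have "submodule K rat_field ?T"
  proof (rule submodule_free_module)
    show "u + v \<in> K" if "u \<in> K" "v \<in> K" for u v
      using that keys_add[of u v] Padd by (auto simp: K_def)
    show "smul c v \<in> K" if "v \<in> K" for c v
      using that keys_smul[of c v] Psm by (auto simp: K_def)
  qed (auto simp: K_def P0)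
  moreover have "R \<subseteq> K"
  proof
    fix p assume "p \<in> R"
    then consider (add) v i a b where "p = single (v(i := a \<oplus>\<^bsub>M i\<^esub> b)) 1 - single (v(i := a)) 1 - single (v(i := b)) 1"
        "v \<in> P" "i \<in> I" "a \<in> carrier (M i)" "b \<in> carrier (M i)"
      | (smult) v i a c where "p = single (v(i := c \<odot>\<^bsub>M i\<^esub> a)) 1 - single (v(i := a)) c"
        "v \<in> P" "i \<in> I" "a \<in> carrier (M i)"
      unfolding R_def tensor_relations_def P_def by blast
    then show "p \<in> K"
    proof cases
      case add
      note D = free_onD[OF M[OF add(3)]]
      have "\<Phi> p = 0"
        unfolding add(1)
        by (rule poly_mapping_eqI)
          (simp add: Pdiff Psingle lookup_minus ltens coef_upd[OF add(3)] D(3)[OF add(4,5)] lookup_add distrib_right)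
      moreover have "keys p \<subseteq> P"
        unfolding add(1) using keys_diff[of "single (v(i := a \<oplus>\<^bsub>M i\<^esub> b)) 1 - single (v(i := a)) 1" "single (v(i := b)) (1::rat)"]
          keys_diff[of "single (v(i := a \<oplus>\<^bsub>M i\<^esub> b)) 1" "single (v(i := a)) (1::rat)"]
          upd[OF add(2,3) D(2)[OF add(4,5)]] upd[OF add(2,3,4)] upd[OF add(2,3,5)] by auto
      ultimately show ?thesis by (simp add: K_def)
    next
      case smult
      note D = free_onD[OF M[OF smult(3)]]
      have "\<Phi> p = 0"
        unfolding smult(1)
        by (rule poly_mapping_eqI)
          (simp add: Pdiff Psingle lookup_minus lookup_smul ltens coef_upd[OF smult(3)] D(5)[OF smult(4)])
      moreover have "keys p \<subseteq> P"
        unfolding smult(1) using keys_diff[of "single (v(i := c \<odot>\<^bsub>M i\<^esub> a)) 1" "single (v(i := a)) c"]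
          upd[OF smult(2,3) D(4)[OF smult(4)]] upd[OF smult(2,3,4)] by (auto split: if_splits)
      ultimately show ?thesis by (simp add: K_def)
    qed
  qed
  ultimately have NK: "N \<subseteq> K" unfolding N_def by (rule gen_submodule_least)
  note Ncl = gen_submodule_free_closed[where X=P and R=R, folded N_def]
  have "\<forall>i\<in>I. \<forall>x\<in>X i. \<exists>a\<in>carrier (M i). \<phi> i a = single x 1"
    using free_on_surj[OF M] by simp
  then obtain e where e: "\<And>i x. i \<in> I \<Longrightarrow> x \<in> X i \<Longrightarrow> e i x \<in> carrier (M i) \<and> \<phi> i (e i x) = single x 1"
    by metis
  define ev where "ev u = (\<lambda>i\<in>I. e i (u i))" for u
  have evP: "ev u \<in> P" if "u \<in> B" for u using that e by (auto simp: ev_def P_def B_def)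
  have tens_ev: "tens (ev u) = single u 1" if u: "u \<in> B" for u
  proof (rule poly_mapping_eqI)
    fix u' show "lookup (tens (ev u)) u' = lookup (single u 1) u'"
    proof (cases "u' \<in> B")
      case True
      have "coef (ev u) u' = (\<Prod>i\<in>I. of_bool (u i = u' i))"
        unfolding coef_def
      proof (rule prod.cong[OF refl])
        fix i assume i: "i \<in> I"
        have "u i \<in> X i" using u i by (auto simp: B_def)
        then have "\<phi> i (ev u i) = single (u i) 1" using e[OF i] i by (simp add: ev_def)
        then show "lookup (\<phi> i (ev u i)) (u' i) = of_bool (u i = u' i)" by (simp add: lookup_single when_def)
      qed
      also have "\<dots> = of_bool (u = u')"
      proof (cases "u = u'")
        case False
        then obtain i where "i \<in> I" "u i \<noteq> u' i" using True u unfolding B_def by (meson PiE_ext)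
        then show ?thesis using False I by (auto intro!: prod_zero)
      qed simp
      finally show ?thesis using True by (simp add: ltens lookup_single when_def)
    next
      case False
      then show ?thesis using u by (auto simp: ltens lookup_single when_def)
    qed
  qed
  \<comment> \<open>The elements that are combinations of tensors of basis vectors modulo
    \<open>N\<close>; \<open>all_S\<close> shows that nothing else exists.\<close>
  define S where "S = {p. \<exists>n\<in>N. \<exists>s. keys s \<subseteq> ev ` B \<and> p = n + s}"
  have Sadd: "p + q \<in> S" if pq: "p \<in> S" "q \<in> S" for p q
  proof -
    obtain n s n' s' where "n \<in> N" "keys s \<subseteq> ev ` B" "p = n + s" "n' \<in> N" "keys s' \<subseteq> ev ` B" "q = n' + s'"
      using pq by (auto simp: S_def)
    then show ?thesis unfolding S_def using Ncl(2)[of n n'] keys_add[of s s']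
      by (intro CollectI bexI[of _ "n + n'"] exI[of _ "s + s'"]) (auto simp: add_ac)
  qed
  have Ssm: "smul c p \<in> S" if p: "p \<in> S" for c p
  proof -
    obtain n s where "n \<in> N" "keys s \<subseteq> ev ` B" "p = n + s" using p by (auto simp: S_def)
    then show ?thesis unfolding S_def using Ncl(3)[of n c] keys_smul[of c s]
      by (intro CollectI bexI[of _ "smul c n"] exI[of _ "smul c s"]) (auto simp: smul_add)
  qed
  have NS: "n \<in> S" if "n \<in> N" for n
    unfolding S_def using that by (intro CollectI bexI[of _ n] exI[of _ 0]) auto
  have S_mod: "p \<in> S" if "q \<in> S" "p - q \<in> N" for p q
    using Sadd[OF NS[OF that(2)] that(1)] by simp
  have R_N: "p \<in> N" if "p \<in> R" for p using Ncl(4) that by blast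
  have expand: "single (v(i := a)) 1 \<in> S"
    if i: "i \<in> I" and v: "v \<in> P" and ih: "\<And>x. x \<in> X i \<Longrightarrow> single (v(i := e i x)) 1 \<in> S" and a: "a \<in> carrier (M i)" for v i a
  proof -
    note D = free_onD[OF M[OF i]]
    have addS: "single (v(i := b \<oplus>\<^bsub>M i\<^esub> b')) 1 \<in> S"
      if b: "b \<in> carrier (M i)" "b' \<in> carrier (M i)" "single (v(i := b)) 1 \<in> S" "single (v(i := b')) 1 \<in> S" for b b'
    proof (rule S_mod[OF Sadd[OF b(3,4)]])
      have "single (v(i := b \<oplus>\<^bsub>M i\<^esub> b')) 1 - single (v(i := b)) 1 - single (v(i := b')) 1 \<in> N"
        by (rule R_N) (unfold R_def tensor_relations_def, use v[unfolded P_def] i b in blast)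
      then show "single (v(i := b \<oplus>\<^bsub>M i\<^esub> b')) 1 - (single (v(i := b)) 1 + single (v(i := b')) 1) \<in> N"
        by (simp add: diff_diff_eq)
    qed
    have smS: "single (v(i := c \<odot>\<^bsub>M i\<^esub> b)) 1 \<in> S" if b: "b \<in> carrier (M i)" "single (v(i := b)) 1 \<in> S" for b c
    proof (rule S_mod)
      show "single (v(i := b)) c \<in> S" using Ssm[OF b(2), of c] by (simp add: smul_single)
      show "single (v(i := c \<odot>\<^bsub>M i\<^esub> b)) 1 - single (v(i := b)) c \<in> N"
        by (rule R_N) (unfold R_def tensor_relations_def, use v[unfolded P_def] i b in blast)
    qed
    have gen: "\<exists>b\<in>carrier (M i). \<phi> i b = (\<Sum>x\<in>A. single x (w x)) \<and> single (v(i := b)) 1 \<in> S"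
      if "finite A" "A \<subseteq> X i" for A and w :: "'x \<Rightarrow> rat"
      using that
    proof (induction A rule: finite_induct)
      case empty
      have "\<zero>\<^bsub>M i\<^esub> = 0 \<odot>\<^bsub>M i\<^esub> a"
        by (rule free_on_inj[OF M[OF i] D(6) D(4)[OF a]])
          (simp add: D(5)[OF a] D(7), rule poly_mapping_eqI, simp add: lookup_smul)
      \<comment> \<open>A tensor with a zero entry lies in \<open>N\<close>: in the scaling relation
        take the scalar 0, so that the subtracted term has coefficient 0 and disappears.\<close>
      have "single (v(i := \<zero>\<^bsub>M i\<^esub>)) 1 - single (v(i := \<zero>\<^bsub>M i\<^esub>)) 0 \<in> N"
      proof (rule R_N)
        have "0 \<odot>\<^bsub>M i\<^esub> \<zero>\<^bsub>M i\<^esub> = \<zero>\<^bsub>M i\<^esub>"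
          by (rule free_on_inj[OF M[OF i] D(4)[OF D(6)] D(6)]) (simp add: D(5)[OF D(6)] D(7))
        then have "single (v(i := \<zero>\<^bsub>M i\<^esub>)) 1 - single (v(i := \<zero>\<^bsub>M i\<^esub>)) 0
          = single (v(i := 0 \<odot>\<^bsub>M i\<^esub> \<zero>\<^bsub>M i\<^esub>)) (1::rat) - single (v(i := \<zero>\<^bsub>M i\<^esub>)) 0" by simp
        also have "\<dots> \<in> R" unfolding R_def tensor_relations_def using v[unfolded P_def] i D(6) by blast
        finally show "single (v(i := \<zero>\<^bsub>M i\<^esub>)) 1 - single (v(i := \<zero>\<^bsub>M i\<^esub>)) 0 \<in> R" .
      qed
      then have "single (v(i := \<zero>\<^bsub>M i\<^esub>)) 1 \<in> S" by (intro NS) (simp only: single_zero diff_zero)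
      then have "\<phi> i \<zero>\<^bsub>M i\<^esub> = (\<Sum>x\<in>{}. single x (w x)) \<and> single (v(i := \<zero>\<^bsub>M i\<^esub>)) 1 \<in> S"
        by (simp only: sum.empty D(7) simp_thms)
      then show ?case by (rule bexI[OF _ D(6)])
    next
      case (insert x A)
      have AX: "A \<subseteq> X i" using insert.prems by simp
      obtain b where b: "b \<in> carrier (M i)" "\<phi> i b = (\<Sum>x\<in>A. single x (w x))" "single (v(i := b)) 1 \<in> S"
        using insert.IH[OF AX] by (elim bexE conjE) (rule that)
      have x: "x \<in> X i" using insert.prems by simp
      let ?b = "(w x \<odot>\<^bsub>M i\<^esub> e i x) \<oplus>\<^bsub>M i\<^esub> b"
      have ex: "e i x \<in> carrier (M i)" "\<phi> i (e i x) = single x 1" using e[OF i x] by auto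
      have wx: "w x \<odot>\<^bsub>M i\<^esub> e i x \<in> carrier (M i)" by (rule D(4)[OF ex(1)])
      have "single (v(i := ?b)) 1 \<in> S" by (rule addS[OF wx b(1) smS[OF ex(1) ih[OF x]] b(3)])
      moreover have "\<phi> i ?b = (\<Sum>x\<in>insert x A. single x (w x))"
        using insert.hyps by (simp add: D(3)[OF wx b(1)] D(5)[OF ex(1)] ex(2) smul_single b(2))
      ultimately show ?case using D(2)[OF wx b(1)] by blast
    qed
    have "keys (\<phi> i a) \<subseteq> X i" by (rule free_on_keys[OF M[OF i] a])
    then obtain b where b: "b \<in> carrier (M i)" "\<phi> i b = (\<Sum>x\<in>keys (\<phi> i a). single x (lookup (\<phi> i a) x))" "single (v(i := b)) 1 \<in> S"
      using gen[OF finite_keys, of "\<phi> i a" "lookup (\<phi> i a)"] by blast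
    have "\<phi> i b = \<phi> i a" using b(2) poly_mapping_sum[of "\<phi> i a"] by simp
    then have "b = a" by (rule free_on_inj[OF M[OF i] b(1) a])
    then show ?thesis using b(3) by simp
  qed
  \<comment> \<open>\<open>J\<close> contains the coordinates whose entries are still arbitrary; all
    other entries are basis vectors already.\<close>
  have span: "v \<in> P \<Longrightarrow> (\<And>i. i \<in> I - J \<Longrightarrow> v i \<in> e i ` X i) \<Longrightarrow> single v 1 \<in> S" if "finite J" "J \<subseteq> I" for J v
    using that
  proof (induction J arbitrary: v rule: finite_induct)
    case empty
    have "\<forall>i\<in>I. \<exists>x\<in>X i. v i = e i x" using empty.prems(2) by blast
    then obtain u where u: "\<And>i. i \<in> I \<Longrightarrow> u i \<in> X i \<and> v i = e i (u i)" by metis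
    have "restrict u I \<in> B" using u by (auto simp: B_def)
    moreover have "v = ev (restrict u I)"
      by (rule ext) (use u empty.prems(1) in \<open>auto simp: ev_def P_def PiE_iff extensional_def\<close>)
    ultimately have "keys (single v (1::rat)) \<subseteq> ev ` B" by auto
    then show ?case unfolding S_def using Ncl(1) by (intro CollectI bexI[of _ 0] exI[of _ "single v 1"]) auto
  next
    case (insert i J)
    have i: "i \<in> I" using insert.prems by simp
    have "single (v(i := v i)) 1 \<in> S"
    proof (rule expand[OF i insert.prems(1)])
      fix x assume x: "x \<in> X i"
      show "single (v(i := e i x)) 1 \<in> S"
      proof (rule insert.IH)
        show "v(i := e i x) \<in> P" by (rule upd[OF insert.prems(1) i]) (use e[OF i x] in simp)
        show "(v(i := e i x)) j \<in> e j ` X j" if "j \<in> I - J" for j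
          using insert.prems(2)[of j] that x by (cases "j = i") auto
      qed (use insert.prems in simp)
    qed (use insert.prems(1) i in \<open>auto simp: P_def\<close>)
    then show ?case by simp
  qed
  have all_S: "p \<in> S" if p: "keys p \<subseteq> P" for p
  proof -
    have "(\<Sum>v\<in>A. single v (lookup p v)) \<in> S" if "finite A" "A \<subseteq> keys p" for A
      using that
    proof (induction A rule: finite_induct)
      case empty
      then show ?case using NS[OF Ncl(1)] by simp
    next
      case (insert v A)
      have "single v 1 \<in> S" by (rule span[OF I order_refl]) (use insert.prems p in blast)+
      then have "single v (lookup p v) \<in> S" using Ssm[of "single v 1" "lookup p v"] by (simp add: smul_single)
      then show ?case using insert Sadd by simp
    qed
    from this[OF finite_keys order_refl] show ?thesis using poly_mapping_sum[of p] by simp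
  qed
  have KN: "K \<subseteq> N"
  proof
    fix p assume p: "p \<in> K"
    then obtain n s where ns: "n \<in> N" "keys s \<subseteq> ev ` B" "p = n + s" using all_S[of p] by (auto simp: K_def S_def)
    have "\<Phi> n = 0" using NK ns(1) by (auto simp: K_def)
    then have s0: "\<Phi> s = 0" using p ns(3) Padd by (simp add: K_def)
    have "s = 0"
    proof (rule ccontr)
      assume "s \<noteq> 0"
      then have "\<exists>k. k \<in> keys s" by (simp add: ex_in_conv)
      then obtain u where u: "u \<in> B" "ev u \<in> keys s" using ns(2) by blast
      have inj: "u' = u''" if "u' \<in> B" "u'' \<in> B" "ev u' = ev u''" for u' u''
      proof -
        have "single u' (1::rat) = single u'' 1" using tens_ev[OF that(1)] tens_ev[OF that(2)] that(3) by simp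
        then have "lookup (single u' (1::rat)) u'' = 1" by simp
        then show ?thesis by (simp add: lookup_single when_def split: if_splits)
      qed
      have "lookup (\<Phi> s) u = (\<Sum>v\<in>keys s. lookup s v * lookup (tens v) u)"
        by (simp add: \<Phi>_def ksum_def lookup_sum lookup_smul)
      also have "\<dots> = (\<Sum>v\<in>keys s. if v = ev u then lookup s v else 0)"
      proof (rule sum.cong[OF refl])
        fix v assume "v \<in> keys s"
        then obtain u' where u': "u' \<in> B" "v = ev u'" using ns(2) by blast
        have "(v = ev u) = (u' = u)" unfolding u'(2) using inj[OF u'(1) u(1)] by auto
        then show "lookup s v * lookup (tens v) u = (if v = ev u then lookup s v else 0)"
          using u'(2) tens_ev[OF u'(1)] by (simp add: lookup_single when_def)
      qed
      also have "\<dots> = lookup s (ev u)" using u(2) by (simp add: sum.delta')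
      finally show False using s0 u(2) by (simp add: in_keys_iff)
    qed
    then show "p \<in> N" using ns by simp
  qed
  then have N_eq: "N = {v\<in>carrier ?T. \<Phi> v = 0}" using NK by (auto simp: K_def free_module_simps)
  have "free_on (quot_module ?T N) B (\<lambda>V. \<Phi> (SOME v. v \<in> V))"
  proof (rule quot_free[OF _ _ _ _ N_eq])
    fix u v assume uv: "u \<in> carrier ?T" "v \<in> carrier ?T"
    show "u \<oplus>\<^bsub>?T\<^esub> v \<in> carrier ?T \<and> \<Phi> (u \<oplus>\<^bsub>?T\<^esub> v) = \<Phi> u + \<Phi> v"
      using uv keys_add[of u v] by (auto simp: free_module_simps Padd)
    show "\<exists>h\<in>carrier ?T. h \<oplus>\<^bsub>?T\<^esub> v = u"
      using uv keys_diff[of u v] by (intro bexI[of _ "u - v"]) (auto simp: free_module_simps)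
  next
    fix c v assume "v \<in> carrier ?T"
    then show "c \<odot>\<^bsub>?T\<^esub> v \<in> carrier ?T \<and> \<Phi> (c \<odot>\<^bsub>?T\<^esub> v) = smul c (\<Phi> v)"
      using keys_smul[of c v] by (auto simp: free_module_simps Psm)
  next
    show "\<Phi> ` carrier ?T = {w. keys w \<subseteq> B}"
    proof (intro equalityI subsetI)
      fix w :: "('i \<Rightarrow> 'x) \<Rightarrow>\<^sub>0 rat" assume "w \<in> \<Phi> ` carrier ?T"
      then show "w \<in> {w. keys w \<subseteq> B}" using ktens by auto
    next
      fix w :: "('i \<Rightarrow> 'x) \<Rightarrow>\<^sub>0 rat" assume "w \<in> {w. keys w \<subseteq> B}"
      then have w: "keys w \<subseteq> B" by simp
      define p where "p = (\<Sum>u\<in>keys w. single (ev u) (lookup w u))"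
      have "keys p \<subseteq> P" unfolding p_def by (rule keys_sum_subset) (use w evP in auto)
      moreover have "\<Phi> p = (\<Sum>u\<in>keys w. \<Phi> (single (ev u) (lookup w u)))"
        unfolding p_def \<Phi>_def by (rule ksum_sum[OF fam])
      then have "\<Phi> p = (\<Sum>u\<in>keys w. single u (lookup w u))"
        using w tens_ev by (simp add: Psingle smul_single subset_iff)
      then have "\<Phi> p = w" using poly_mapping_sum[of w] by simp
      ultimately show "w \<in> \<Phi> ` carrier ?T" by (auto simp: free_module_simps)
    qed
  qed
  then show ?thesis unfolding tensor_def Let_def N_def R_def P_def B_def by blast
qed

section \<open>The Leray model\<close>

lemma smul_diff: "smul c (v - w) = smul c v - smul c (w :: 'k \<Rightarrow>\<^sub>0 'b::comm_ring_1)"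
  by (rule poly_mapping_eqI) (simp add: lookup_smul lookup_minus right_diff_distrib)

lemma additive_eq_on:
  fixes F H :: "('k \<Rightarrow>\<^sub>0 'c::comm_monoid_add) \<Rightarrow> 'd::comm_monoid_add"
  assumes "\<And>p q. F (p + q) = F p + F q" "F 0 = 0" "\<And>p q. H (p + q) = H p + H q" "H 0 = 0"
    and "\<And>k. k \<in> keys p \<Longrightarrow> F (single k (lookup p k)) = H (single k (lookup p k))"
  shows "F p = H p"
proof -
  have "F p = ksum (\<lambda>k c. H (single k c)) p" by (rule ksum_eqI) (use assms in auto)
  also have "\<dots> = H p" by (rule ksum_eqI[symmetric]) (use assms in auto)
  finally show ?thesis .
qed

text \<open>The sign that sorts the concatenation of \<open>S\<close> and \<open>T\<close>. It
  serves for the exterior product and again for joins of chains.\<close>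

definition esign :: "'g rel \<Rightarrow> 'g set \<Rightarrow> 'g set \<Rightarrow> 'b::ring_1" where
  "esign r S T = (-1) ^ card {(s, t). s \<in> S \<and> t \<in> T \<and> (t, s) \<in> r}"

lemma esign_Un_left:
  assumes "finite S" "finite T" "finite U" "S \<inter> T = {}"
  shows "esign r (S \<union> T) U = esign r S U * (esign r T U :: 'b::comm_ring_1)"
proof -
  let ?I = "\<lambda>S. {(s, t). s \<in> S \<and> t \<in> U \<and> (t, s) \<in> r}"
  have "?I S \<subseteq> S \<times> U" "?I T \<subseteq> T \<times> U" by auto
  then have "finite (?I S)" "finite (?I T)" using assms by (meson finite_SigmaI finite_subset)+
  moreover have "?I (S \<union> T) = ?I S \<union> ?I T" "?I S \<inter> ?I T = {}" using assms(4) by auto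
  ultimately have "card (?I (S \<union> T)) = card (?I S) + card (?I T)" by (simp add: card_Un_disjoint)
  then show ?thesis by (simp only: esign_def power_add)
qed

lemma esign_Un_right:
  assumes "finite S" "finite T" "finite U" "T \<inter> U = {}"
  shows "esign r S (T \<union> U) = esign r S T * (esign r S U :: 'b::comm_ring_1)"
proof -
  let ?I = "\<lambda>T. {(s, t). s \<in> S \<and> t \<in> T \<and> (t, s) \<in> r}"
  have "?I U \<subseteq> S \<times> U" "?I T \<subseteq> S \<times> T" by auto
  then have "finite (?I U)" "finite (?I T)" using assms by (meson finite_SigmaI finite_subset)+
  moreover have "?I (T \<union> U) = ?I T \<union> ?I U" "?I T \<inter> ?I U = {}" using assms(4) by auto
  ultimately have "card (?I (T \<union> U)) = card (?I T) + card (?I U)" by (simp add: card_Un_disjoint)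
  then show ?thesis by (simp only: esign_def power_add)
qed

lemma esign_empty [simp]: "esign r {} T = 1" "esign r S {} = 1"
  by (simp_all add: esign_def)

definition emul :: "'g rel \<Rightarrow> 'g set \<Rightarrow> 'g set \<Rightarrow> 'g polynomial \<Rightarrow> 'g polynomial \<Rightarrow> 'g leray" where
  "emul r S T p q = (if S \<inter> T = {} then single (S \<union> T) (esign r S T * p * q) else 0)"

lemma leray_mult_ksum: "leray_mult r \<omega> \<eta> = ksum (\<lambda>S p. ksum (\<lambda>T q. emul r S T p q) \<eta>) \<omega>"
  by (simp add: leray_mult_def ksum_def emul_def esign_def cong: if_cong)

lemma emul_family: "additive_family (\<lambda>T q. emul r S T p q)"
  by (rule additive_familyI) (auto simp: emul_def distrib_left single_add)

lemma emul_family2: "additive_family (\<lambda>S p. ksum (\<lambda>T q. emul r S T p q) \<eta>)"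
proof (rule additive_familyI)
  show "ksum (\<lambda>T q. emul r S T 0 q) \<eta> = 0" for S by (auto simp: ksum_def emul_def intro!: sum.neutral)
  show "ksum (\<lambda>T q. emul r S T (a + b) q) \<eta> = ksum (\<lambda>T q. emul r S T a q) \<eta> + ksum (\<lambda>T q. emul r S T b q) \<eta>" for S a b
    by (auto simp: ksum_def emul_def distrib_left distrib_right single_add sum.distrib[symmetric] intro!: sum.cong)
qed

lemma leray_mult_add_left: "leray_mult r (\<omega> + \<omega>') \<eta> = leray_mult r \<omega> \<eta> + leray_mult r \<omega>' \<eta>"
  unfolding leray_mult_ksum by (rule ksum_add[OF emul_family2])

lemma leray_mult_add_right: "leray_mult r \<omega> (\<eta> + \<eta>') = leray_mult r \<omega> \<eta> + leray_mult r \<omega> \<eta>'"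
  unfolding leray_mult_ksum ksum_add[OF emul_family] by (simp add: ksum_def sum.distrib)

lemma leray_mult_zero [simp]: "leray_mult r 0 \<eta> = 0" "leray_mult r \<omega> 0 = 0"
  by (simp_all add: leray_mult_def)

lemma leray_mult_single: "leray_mult r (single S p) (single T q) = emul r S T p q"
  unfolding leray_mult_ksum ksum_single[OF emul_family2] by (rule ksum_single[OF emul_family])

text \<open>Both bracketings count the inversions between each pair of the three sets.\<close>

lemma emul_assoc:
  fixes S T U :: "'g set"
  assumes "finite S" "finite T" "finite U"
  shows "leray_mult r (emul r S T p q) (single U x) = leray_mult r (single S p) (emul r T U q x)"
proof (cases "S \<inter> T = {} \<and> T \<inter> U = {} \<and> S \<inter> U = {}")
  case True
  have e1: "esign r (S \<union> T) U = esign r S U * (esign r T U :: 'g polynomial)"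
    by (rule esign_Un_left) (use assms True in auto)
  have e2: "esign r S (T \<union> U) = esign r S T * (esign r S U :: 'g polynomial)"
    by (rule esign_Un_right) (use assms True in auto)
  have "esign r (S \<union> T) U * (esign r S T * p * q) * x = esign r S (T \<union> U) * p * (esign r T U * q * x)"
    unfolding e1 e2 by (simp only: mult_ac)
  moreover have "(S \<union> T) \<inter> U = {}" "S \<inter> (T \<union> U) = {}" using True by auto
  moreover have "emul r S T p q = single (S \<union> T) (esign r S T * p * q)" "emul r T U q x = single (T \<union> U) (esign r T U * q * x)"
    using True by (simp_all add: emul_def)
  ultimately show ?thesis by (simp only: leray_mult_single emul_def Un_assoc if_True)
next
  case False
  then consider "S \<inter> T \<noteq> {}" | "S \<inter> T = {}" "T \<inter> U \<noteq> {}" | "S \<inter> T = {}" "T \<inter> U = {}" "S \<inter> U \<noteq> {}" by auto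
  then show ?thesis
    by cases (auto simp: emul_def leray_mult_single)
qed

context building_polymatroid
begin

section \<open>The ring structure and the ideal of relations\<close>

abbreviation "RA \<equiv> leray_algebra G r"

lemma RA_simps: "carrier RA = LC" "x \<oplus>\<^bsub>RA\<^esub> y = x + y" "\<zero>\<^bsub>RA\<^esub> = 0" "x \<otimes>\<^bsub>RA\<^esub> y = leray_mult r x y"
  "\<one>\<^bsub>RA\<^esub> = single {} 1" "c \<odot>\<^bsub>RA\<^esub> x = smul (single 0 c) x"
  by (simp add: LC_carrier) (simp_all add: leray_algebra_def)

lemma LC_zero: "0 \<in> LC"
  by (simp add: LC_def)

lemma LC_sum: "(\<And>i. i \<in> I \<Longrightarrow> p i \<in> LC) \<Longrightarrow> (\<Sum>i\<in>I. p i) \<in> LC"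
  by (induction I rule: infinite_finite_induct) (auto simp: LC_add LC_zero)

lemma LC_single: "S \<subseteq> G \<Longrightarrow> p \<in> PG \<Longrightarrow> single S p \<in> LC"
  by (simp add: LC_def)

lemma PG_esign: "esign r S T \<in> PG"
  using PG_one by (simp add: esign_def minus_one_power_iff PG_def)

lemma emul_LC: "S \<subseteq> G \<Longrightarrow> T \<subseteq> G \<Longrightarrow> p \<in> PG \<Longrightarrow> q \<in> PG \<Longrightarrow> emul r S T p q \<in> LC"
  unfolding emul_def using PG_esign by (auto intro!: LC_single PG_mult LC_zero)

lemma leray_mult_LC: "\<omega> \<in> LC \<Longrightarrow> \<eta> \<in> LC \<Longrightarrow> leray_mult r \<omega> \<eta> \<in> LC"
  unfolding leray_mult_ksum ksum_def
  by (intro LC_sum emul_LC) (auto simp: LC_lookup dest: LC_keys)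

lemma leray_mult_assoc:
  assumes "\<omega> \<in> LC" "\<eta> \<in> LC" "\<zeta> \<in> LC"
  shows "leray_mult r (leray_mult r \<omega> \<eta>) \<zeta> = leray_mult r \<omega> (leray_mult r \<eta> \<zeta>)"
proof -
  have fin: "finite S" if "S \<in> keys \<omega>'" "\<omega>' \<in> LC" for S and \<omega>' :: "'a set leray"
    using LC_keys[OF that(2)] that(1) finite_G by (meson PowD finite_subset subsetD)
  show ?thesis
  proof (rule additive_eq_on[of "\<lambda>\<omega>. leray_mult r (leray_mult r \<omega> \<eta>) \<zeta>"])
    fix S assume S: "S \<in> keys \<omega>"
    let ?p = "single S (lookup \<omega> S)"
    show "leray_mult r (leray_mult r ?p \<eta>) \<zeta> = leray_mult r ?p (leray_mult r \<eta> \<zeta>)"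
    proof (rule additive_eq_on[of "\<lambda>\<eta>. leray_mult r (leray_mult r ?p \<eta>) \<zeta>"])
      fix T assume T: "T \<in> keys \<eta>"
      let ?q = "single T (lookup \<eta> T)"
      show "leray_mult r (leray_mult r ?p ?q) \<zeta> = leray_mult r ?p (leray_mult r ?q \<zeta>)"
      proof (rule additive_eq_on[of "\<lambda>\<zeta>. leray_mult r (leray_mult r ?p ?q) \<zeta>"])
        fix U assume U: "U \<in> keys \<zeta>"
        show "leray_mult r (leray_mult r ?p ?q) (single U (lookup \<zeta> U)) = leray_mult r ?p (leray_mult r ?q (single U (lookup \<zeta> U)))"
          unfolding leray_mult_single by (rule emul_assoc) (use fin S T U assms in auto)
      qed (simp_all add: leray_mult_add_right)
    qed (simp_all add: leray_mult_add_right leray_mult_add_left)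
  qed (simp_all add: leray_mult_add_left)
qed

lemma leray_mult_one: "leray_mult r (single {} 1) \<omega> = \<omega>" "leray_mult r \<omega> (single {} 1) = \<omega>"
proof -
  show "leray_mult r (single {} 1) \<omega> = \<omega>"
    by (rule additive_eq_on[of "\<lambda>\<omega>. leray_mult r (single {} 1) \<omega>"])
      (simp_all add: leray_mult_add_right leray_mult_single emul_def)
  show "leray_mult r \<omega> (single {} 1) = \<omega>"
    by (rule additive_eq_on[of "\<lambda>\<omega>. leray_mult r \<omega> (single {} 1)"])
      (simp_all add: leray_mult_add_left leray_mult_single emul_def)
qed

lemma ring_RA: "ring RA"
proof (rule ringI)
  show "abelian_group RA"
  proof (rule abelian_groupI)
    show "\<exists>y\<in>carrier RA. y \<oplus>\<^bsub>RA\<^esub> x = \<zero>\<^bsub>RA\<^esub>" if "x \<in> carrier RA" for x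
      using that LC_uminus by (intro bexI[of _ "- x"]) (auto simp: RA_simps)
  qed (auto simp: RA_simps LC_add LC_zero add_ac)
  show "Group.monoid RA"
  proof (rule monoidI)
    show "\<one>\<^bsub>RA\<^esub> \<in> carrier RA" by (simp add: RA_simps LC_single PG_one)
  qed (auto simp: RA_simps leray_mult_LC leray_mult_assoc leray_mult_one)
qed (auto simp: RA_simps leray_mult_add_left leray_mult_add_right)

lemma LI_sum: "(\<And>i. i \<in> I \<Longrightarrow> p i \<in> LI) \<Longrightarrow> (\<Sum>i\<in>I. p i) \<in> LI"
  by (induction I rule: infinite_finite_induct) (auto simp: LI_add LI_zero)

lemma LI_single: "T \<subseteq> G \<Longrightarrow> p \<in> JI T \<Longrightarrow> single T p \<in> LI"
  by (auto simp: LI_def LC_single JI_PG lookup_single when_def JI_zero)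

text \<open>A product of components over \<open>S\<close> and \<open>T\<close> lies over
  \<open>S \<union> T\<close>, whose ideal contains both \<open>JI S\<close> and
  \<open>JI T\<close>. So the componentwise description is closed under multiplication from both
  sides.\<close>

lemma emul_LI:
  assumes "S \<subseteq> G" "T \<subseteq> G" "p \<in> PG" "q \<in> PG" "p \<in> JI S \<or> q \<in> JI T"
  shows "emul r S T p q \<in> LI"
proof (cases "S \<inter> T = {}")
  case True
  have "esign r S T * p * q \<in> JI (S \<union> T)"
  proof (cases "p \<in> JI S")
    case True
    then have "p \<in> JI (S \<union> T)" by (rule JI_mono) (use assms in auto)
    then have "(esign r S T * q) * p \<in> JI (S \<union> T)" by (rule JI_mult) (simp add: PG_esign PG_mult assms)
    then show ?thesis by (simp add: mult_ac)
  next
    case False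
    then have "q \<in> JI T" using assms by simp
    then have "q \<in> JI (S \<union> T)" by (rule JI_mono) (use assms in auto)
    then show ?thesis by (rule JI_mult) (simp add: PG_esign PG_mult assms)
  qed
  then show ?thesis using True assms by (simp add: emul_def LI_single)
qed (simp add: emul_def LI_zero)

lemma LI_lookup: "\<omega> \<in> LI \<Longrightarrow> lookup \<omega> T \<in> JI T"
  by (simp add: LI_def)

lemma ideal_LI: "ideal LI RA"
proof (rule idealI[OF ring_RA])
  have inv: "m_inv (add_monoid RA) x = - x" if "x \<in> LC" for x
    unfolding m_inv_def
  proof (rule the_equality)
    fix y assume "y \<in> carrier (add_monoid RA) \<and> x \<otimes>\<^bsub>add_monoid RA\<^esub> y = \<one>\<^bsub>add_monoid RA\<^esub> \<and> y \<otimes>\<^bsub>add_monoid RA\<^esub> x = \<one>\<^bsub>add_monoid RA\<^esub>"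
    then have "x + y = 0" by (simp add: RA_simps)
    then show "y = - x" by (simp add: add_eq_0_iff)
  qed (use that LC_uminus in \<open>auto simp: RA_simps\<close>)
  show "subgroup LI (add_monoid RA)"
  proof (rule subgroup.intro)
    fix x assume x: "x \<in> LI"
    show "m_inv (add_monoid RA) x \<in> LI" unfolding inv[OF LI_LC[OF x]] by (rule LI_uminus[OF x])
  qed (auto simp: RA_simps LI_LC LI_add LI_zero)
next
  fix a x assume a: "a \<in> LI" and x: "x \<in> carrier RA"
  have x: "x \<in> LC" using x by (simp add: RA_simps)
  have aL: "a \<in> LC" by (rule LI_LC[OF a])
  note k = LC_keys[OF x] LC_keys[OF aL]
  show "x \<otimes>\<^bsub>RA\<^esub> a \<in> LI" "a \<otimes>\<^bsub>RA\<^esub> x \<in> LI"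
    unfolding RA_simps leray_mult_ksum ksum_def
    by (intro LI_sum emul_LI; use k LC_lookup[OF x] LC_lookup[OF aL] LI_lookup[OF a] in auto)+
qed

lemma leray_relations_eq: "leray_relations E cd G = {single T \<rho> | T \<rho>. T \<subseteq> G \<and> \<rho> \<in> rels T}"
proof -
  have s: "\<Squnion>\<^bsub>flats E cd\<^esub> {h \<in> S \<union> T. h \<subset> g} = jn (blw (S \<union> T) g)" if "S \<subseteq> G" "T \<subseteq> G" for S T g
    unfolding blw_def by (rule sup_flats) (use that G_Fl in auto)
  show ?thesis
  proof (intro equalityI subsetI)
    fix w assume "w \<in> leray_relations E cd G"
    then consider S T where "w = single T (xprod S)" "S \<subseteq> G" "T \<subseteq> G" "S \<union> T \<notin> NS"
      | S T g b where "w = single T (xprod S * c_elem G g ^ b)" "S \<subseteq> G" "T \<subseteq> G" "g \<in> G"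
        "cd g \<le> b + cd (\<Squnion>\<^bsub>flats E cd\<^esub> {h \<in> S \<union> T. h \<subset> g})"
      unfolding leray_relations_def by blast
    then show "w \<in> {single T \<rho> | T \<rho>. T \<subseteq> G \<and> \<rho> \<in> rels T}"
    proof cases
      case 1
      then have "xprod S \<in> rels T" unfolding rels_def by blast
      then show ?thesis using 1 by blast
    next
      case 2
      then have "xprod S * c_elem G g ^ b \<in> rels T" unfolding s[OF 2(2,3)] rels_def by blast
      then show ?thesis using 2 by blast
    qed
  next
    fix w assume "w \<in> {single T \<rho> | T \<rho>. T \<subseteq> G \<and> \<rho> \<in> rels T}"
    then obtain T \<rho> where w: "w = single T \<rho>" "T \<subseteq> G" "\<rho> \<in> rels T" by blast
    from w(3) consider S where "\<rho> = xprod S" "S \<subseteq> G" "S \<union> T \<notin> NS"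
      | S g b where "\<rho> = xprod S * c_elem G g ^ b" "S \<subseteq> G" "g \<in> G" "cd g \<le> b + cd (jn (blw (S \<union> T) g))"
      unfolding rels_def by blast
    then show "w \<in> leray_relations E cd G"
    proof cases
      case 1
      then show ?thesis unfolding leray_relations_def w(1) using w(2) by blast
    next
      case 2
      then have "cd g \<le> b + cd (\<Squnion>\<^bsub>flats E cd\<^esub> {h \<in> S \<union> T. h \<subset> g})" using s[OF 2(2) w(2)] by simp
      then show ?thesis unfolding leray_relations_def w(1) 2(1) using w(2) 2(2,3) by blast
    qed
  qed
qed

text \<open>\<open>LI\<close> is an ideal that contains the relations. Conversely, multiplying a
  relation by an element with empty exterior part yields every generator of each component, and
  elements of \<open>LI\<close> are finite sums of their components.\<close>

lemma leray_ideal_LI: "leray_ideal E cd G r = LI"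
proof
  show "leray_ideal E cd G r \<subseteq> LI"
  proof -
    have "leray_relations E cd G \<subseteq> LI"
    proof
      fix w assume "w \<in> leray_relations E cd G"
      then obtain T \<rho> where w: "w = single T \<rho>" "T \<subseteq> G" "\<rho> \<in> rels T" unfolding leray_relations_eq by blast
      have "1 * \<rho> \<in> JI T" by (rule JI_rel[OF w(3) PG_one])
      then show "w \<in> LI" using w by (simp add: LI_single)
    qed
    then show ?thesis unfolding leray_ideal_def genideal_def using ideal_LI by blast
  qed
  show "LI \<subseteq> leray_ideal E cd G r"
    unfolding leray_ideal_def genideal_def
  proof (intro subsetI InterI)
    fix \<omega> J assume \<omega>: "\<omega> \<in> LI" and "J \<in> {I. ideal I RA \<and> leray_relations E cd G \<subseteq> I}"
    then have J: "ideal J RA" "leray_relations E cd G \<subseteq> J" by auto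
    interpret ideal J RA by (rule J(1))
    have J0: "0 \<in> J" using additive_subgroup.zero_closed[OF is_additive_subgroup] by (simp add: RA_simps)
    have Ja: "u + v \<in> J" if "u \<in> J" "v \<in> J" for u v using additive_subgroup.a_closed[OF is_additive_subgroup that] by (simp add: RA_simps)
    have s: "single T p \<in> J" if "p \<in> JI T" "T \<subseteq> G" for T p
      using that
    proof (induction p rule: JI.induct)
      case (JI_step p \<rho> q)
      have "single T \<rho> \<in> J" using J(2) JI_step by (auto simp: leray_relations_eq)
      moreover have "single {} q \<in> carrier RA" using JI_step by (simp add: RA_simps LC_single)
      ultimately have "leray_mult r (single {} q) (single T \<rho>) \<in> J" using I_l_closed by (simp add: RA_simps)
      then have "single T (q * \<rho>) \<in> J" by (simp add: leray_mult_single emul_def)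
      then show ?case using Ja JI_step by (simp add: single_add)
    qed (simp add: J0)
    have "(\<Sum>T\<in>A. single T (lookup \<omega> T)) \<in> J" if "finite A" "A \<subseteq> keys \<omega>" for A
      using that
    proof (induction A rule: finite_induct)
      case (insert T A)
      have "single T (lookup \<omega> T) \<in> J" by (rule s[OF LI_lookup[OF \<omega>]]) (use insert.prems LC_keys[OF LI_LC[OF \<omega>]] in blast)
      then show ?case using insert Ja by simp
    qed (simp add: J0)
    from this[OF finite_keys order_refl] show "\<omega> \<in> J" using poly_mapping_sum[of \<omega>] by simp
  qed
qed

section \<open>Cosets and the homology of the Leray model\<close>

definition cst :: "'a set leray \<Rightarrow> 'a set leray set" where
  "cst \<omega> = {\<eta>. \<eta> - \<omega> \<in> LI}"

lemma cst_coset: "LI +>\<^bsub>RA\<^esub> \<omega> = cst \<omega>"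
proof -
  have "LI +>\<^bsub>RA\<^esub> \<omega> = (\<lambda>i. i + \<omega>) ` LI" by (auto simp: a_r_coset_def r_coset_def RA_simps)
  also have "\<dots> = cst \<omega>" by (force simp: cst_def image_iff)
  finally show ?thesis .
qed

lemma cst_self: "\<omega> \<in> cst \<omega>"
  by (simp add: cst_def LI_zero)

lemma cst_eq: "\<omega> - \<eta> \<in> LI \<Longrightarrow> cst \<omega> = cst \<eta>"
  unfolding cst_def
proof (intro Collect_cong iffI)
  fix x assume H: "\<omega> - \<eta> \<in> LI"
  show "x - \<eta> \<in> LI" if "x - \<omega> \<in> LI" using LI_add[OF that H] by simp
  show "x - \<omega> \<in> LI" if "x - \<eta> \<in> LI" using LI_diff[OF that H] by simp
qed

lemma cst_eq_iff: "cst \<omega> = cst \<eta> \<longleftrightarrow> \<omega> - \<eta> \<in> LI"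
  using cst_eq cst_self[of \<omega>] by (auto simp: cst_def)

lemma cst_zero: "cst 0 = LI"
  by (simp add: cst_def)

lemma LC_smul: "\<omega> \<in> LC \<Longrightarrow> smul (single 0 c) \<omega> \<in> LC"
proof (rule LC_I)
  assume \<omega>: "\<omega> \<in> LC"
  show "keys (smul (single 0 c) \<omega>) \<subseteq> Pow G" using keys_smul[of "single 0 c" \<omega>] LC_keys[OF \<omega>] by (rule subset_trans)
  have "(single 0 c :: 'a set polynomial) \<in> PG" by (simp add: PG_def)
  then show "lookup (smul (single 0 c) \<omega>) T \<in> PG" for T
    unfolding lookup_smul by (rule PG_mult) (rule LC_lookup[OF \<omega>])
qed

lemma LI_smul: "\<omega> \<in> LI \<Longrightarrow> smul (single 0 c) \<omega> \<in> LI"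
  unfolding LI_def by (simp add: LC_smul lookup_smul JI_scale)

abbreviation "RM \<equiv> leray_model E cd G r"
abbreviation "dM \<equiv> leray_model_d E cd G r"

lemma RM_add: "cst \<omega> \<oplus>\<^bsub>RM\<^esub> cst \<eta> = cst (\<omega> + \<eta>)"
proof -
  have "cst \<omega> \<oplus>\<^bsub>RM\<^esub> cst \<eta> = {h + k | h k. h \<in> cst \<omega> \<and> k \<in> cst \<eta>}"
    by (auto simp: leray_model_def quot_module_def FactRing_def set_add_def set_mult_def RA_simps)
  also have "\<dots> = cst (\<omega> + \<eta>)"
  proof (intro equalityI subsetI)
    fix x assume "x \<in> {h + k | h k. h \<in> cst \<omega> \<and> k \<in> cst \<eta>}"
    then obtain h k where x: "x = h + k" "h - \<omega> \<in> LI" "k - \<eta> \<in> LI" by (auto simp: cst_def)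
    show "x \<in> cst (\<omega> + \<eta>)" using LI_add[OF x(2,3)] x(1) by (simp add: cst_def algebra_simps)
  next
    fix x assume "x \<in> cst (\<omega> + \<eta>)"
    then have "(x - \<eta>) \<in> cst \<omega>" by (simp add: cst_def algebra_simps)
    then show "x \<in> {h + k | h k. h \<in> cst \<omega> \<and> k \<in> cst \<eta>}"
      using cst_self[of \<eta>] by (intro CollectI exI[of _ "x - \<eta>"] exI[of _ \<eta>]) simp
  qed
  finally show ?thesis .
qed

lemma RM_smul: "c \<odot>\<^bsub>RM\<^esub> cst \<omega> = cst (smul (single 0 c) \<omega>)"
proof -
  have "cst (smul (single 0 c) \<eta>) = cst (smul (single 0 c) \<omega>)" if "\<eta> \<in> cst \<omega>" for \<eta>
    using LI_smul[of "\<eta> - \<omega>" c] that by (intro cst_eq) (simp add: cst_def smul_diff)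
  then have "(\<Union>\<eta>\<in>cst \<omega>. cst (smul (single 0 c) \<eta>)) = cst (smul (single 0 c) \<omega>)" using cst_self by blast
  then show ?thesis by (simp add: leray_model_def quot_module_def leray_ideal_LI cst_coset RA_simps)
qed

lemma RM_zero: "\<zero>\<^bsub>RM\<^esub> = LI"
  by (simp add: leray_model_def quot_module_def FactRing_def leray_ideal_LI)

lemma dM_cst: "dM (cst \<omega>) = cst (leray_d r \<omega>)"
proof -
  have "cst (leray_d r \<eta>) = cst (leray_d r \<omega>)" if "\<eta> \<in> cst \<omega>" for \<eta>
  proof (rule cst_eq)
    have "leray_d r (\<eta> - \<omega>) \<in> LI" by (rule leray_d_LI) (use that in \<open>simp add: cst_def\<close>)
    then show "leray_d r \<eta> - leray_d r \<omega> \<in> LI" by (simp only: leray_d_diff)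
  qed
  then have "(\<Union>\<eta>\<in>cst \<omega>. cst (leray_d r \<eta>)) = cst (leray_d r \<omega>)" using cst_self by blast
  then show ?thesis by (simp add: leray_model_d_def leray_ideal_LI cst_coset)
qed

lemma leray_part: "leray_model_part E cd G r D = cst ` LD D"
proof -
  have "{\<omega> \<in> carrier RA. \<forall>T\<in>keys \<omega>. \<forall>m\<in>keys (lookup \<omega> T). (2 * int (\<Sum>g\<in>keys m. lookup m g), int (card T)) \<in> D} = LD D"
    by (auto simp: LD_def RA_simps mdeg_def)
  then show ?thesis unfolding leray_model_part_def leray_ideal_LI cst_coset by simp
qed

lemma psi_smul: "psi (smul (single 0 c) \<omega>) = smul c (psi \<omega>)"
  by (rule poly_mapping_eqI) (simp add: lookup_psi lookup_smul dg_scale)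

lemma leray_d_smul: "\<omega> \<in> LC \<Longrightarrow> leray_d r (smul (single 0 c) \<omega>) = smul (single 0 c) (leray_d r \<omega>)"
  by (rule poly_mapping_eqI)
    (simp add: lookup_leray_d LC_smul lookup_smul sum_distrib_left mult.left_commute)

lemma LD_smul: "\<omega> \<in> LD D \<Longrightarrow> smul (single 0 c) \<omega> \<in> LD D"
  unfolding LD_iff
proof (intro conjI allI impI)
  fix T m
  assume H: "\<omega> \<in> LC \<and> (\<forall>T m. lookup (lookup \<omega> T) m \<noteq> 0 \<longrightarrow> (2 * int (mdeg m), int (card T)) \<in> D)"
    "lookup (lookup (smul (single 0 c) \<omega>) T) m \<noteq> 0"
  then have "m \<in> keys (single 0 c * lookup \<omega> T)" by (simp add: lookup_smul in_keys_iff)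
  then have "m \<in> keys (lookup \<omega> T)" by (rule subsetD[OF keys_scale])
  then show "(2 * int (mdeg m), int (card T)) \<in> D" using H by (simp add: in_keys_iff)
qed (simp add: LC_smul)

lemma psi_CD: "\<omega> \<in> LD D \<Longrightarrow> psi \<omega> \<in> CD D"
  unfolding CD_def
proof (intro CollectI conjI ballI keys_psi)
  fix T assume \<omega>: "\<omega> \<in> LD D" and T: "T \<in> keys (psi \<omega>)"
  have N: "T \<in> NS" using T keys_psi by blast
  then have "dg T (lookup \<omega> T) \<noteq> 0" using T by (simp add: in_keys_iff lookup_psi)
  then obtain m where m: "m \<in> keys (lookup \<omega> T)" "dg T (mon m) \<noteq> 0"
    unfolding dg_expand[of T "lookup \<omega> T"] by (metis (no_types, lifting) mult_zero_right sum.neutral)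
  have "mdeg m + card T = cd (jn T)" by (rule dg_monomial(1)[OF N m(2)])
  moreover have "(2 * int (mdeg m), int (card T)) \<in> D" using \<omega> m(1) unfolding LD_iff by (simp add: in_keys_iff)
  ultimately show "(2 * (int (cd (jn T)) - int (card T)), int (card T)) \<in> D" by (metis add_diff_cancel_right' of_nat_add)
qed

text \<open>Coordinates \<open>P\<close> on the homology of \<open>CM\<close> are pulled back along
  \<open>psi\<close>: \<open>psi_homology_surj\<close> gives the image and
  \<open>psi_homology_inj\<close> the kernel. Thus the Leray homology inherits the same
  basis.\<close>

lemma leray_homology_free:
  assumes Padd: "\<And>u v. P (u + v) = P u + P v" and Psm: "\<And>c v. P (smul c v) = smul c (P v)"
    and im: "P ` {v\<in>CD D. CM_d r v = 0} = {w. keys w \<subseteq> Y}"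
    and ker: "CM_d r ` CD (shift D) = {v\<in>CD D. CM_d r v = 0 \<and> P v = 0}"
  shows "\<exists>\<phi>. free_on (homology_at RM dM (leray_model_part E cd G r (shift D)) (leray_model_part E cd G r D)) Y \<phi>"
proof -
  define \<phi> where "\<phi> W = P (psi (SOME \<omega>. \<omega> \<in> W))" for W
  have phi: "\<phi> (cst \<omega>) = P (psi \<omega>)" for \<omega>
  proof -
    have "(SOME \<eta>. \<eta> \<in> cst \<omega>) \<in> cst \<omega>" by (rule someI[of _ \<omega>]) (rule cst_self)
    then have "psi ((SOME \<eta>. \<eta> \<in> cst \<omega>) - \<omega>) = 0" by (intro psi_LI) (simp add: cst_def)
    then show ?thesis by (simp add: \<phi>_def psi_diff)
  qed
  have dz: "dM (cst \<omega>) = \<zero>\<^bsub>RM\<^esub> \<longleftrightarrow> leray_d r \<omega> \<in> LI" for \<omega>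
    unfolding dM_cst RM_zero cst_zero[symmetric] cst_eq_iff by simp
  have cyc: "psi \<omega> \<in> CD D \<and> CM_d r (psi \<omega>) = 0" if "\<omega> \<in> LD D" "leray_d r \<omega> \<in> LI" for \<omega>
    using psi_CD[OF that(1)] psi_chain[OF LD_LC[OF that(1)]] psi_LI[OF that(2)] by simp
  let ?Z = "leray_model_part E cd G r D"
  show ?thesis
  proof (rule homology_free[where \<phi>=\<phi>])
    fix u v assume "u \<in> ?Z" "v \<in> ?Z" "dM u = \<zero>\<^bsub>RM\<^esub>" "dM v = \<zero>\<^bsub>RM\<^esub>"
    then obtain \<omega> \<eta> where u: "u = cst \<omega>" "\<omega> \<in> LD D" "leray_d r \<omega> \<in> LI" and v: "v = cst \<eta>" "\<eta> \<in> LD D" "leray_d r \<eta> \<in> LI"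
      unfolding leray_part using dz by auto
    show "u \<oplus>\<^bsub>RM\<^esub> v \<in> ?Z \<and> dM (u \<oplus>\<^bsub>RM\<^esub> v) = \<zero>\<^bsub>RM\<^esub> \<and> \<phi> (u \<oplus>\<^bsub>RM\<^esub> v) = \<phi> u + \<phi> v"
      unfolding u(1) v(1) RM_add dz phi leray_part
      using LD_add[OF u(2) v(2)] LI_add[OF u(3) v(3)] by (simp add: leray_d_add psi_add Padd)
    show "\<exists>h\<in>?Z. dM h = \<zero>\<^bsub>RM\<^esub> \<and> h \<oplus>\<^bsub>RM\<^esub> v = u"
      by (rule bexI[of _ "cst (\<omega> - \<eta>)"]; unfold u(1) v(1) RM_add dz leray_part)
        (use LD_diff[OF u(2) v(2)] LI_diff[OF u(3) v(3)] in \<open>simp_all add: leray_d_diff\<close>)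
  next
    fix c v assume "v \<in> ?Z" "dM v = \<zero>\<^bsub>RM\<^esub>"
    then obtain \<eta> where v: "v = cst \<eta>" "\<eta> \<in> LD D" "leray_d r \<eta> \<in> LI" unfolding leray_part using dz by auto
    show "c \<odot>\<^bsub>RM\<^esub> v \<in> ?Z \<and> dM (c \<odot>\<^bsub>RM\<^esub> v) = \<zero>\<^bsub>RM\<^esub> \<and> \<phi> (c \<odot>\<^bsub>RM\<^esub> v) = smul c (\<phi> v)"
      unfolding v(1) RM_smul dz phi leray_part
      using LD_smul[OF v(2)] LI_smul[OF v(3)] LD_LC[OF v(2)] by (simp add: leray_d_smul psi_smul Psm)
  next
    have "\<phi> ` {z\<in>?Z. dM z = \<zero>\<^bsub>RM\<^esub>} = P ` psi ` {\<omega>\<in>LD D. leray_d r \<omega> \<in> LI}"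
    proof -
      have "{z\<in>?Z. dM z = \<zero>\<^bsub>RM\<^esub>} = cst ` {\<omega>\<in>LD D. leray_d r \<omega> \<in> LI}" unfolding leray_part using dz by auto
      then show ?thesis by (simp add: image_image phi)
    qed
    also have "psi ` {\<omega>\<in>LD D. leray_d r \<omega> \<in> LI} = {v\<in>CD D. CM_d r v = 0}"
      using cyc psi_homology_surj by (auto simp: image_iff) metis
    finally show "\<phi> ` {z\<in>?Z. dM z = \<zero>\<^bsub>RM\<^esub>} = {w. keys w \<subseteq> Y}" using im by simp
  next
    show "dM ` leray_model_part E cd G r (shift D) = {v\<in>?Z. dM v = \<zero>\<^bsub>RM\<^esub> \<and> \<phi> v = 0}"
    proof (intro equalityI subsetI)
      fix x assume "x \<in> dM ` leray_model_part E cd G r (shift D)"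
      then obtain y where y: "x = cst (leray_d r y)" "y \<in> LD (shift D)" unfolding leray_part using dM_cst by auto
      have "CM_d r (psi y) \<in> CM_d r ` CD (shift D)" using psi_CD[OF y(2)] by blast
      then have "P (CM_d r (psi y)) = 0" unfolding ker by simp
      then have "P (psi (leray_d r y)) = 0" using psi_chain[OF LD_LC[OF y(2)]] by simp
      then show "x \<in> {v\<in>?Z. dM v = \<zero>\<^bsub>RM\<^esub> \<and> \<phi> v = 0}"
        using leray_d_LD[OF y(2)] leray_d_square[OF LD_LC[OF y(2)]] LI_zero unfolding y(1) leray_part by (simp add: dz phi)
    next
      fix x assume "x \<in> {v\<in>?Z. dM v = \<zero>\<^bsub>RM\<^esub> \<and> \<phi> v = 0}"
      then obtain z where z: "x = cst z" "z \<in> LD D" "leray_d r z \<in> LI" "P (psi z) = 0" unfolding leray_part using dz phi by auto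
      have "psi z \<in> CM_d r ` CD (shift D)" unfolding ker using cyc[OF z(2,3)] z(4) by simp
      then obtain c where "c \<in> CD (shift D)" "psi z = CM_d r c" by auto
      then obtain y where y: "y \<in> LD (shift D)" "z - leray_d r y \<in> LI" using psi_homology_inj[OF z(2,3)] by blast
      have "x = dM (cst y)" unfolding z(1) dM_cst using y(2) by (rule cst_eq)
      then show "x \<in> dM ` leray_model_part E cd G r (shift D)" unfolding leray_part using y(1) by blast
    qed
  qed
qed

end

section \<open>Contractions of based complexes\<close>

definition lin :: "(('j \<Rightarrow>\<^sub>0 rat) \<Rightarrow> ('k \<Rightarrow>\<^sub>0 rat)) \<Rightarrow> bool" where
  "lin f \<longleftrightarrow> (\<forall>u v. f (u + v) = f u + f v) \<and> (\<forall>c v. f (smul c v) = smul c (f v))"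

lemma linI: "(\<And>u v. f (u + v) = f u + f v) \<Longrightarrow> (\<And>c v. f (smul c v) = smul c (f v)) \<Longrightarrow> lin f"
  by (simp add: lin_def)

lemma lin_add: "lin f \<Longrightarrow> f (u + v) = f u + f v"
  and lin_smul: "lin f \<Longrightarrow> f (smul c v) = smul c (f v)"
  by (simp_all add: lin_def)

lemma lin_zero: "lin f \<Longrightarrow> f 0 = 0"
  using lin_add[of f 0 0] by simp

lemma lin_diff: "lin f \<Longrightarrow> f (u - v) = f u - f v"
  using lin_add[of f "u - v" v] by simp

lemma lin_sum: "lin f \<Longrightarrow> f (\<Sum>i\<in>I. v i) = (\<Sum>i\<in>I. f (v i))"
  by (induction I rule: infinite_finite_induct) (simp_all add: lin_zero lin_add)

lemma lin_id: "lin (\<lambda>v. v)"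
  by (simp add: lin_def)

lemma lin_comp: "lin f \<Longrightarrow> lin g \<Longrightarrow> lin (\<lambda>v. g (f v))"
  by (simp add: lin_def)

lemma lin_plus: "lin f \<Longrightarrow> lin g \<Longrightarrow> lin (\<lambda>v. f v + g v)"
  by (simp add: lin_def smul_add add_ac)

lemma lin_minus: "lin f \<Longrightarrow> lin g \<Longrightarrow> lin (\<lambda>v. f v - g v)"
  by (simp add: lin_def smul_diff algebra_simps)

lemma lin_expand:
  assumes "lin f" shows "f v = (\<Sum>x\<in>keys v. smul (lookup v x) (f (single x 1)))"
proof -
  have "f v = f (\<Sum>x\<in>keys v. smul (lookup v x) (single x 1))"
    by (simp add: smul_single flip: poly_mapping_sum)
  then show ?thesis by (simp only: lin_sum[OF assms] lin_smul[OF assms])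
qed

lemma lin_eqI:
  assumes "lin f" "lin g" "\<And>x. x \<in> X \<Longrightarrow> f (single x 1) = g (single x 1)" "keys v \<subseteq> X"
  shows "f v = g v"
  unfolding lin_expand[OF assms(1), of v] lin_expand[OF assms(2), of v] using assms(3,4) by (intro sum.cong) auto

lemma lin_keys: "lin f \<Longrightarrow> y \<in> keys (f v) \<Longrightarrow> \<exists>x\<in>keys v. y \<in> keys (f (single x 1))"
  using lin_expand[of f v] keys_sum_subset[of "keys v" "\<lambda>x. smul (lookup v x) (f (single x 1))" "\<Union>x\<in>keys v. keys (f (single x 1))"]
    keys_smul by fastforce

definition lext :: "('j \<Rightarrow> 'k \<Rightarrow>\<^sub>0 rat) \<Rightarrow> ('j \<Rightarrow>\<^sub>0 rat) \<Rightarrow> ('k \<Rightarrow>\<^sub>0 rat)" where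
  "lext h = ksum (\<lambda>x c. smul c (h x))"

lemma lext_family: "additive_family (\<lambda>x c. smul c (h x) :: 'k \<Rightarrow>\<^sub>0 rat)"
  by (rule additive_familyI; rule poly_mapping_eqI) (simp_all add: lookup_smul lookup_add distrib_right)

lemma lext_single: "lext h (single x c) = smul c (h x)"
  unfolding lext_def by (rule ksum_single[OF lext_family])

lemma lext_single_one [simp]: "lext h (single x 1) = h x"
  by (simp add: lext_single)

lemma lin_lext: "lin (lext h)"
proof (rule linI)
  show add: "lext h (u + v) = lext h u + lext h v" for u v unfolding lext_def by (rule ksum_add[OF lext_family])
  show "lext h (smul c v) = smul c (lext h v)" for c v
  proof -
    have "lext h (smul c v) = (\<Sum>x\<in>keys v. smul (lookup (smul c v) x) (h x))"
      unfolding lext_def by (rule ksum_superset[OF lext_family finite_keys keys_smul])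
    also have "\<dots> = smul c (lext h v)" unfolding lext_def ksum_def by (simp add: smul_sum smul_smul lookup_smul)
    finally show ?thesis .
  qed
qed

text \<open>\<open>X\<close> and \<open>Y\<close> index basis vectors, so one condition controls
  supports and the shift \<open>\<tau>\<close> of degree.\<close>

definition graded :: "('k \<Rightarrow> 'g::ab_group_add) \<Rightarrow> 'g \<Rightarrow> 'k set \<Rightarrow> 'k set \<Rightarrow> (('k \<Rightarrow>\<^sub>0 rat) \<Rightarrow> ('k \<Rightarrow>\<^sub>0 rat)) \<Rightarrow> bool" where
  "graded \<delta> \<tau> X Y f \<longleftrightarrow> lin f \<and> (\<forall>x\<in>X. \<forall>y\<in>keys (f (single x 1)). y \<in> Y \<and> \<delta> y = \<delta> x + \<tau>)"

lemma gradedI: "lin f \<Longrightarrow> (\<And>x y. x \<in> X \<Longrightarrow> y \<in> keys (f (single x 1)) \<Longrightarrow> y \<in> Y \<and> \<delta> y = \<delta> x + \<tau>) \<Longrightarrow> graded \<delta> \<tau> X Y f"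
  by (simp add: graded_def)

lemma graded_lin: "graded \<delta> \<tau> X Y f \<Longrightarrow> lin f"
  by (simp add: graded_def)

lemma graded_key:
  assumes "graded \<delta> \<tau> X Y f" "keys v \<subseteq> X" "y \<in> keys (f v)"
  obtains x where "x \<in> keys v" "y \<in> Y" "\<delta> y = \<delta> x + \<tau>"
  using lin_keys[OF graded_lin[OF assms(1)] assms(3)] assms(1,2) unfolding graded_def by blast

lemma graded_keys: "graded \<delta> \<tau> X Y f \<Longrightarrow> keys v \<subseteq> X \<Longrightarrow> keys (f v) \<subseteq> Y"
  using graded_key by (metis subsetI)

lemma graded_comp:
  assumes "graded \<delta> \<tau> X Y f" "graded \<delta> \<tau>' Y Z g" shows "graded \<delta> (\<tau> + \<tau>') X Z (\<lambda>v. g (f v))"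
proof (rule gradedI)
  show "lin (\<lambda>v. g (f v))" by (rule lin_comp[OF graded_lin graded_lin]) (rule assms)+
  fix x y assume x: "x \<in> X" and y: "y \<in> keys (g (f (single x 1)))"
  have k: "keys (f (single x 1)) \<subseteq> Y" by (rule graded_keys[OF assms(1)]) (use x in auto)
  obtain z where z: "z \<in> keys (f (single x 1))" "y \<in> Z" "\<delta> y = \<delta> z + \<tau>'" using graded_key[OF assms(2) k y] by metis
  then show "y \<in> Z \<and> \<delta> y = \<delta> x + (\<tau> + \<tau>')" using assms(1) x unfolding graded_def by (auto simp: add.assoc)
qed

lemma graded_plus:
  assumes "graded \<delta> \<tau> X Y f" "graded \<delta> \<tau> X Y g" shows "graded \<delta> \<tau> X Y (\<lambda>v. f v + g v)"
  using assms lin_plus[OF graded_lin graded_lin, OF assms] unfolding graded_def by (meson UnE keys_add subsetD)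

lemma graded_minus:
  assumes "graded \<delta> \<tau> X Y f" "graded \<delta> \<tau> X Y g" shows "graded \<delta> \<tau> X Y (\<lambda>v. f v - g v)"
  using assms lin_minus[OF graded_lin graded_lin, OF assms] unfolding graded_def by (meson UnE keys_diff subsetD)

lemma graded_id: "X \<subseteq> Y \<Longrightarrow> graded \<delta> 0 X Y (\<lambda>v. v)"
  by (rule gradedI[OF lin_id]) auto

lemma graded_zero: "graded \<delta> \<tau> X Y (\<lambda>v. 0)"
  by (rule gradedI) (simp_all add: lin_def)

lemma graded_mono: "graded \<delta> \<tau> X Y f \<Longrightarrow> X' \<subseteq> X \<Longrightarrow> Y \<subseteq> Y' \<Longrightarrow> graded \<delta> \<tau> X' Y' f"
  unfolding graded_def by blast

text \<open>A homotopy equivalence with a complex with zero differential, so \<open>Y\<close>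
  indexes a basis of the homology. \<open>Y\<close> is a subset of the old basis: homology classes
  are counted by simplices of the original complex.\<close>

locale contraction =
  fixes \<delta> :: "'k \<Rightarrow> 'g::ab_group_add" and \<sigma> :: 'g and d :: "('k \<Rightarrow>\<^sub>0 rat) \<Rightarrow> ('k \<Rightarrow>\<^sub>0 rat)"
    and X Y :: "'k set" and P Q S :: "('k \<Rightarrow>\<^sub>0 rat) \<Rightarrow> ('k \<Rightarrow>\<^sub>0 rat)"
  assumes graded_d: "graded \<delta> \<sigma> X X d" and graded_P: "graded \<delta> 0 X Y P"
    and graded_Q: "graded \<delta> 0 Y X Q" and graded_S: "graded \<delta> (- \<sigma>) X X S"
    and subset: "Y \<subseteq> X"
    and d_d: "keys v \<subseteq> X \<Longrightarrow> d (d v) = 0"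
    and P_Q: "keys w \<subseteq> Y \<Longrightarrow> P (Q w) = w"
    and d_Q: "keys w \<subseteq> Y \<Longrightarrow> d (Q w) = 0"
    and P_d: "keys v \<subseteq> X \<Longrightarrow> P (d v) = 0"
    and homotopy: "keys v \<subseteq> X \<Longrightarrow> v - Q (P v) = d (S v) + S (d v)"
begin

lemmas lin_d = graded_lin[OF graded_d] and lin_P = graded_lin[OF graded_P]
  and lin_Q = graded_lin[OF graded_Q] and lin_S = graded_lin[OF graded_S]
lemmas keys_d = graded_keys[OF graded_d] and keys_P = graded_keys[OF graded_P]
  and keys_Q = graded_keys[OF graded_Q] and keys_S = graded_keys[OF graded_S]

lemma image_cycles:
  "P ` {v. keys v \<subseteq> {x\<in>X. \<delta> x \<in> D} \<and> d v = 0} = {w. keys w \<subseteq> {y\<in>Y. \<delta> y \<in> D}}"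
proof (intro equalityI subsetI)
  fix w :: "'k \<Rightarrow>\<^sub>0 rat" assume "w \<in> P ` {v. keys v \<subseteq> {x\<in>X. \<delta> x \<in> D} \<and> d v = 0}"
  then obtain v where v: "w = P v" "keys v \<subseteq> {x\<in>X. \<delta> x \<in> D}" by auto
  have "y \<in> Y \<and> \<delta> y \<in> D" if "y \<in> keys w" for y
    by (rule graded_key[OF graded_P, of v y]) (use v that in auto)
  then show "w \<in> {w. keys w \<subseteq> {y\<in>Y. \<delta> y \<in> D}}" by auto
next
  fix w :: "'k \<Rightarrow>\<^sub>0 rat" assume "w \<in> {w. keys w \<subseteq> {y\<in>Y. \<delta> y \<in> D}}"
  then have w: "keys w \<subseteq> {y\<in>Y. \<delta> y \<in> D}" "keys w \<subseteq> Y" by auto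
  have "y \<in> X \<and> \<delta> y \<in> D" if "y \<in> keys (Q w)" for y
    by (rule graded_key[OF graded_Q, of w y]) (use w that in auto)
  then show "w \<in> P ` {v. keys v \<subseteq> {x\<in>X. \<delta> x \<in> D} \<and> d v = 0}"
    using P_Q[OF w(2)] d_Q[OF w(2)] by (intro image_eqI[of _ _ "Q w"]) auto
qed

text \<open>By the homotopy formula a cycle killed by \<open>P\<close> is the differential of its
  image under \<open>S\<close>.\<close>

lemma boundaries:
  "d ` {v. keys v \<subseteq> {x\<in>X. \<delta> x + \<sigma> \<in> D}} = {v. keys v \<subseteq> {x\<in>X. \<delta> x \<in> D} \<and> d v = 0 \<and> P v = 0}"
proof (intro equalityI subsetI)
  fix w :: "'k \<Rightarrow>\<^sub>0 rat" assume "w \<in> d ` {v. keys v \<subseteq> {x\<in>X. \<delta> x + \<sigma> \<in> D}}"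
  then obtain v where v: "w = d v" "keys v \<subseteq> {x\<in>X. \<delta> x + \<sigma> \<in> D}" "keys v \<subseteq> X" by auto
  have "y \<in> X \<and> \<delta> y \<in> D" if "y \<in> keys w" for y
    by (rule graded_key[OF graded_d, of v y]) (use v that in auto)
  then show "w \<in> {v. keys v \<subseteq> {x\<in>X. \<delta> x \<in> D} \<and> d v = 0 \<and> P v = 0}"
    using d_d[OF v(3)] P_d[OF v(3)] v(1) by auto
next
  fix v :: "'k \<Rightarrow>\<^sub>0 rat" assume "v \<in> {v. keys v \<subseteq> {x\<in>X. \<delta> x \<in> D} \<and> d v = 0 \<and> P v = 0}"
  then have v: "keys v \<subseteq> {x\<in>X. \<delta> x \<in> D}" "keys v \<subseteq> X" "d v = 0" "P v = 0" by auto
  have "y \<in> X \<and> \<delta> y + \<sigma> \<in> D" if "y \<in> keys (S v)" for y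
    by (rule graded_key[OF graded_S, of v y]) (use v that in auto)
  moreover have "v = d (S v)" using homotopy[OF v(2)] v(3,4) by (simp add: lin_zero[OF lin_Q] lin_zero[OF lin_S])
  ultimately show "v \<in> d ` {v. keys v \<subseteq> {x\<in>X. \<delta> x + \<sigma> \<in> D}}"
    by (intro image_eqI[of _ _ "S v"]) auto
qed

end

text \<open>Gaussian elimination: cancel a pair \<open>a\<close>, \<open>b\<close> of basis elements such that \<open>d a\<close> has a nonzero \<open>b\<close>-coefficient.\<close>

lemma contraction_exists:
  fixes \<delta> :: "'k \<Rightarrow> 'g::ab_group_add"
  assumes "finite X" "graded \<delta> \<sigma> X X d" "\<And>v. keys v \<subseteq> X \<Longrightarrow> d (d v) = 0" "\<sigma> \<noteq> 0"
  shows "\<exists>Y P Q S. contraction \<delta> \<sigma> d X Y P Q S"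
  using assms
proof (induction "card X" arbitrary: X d rule: less_induct)
  case less
  note grd = less.prems(2) and dd = less.prems(3)
  note lind = graded_lin[OF grd] and kd = graded_keys[OF grd]
  show ?case
  proof (cases "\<forall>a\<in>X. d (single a 1) = 0")
    case True
    have d0: "d v = 0" if "keys v \<subseteq> X" for v
      by (rule lin_eqI[OF lind, of "\<lambda>_. 0" X]) (use True that in \<open>auto simp: lin_def\<close>)
    have "contraction \<delta> \<sigma> d X X (\<lambda>v. v) (\<lambda>v. v) (\<lambda>v. 0)"
      by unfold_locales (use d0 grd graded_id graded_zero in \<open>auto simp: dd\<close>)
    then show ?thesis by blast
  next
    case False
    then obtain a b where a: "a \<in> X" and b: "b \<in> keys (d (single a 1))" by (auto simp flip: keys_eq_empty)
    have bX: "b \<in> X" "\<delta> b = \<delta> a + \<sigma>" using grd a b unfolding graded_def by auto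
    have ab: "a \<noteq> b" using bX less.prems(4) by auto
    define c where "c = lookup (d (single a 1)) b"
    have c: "c \<noteq> 0" using b by (simp add: c_def in_keys_iff)
    \<comment> \<open>Sends \<open>b\<close> back to \<open>a\<close> and is a partial inverse of
      \<open>d\<close>: \<open>s s = 0\<close> and \<open>s d s = s\<close>. Therefore
      \<open>e\<close> below is a projection that commutes with \<open>d\<close>.\<close>
    define s where "s = lext (\<lambda>x. if x = b then single a (1 / c) else 0)"
    have lins: "lin s" unfolding s_def by (rule lin_lext)
    have s: "s v = single a (lookup v b / c)" for v
    proof -
      have "lin (\<lambda>v. single a (lookup v b / c))"
        by (rule linI) (simp_all add: lookup_add lookup_smul add_divide_distrib single_add smul_single)
      from lin_eqI[OF lins this, of "keys v" v] show ?thesis by (auto simp: s_def lookup_single)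
    qed
    have grs: "graded \<delta> (- \<sigma>) X X s"
      by (rule gradedI[OF lins]) (use a bX in \<open>auto simp: s lookup_single when_def split: if_splits\<close>)
    note ks = graded_keys[OF grs]
    have ss: "s (s v) = 0" for v using ab by (simp add: s lookup_single)
    have sds: "s (d (s v)) = s v" for v
    proof -
      have "s v = smul (lookup v b / c) (single a 1)" by (simp add: s smul_single)
      then have "lookup (d (s v)) b = lookup v b / c * c" by (simp only: lin_smul[OF lind] lookup_smul c_def)
      then have "lookup (d (s v)) b = lookup v b" using c by simp
      then show ?thesis by (subst (1 3) s) simp
    qed
    define e where "e v = v - (d (s v) + s (d v))" for v
    have gre: "graded \<delta> 0 X X e" unfolding e_def
      using graded_comp[OF grs grd] graded_comp[OF grd grs] by (intro graded_minus graded_plus graded_id) simp_all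
    note line = graded_lin[OF gre] and ke = graded_keys[OF gre]
    have de: "d (e v) = d v - d (s (d v))" if "keys v \<subseteq> X" for v
      using dd[OF ks[OF that]] by (simp add: e_def lin_diff[OF lind] lin_add[OF lind])
    have ed: "e (d v) = d (e v)" if "keys v \<subseteq> X" for v
      unfolding de[OF that] using dd[OF that] by (simp add: e_def lin_zero[OF lins])
    have se: "s (e v) = 0" if "keys v \<subseteq> X" for v
      by (simp add: e_def lin_diff[OF lins] lin_add[OF lins] ss sds)
    have es: "e (s v) = 0" if "keys v \<subseteq> X" for v
      by (simp add: e_def ss sds lin_zero[OF lind])
    have ee: "e (e v) = e v" if v: "keys v \<subseteq> X" for v
      using se[OF kd[OF v]] se[OF v] unfolding e_def[of "e v"] ed[OF v, symmetric] by (simp add: lin_zero[OF lind])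
    let ?X = "X - {a, b}"
    \<comment> \<open>Forgets the cancelled basis elements. Since \<open>e\<close> kills
      \<open>a\<close> and its values have no \<open>b\<close>-coefficient, \<open>e\<close> and
      \<open>q\<close> are inverse to each other between the span of \<open>?X\<close> and the image
      of \<open>e\<close>.\<close>
    define q where "q = lext (\<lambda>x. if x \<in> ?X then single x 1 else 0)"
    have linq: "lin q" unfolding q_def by (rule lin_lext)
    have grq: "graded \<delta> 0 X ?X q" by (rule gradedI[OF linq]) (auto simp: q_def split: if_splits)
    note kq = graded_keys[OF grq]
    have q_id: "q v = v" if "keys v \<subseteq> ?X" for v
      by (rule lin_eqI[OF linq lin_id _ that]) (simp add: q_def)
    have q_s: "q (s v) = 0" for v
      by (simp add: s q_def lext_single)
    have eq: "e (q v) = e v" if "lookup v b = 0" "keys v \<subseteq> X" for v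
    proof (rule lin_eqI[of "\<lambda>v. e (q v)" e "X - {b}"])
      show "lin (\<lambda>v. e (q v))" by (rule lin_comp[OF linq line])
      fix x assume x: "x \<in> X - {b}"
      show "e (q (single x 1)) = e (single x 1)"
      proof (cases "x = a")
        case True
        have "single a 1 = s (single b c)" using c by (simp add: s)
        then have "e (single a 1) = 0" using es[of "single b c"] bX by auto
        then show ?thesis using True by (simp add: q_def lin_zero[OF line])
      qed (use x in \<open>simp add: q_def\<close>)
    qed (use that line in \<open>auto simp: in_keys_iff\<close>)
    have s0: "lookup v b = 0" if "s v = 0" for v
      using that c by (metis s divide_eq_0_iff lookup_single_eq lookup_zero)
    have eqe: "e (q (e v)) = e v" if "keys v \<subseteq> X" for v
      using eq[OF s0[OF se[OF that]] ke[OF that]] ee[OF that] by simp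
    \<comment> \<open>The differential on the image of \<open>e\<close>, transported to the span of
      \<open>?X\<close>.\<close>
    define d' where "d' v = q (d (e v))" for v
    have grd': "graded \<delta> \<sigma> ?X ?X d'"
      using graded_comp[OF graded_comp[OF gre grd] grq] unfolding d'_def by (auto intro: graded_mono)
    have sub: "keys v \<subseteq> X" if "keys v \<subseteq> ?X" for v using that by auto
    have ed': "e (d' v) = d (e v)" if v: "keys v \<subseteq> X" for v
      unfolding d'_def ed[OF v, symmetric] by (rule eqe[OF kd[OF v]])
    have d'q: "d' (q (e v)) = q (e (d v))" if v: "keys v \<subseteq> X" for v
      unfolding d'_def eqe[OF v] ed[OF v] ..
    have dd': "d' (d' v) = 0" if "keys v \<subseteq> ?X" for v
      unfolding d'_def[of "d' v"] ed'[OF sub[OF that]] using dd[OF ke[OF sub[OF that]]] by (simp add: lin_zero[OF linq])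
    have "card ?X < card X" using a less.prems(1) by (intro psubset_card_mono) auto
    then obtain Y P Q S where "contraction \<delta> \<sigma> d' ?X Y P Q S"
      using less.hyps[OF _ _ grd' dd' less.prems(4)] less.prems(1) by blast
    then interpret C: contraction \<delta> \<sigma> d' ?X Y P Q S .
    have kX: "keys w \<subseteq> ?X" if "keys w \<subseteq> Y" for w using that C.subset by auto
    have gre': "graded \<delta> 0 ?X X e" and grqe: "graded \<delta> 0 X ?X (\<lambda>v. q (e v))"
      using graded_comp[OF gre grq] gre by (auto intro: graded_mono)
    have qe_id: "q (e w) = w" if w: "keys w \<subseteq> ?X" for w
    proof -
      have "lookup w b = 0" using w by (auto simp: in_keys_iff)
      then have "s w = 0" by (simp add: s)
      then have "q (e w) = q w" unfolding e_def by (simp add: lin_diff[OF linq] lin_add[OF linq] q_s lin_zero[OF linq] lin_zero[OF lind])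
      then show ?thesis using q_id[OF w] by simp
    qed
    \<comment> \<open>Composition of two contractions: \<open>s\<close> contracts onto the image of
      \<open>e\<close>, and the homotopy of the smaller complex is transported by \<open>e\<close>
      and \<open>q\<close>.\<close>
    have "contraction \<delta> \<sigma> d X Y (\<lambda>v. P (q (e v))) (\<lambda>w. e (Q w)) (\<lambda>v. s v + e (S (q (e v))))"
    proof
      show "graded \<delta> \<sigma> X X d" by (rule grd)
      show "graded \<delta> 0 X Y (\<lambda>v. P (q (e v)))" using graded_comp[OF grqe C.graded_P] by simp
      show "graded \<delta> 0 Y X (\<lambda>w. e (Q w))" using graded_comp[OF C.graded_Q gre'] by simp
      show "graded \<delta> (- \<sigma>) X X (\<lambda>v. s v + e (S (q (e v))))"
        using graded_comp[OF graded_comp[OF grqe C.graded_S] gre'] by (intro graded_plus grs) simp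
      show "Y \<subseteq> X" using C.subset by auto
      show "d (d v) = 0" if "keys v \<subseteq> X" for v using that by (rule dd)
      fix w :: "'k \<Rightarrow>\<^sub>0 rat" assume w: "keys w \<subseteq> Y"
      note w' = C.keys_Q[OF w]
      show "P (q (e (e (Q w)))) = w" using ee[OF sub[OF w']] qe_id[OF w'] C.P_Q[OF w] by simp
      show "d (e (Q w)) = 0" using ed'[OF sub[OF w']] C.d_Q[OF w] by (simp add: lin_zero[OF line])
    next
      fix v :: "'k \<Rightarrow>\<^sub>0 rat" assume v: "keys v \<subseteq> X"
      let ?u = "q (e v)"
      have u: "keys ?u \<subseteq> ?X" by (rule kq[OF ke[OF v]])
      show "P (q (e (d v))) = 0" unfolding d'q[OF v, symmetric] by (rule C.P_d[OF u])
      have "e (?u - Q (P ?u)) = e (d' (S ?u) + S (d' ?u))" by (simp only: C.homotopy[OF u])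
      then have "e v - e (Q (P ?u)) = d (e (S ?u)) + e (S (q (e (d v))))"
        by (simp only: lin_diff[OF line] lin_add[OF line] eqe[OF v] ed'[OF sub[OF C.keys_S[OF u]]] d'q[OF v])
      then show "v - e (Q (P ?u)) = d (s v + e (S ?u)) + (s (d v) + e (S (q (e (d v)))))"
        unfolding e_def[of v] by (simp add: lin_add[OF lind] algebra_simps)
    qed
    then show ?thesis by blast
  qed
qed

section \<open>Contractions of joins\<close>

lemma lext_add_fun: "lext (\<lambda>x. f x + g x) v = lext f v + lext g v"
  by (simp add: lext_def ksum_def smul_add sum.distrib)

lemma lext_smul_fun: "lext (\<lambda>x. smul c (f x)) v = smul c (lext f v)"
  by (simp add: lext_def ksum_def smul_sum smul_smul mult.commute)

lemma smul_minus_left: "smul (- c) v = - smul c (v :: 'k \<Rightarrow>\<^sub>0 rat)"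
  by (rule poly_mapping_eqI) (simp add: lookup_smul)

lemma lin_scale: "lin (smul s)"
  by (rule linI) (simp_all only: smul_add smul_smul mult.commute[of s])

lemma gradedD: "graded \<delta> \<tau> X Y f \<Longrightarrow> x \<in> X \<Longrightarrow> y \<in> keys (f (single x 1)) \<Longrightarrow> y \<in> Y \<and> \<delta> y = \<delta> x + \<tau>"
  unfolding graded_def by blast

lemma contraction_singleI:
  fixes \<delta> :: "'k \<Rightarrow> 'g::ab_group_add"
  assumes d: "graded \<delta> \<sigma> X X d" and P: "graded \<delta> 0 X Y P" and Q: "graded \<delta> 0 Y X Q" and S: "graded \<delta> (- \<sigma>) X X S"
    and "Y \<subseteq> X"
    and "\<And>x. x \<in> X \<Longrightarrow> d (d (single x 1)) = 0" "\<And>y. y \<in> Y \<Longrightarrow> P (Q (single y 1)) = single y 1"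
    and "\<And>y. y \<in> Y \<Longrightarrow> d (Q (single y 1)) = 0" "\<And>x. x \<in> X \<Longrightarrow> P (d (single x 1)) = 0"
    and "\<And>x. x \<in> X \<Longrightarrow> single x 1 - Q (P (single x 1)) = d (S (single x 1)) + S (d (single x 1))"
  shows "contraction \<delta> \<sigma> d X Y P Q S"
proof
  note l = graded_lin[OF d] graded_lin[OF P] graded_lin[OF Q] graded_lin[OF S]
  have l0: "lin (\<lambda>_. 0)" by (simp add: lin_def)
  show "graded \<delta> \<sigma> X X d" "graded \<delta> 0 X Y P" "graded \<delta> 0 Y X Q" "graded \<delta> (- \<sigma>) X X S" "Y \<subseteq> X" by fact+
  fix v :: "'k \<Rightarrow>\<^sub>0 rat" assume v: "keys v \<subseteq> X"
  show "d (d v) = 0" by (rule lin_eqI[OF lin_comp l0 _ v]) (rule l assms | assumption)+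
  show "P (d v) = 0" by (rule lin_eqI[OF lin_comp l0 _ v]) (rule l assms | assumption)+
  show "v - Q (P v) = d (S v) + S (d v)"
    by (rule lin_eqI[OF lin_minus[OF lin_id lin_comp] lin_plus[OF lin_comp lin_comp] _ v]) (rule l assms | assumption)+
next
  note l = graded_lin[OF d] graded_lin[OF P] graded_lin[OF Q] graded_lin[OF S]
  have l0: "lin (\<lambda>_. 0)" by (simp add: lin_def)
  fix v :: "'k \<Rightarrow>\<^sub>0 rat" assume v: "keys v \<subseteq> Y"
  show "d (Q v) = 0" by (rule lin_eqI[OF lin_comp l0 _ v]) (rule l assms | assumption)+
  show "P (Q v) = v" by (rule lin_eqI[OF lin_comp lin_id _ v]) (rule l assms | assumption)+
qed

text \<open>The product of chains on two disjoint vertex sets, with values in the chains of the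
  join. The sign sorts the vertices of \<open>U\<close> followed by those of \<open>W\<close> in the
  common order.\<close>

definition join_chain :: "'v rel \<Rightarrow> ('v set \<Rightarrow>\<^sub>0 rat) \<Rightarrow> ('v set \<Rightarrow>\<^sub>0 rat) \<Rightarrow> ('v set \<Rightarrow>\<^sub>0 rat)" where
  "join_chain r v w = lext (\<lambda>U. lext (\<lambda>W. single (U \<union> W) (esign r U W)) w) v"

lemma join_chain_single: "join_chain r (single U a) (single W b) = single (U \<union> W) (a * (b * esign r U W))"
  by (simp add: join_chain_def lext_single smul_single)

lemma lin_join_left: "lin (\<lambda>v. join_chain r v w)"
  unfolding join_chain_def by (rule lin_lext)

lemma lin_join_right: "lin (\<lambda>w. join_chain r v w)"
  by (rule linI) (simp_all add: join_chain_def lin_add[OF lin_lext] lin_smul[OF lin_lext] lext_add_fun lext_smul_fun)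

lemmas join_left = lin_add[OF lin_join_left] lin_smul[OF lin_join_left] lin_zero[OF lin_join_left]
lemmas join_right = lin_add[OF lin_join_right] lin_smul[OF lin_join_right] lin_zero[OF lin_join_right]

lemma keys_join_chain: "keys (join_chain r v w) \<subseteq> {U \<union> W | U W. U \<in> keys v \<and> W \<in> keys w}"
proof
  fix T assume "T \<in> keys (join_chain r v w)"
  then obtain U where U: "U \<in> keys v" "T \<in> keys (join_chain r (single U 1) w)"
    using lin_keys[OF lin_join_left] by metis
  then obtain W where "W \<in> keys w" "T \<in> keys (join_chain r (single U 1) (single W 1))"
    using lin_keys[OF lin_join_right] by metis
  then show "T \<in> {U \<union> W | U W. U \<in> keys v \<and> W \<in> keys w}"
    using U(1) by (auto simp: join_chain_single split: if_splits)
qed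

lemma join_eqI:
  assumes "\<And>w. lin (\<lambda>v. f v w)" "\<And>w. lin (\<lambda>v. g v w)" "\<And>v. lin (f v)" "\<And>v. lin (g v)"
    and "\<And>U W. U \<in> X \<Longrightarrow> W \<in> Y \<Longrightarrow> f (single U 1) (single W 1) = g (single U 1) (single W 1)"
    and "keys v \<subseteq> X" "keys w \<subseteq> Y"
  shows "f v w = g v w"
  by (rule lin_eqI[of "\<lambda>v. f v w" "\<lambda>v. g v w" X]) (use assms lin_eqI[of "f (single _ 1)" "g (single _ 1)" Y w] in auto)

lemma esign_square: "esign r U W * (esign r U W * x) = (x :: 'b::ring_1)"
  by (simp add: esign_def mult.assoc[symmetric] power_add[symmetric] flip: mult_2)

lemma psign_Un:
  assumes "finite U" "finite W" "U \<inter> W = {}"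
  shows "psign r (U \<union> W) t = psign r U t * (psign r W t :: 'b::comm_ring_1)"
proof -
  have "preceding r (U \<union> W) t = preceding r U t \<union> preceding r W t" "preceding r U t \<inter> preceding r W t = {}"
    using assms(3) by (auto simp: preceding_def)
  moreover have "finite (preceding r U t)" "finite (preceding r W t)" using assms by (auto simp: preceding_def)
  ultimately show ?thesis by (simp add: psign_def card_Un_disjoint power_add)
qed

text \<open>The vertices of \<open>W\<close> before \<open>t\<close> are counted twice, in the sign
  of removal and as inversions with \<open>t\<close>, and cancel.\<close>

lemma esign_left_removal:
  assumes "finite U" "finite W" "U \<inter> W = {}" "t \<in> U"
  shows "psign r (U \<union> W) t * esign r U W = psign r U t * (esign r (U - {t}) W :: 'b::comm_ring_1)"
proof -
  have "esign r (U - {t} \<union> {t}) W = esign r (U - {t}) W * (esign r {t} W :: 'b)"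
    by (rule esign_Un_left) (use assms in auto)
  moreover have "{(s, w). s \<in> {t} \<and> w \<in> W \<and> (w, s) \<in> r} = Pair t ` preceding r W t"
    by (auto simp: preceding_def)
  then have "esign r {t} W = (psign r W t :: 'b)" by (simp add: esign_def psign_def card_image inj_on_def)
  moreover have "U - {t} \<union> {t} = U" using assms(4) by auto
  ultimately have e: "esign r U W = esign r (U - {t}) W * (psign r W t :: 'b)" by simp
  have "psign r (U \<union> W) t * esign r U W = psign r U t * (psign r W t * (psign r W t * (esign r (U - {t}) W :: 'b)))"
    unfolding psign_Un[OF assms(1-3)] e by (simp only: mult_ac)
  then show ?thesis by (simp only: psign_square)
qed

text \<open>Each vertex of \<open>U\<close> is counted once: in the sign of removal if it precedes
  \<open>t\<close>, as an inversion if it follows \<open>t\<close>. This gives the Koszul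
  sign.\<close>

lemma esign_right_removal:
  assumes "strict_linear_order_on V r" "U \<subseteq> V" "W \<subseteq> V" "finite U" "finite W" "U \<inter> W = {}" "t \<in> W"
  shows "psign r (U \<union> W) t * esign r U W = (- 1) ^ card U * (psign r W t * (esign r U (W - {t}) :: 'b::comm_ring_1))"
proof -
  have "esign r U (W - {t} \<union> {t}) = esign r U (W - {t}) * (esign r U {t} :: 'b)"
    by (rule esign_Un_right) (use assms in auto)
  moreover have "W - {t} \<union> {t} = W" using assms(7) by auto
  ultimately have e: "esign r U W = esign r U (W - {t}) * (esign r U {t} :: 'b)" by simp
  have tot: "(u, t) \<in> r \<longleftrightarrow> (t, u) \<notin> r" if "u \<in> U" for u
  proof -
    have "u \<in> V" "t \<in> V" "u \<noteq> t" using assms(2,3,6,7) that by auto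
    moreover have "irrefl r" "trans r" "total_on V r" using assms(1) by (auto simp: strict_linear_order_on_def)
    ultimately show ?thesis unfolding irrefl_def trans_def total_on_def by blast
  qed
  let ?L = "{u\<in>U. (t, u) \<in> r}"
  have "{(s, w). s \<in> U \<and> w \<in> {t} \<and> (w, s) \<in> r} = (\<lambda>u. (u, t)) ` ?L" by auto
  then have "esign r U {t} = ((- 1) ^ card ?L :: 'b)" by (simp add: esign_def card_image inj_on_def)
  moreover have "U = ?L \<union> preceding r U t" "?L \<inter> preceding r U t = {}" using tot by (auto simp: preceding_def)
  then have "card U = card ?L + card (preceding r U t)"
    using assms(4) by (metis card_Un_disjoint finite_Un)
  ultimately have s: "esign r U {t} * psign r U t = ((- 1) ^ card U :: 'b)" by (simp add: psign_def power_add)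
  show ?thesis unfolding psign_Un[OF assms(4-6)] e s[symmetric] by (simp only: mult_ac)
qed

text \<open>\<open>A\<close> and \<open>B\<close> are the vertices that may be removed: all vertices
  for the simplicial boundary, but no factor for the differential of \<open>CM\<close>.\<close>

lemma join_leibniz:
  assumes "strict_linear_order_on V r" "U \<subseteq> V" "W \<subseteq> V" "finite U" "finite W" "U \<inter> W = {}" "A \<subseteq> U" "B \<subseteq> W"
  shows "(\<Sum>t\<in>A \<union> B. single (U \<union> W - {t}) (psign r (U \<union> W) t * esign r U W)) =
    join_chain r (\<Sum>t\<in>A. single (U - {t}) (psign r U t)) (single W 1)
    + smul ((- 1) ^ card U) (join_chain r (single U 1) (\<Sum>t\<in>B. single (W - {t}) (psign r W t)))"
proof -
  have fin: "finite A" "finite B" "A \<inter> B = {}" using assms finite_subset by blast+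
  have "(\<Sum>t\<in>A. single (U \<union> W - {t}) (psign r (U \<union> W) t * esign r U W))
      = join_chain r (\<Sum>t\<in>A. single (U - {t}) (psign r U t)) (single W 1)"
    unfolding lin_sum[OF lin_join_left]
  proof (rule sum.cong[OF refl])
    fix t assume t: "t \<in> A"
    then have "U \<union> W - {t} = (U - {t}) \<union> W" using assms by auto
    moreover have "psign r (U \<union> W) t * esign r U W = psign r U t * (esign r (U - {t}) W :: rat)"
      by (rule esign_left_removal) (use t assms in auto)
    ultimately show "single (U \<union> W - {t}) (psign r (U \<union> W) t * esign r U W :: rat)
        = join_chain r (single (U - {t}) (psign r U t)) (single W 1)"
      by (simp add: join_chain_single)
  qed
  moreover have "(\<Sum>t\<in>B. single (U \<union> W - {t}) (psign r (U \<union> W) t * esign r U W))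
      = smul ((- 1) ^ card U) (join_chain r (single U 1) (\<Sum>t\<in>B. single (W - {t}) (psign r W t)))"
    unfolding lin_sum[OF lin_join_right] smul_sum
  proof (rule sum.cong[OF refl])
    fix t assume t: "t \<in> B"
    then have "U \<union> W - {t} = U \<union> (W - {t})" using assms by auto
    moreover have "psign r (U \<union> W) t * esign r U W = (- 1) ^ card U * (psign r W t * (esign r U (W - {t}) :: rat))"
      by (rule esign_right_removal[OF assms(1-6)]) (use t assms in auto)
    ultimately show "single (U \<union> W - {t}) (psign r (U \<union> W) t * esign r U W :: rat)
        = smul ((- 1) ^ card U) (join_chain r (single U 1) (single (W - {t}) (psign r W t)))"
      by (simp add: join_chain_single smul_single)
  qed
  ultimately show ?thesis using fin by (simp add: sum.union_disjoint)
qed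

definition join_sets :: "'v set set \<Rightarrow> 'v set set \<Rightarrow> 'v set set" where
  "join_sets K L = {U \<union> W | U W. U \<in> K \<and> W \<in> L}"

text \<open>The tensor product of \<open>A\<close> and \<open>B\<close>, without Koszul sign, on the
  chains of the join: a simplex is split along \<open>V1\<close> and \<open>V2\<close>, and its
  sorting sign is undone first.\<close>

definition join_map :: "'v rel \<Rightarrow> 'v set \<Rightarrow> 'v set \<Rightarrow> (('v set \<Rightarrow>\<^sub>0 rat) \<Rightarrow> ('v set \<Rightarrow>\<^sub>0 rat)) \<Rightarrow>
    (('v set \<Rightarrow>\<^sub>0 rat) \<Rightarrow> ('v set \<Rightarrow>\<^sub>0 rat)) \<Rightarrow> ('v set \<Rightarrow>\<^sub>0 rat) \<Rightarrow> ('v set \<Rightarrow>\<^sub>0 rat)" where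
  "join_map r V1 V2 A B = lext (\<lambda>T. smul (esign r (T \<inter> V1) (T \<inter> V2))
     (join_chain r (A (single (T \<inter> V1) 1)) (B (single (T \<inter> V2) 1))))"

lemma join_map_chain:
  assumes "V1 \<inter> V2 = {}" "lin A" "lin B" "keys v \<subseteq> Pow V1" "keys w \<subseteq> Pow V2"
  shows "join_map r V1 V2 A B (join_chain r v w) = join_chain r (A v) (B w)"
proof (rule join_eqI[where X="Pow V1" and Y="Pow V2" and f="\<lambda>v w. join_map r V1 V2 A B (join_chain r v w)"
      and g="\<lambda>v w. join_chain r (A v) (B w)"])
  show "lin (\<lambda>v. join_map r V1 V2 A B (join_chain r v w))" for w
    unfolding join_map_def by (rule lin_comp[OF lin_join_left lin_lext])
  show "lin (\<lambda>w. join_map r V1 V2 A B (join_chain r v w))" for v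
    unfolding join_map_def by (rule lin_comp[OF lin_join_right lin_lext])
  show "lin (\<lambda>v. join_chain r (A v) (B w))" for w by (rule lin_comp[OF assms(2) lin_join_left])
  show "lin (\<lambda>w. join_chain r (A v) (B w))" for v by (rule lin_comp[OF assms(3) lin_join_right])
  fix U W assume "U \<in> Pow V1" "W \<in> Pow V2"
  then have "(U \<union> W) \<inter> V1 = U" "(U \<union> W) \<inter> V2 = W" using assms(1) by auto
  then show "join_map r V1 V2 A B (join_chain r (single U 1) (single W 1)) = join_chain r (A (single U 1)) (B (single W 1))"
    unfolding join_chain_single join_map_def lext_single using esign_square[of r U W "1::rat"] by (simp add: smul_smul)
qed fact+

lemma graded_join_map:
  assumes V: "V1 \<inter> V2 = {}" "finite V1" "finite V2" and K: "K1 \<subseteq> Pow V1" "K2 \<subseteq> Pow V2" and L: "L1 \<subseteq> Pow V1" "L2 \<subseteq> Pow V2"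
    and A: "graded (\<lambda>U. int (card U)) \<tau>1 K1 L1 A" and B: "graded (\<lambda>U. int (card U)) \<tau>2 K2 L2 B"
  shows "graded (\<lambda>U. int (card U)) (\<tau>1 + \<tau>2) (join_sets K1 K2) (join_sets L1 L2) (join_map r V1 V2 A B)"
proof (rule gradedI)
  show "lin (join_map r V1 V2 A B)" unfolding join_map_def by (rule lin_lext)
  have card: "int (card (U \<union> W)) = int (card U) + int (card W)" if "U \<subseteq> V1" "W \<subseteq> V2" for U W
    using that V by (subst card_Un_disjoint) (auto intro: finite_subset)
  fix T T' assume T: "T \<in> join_sets K1 K2" and T': "T' \<in> keys (join_map r V1 V2 A B (single T 1))"
  obtain U W where UW: "T = U \<union> W" "U \<in> K1" "W \<in> K2" using T unfolding join_sets_def by auto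
  have sub: "U \<subseteq> V1" "W \<subseteq> V2" using UW K by auto
  have int: "T \<inter> V1 = U" "T \<inter> V2 = W" using sub V(1) UW(1) by auto
  have "T' \<in> keys (join_chain r (A (single U 1)) (B (single W 1)))"
    using T' unfolding join_map_def lext_single_one int by (rule subsetD[OF keys_smul])
  from subsetD[OF keys_join_chain this]
  obtain U' W' where t: "T' = U' \<union> W'" "U' \<in> keys (A (single U 1))" "W' \<in> keys (B (single W 1))" by auto
  have u: "U' \<in> L1" "int (card U') = int (card U) + \<tau>1" using gradedD[OF A UW(2) t(2)] by simp_all
  have w: "W' \<in> L2" "int (card W') = int (card W) + \<tau>2" using gradedD[OF B UW(3) t(3)] by simp_all
  have sub': "U' \<subseteq> V1" "W' \<subseteq> V2" using u(1) w(1) L by auto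
  show "T' \<in> join_sets L1 L2 \<and> int (card T') = int (card T) + (\<tau>1 + \<tau>2)"
    using u w unfolding t(1) UW(1) card[OF sub] card[OF sub'] join_sets_def by auto
qed

text \<open>The tensor product of two contractions. \<open>P\<close> and \<open>Q\<close> are
  products; the homotopy is \<open>S1\<close> times \<open>Q2 P2\<close> plus, with the Koszul sign
  \<open>\<alpha>\<close>, the identity times \<open>S2\<close>.\<close>

lemma contraction_join:
  fixes V1 V2 :: "'v set"
  assumes V: "V1 \<inter> V2 = {}" "finite V1" "finite V2" and K: "K1 \<subseteq> Pow V1" "K2 \<subseteq> Pow V2"
    and c1: "contraction (\<lambda>U. int (card U)) (- 1) d1 K1 H1 P1 Q1 S1"
    and c2: "contraction (\<lambda>U. int (card U)) (- 1) d2 K2 H2 P2 Q2 S2"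
    and d: "lin d" "\<And>U W. U \<in> K1 \<Longrightarrow> W \<in> K2 \<Longrightarrow> d (join_chain r (single U 1) (single W 1)) =
      join_chain r (d1 (single U 1)) (single W 1) + smul ((- 1) ^ card U) (join_chain r (single U 1) (d2 (single W 1)))"
  shows "\<exists>P Q S. contraction (\<lambda>U. int (card U)) (- 1) d (join_sets K1 K2) (join_sets H1 H2) P Q S"
proof -
  interpret A: contraction "\<lambda>U. int (card U)" "- 1" d1 K1 H1 P1 Q1 S1 by (rule c1)
  interpret B: contraction "\<lambda>U. int (card U)" "- 1" d2 K2 H2 P2 Q2 S2 by (rule c2)
  let ?j = "join_chain r" and ?m = "join_map r V1 V2" and ?K = "join_sets K1 K2" and ?H = "join_sets H1 H2"
  let ?\<delta> = "\<lambda>U :: 'v set. int (card U)"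
  have H: "H1 \<subseteq> Pow V1" "H2 \<subseteq> Pow V2" using K A.subset B.subset by auto
  have m: "?m F F' (?j v w) = ?j (F v) (F' w)" if "lin F" "lin F'" "keys v \<subseteq> K1" "keys w \<subseteq> K2" for F F' v w
    by (rule join_map_chain[OF V(1) that(1,2)]) (use that K in auto)
  have mH: "?m F F' (?j v w) = ?j (F v) (F' w)" if "lin F" "lin F'" "keys v \<subseteq> H1" "keys w \<subseteq> H2" for F F' v w
    by (rule join_map_chain[OF V(1) that(1,2)]) (use that H in auto)
  have linm: "lin (?m F F')" for F F' unfolding join_map_def by (rule lin_lext)
  \<comment> \<open>On chains the Koszul sign makes sense only if all simplices of \<open>v\<close>
    have the same parity; \<open>s\<close> is their common sign. By \<open>sg\<close> it is reversed
    under \<open>d1\<close> and \<open>S1\<close>.\<close>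
  have dj: "d (?j v w) = ?j (d1 v) w + smul s (?j v (d2 w))"
    if "\<And>U. U \<in> keys v \<Longrightarrow> (- 1) ^ card U = s" "keys v \<subseteq> K1" "keys w \<subseteq> K2" for v w and s :: rat
  proof (rule join_eqI[where X="keys v" and Y=K2 and f="\<lambda>v w. d (?j v w)" and g="\<lambda>v w. ?j (d1 v) w + smul s (?j v (d2 w))"])
    show "lin (\<lambda>v. d (?j v w))" for w by (rule lin_comp[OF lin_join_left d(1)])
    show "lin (\<lambda>w. d (?j v w))" for v by (rule lin_comp[OF lin_join_right d(1)])
    show "lin (\<lambda>v. ?j (d1 v) w + smul s (?j v (d2 w)))" for w
      by (rule lin_plus[OF lin_comp[OF A.lin_d lin_join_left] lin_comp[OF lin_join_left lin_scale]])
    show "lin (\<lambda>w. ?j (d1 v) w + smul s (?j v (d2 w)))" for v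
      by (rule lin_plus[OF lin_join_right lin_comp[OF lin_comp[OF B.lin_d lin_join_right] lin_scale]])
    fix U W assume "U \<in> keys v" "W \<in> K2"
    then show "d (?j (single U 1) (single W 1)) = ?j (d1 (single U 1)) (single W 1) + smul s (?j (single U 1) (d2 (single W 1)))"
      using d(2)[of U W] that(1)[of U] that(2) by auto
  qed (use that in auto)
  define \<alpha> where "\<alpha> = lext (\<lambda>U :: 'v set. single U ((- 1) ^ card U))"
  have lina: "lin \<alpha>" unfolding \<alpha>_def by (rule lin_lext)
  have alpha: "\<alpha> v = smul s v" if "\<And>U. U \<in> keys v \<Longrightarrow> (- 1) ^ card U = s" for v s
    by (rule lin_eqI[OF lina lin_scale _ order_refl]) (use that in \<open>simp add: \<alpha>_def smul_single\<close>)
  have gra: "graded ?\<delta> 0 K1 K1 \<alpha>" by (rule gradedI[OF lina]) (auto simp: \<alpha>_def split: if_splits)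
  define P where "P = ?m P1 P2"
  define Q where "Q = ?m Q1 Q2"
  define S where "S v = ?m S1 (\<lambda>w. Q2 (P2 w)) v + ?m \<alpha> S2 v" for v
  have lQP: "lin (\<lambda>w. Q2 (P2 w))" by (rule lin_comp[OF B.lin_P B.lin_Q])
  have linS: "lin S" unfolding S_def by (rule lin_plus[OF linm linm])
  have linP: "lin P" and linQ: "lin Q" unfolding P_def Q_def by (rule linm)+
  have Pj: "P (?j v w) = ?j (P1 v) (P2 w)" if "keys v \<subseteq> K1" "keys w \<subseteq> K2" for v w
    unfolding P_def by (rule m[OF A.lin_P B.lin_P that])
  have Qj: "Q (?j v w) = ?j (Q1 v) (Q2 w)" if "keys v \<subseteq> H1" "keys w \<subseteq> H2" for v w
    unfolding Q_def by (rule mH[OF A.lin_Q B.lin_Q that])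
  have Sj: "S (?j v w) = ?j (S1 v) (Q2 (P2 w)) + smul s (?j v (S2 w))"
    if "\<And>U. U \<in> keys v \<Longrightarrow> (- 1) ^ card U = s" "keys v \<subseteq> K1" "keys w \<subseteq> K2" for v w s
  proof -
    have "\<alpha> v = smul s v" by (rule alpha) (fact that)
    then show ?thesis unfolding S_def m[OF A.lin_S lQP that(2,3)] m[OF lina B.lin_S that(2,3)] by (simp add: join_left)
  qed
  have flip: "(- 1 :: rat) ^ card U' = - ((- 1) ^ card U)" if "int (card U') = int (card U) + 1 \<or> int (card U') = int (card U) - 1" for U' U :: "'v set"
  proof -
    have "card U' = Suc (card U) \<or> card U = Suc (card U')" using that by linarith
    then show ?thesis by auto
  qed
  have lind: "lin d" by (rule d(1))
  have key: "T = U \<union> W \<Longrightarrow> single T (1::rat) = smul (esign r U W) (?j (single U 1) (single W 1))" for T U W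
    using esign_square[of r U W "1::rat"] by (simp add: join_chain_single smul_single)
  have split: "f (single T 1) = g (single T 1)" if lf: "lin f" and lg: "lin g" and T: "T \<in> ?K"
    and fg: "\<And>U W. U \<in> K1 \<Longrightarrow> W \<in> K2 \<Longrightarrow> f (?j (single U 1) (single W 1)) = g (?j (single U 1) (single W 1))"
    for f g :: "('v set \<Rightarrow>\<^sub>0 rat) \<Rightarrow> ('v set \<Rightarrow>\<^sub>0 rat)" and T
  proof -
    obtain U W where "T = U \<union> W" "U \<in> K1" "W \<in> K2" using T unfolding join_sets_def by auto
    then show ?thesis using fg[of U W] by (simp only: key lin_smul[OF lf] lin_smul[OF lg])
  qed
  have splitH: "f (single T 1) = g (single T 1)" if lf: "lin f" and lg: "lin g" and T: "T \<in> ?H"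
    and fg: "\<And>U W. U \<in> H1 \<Longrightarrow> W \<in> H2 \<Longrightarrow> f (?j (single U 1) (single W 1)) = g (?j (single U 1) (single W 1))"
    for f g :: "('v set \<Rightarrow>\<^sub>0 rat) \<Rightarrow> ('v set \<Rightarrow>\<^sub>0 rat)" and T
  proof -
    obtain U W where "T = U \<union> W" "U \<in> H1" "W \<in> H2" using T unfolding join_sets_def by auto
    then show ?thesis using fg[of U W] by (simp only: key lin_smul[OF lf] lin_smul[OF lg])
  qed
  have l0: "lin (\<lambda>_ :: 'v set \<Rightarrow>\<^sub>0 rat. 0 :: 'v set \<Rightarrow>\<^sub>0 rat)" by (simp add: lin_def)
  have sg: "(- 1) ^ card U' = (- ((- 1) ^ card U) :: rat)" if "U \<in> K1" "U' \<in> keys (d1 (single U 1)) \<or> U' \<in> keys (S1 (single U 1))" for U U'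
    using that(2) gradedD[OF A.graded_d that(1), of U'] gradedD[OF A.graded_S that(1), of U'] by (intro flip) auto
  have "contraction ?\<delta> (- 1) d ?K ?H P Q S"
  proof (rule contraction_singleI)
    show "graded ?\<delta> 0 ?K ?H P" unfolding P_def
      using graded_join_map[OF V K H A.graded_P B.graded_P] by simp
    show "graded ?\<delta> 0 ?H ?K Q" unfolding Q_def
      using graded_join_map[OF V H K A.graded_Q B.graded_Q] by simp
    have "graded ?\<delta> 0 K2 K2 (\<lambda>w. Q2 (P2 w))" using graded_comp[OF B.graded_P B.graded_Q] by simp
    from graded_join_map[OF V K K A.graded_S this] graded_join_map[OF V K K gra B.graded_S]
    show "graded ?\<delta> (- (- 1)) ?K ?K S" unfolding S_def by (intro graded_plus) simp_all
    show "?H \<subseteq> ?K" using A.subset B.subset by (auto simp: join_sets_def)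
  next
    \<comment> \<open>\<open>d\<close> agrees on the join with a sum of two product maps, from which
      its grading follows.\<close>
    have e: "d (single T 1) = (\<lambda>v. ?m d1 (\<lambda>w. w) v + ?m \<alpha> d2 v) (single T 1)" if "T \<in> ?K" for T
    proof (rule split[OF lind _ that])
      show "lin (\<lambda>v. ?m d1 (\<lambda>w. w) v + ?m \<alpha> d2 v)" by (rule lin_plus[OF linm linm])
      fix U W assume UW: "U \<in> K1" "W \<in> K2"
      then have k: "keys (single U (1::rat)) \<subseteq> K1" "keys (single W (1::rat)) \<subseteq> K2" by auto
      show "d (?j (single U 1) (single W 1)) = ?m d1 (\<lambda>w. w) (?j (single U 1) (single W 1)) + ?m \<alpha> d2 (?j (single U 1) (single W 1))"
      proof -
        have "\<alpha> (single U 1) = smul ((- 1) ^ card U) (single U 1)" by (simp add: \<alpha>_def smul_single)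
        then show ?thesis unfolding m[OF A.lin_d lin_id k] m[OF lina B.lin_d k] d(2)[OF UW] by (simp only: join_left)
      qed
    qed
    have "graded ?\<delta> (- 1) ?K ?K (\<lambda>v. ?m d1 (\<lambda>w. w) v + ?m \<alpha> d2 v)"
      using graded_join_map[OF V K K A.graded_d graded_id[OF order_refl]] graded_join_map[OF V K K gra B.graded_d]
      by (intro graded_plus) simp_all
    then show "graded ?\<delta> (- 1) ?K ?K d" using e lind unfolding graded_def by simp
  next
    fix T assume T: "T \<in> ?K"
    show "d (d (single T 1)) = 0"
    proof (rule split[OF lin_comp[OF lind lind] l0 T])
      fix U W assume UW: "U \<in> K1" "W \<in> K2"
      then have k: "keys (single U (1::rat)) \<subseteq> K1" "keys (single W (1::rat)) \<subseteq> K2" by auto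
      note k' = A.keys_d[OF k(1)] B.keys_d[OF k(2)]
      have "d (?j (d1 (single U 1)) (single W 1)) = ?j (d1 (d1 (single U 1))) (single W 1)
          + smul (- ((- 1) ^ card U)) (?j (d1 (single U 1)) (d2 (single W 1)))"
        by (rule dj[OF sg k'(1) k(2)]) (use UW in auto)
      moreover have "d (?j (single U 1) (d2 (single W 1))) = ?j (d1 (single U 1)) (d2 (single W 1))
          + smul ((- 1) ^ card U) (?j (single U 1) (d2 (d2 (single W 1))))"
        by (rule dj[OF _ k(1) k'(2)]) auto
      ultimately show "d (d (?j (single U 1) (single W 1))) = 0"
        unfolding d(2)[OF UW] using A.d_d[OF k(1)] B.d_d[OF k(2)]
        by (simp add: lin_add[OF lind] lin_smul[OF lind] join_left join_right smul_minus_left)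
    qed
    show "P (d (single T 1)) = 0"
    proof (rule split[OF lin_comp[OF lind linP] l0 T])
      fix U W assume UW: "U \<in> K1" "W \<in> K2"
      then have k: "keys (single U (1::rat)) \<subseteq> K1" "keys (single W (1::rat)) \<subseteq> K2" by auto
      show "P (d (?j (single U 1) (single W 1))) = 0"
        unfolding d(2)[OF UW] using A.P_d[OF k(1)] B.P_d[OF k(2)]
        by (simp only: lin_add[OF linP] lin_smul[OF linP] Pj[OF A.keys_d[OF k(1)] k(2)] Pj[OF k(1) B.keys_d[OF k(2)]]
            join_left join_right smul_zero add_0)
    qed
    show "single T 1 - Q (P (single T 1)) = d (S (single T 1)) + S (d (single T 1))"
    proof (rule split[OF lin_minus[OF lin_id lin_comp[OF linP linQ]] lin_plus[OF lin_comp[OF linS lind] lin_comp[OF lind linS]] T])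
      fix U W assume UW: "U \<in> K1" "W \<in> K2"
      let ?u = "single U (1::rat)" and ?w = "single W (1::rat)" and ?s = "(- 1) ^ card U :: rat"
      have k: "keys ?u \<subseteq> K1" "keys ?w \<subseteq> K2" using UW by auto
      note kd = A.keys_d[OF k(1)] B.keys_d[OF k(2)] and kS = A.keys_S[OF k(1)] B.keys_S[OF k(2)]
      have kqp: "keys (Q2 (P2 ?w)) \<subseteq> K2" by (rule B.keys_Q[OF B.keys_P[OF k(2)]])
      have su: "(- 1) ^ card U' = ?s" if "U' \<in> keys ?u" for U' using that by simp
      have sq: "smul ?s (smul ?s x) = x" for x :: "'v set \<Rightarrow>\<^sub>0 rat"
        by (simp add: smul_smul minus_one_power_iff)
      have dS: "d (S (?j ?u ?w)) = ?j (d1 (S1 ?u)) (Q2 (P2 ?w)) + smul ?s (?j (d1 ?u) (S2 ?w)) + ?j ?u (d2 (S2 ?w))"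
      proof -
        have "d (?j (S1 ?u) (Q2 (P2 ?w))) = ?j (d1 (S1 ?u)) (Q2 (P2 ?w)) + smul (- ?s) (?j (S1 ?u) (d2 (Q2 (P2 ?w))))"
          by (rule dj[OF sg kS(1) kqp]) (use UW in auto)
        moreover have "d (?j ?u (S2 ?w)) = ?j (d1 ?u) (S2 ?w) + smul ?s (?j ?u (d2 (S2 ?w)))"
          by (rule dj[OF su k(1) kS(2)])
        moreover have "S (?j ?u ?w) = ?j (S1 ?u) (Q2 (P2 ?w)) + smul ?s (?j ?u (S2 ?w))" by (rule Sj[OF su k])
        ultimately show ?thesis
          by (simp only: lin_add[OF lind] lin_smul[OF lind] B.d_Q[OF B.keys_P[OF k(2)]] join_right smul_add sq
              smul_zero add_0_right add.assoc)
      qed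
      have Sd: "S (d (?j ?u ?w)) = ?j (S1 (d1 ?u)) (Q2 (P2 ?w)) - smul ?s (?j (d1 ?u) (S2 ?w)) + ?j ?u (S2 (d2 ?w))"
      proof -
        have "S (?j (d1 ?u) ?w) = ?j (S1 (d1 ?u)) (Q2 (P2 ?w)) + smul (- ?s) (?j (d1 ?u) (S2 ?w))"
          by (rule Sj[OF sg kd(1) k(2)]) (use UW in auto)
        moreover have "S (?j ?u (d2 ?w)) = ?j (S1 ?u) (Q2 (P2 (d2 ?w))) + smul ?s (?j ?u (S2 (d2 ?w)))"
          by (rule Sj[OF su k(1) kd(2)])
        ultimately show ?thesis unfolding d(2)[OF UW]
          by (simp only: lin_add[OF linS] lin_smul[OF linS] B.P_d[OF k(2)] lin_zero[OF B.lin_Q] join_right smul_add sq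
              smul_minus_left add_0 diff_conv_add_uminus)
      qed
      \<comment> \<open>The mixed terms with \<open>d1\<close> and \<open>S2\<close> in
        \<open>dS\<close> and \<open>Sd\<close> cancel. The two homotopy formulas then telescope
        through the product of \<open>?u\<close> with \<open>Q2 (P2 ?w)\<close>.\<close>
      have "?j (d1 (S1 ?u)) (Q2 (P2 ?w)) + ?j (S1 (d1 ?u)) (Q2 (P2 ?w)) = ?j (?u - Q1 (P1 ?u)) (Q2 (P2 ?w))"
        unfolding A.homotopy[OF k(1)] by (simp only: join_left)
      moreover have "?j ?u (d2 (S2 ?w)) + ?j ?u (S2 (d2 ?w)) = ?j ?u (?w - Q2 (P2 ?w))"
        unfolding B.homotopy[OF k(2)] by (simp only: join_right)
      moreover have "Q (P (?j ?u ?w)) = ?j (Q1 (P1 ?u)) (Q2 (P2 ?w))"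
        by (simp only: Pj[OF k] Qj[OF A.keys_P[OF k(1)] B.keys_P[OF k(2)]])
      ultimately show "?j ?u ?w - Q (P (?j ?u ?w)) = d (S (?j ?u ?w)) + S (d (?j ?u ?w))"
        unfolding dS Sd lin_diff[OF lin_join_left] lin_diff[OF lin_join_right] by (simp add: algebra_simps)
    qed
  next
    fix T assume T: "T \<in> ?H"
    show "P (Q (single T 1)) = single T 1"
    proof (rule splitH[OF lin_comp[OF linQ linP] lin_id T])
      fix U W assume "U \<in> H1" "W \<in> H2"
      then have k: "keys (single U (1::rat)) \<subseteq> H1" "keys (single W (1::rat)) \<subseteq> H2" by auto
      show "P (Q (?j (single U 1) (single W 1))) = ?j (single U 1) (single W 1)"
        by (simp only: Qj[OF k] Pj[OF A.keys_Q[OF k(1)] B.keys_Q[OF k(2)]] A.P_Q[OF k(1)] B.P_Q[OF k(2)])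
    qed
    show "d (Q (single T 1)) = 0"
    proof (rule splitH[OF lin_comp[OF linQ lind] l0 T])
      fix U W assume "U \<in> H1" and W: "W \<in> H2"
      then have U: "U \<in> H1" by simp
      then have k: "keys (single U (1::rat)) \<subseteq> H1" "keys (single W (1::rat)) \<subseteq> H2" using W by auto
      have "d (?j (Q1 (single U 1)) (Q2 (single W 1))) = ?j (d1 (Q1 (single U 1))) (Q2 (single W 1))
          + smul ((- 1) ^ card U) (?j (Q1 (single U 1)) (d2 (Q2 (single W 1))))"
        by (rule dj[OF _ A.keys_Q[OF k(1)] B.keys_Q[OF k(2)]]) (use gradedD[OF A.graded_Q U] in auto)
      then show "d (Q (?j (single U 1) (single W 1))) = 0"
        unfolding Qj[OF k] by (simp add: A.d_Q[OF k(1)] B.d_Q[OF k(2)] join_left join_right)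
    qed
  qed
  then show ?thesis by blast
qed

section \<open>Critical nested sets\<close>

lemma bdry_lext: "bdry r P c v = lext (\<lambda>T. \<Sum>t\<in>P T. single (T - {t}) (psign r T t * c t)) v"
  by (simp add: bdry_def lext_def smul_sum smul_single mult.commute)

lemma lin_bdry: "lin (bdry r P c)"
  using lin_lext[of "\<lambda>T. \<Sum>t\<in>P T. single (T - {t}) (psign r T t * c t)"] by (simp add: lin_def bdry_lext)

lemma lin_simplicial_boundary: "lin (simplicial_boundary r)"
  using lin_bdry[of r "\<lambda>T. T" "\<lambda>_. 1"] by (simp add: lin_def simplicial_boundary_bdry)

lemma lin_CM_d: "lin (CM_d r)"
  using lin_bdry[of r "\<lambda>T. T - max_elements T" "\<lambda>_. 1"] by (simp add: lin_def CM_d_bdry)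

lemma keys_simplicial_boundary: "keys (simplicial_boundary r (single U 1)) \<subseteq> (\<lambda>t. U - {t}) ` U"
  unfolding simplicial_boundary_bdry bdry_single by (rule keys_sum_subset) auto

lemma graded_simplicial_boundary:
  assumes "\<And>U. U \<in> K \<Longrightarrow> finite U" "\<And>U t. U \<in> K \<Longrightarrow> U - {t} \<in> K"
  shows "graded (\<lambda>U. int (card U)) (- 1) K K (simplicial_boundary r)"
proof (rule gradedI[OF lin_simplicial_boundary])
  fix U T assume U: "U \<in> K" and T: "T \<in> keys (simplicial_boundary r (single U 1))"
  from subsetD[OF keys_simplicial_boundary T] obtain t where t: "t \<in> U" "T = U - {t}" by auto
  then have "card U = Suc (card T)" using card_Suc_Diff1[OF assms(1)[OF U] t(1)] by simp
  then show "T \<in> K \<and> int (card T) = int (card U) + - 1" using assms(2)[OF U] t(2) by simp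
qed

lemma contraction_point: "contraction \<delta> \<sigma> (\<lambda>_. 0) X X (\<lambda>v. v) (\<lambda>v. v) (\<lambda>_. 0)"
  by unfold_locales (auto intro: graded_id graded_zero)

lemma (in contraction) homology_free_on:
  "\<exists>\<psi>. free_on (homology_at (free_module X) d {v. keys v \<subseteq> {x\<in>X. \<delta> x + \<sigma> \<in> D}} {v. keys v \<subseteq> {x\<in>X. \<delta> x \<in> D}})
     {y\<in>Y. \<delta> y \<in> D} \<psi>"
proof (rule homology_free[where \<phi>=P]; (simp only: free_module_simps mem_Collect_eq)?)
  fix u v :: "'k \<Rightarrow>\<^sub>0 rat"
  assume uv: "keys u \<subseteq> {x\<in>X. \<delta> x \<in> D}" "keys v \<subseteq> {x\<in>X. \<delta> x \<in> D}" "d u = 0" "d v = 0"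
  show "keys (u + v) \<subseteq> {x\<in>X. \<delta> x \<in> D} \<and> d (u + v) = 0 \<and> P (u + v) = P u + P v"
    using uv keys_add[of u v] by (auto simp: lin_add[OF lin_d] lin_add[OF lin_P])
  show "\<exists>h\<in>{v. keys v \<subseteq> {x\<in>X. \<delta> x \<in> D}}. d h = 0 \<and> h + v = u"
    using uv keys_diff[of u v] by (intro bexI[of _ "u - v"]) (auto simp: lin_diff[OF lin_d])
next
  fix c and v :: "'k \<Rightarrow>\<^sub>0 rat"
  assume "keys v \<subseteq> {x\<in>X. \<delta> x \<in> D}" "d v = 0"
  then show "keys (smul c v) \<subseteq> {x\<in>X. \<delta> x \<in> D} \<and> d (smul c v) = 0 \<and> P (smul c v) = smul c (P v)"
    using keys_smul[of c v] by (auto simp: lin_smul[OF lin_d] lin_smul[OF lin_P])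
next
  show "P ` {z. keys z \<subseteq> {x\<in>X. \<delta> x \<in> D} \<and> d z = 0} = {w. keys w \<subseteq> {y\<in>Y. \<delta> y \<in> D}}" by (rule image_cycles)
  show "d ` {v. keys v \<subseteq> {x\<in>X. \<delta> x + \<sigma> \<in> D}} = {v. keys v \<subseteq> {x\<in>X. \<delta> x \<in> D} \<and> d v = 0 \<and> P v = 0}" by (rule boundaries)
qed

text \<open>Applied to a fibre of \<open>jn\<close>, where the bidegree is an affine function of the
  cardinality.\<close>

lemma contraction_regrade:
  fixes \<delta> :: "'k \<Rightarrow> 'g::ab_group_add" and \<delta>' :: "'k \<Rightarrow> 'h::ab_group_add"
  assumes c: "contraction \<delta> \<sigma> d X Y P Q S"
    and h: "\<And>x y \<tau>. x \<in> X \<Longrightarrow> y \<in> X \<Longrightarrow> \<delta> y = \<delta> x + \<tau> \<Longrightarrow> \<delta>' y = \<delta>' x + h \<tau>" "h 0 = 0" "h (- \<sigma>) = - h \<sigma>"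
  shows "contraction \<delta>' (h \<sigma>) d X Y P Q S"
proof -
  interpret contraction \<delta> \<sigma> d X Y P Q S by (rule c)
  have g: "graded \<delta>' (h \<tau>) A B f" if "graded \<delta> \<tau> A B f" "A \<subseteq> X" "B \<subseteq> X" for \<tau> A B f
    using that h(1) unfolding graded_def by blast
  show ?thesis
    using g[OF graded_d] g[OF graded_P] g[OF graded_Q] g[OF graded_S] subset h(2,3) d_d P_Q d_Q P_d homotopy
    by unfold_locales auto
qed

text \<open>The blocks are the fibres of \<open>\<tau>\<close>. Maps given on the blocks are glued
  by their values on basis vectors, and on chains of one block the glued map is the given
  one.\<close>

lemma contraction_partition:
  fixes \<delta> :: "'k \<Rightarrow> 'g::ab_group_add" and \<tau> :: "'k \<Rightarrow> 'j"
  assumes lin: "lin d" and sub: "Y \<subseteq> X"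
    and c: "\<And>f. f \<in> \<tau> ` X \<Longrightarrow> \<exists>P Q S. contraction \<delta> \<sigma> d {x\<in>X. \<tau> x = f} {y\<in>Y. \<tau> y = f} P Q S"
  shows "\<exists>P Q S. contraction \<delta> \<sigma> d X Y P Q S"
proof -
  from c obtain P Q S where PQS: "\<And>f. f \<in> \<tau> ` X \<Longrightarrow> contraction \<delta> \<sigma> d {x\<in>X. \<tau> x = f} {y\<in>Y. \<tau> y = f} (P f) (Q f) (S f)"
    by metis
  define glue where "glue F = lext (\<lambda>x. F (\<tau> x) (single x (1::rat)))" for F :: "'j \<Rightarrow> ('k \<Rightarrow>\<^sub>0 rat) \<Rightarrow> ('k \<Rightarrow>\<^sub>0 rat)"
  have ling: "lin (glue F)" for F unfolding glue_def by (rule lin_lext)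
  have glue: "glue F v = F f v" if "lin (F f)" "keys v \<subseteq> {x\<in>Z. \<tau> x = f}" for F f v Z
    by (rule lin_eqI[OF ling that(1) _ that(2)]) (auto simp: glue_def)
  have "contraction \<delta> \<sigma> d X Y (glue P) (glue Q) (glue S)"
  proof (rule contraction_singleI[OF _ _ _ _ sub])
    show "graded \<delta> \<sigma> X X d"
    proof (rule gradedI[OF lin])
      fix x y assume x: "x \<in> X" and y: "y \<in> keys (d (single x 1))"
      interpret contraction \<delta> \<sigma> d "{z\<in>X. \<tau> z = \<tau> x}" "{z\<in>Y. \<tau> z = \<tau> x}" "P (\<tau> x)" "Q (\<tau> x)" "S (\<tau> x)" by (rule PQS) (use x in auto)
      show "y \<in> X \<and> \<delta> y = \<delta> x + \<sigma>" using gradedD[OF graded_d _ y] x by auto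
    qed
    show "graded \<delta> 0 X Y (glue P)"
    proof (rule gradedI[OF ling])
      fix x y assume x: "x \<in> X" and y: "y \<in> keys (glue P (single x 1))"
      interpret contraction \<delta> \<sigma> d "{z\<in>X. \<tau> z = \<tau> x}" "{z\<in>Y. \<tau> z = \<tau> x}" "P (\<tau> x)" "Q (\<tau> x)" "S (\<tau> x)" by (rule PQS) (use x in auto)
      show "y \<in> Y \<and> \<delta> y = \<delta> x + 0" using gradedD[OF graded_P, of x y] x y by (auto simp: glue_def)
    qed
    show "graded \<delta> (- \<sigma>) X X (glue S)"
    proof (rule gradedI[OF ling])
      fix x y assume x: "x \<in> X" and y: "y \<in> keys (glue S (single x 1))"
      interpret contraction \<delta> \<sigma> d "{z\<in>X. \<tau> z = \<tau> x}" "{z\<in>Y. \<tau> z = \<tau> x}" "P (\<tau> x)" "Q (\<tau> x)" "S (\<tau> x)" by (rule PQS) (use x in auto)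
      show "y \<in> X \<and> \<delta> y = \<delta> x + - \<sigma>" using gradedD[OF graded_S, of x y] x y by (auto simp: glue_def)
    qed
    show "graded \<delta> 0 Y X (glue Q)"
    proof (rule gradedI[OF ling])
      fix x y assume x: "x \<in> Y" and y: "y \<in> keys (glue Q (single x 1))"
      interpret contraction \<delta> \<sigma> d "{z\<in>X. \<tau> z = \<tau> x}" "{z\<in>Y. \<tau> z = \<tau> x}" "P (\<tau> x)" "Q (\<tau> x)" "S (\<tau> x)" by (rule PQS) (use x sub in auto)
      show "y \<in> X \<and> \<delta> y = \<delta> x + 0" using gradedD[OF graded_Q, of x y] x y by (auto simp: glue_def)
    qed
  next
    fix x assume x: "x \<in> X"
    interpret contraction \<delta> \<sigma> d "{z\<in>X. \<tau> z = \<tau> x}" "{z\<in>Y. \<tau> z = \<tau> x}" "P (\<tau> x)" "Q (\<tau> x)" "S (\<tau> x)" by (rule PQS) (use x in auto)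
    have kx: "keys (single x (1::rat)) \<subseteq> {z\<in>X. \<tau> z = \<tau> x}" using x by auto
    show "d (d (single x 1)) = 0" by (rule d_d[OF kx])
    note gP = glue[of P "\<tau> x" _ X, OF lin_P] and gQ = glue[of Q "\<tau> x" _ Y, OF lin_Q] and gS = glue[of S "\<tau> x" _ X, OF lin_S]
    show "glue P (d (single x 1)) = 0" using gP[OF keys_d[OF kx]] P_d[OF kx] by simp
    show "single x 1 - glue Q (glue P (single x 1)) = d (glue S (single x 1)) + glue S (d (single x 1))"
      using homotopy[OF kx] by (simp only: gS[OF kx] gP[OF kx] gQ[OF keys_P[OF kx]] gS[OF keys_d[OF kx]])
  next
    fix x assume x: "x \<in> Y"
    interpret contraction \<delta> \<sigma> d "{z\<in>X. \<tau> z = \<tau> x}" "{z\<in>Y. \<tau> z = \<tau> x}" "P (\<tau> x)" "Q (\<tau> x)" "S (\<tau> x)" by (rule PQS) (use x sub in auto)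
    have kx: "keys (single x (1::rat)) \<subseteq> {z\<in>Y. \<tau> z = \<tau> x}" using x by auto
    note gP = glue[of P "\<tau> x" _ X, OF lin_P] and gQ = glue[of Q "\<tau> x" _ Y, OF lin_Q]
    show "glue P (glue Q (single x 1)) = single x 1"
      using P_Q[OF kx] by (simp only: gQ[OF kx] gP[OF keys_Q[OF kx]])
    show "d (glue Q (single x 1)) = 0" using d_Q[OF kx] by (simp only: gQ[OF kx])
  qed
  then show ?thesis by blast
qed

context building_polymatroid
begin

section \<open>Cells of the local complexes\<close>

abbreviation under :: "'a set \<Rightarrow> 'a set set set" where
  "under \<equiv> nested_below E cd G"

lemma under_iff: "U \<in> under g \<longleftrightarrow> U \<in> NS \<and> (\<forall>u\<in>U. u \<subset> g)"
  using NS_G by (auto simp: nested_below_def)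

lemma under_G: "under g \<subseteq> Pow G"
  by (auto simp: nested_below_def)

lemma under_contraction:
  "\<exists>H P Q S. contraction (\<lambda>U. int (card U)) (- 1) (simplicial_boundary r) (under g) H P Q S"
proof (rule contraction_exists)
  show "finite (under g)" by (rule finite_subset[OF _ finite_NS]) (simp add: nested_below_def)
  show "graded (\<lambda>U. int (card U)) (- 1) (under g) (under g) (simplicial_boundary r)"
  proof (rule graded_simplicial_boundary)
    fix U t assume U: "U \<in> under g"
    then show "finite U" by (simp add: under_iff NS_finite)
    show "U - {t} \<in> under g" using U NS_subset[of U "U - {t}"] by (auto simp: under_iff)
  qed
  show "simplicial_boundary r (simplicial_boundary r v) = 0" if "keys v \<subseteq> under g" for v
    unfolding simplicial_boundary_bdry
    by (rule bdry_bdry[OF linear finite_G]) (rule subset_trans[OF that under_G])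
qed simp

text \<open>The simplices that survive elimination, chosen once for each \<open>g\<close>, because
  the bases on both sides of the theorem have to refer to the same choice.\<close>

definition cells :: "'a set \<Rightarrow> 'a set set set" where
  "cells g = (SOME H. \<exists>P Q S. contraction (\<lambda>U. int (card U)) (- 1) (simplicial_boundary r) (under g) H P Q S)"

lemma cells_contraction:
  "\<exists>P Q S. contraction (\<lambda>U. int (card U)) (- 1) (simplicial_boundary r) (under g) (cells g) P Q S"
  unfolding cells_def by (rule someI_ex) (rule under_contraction)

lemma cells_under: "cells g \<subseteq> under g"
  using cells_contraction[of g] contraction.subset by blast

lemma finite_cells: "finite (cells g)"
proof -
  have "cells g \<subseteq> NS" using cells_under[of g] by (auto simp: nested_below_def)
  then show ?thesis using finite_NS by (rule finite_subset)
qed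

lemma reduced_homology_free:
  "\<exists>\<phi>. free_on (reduced_homology r (under g) i) {U\<in>cells g. int (card U) = i + 1} \<phi>"
proof -
  obtain P Q S where "contraction (\<lambda>U. int (card U)) (- 1) (simplicial_boundary r) (under g) (cells g) P Q S"
    using cells_contraction by blast
  then interpret contraction "\<lambda>U. int (card U)" "- 1" "simplicial_boundary r" "under g" "cells g" P Q S .
  have "{v :: 'a set set \<Rightarrow>\<^sub>0 rat. keys v \<subseteq> {x\<in>under g. int (card x) + - 1 \<in> {i + 1}}} = simplicial_chains (under g) (i + 1)"
    by (auto simp: simplicial_chains_def)
  moreover have "{v :: 'a set set \<Rightarrow>\<^sub>0 rat. keys v \<subseteq> {x\<in>under g. int (card x) \<in> {i + 1}}} = simplicial_chains (under g) i"
    by (simp add: simplicial_chains_def)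
  ultimately show ?thesis using homology_free_on[of "{i + 1}"] by (simp add: reduced_homology_def)
qed

text \<open>An antichain with join in \<open>G\<close> lies below one factor \<open>y\<close> of
  \<open>f\<close>. As each of its elements is below only one factor, it is contained in
  \<open>U y\<close>, which is nested.\<close>

lemma under_union:
  assumes f: "f \<in> Fl" and F: "F \<subseteq> Fc f" and U: "\<And>g. g \<in> F \<Longrightarrow> U g \<in> under g"
  shows "(\<Union>g\<in>F. U g) \<in> NS"
proof (rule NS_I)
  have "U g \<subseteq> G" if "g \<in> F" for g using subsetD[OF under_G U[OF that]] by simp
  then show "(\<Union>g\<in>F. U g) \<subseteq> G" by (rule UN_least)
next
  fix A assume A: "A \<subseteq> (\<Union>g\<in>F. U g)" "2 \<le> card A" "\<And>g h. g \<in> A \<Longrightarrow> h \<in> A \<Longrightarrow> g \<subseteq> h \<Longrightarrow> g = h" and jA: "jn A \<in> G"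
  have below: "x \<subset> g" if "g \<in> F" "x \<in> U g" for g x using U[OF that(1)] that(2) by (simp add: under_iff)
  have "U g \<subseteq> G" if "g \<in> F" for g using subsetD[OF under_G U[OF that]] by simp
  then have "(\<Union>g\<in>F. U g) \<subseteq> G" by (rule UN_least)
  then have AG: "A \<subseteq> G" using A(1) by simp
  then have AFl: "A \<subseteq> Fl" using G_Fl by simp
  have "x \<subseteq> f" if x: "x \<in> A" for x
  proof -
    obtain g where g: "g \<in> F" "x \<in> U g" using A(1) x by blast
    have "g \<subseteq> f" using Fc_le g(1) F by blast
    then show ?thesis using below[OF g] by auto
  qed
  then have "jn A \<subseteq> f" using f by (rule jn_least)
  then obtain y where y: "y \<in> Fc f" "jn A \<subseteq> y" using Fc_above_ex[OF jA] by blast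
  have *: "y \<in> F \<and> x \<in> U y" if x: "x \<in> A" for x
  proof -
    obtain g where g: "g \<in> F" "x \<in> U g" using A(1) x by blast
    have "x \<subseteq> g" using below[OF g] by auto
    moreover have "x \<subseteq> y" using jn_upper[OF AFl x] y(2) by simp
    moreover have "g \<in> Fc f" "x \<in> G" using g(1) F x AG by auto
    ultimately have "g = y" by (intro Fc_unique[OF f _ y(1)])
    then show ?thesis using g by simp
  qed
  have "A \<noteq> {}" using A(2) by auto
  then have "y \<in> F" "A \<subseteq> U y" using * by auto
  then show False using NS_D[of "U y" A] A(2,3) U[of y] jA by (auto simp: under_iff)
qed

text \<open>For a set \<open>F\<close> of factors of a flat this is the iterated join of the
  complexes \<open>under g\<close>; \<open>join_beneath\<close> adds one of them.\<close>

definition beneath :: "'a set set \<Rightarrow> 'a set set set" where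
  "beneath F = {W\<in>NS. \<forall>w\<in>W. \<exists>g\<in>F. w \<subset> g}"

lemma beneath_Pow: "beneath F \<subseteq> Pow {h\<in>G. \<exists>g\<in>F. h \<subset> g}"
proof
  fix W assume "W \<in> beneath F"
  then have "W \<in> NS" "\<forall>w\<in>W. \<exists>g\<in>F. w \<subset> g" by (simp_all add: beneath_def)
  then show "W \<in> Pow {h\<in>G. \<exists>g\<in>F. h \<subset> g}" using NS_G[of W] by blast
qed

definition cells_beneath :: "'a set set \<Rightarrow> 'a set set set" where
  "cells_beneath F = {W\<in>beneath F. \<forall>g\<in>F. blw W g \<in> cells g}"

lemma blw_under: "W \<in> NS \<Longrightarrow> blw W g \<in> under g"
  using NS_subset[OF _ blw_subset] by (auto simp: under_iff blw_def)

lemma blw_disjoint: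
  assumes f: "f \<in> Fl" and g: "g \<in> Fc f" "g' \<in> Fc f" "g \<noteq> g'" and W: "W \<in> NS" "\<And>w. w \<in> W \<Longrightarrow> w \<subset> g"
  shows "blw W g' = {}"
proof -
  have False if "w \<in> W" "w \<subset> g'" for w
    using Fc_unique[OF f g(1,2), of w] W(2)[OF that(1)] that NS_G[OF W(1)] g(3) by auto
  then show ?thesis by (auto simp: blw_def)
qed

lemma blw_Un: "blw (U \<union> W) g = blw U g \<union> blw W g"
  by (auto simp: blw_def)

lemma blw_self: "(\<And>w. w \<in> W \<Longrightarrow> w \<subset> g) \<Longrightarrow> blw W g = W"
  by (auto simp: blw_def)

context
  fixes f F g
  assumes f: "f \<in> Fl" and F: "F \<subseteq> Fc f" and g: "g \<in> Fc f" "g \<notin> F"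
begin

lemma blw_Un_new:
  assumes "U \<in> under g" "W \<in> beneath F" shows "blw (U \<union> W) g = U"
proof -
  have "\<not> w \<subset> g" if w: "w \<in> W" for w
  proof
    assume wg: "w \<subset> g"
    have WN: "W \<in> NS" using assms(2) by (simp add: beneath_def)
    obtain g' where g': "g' \<in> F" "w \<subset> g'" using assms(2) w unfolding beneath_def by auto
    have "w \<in> G" "g' \<in> Fc f" using NS_G[OF WN] w F g'(1) by auto
    then have "g = g'" using Fc_unique[OF f g(1)] wg g'(2) by (meson psubset_imp_subset)
    then show False using g(2) g'(1) by simp
  qed
  then have "blw W g = {}" by (auto simp: blw_def)
  then show ?thesis using assms(1) blw_self[of U g] by (simp add: blw_Un under_iff)
qed

lemma blw_Un_old:
  assumes "U \<in> under g" "W \<in> beneath F" "g' \<in> F" shows "blw (U \<union> W) g' = blw W g'"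
  using blw_disjoint[OF f g(1) _ _ , of g' U] assms F g(2) by (auto simp: blw_Un under_iff)

lemma join_beneath: "join_sets (under g) (beneath F) = beneath (insert g F)"
proof (intro equalityI subsetI)
  fix T assume "T \<in> join_sets (under g) (beneath F)"
  then obtain U W where T: "T = U \<union> W" "U \<in> under g" "W \<in> beneath F" unfolding join_sets_def by auto
  have "(\<Union>h\<in>insert g F. if h = g then U else blw W h) \<in> NS"
    by (rule under_union[OF f]) (use F g(1) T blw_under in \<open>auto simp: beneath_def\<close>)
  moreover have "(\<Union>h\<in>insert g F. if h = g then U else blw W h) = T"
    using T(1,3) g(2) by (auto simp: beneath_def blw_def)
  ultimately show "T \<in> beneath (insert g F)" using T by (auto simp: beneath_def under_iff)
next
  fix T assume T: "T \<in> beneath (insert g F)"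
  then have "T = blw T g \<union> {t\<in>T. \<exists>h\<in>F. t \<subset> h}" by (auto simp: beneath_def blw_def)
  moreover have "blw T g \<in> under g" using T blw_under by (simp add: beneath_def)
  moreover have "{t\<in>T. \<exists>h\<in>F. t \<subset> h} \<in> beneath F" using T NS_subset[of T "{t\<in>T. \<exists>h\<in>F. t \<subset> h}"] by (auto simp: beneath_def)
  ultimately show "T \<in> join_sets (under g) (beneath F)" unfolding join_sets_def by blast
qed

lemma join_cells_beneath: "join_sets (cells g) (cells_beneath F) = cells_beneath (insert g F)"
proof (intro equalityI subsetI)
  fix T assume "T \<in> join_sets (cells g) (cells_beneath F)"
  then obtain U W where T: "T = U \<union> W" "U \<in> cells g" "W \<in> cells_beneath F" unfolding join_sets_def by auto
  have UW: "U \<in> under g" "W \<in> beneath F" using T cells_under by (auto simp: cells_beneath_def)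
  then have "T \<in> beneath (insert g F)" using T(1) unfolding join_beneath[symmetric] join_sets_def by blast
  then show "T \<in> cells_beneath (insert g F)"
    using blw_Un_new[OF UW] blw_Un_old[OF UW] T by (auto simp: cells_beneath_def)
next
  fix T assume T: "T \<in> cells_beneath (insert g F)"
  then have "T \<in> beneath (insert g F)" by (simp add: cells_beneath_def)
  then obtain U W where UW: "T = U \<union> W" "U \<in> under g" "W \<in> beneath F" unfolding join_beneath[symmetric] join_sets_def by auto
  have "U \<in> cells g" using T blw_Un_new[OF UW(2,3)] UW(1) by (auto simp: cells_beneath_def)
  moreover have "W \<in> cells_beneath F" using T blw_Un_old[OF UW(2,3)] UW(1,3) by (auto simp: cells_beneath_def)
  ultimately show "T \<in> join_sets (cells g) (cells_beneath F)" using UW(1) unfolding join_sets_def by blast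
qed

end

lemma beneath_contraction:
  assumes f: "f \<in> Fl"
  shows "finite F \<Longrightarrow> F \<subseteq> Fc f \<Longrightarrow>
    \<exists>P Q S. contraction (\<lambda>U. int (card U)) (- 1) (simplicial_boundary r) (beneath F) (cells_beneath F) P Q S"
proof (induction F rule: finite_induct)
  case empty
  \<comment> \<open>The empty join consists of the empty simplex alone, which is its own homology
    class.\<close>
  have e: "beneath {} = {{}}" "cells_beneath {} = {{}}" using NS_empty by (auto simp: beneath_def cells_beneath_def)
  have d0: "simplicial_boundary r v = 0" if "keys v \<subseteq> {{}}" for v :: "'a set set \<Rightarrow>\<^sub>0 rat"
    by (rule lin_eqI[OF lin_simplicial_boundary, of "\<lambda>_. 0" "{{}}"])
      (use that in \<open>auto simp: lin_def simplicial_boundary_bdry bdry_single\<close>)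
  have "contraction (\<lambda>U. int (card U)) (- 1) (simplicial_boundary r) {{}} {{} :: 'a set set} (\<lambda>v. v) (\<lambda>v. v) (\<lambda>_. 0)"
    by unfold_locales (use d0 graded_id graded_zero in \<open>auto simp: graded_def lin_simplicial_boundary\<close>)
  then show ?case unfolding e by blast
next
  case (insert g F)
  have g: "g \<in> Fc f" "g \<notin> F" and F: "F \<subseteq> Fc f" using insert by auto
  obtain P2 Q2 S2 where c2: "contraction (\<lambda>U. int (card U)) (- 1) (simplicial_boundary r) (beneath F) (cells_beneath F) P2 Q2 S2"
    using insert.IH[OF F] by blast
  obtain P1 Q1 S1 where c1: "contraction (\<lambda>U. int (card U)) (- 1) (simplicial_boundary r) (under g) (cells g) P1 Q1 S1"
    using cells_contraction by blast
  let ?V1 = "{h\<in>G. h \<subset> g}" and ?V2 = "{h\<in>G. \<exists>g'\<in>F. h \<subset> g'}"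
  have V: "?V1 \<inter> ?V2 = {}" using Fc_unique[OF f g(1)] F g(2) by blast
  have K1: "under g \<subseteq> Pow ?V1" by (auto simp: nested_below_def)
  have K2: "beneath F \<subseteq> Pow ?V2" by (rule beneath_Pow)
  have fV: "finite ?V1" "finite ?V2" using finite_G by auto
  have leib: "simplicial_boundary r (join_chain r (single U 1) (single W 1)) =
      join_chain r (simplicial_boundary r (single U 1)) (single W 1)
      + smul ((- 1) ^ card U) (join_chain r (single U 1) (simplicial_boundary r (single W 1)))"
    if "U \<in> under g" "W \<in> beneath F" for U W
  proof -
    have "U \<subseteq> ?V1" "W \<subseteq> ?V2" using that K1 K2 by auto
    then have "U \<subseteq> G" "W \<subseteq> G" "U \<inter> W \<subseteq> ?V1 \<inter> ?V2" by auto
    then have "U \<subseteq> G" "W \<subseteq> G" "U \<inter> W = {}" unfolding V by auto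
    moreover have "finite U" "finite W" using that NS_finite by (auto simp: under_iff beneath_def)
    ultimately show ?thesis
      using join_leibniz[OF linear, of U W U W] by (simp add: join_chain_single simplicial_boundary_bdry bdry_single)
  qed
  show ?case
    using contraction_join[OF V fV K1 K2 c1 c2 lin_simplicial_boundary leib]
    unfolding join_beneath[OF f F g] join_cells_beneath[OF f F g] .
qed

text \<open>The nested sets whose part below each maximal element is a surviving cell, since
  \<open>Fc (jn T)\<close> is the set of maximal elements. They index all bases.\<close>

definition critical :: "'a set set set" where
  "critical = {T\<in>NS. \<forall>g\<in>Fc (jn T). blw T g \<in> cells g}"

lemma beneath_Un_factors:
  assumes f: "f \<in> Fl" and W: "W \<in> beneath (Fc f)"
  shows "W \<union> Fc f \<in> NS" "jn (W \<union> Fc f) = f" "W \<inter> Fc f = {}" "g \<in> Fc f \<Longrightarrow> blw (W \<union> Fc f) g = blw W g"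
proof -
  have W': "W \<in> NS" "w \<in> W \<Longrightarrow> \<exists>g\<in>Fc f. w \<subset> g" for w using W by (auto simp: beneath_def)
  have le: "w \<subseteq> f" if "w \<in> W \<union> Fc f" for w using that W'(2) Fc_le by blast
  show N: "W \<union> Fc f \<in> NS" by (rule NS_Un_factors[OF f W'(1)]) (use le in auto)
  have "jn (Fc f) \<subseteq> jn (W \<union> Fc f)" by (rule jn_mono[OF _ NS_Fl[OF N]]) auto
  then show "jn (W \<union> Fc f) = f" using jn_least[of "W \<union> Fc f" f, OF le f] jn_Fc[OF f] by auto
  have incomp: "\<not> x \<subset> y" if "x \<in> Fc f" "y \<in> Fc f" for x y
    using that Fc_mem_iff[of x f] Fc_mem_iff[of y f] by blast
  then show "W \<inter> Fc f = {}" using W'(2) by blast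
  show "g \<in> Fc f \<Longrightarrow> blw (W \<union> Fc f) g = blw W g" using incomp by (auto simp: blw_def)
qed

lemma remove_factors:
  assumes T: "T \<in> NS"
  shows "T - Fc (jn T) \<in> beneath (Fc (jn T))" "T = (T - Fc (jn T)) \<union> Fc (jn T)"
proof -
  have "\<exists>g\<in>max_elements T. t \<subset> g" if "t \<in> T - max_elements T" for t
    using max_above[OF NS_finite[OF T], of t] that by blast
  then show "T - Fc (jn T) \<in> beneath (Fc (jn T))"
    using NS_subset[OF T, of "T - Fc (jn T)"] unfolding beneath_def NS_factors[OF T] by blast
  show "T = (T - Fc (jn T)) \<union> Fc (jn T)" unfolding NS_factors[OF T] using max_subset by blast
qed

text \<open>A nested set with join \<open>f\<close> is the set of factors of \<open>f\<close>
  together with a simplex of the join beneath them, and \<open>CM_d\<close> removes vertices of the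
  latter only. So the fibre is the join with a second complex that has one simplex and zero
  differential.\<close>

lemma CM_fibre_contraction:
  assumes f: "f \<in> Fl"
  shows "\<exists>P Q S. contraction (\<lambda>U. int (card U)) (- 1) (CM_d r) {T\<in>NS. jn T = f} {T\<in>critical. jn T = f} P Q S"
proof -
  let ?F = "Fc f" and ?V1 = "{h\<in>G. \<exists>g\<in>Fc f. h \<subset> g}"
  have incomp: "\<not> x \<subset> y" if "x \<in> ?F" "y \<in> ?F" for x y
    using that Fc_mem_iff[of x f] Fc_mem_iff[of y f] by blast
  obtain P1 Q1 S1 where c1: "contraction (\<lambda>U. int (card U)) (- 1) (simplicial_boundary r) (beneath ?F) (cells_beneath ?F) P1 Q1 S1"
    using beneath_contraction[OF f finite_Fc order_refl] by blast
  have V: "?V1 \<inter> ?F = {}" using incomp by blast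
  have K: "beneath ?F \<subseteq> Pow ?V1" "{?F} \<subseteq> Pow ?F" using beneath_Pow by auto
  have leib: "CM_d r (join_chain r (single U 1) (single W 1)) =
      join_chain r (simplicial_boundary r (single U 1)) (single W 1) + smul ((- 1) ^ card U) (join_chain r (single U 1) 0)"
    if U: "U \<in> beneath ?F" and W: "W \<in> {?F}" for U W
  proof -
    note p = beneath_Un_factors[OF f U]
    have "max_elements (U \<union> ?F) = ?F" using NS_factors[OF p(1)] p(2) by simp
    then have m: "U \<union> ?F - max_elements (U \<union> ?F) = U" using p(3) by auto
    have "U \<in> NS" using U by (simp add: beneath_def)
    then have *: "U \<subseteq> G" "finite U" using NS_G NS_finite by auto
    have **: "Fc f \<subseteq> G" by (rule Fc_G)
    show ?thesis
      using join_leibniz[OF linear *(1) ** *(2) finite_Fc p(3) order_refl empty_subsetI] W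
      by (simp add: join_chain_single CM_d_bdry bdry_single m simplicial_boundary_bdry)
  qed
  have X: "join_sets (beneath ?F) {?F} = {T\<in>NS. jn T = f}"
  proof (intro equalityI subsetI)
    fix T assume "T \<in> join_sets (beneath ?F) {?F}"
    then obtain W where W: "W \<in> beneath ?F" "T = W \<union> ?F" by (auto simp: join_sets_def)
    show "T \<in> {T\<in>NS. jn T = f}" using beneath_Un_factors(1,2)[OF f W(1)] W(2) by simp
  next
    fix T assume "T \<in> {T\<in>NS. jn T = f}"
    then have T: "T \<in> NS" "jn T = f" by auto
    show "T \<in> join_sets (beneath ?F) {?F}" using remove_factors[OF T(1)] unfolding T(2) join_sets_def by blast
  qed
  have Y: "join_sets (cells_beneath ?F) {?F} = {T\<in>critical. jn T = f}"
  proof (intro equalityI subsetI)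
    fix T assume "T \<in> join_sets (cells_beneath ?F) {?F}"
    then obtain W where W: "W \<in> beneath ?F" "\<forall>g\<in>?F. blw W g \<in> cells g" "T = W \<union> ?F" by (auto simp: join_sets_def cells_beneath_def)
    show "T \<in> {T\<in>critical. jn T = f}" using beneath_Un_factors[OF f W(1)] W(2,3) by (simp add: critical_def)
  next
    fix T assume "T \<in> {T\<in>critical. jn T = f}"
    then have T: "T \<in> NS" "jn T = f" "\<forall>g\<in>?F. blw T g \<in> cells g" by (auto simp: critical_def)
    define W where "W = T - ?F"
    have W: "W \<in> beneath ?F" "T = W \<union> ?F" using remove_factors[OF T(1)] unfolding T(2) W_def by auto
    have "W \<in> cells_beneath ?F" using T(3) beneath_Un_factors(4)[OF f W(1)] W unfolding cells_beneath_def by simp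
    then show "T \<in> join_sets (cells_beneath ?F) {?F}" using W(2) unfolding join_sets_def by blast
  qed
  have fV: "finite ?V1" using finite_G by auto
  show ?thesis
    using contraction_join[OF V fV finite_Fc K c1 contraction_point lin_CM_d leib] unfolding X Y .
qed

definition bidegree :: "'a set set \<Rightarrow> int \<times> int" where
  "bidegree T = (2 * (int (cd (jn T)) - int (card T)), int (card T))"

lemma CM_contraction: "\<exists>P Q S. contraction bidegree (2, - 1) (CM_d r) NS critical P Q S"
proof (rule contraction_partition[OF lin_CM_d, where \<tau>=jn])
  show "critical \<subseteq> NS" by (auto simp: critical_def)
  fix f assume "f \<in> jn ` NS"
  then have "f \<in> Fl" using jn_Fl NS_Fl by auto
  then obtain P Q S where c: "contraction (\<lambda>U. int (card U)) (- 1) (CM_d r) {T\<in>NS. jn T = f} {T\<in>critical. jn T = f} P Q S"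
    using CM_fibre_contraction by blast
  \<comment> \<open>In the fibre over \<open>f\<close> the value of \<open>cd\<close> is constant,
    so one more vertex changes the bidegree by (-2, 1).\<close>
  have "contraction bidegree ((\<lambda>n. (- 2 * n, n)) (- 1)) (CM_d r) {T\<in>NS. jn T = f} {T\<in>critical. jn T = f} P Q S"
    by (rule contraction_regrade[OF c]) (auto simp: bidegree_def algebra_simps zero_prod_def)
  then show "\<exists>P Q S. contraction bidegree (2, - 1) (CM_d r) {T\<in>NS. jn T = f} {T\<in>critical. jn T = f} P Q S" by auto
qed

lemma CD_bidegree: "CD D = {v. keys v \<subseteq> {T\<in>NS. bidegree T \<in> D}}"
  by (auto simp: CD_def bidegree_def)

lemma homology_critical:
  "\<exists>\<phi>. free_on (homology_at (CM_space E cd G) (CM_d r) (CM_part E cd G (shift D)) (CM_part E cd G D)) {T\<in>critical. bidegree T \<in> D} \<phi>"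
  "\<exists>\<phi>. free_on (homology_at RM dM (leray_model_part E cd G r (shift D)) (leray_model_part E cd G r D)) {T\<in>critical. bidegree T \<in> D} \<phi>"
proof -
  obtain P Q S where "contraction bidegree (2, - 1) (CM_d r) NS critical P Q S" using CM_contraction by blast
  then interpret C: contraction bidegree "(2, - 1)" "CM_d r" NS critical P Q S .
  show "\<exists>\<phi>. free_on (homology_at (CM_space E cd G) (CM_d r) (CM_part E cd G (shift D)) (CM_part E cd G D)) {T\<in>critical. bidegree T \<in> D} \<phi>"
    using C.homology_free_on[of D] by (simp only: CM_part_CD CM_space_def CD_bidegree shift_def mem_Collect_eq)
  show "\<exists>\<phi>. free_on (homology_at RM dM (leray_model_part E cd G r (shift D)) (leray_model_part E cd G r D)) {T\<in>critical. bidegree T \<in> D} \<phi>"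
  proof (rule leray_homology_free)
    show "P ` {v\<in>CD D. CM_d r v = 0} = {w. keys w \<subseteq> {T\<in>critical. bidegree T \<in> D}}"
      using C.image_cycles[of D] by (simp add: CD_bidegree)
    show "CM_d r ` CD (shift D) = {v\<in>CD D. CM_d r v = 0 \<and> P v = 0}"
      using C.boundaries[of D] by (simp add: CD_bidegree shift_def)
  qed (simp_all add: lin_add[OF C.lin_P] lin_smul[OF C.lin_P])
qed

end

section \<open>Comparison of degrees\<close>

context building_polymatroid
begin

lemma blw_union:
  assumes f: "f \<in> Fl" and U: "\<And>h. h \<in> Fc f \<Longrightarrow> U h \<in> under h" and g: "g \<in> Fc f"
  shows "blw (\<Union>h\<in>Fc f. U h) g = U g"
proof (intro equalityI subsetI)
  fix w assume "w \<in> blw (\<Union>h\<in>Fc f. U h) g"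
  then obtain h where h: "h \<in> Fc f" "w \<in> U h" "w \<subset> g" by (auto simp: blw_def)
  have "w \<in> G" "w \<subset> h" using subsetD[OF under_G U[OF h(1)]] U[OF h(1)] h(2) by (auto simp: under_iff)
  then have "g = h" using h(3) by (intro Fc_unique[OF f g h(1), of w]) auto
  then show "w \<in> U g" using h(2) by simp
next
  fix w assume "w \<in> U g"
  then show "w \<in> blw (\<Union>h\<in>Fc f. U h) g" using U[OF g] g by (auto simp: blw_def under_iff)
qed

text \<open>A basis element of the right side is a flat with a cell below each of its factors. The
  union of these cells and the factors is a critical nested set, from which \<open>blw\<close>
  recovers the cells. The type of degrees is a parameter, so that both gradings share the
  argument.\<close>

lemma tensor_side_free:
  fixes V :: "'a set \<Rightarrow> 'd::comm_monoid_add \<Rightarrow> (rat, 'v) module" and deg :: "'a set \<Rightarrow> 'a set set \<Rightarrow> 'd"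
  assumes V: "\<And>g k. \<exists>\<phi>. free_on (V g k) {U\<in>cells g. deg g U = k} \<phi>"
  shows "\<exists>\<phi>. free_on (direct_sum Fl (\<lambda>f. graded_tensor (Fc f) V k))
    {T\<in>critical. (\<Sum>g\<in>Fc (jn T). deg g (blw T g)) = k} \<phi>"
proof -
  let ?K = "\<lambda>f. {\<kappa> \<in> Fc f \<rightarrow>\<^sub>E UNIV. (\<Sum>g\<in>Fc f. \<kappa> g) = k}"
  let ?X = "\<lambda>f \<kappa>. \<Pi>\<^sub>E g\<in>Fc f. {U\<in>cells g. deg g U = \<kappa> g}"
  let ?Y = "{T\<in>critical. (\<Sum>g\<in>Fc (jn T). deg g (blw T g)) = k}"
  note \<Phi> = someI_ex[OF V]
  have "\<exists>\<psi>. free_on (tensor (Fc f) (\<lambda>g. V g (\<kappa> g))) (?X f \<kappa>) \<psi>" for f and \<kappa> :: "'a set \<Rightarrow> 'd"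
    by (rule tensor_free[OF finite_Fc \<Phi>]) (simp add: finite_cells)
  note \<Psi> = someI_ex[OF this]
  have "\<exists>\<psi>. free_on (graded_tensor (Fc f) V k) (Sigma (?K f) (?X f)) \<psi>" for f
    unfolding graded_tensor_def by (rule direct_sum_free) (rule \<Psi>)
  note \<Theta> = someI_ex[OF this]
  obtain \<phi> where \<phi>: "free_on (direct_sum Fl (\<lambda>f. graded_tensor (Fc f) V k)) (Sigma Fl (\<lambda>f. Sigma (?K f) (?X f))) \<phi>"
    using direct_sum_free[where J=Fl and M="\<lambda>f. graded_tensor (Fc f) V k", OF \<Theta>] by auto
  \<comment> \<open>The distribution \<open>\<kappa>\<close> of degrees is dropped, because the
    cells determine it; \<open>c\<close> restores it.\<close>
  define b :: "'a set \<times> ('a set \<Rightarrow> 'd) \<times> ('a set \<Rightarrow> 'a set set) \<Rightarrow> 'a set set"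
    where "b = (\<lambda>(f, \<kappa>, U). (\<Union>g\<in>Fc f. U g) \<union> Fc f)"
  define c where "c T = (jn T, \<lambda>g\<in>Fc (jn T). deg g (blw T g), \<lambda>g\<in>Fc (jn T). blw T g)" for T
  have fwd: "b (f, \<kappa>, U) \<in> ?Y \<and> c (b (f, \<kappa>, U)) = (f, \<kappa>, U)"
    if f: "f \<in> Fl" and K: "\<kappa> \<in> ?K f" and U: "U \<in> ?X f \<kappa>" for f \<kappa> U
  proof -
    have Ug: "U g \<in> cells g" "deg g (U g) = \<kappa> g" if "g \<in> Fc f" for g using PiE_mem[OF U that] by auto
    have Uu: "U g \<in> under g" if "g \<in> Fc f" for g using Ug(1)[OF that] cells_under by blast
    let ?W = "\<Union>g\<in>Fc f. U g"
    have "w \<subset> g" if "g \<in> Fc f" "w \<in> U g" for g w using Uu[OF that(1)] that(2) by (simp add: under_iff)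
    then have W: "?W \<in> beneath (Fc f)" using under_union[OF f order_refl Uu] unfolding beneath_def by blast
    note T = beneath_Un_factors[OF f W]
    have bl: "blw (?W \<union> Fc f) g = U g" if "g \<in> Fc f" for g using T(4)[OF that] blw_union[OF f Uu that] by simp
    have "b (f, \<kappa>, U) \<in> ?Y" using T(1,2) bl Ug K by (simp add: b_def critical_def)
    moreover have "(\<lambda>g\<in>Fc f. deg g (U g)) = \<kappa>" using K Ug(2) by (intro extensionalityI[of _ "Fc f"]) (auto simp: PiE_def)
    moreover have "(\<lambda>g\<in>Fc f. U g) = U" using U by (intro extensionalityI[of _ "Fc f"]) (auto simp: PiE_def)
    moreover have "c (b (f, \<kappa>, U)) = (f, \<lambda>g\<in>Fc f. deg g (U g), \<lambda>g\<in>Fc f. U g)"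
      using bl T(2) unfolding c_def b_def by (simp cong: restrict_cong)
    ultimately show ?thesis by simp
  qed
  have bwd: "c T \<in> Sigma Fl (\<lambda>f. Sigma (?K f) (?X f)) \<and> b (c T) = T" if T: "T \<in> ?Y" for T
  proof -
    have N: "T \<in> NS" "\<And>g. g \<in> Fc (jn T) \<Longrightarrow> blw T g \<in> cells g" using T by (auto simp: critical_def)
    have "jn T \<in> Fl" by (rule jn_Fl[OF NS_Fl[OF N(1)]])
    then have 1: "c T \<in> Sigma Fl (\<lambda>f. Sigma (?K f) (?X f))" using T N(2) by (auto simp: c_def)
    have "(\<Union>g\<in>Fc (jn T). blw T g) \<subseteq> T" by (auto simp: blw_def)
    moreover have "T - Fc (jn T) \<subseteq> (\<Union>g\<in>Fc (jn T). blw T g)"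
      using remove_factors(1)[OF N(1)] by (auto simp: beneath_def blw_def)
    ultimately have "(\<Union>g\<in>Fc (jn T). blw T g) \<union> Fc (jn T) = T" using remove_factors(2)[OF N(1)] by blast
    then have "b (c T) = T" by (simp add: b_def c_def)
    with 1 show ?thesis by simp
  qed
  have "bij_betw b (Sigma Fl (\<lambda>f. Sigma (?K f) (?X f))) ?Y"
  proof (rule bij_betw_byWitness[where f'=c])
    have "c (b x) = x \<and> b x \<in> ?Y" if "x \<in> Sigma Fl (\<lambda>f. Sigma (?K f) (?X f))" for x
      using that fwd by (elim SigmaE) blast
    then show "\<forall>x\<in>Sigma Fl (\<lambda>f. Sigma (?K f) (?X f)). c (b x) = x" "b ` Sigma Fl (\<lambda>f. Sigma (?K f) (?X f)) \<subseteq> ?Y" by blast+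
    show "\<forall>T\<in>?Y. b (c T) = T" "c ` ?Y \<subseteq> Sigma Fl (\<lambda>f. Sigma (?K f) (?X f))" using bwd by blast+
  qed
  from free_on_bij[OF \<phi> this] show ?thesis by blast
qed

text \<open>For \<open>card U = i + 1\<close> this is (2 (cd g - 2 - i), 2 + i), the bidegree in the
  theorem. The additional 1 accounts for the vertex \<open>g\<close> itself.\<close>

definition local_bidegree :: "'a set \<Rightarrow> 'a set set \<Rightarrow> int \<times> int" where
  "local_bidegree g U = (2 * (int (cd g) - 1 - int (card U)), 1 + int (card U))"

text \<open>A nested set is the disjoint union of blocks, each consisting of a factor of the join
  and the vertices strictly below it, and \<open>cd\<close> is additive over the factors.\<close>

lemma bidegree_sum:
  assumes T: "T \<in> NS"
  shows "bidegree T = (\<Sum>g\<in>Fc (jn T). local_bidegree g (blw T g))"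
proof -
  let ?F = "Fc (jn T)"
  have f: "jn T \<in> Fl" by (rule jn_Fl[OF NS_Fl[OF T]])
  have "T - ?F \<subseteq> (\<Union>g\<in>?F. blw T g)"
    using remove_factors(1)[OF T] by (auto simp: beneath_def blw_def)
  moreover have "(\<Union>g\<in>?F. blw T g) \<subseteq> T" by (auto simp: blw_def)
  ultimately have T_eq: "T = (\<Union>g\<in>?F. insert g (blw T g))" using remove_factors(2)[OF T] by blast
  have fin: "finite (insert g (blw T g))" for g
    using NS_finite[OF T] blw_subset[of T g] finite_subset by auto
  have disj: "insert g (blw T g) \<inter> insert h (blw T h) = {}" if "g \<in> ?F" "h \<in> ?F" "g \<noteq> h" for g h
  proof -
    have False if "t \<in> insert g (blw T g)" "t \<in> insert h (blw T h)" for t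
    proof -
      have "t \<in> T" using that(1) \<open>g \<in> ?F\<close> T_eq by blast
      then have "t \<in> G" using NS_G[OF T] by auto
      then show False using Fc_unique[OF f \<open>g \<in> ?F\<close> \<open>h \<in> ?F\<close>, of t] that \<open>g \<noteq> h\<close> by (auto simp: blw_def)
    qed
    then show ?thesis by blast
  qed
  have "card T = (\<Sum>g\<in>?F. card (insert g (blw T g)))"
    by (subst T_eq) (rule card_UN_disjoint, use finite_Fc fin disj in auto)
  also have "\<dots> = (\<Sum>g\<in>?F. 1 + card (blw T g))"
    using fin by (intro sum.cong) (auto simp: blw_def)
  finally have card: "int (card T) = (\<Sum>g\<in>?F. 1 + int (card (blw T g)))" by simp
  have "cd (jn T) = (\<Sum>g\<in>?F. cd (jn T \<inter> g))" by (rule cd_meet_sum[OF f f order_refl])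
  also have "\<dots> = (\<Sum>g\<in>?F. cd g)" by (intro sum.cong refl) (simp add: Fc_le Int_absorb1)
  finally have "2 * (int (cd (jn T)) - int (card T)) = (\<Sum>g\<in>?F. 2 * (int (cd g) - 1 - int (card (blw T g))))"
    unfolding card by (simp add: sum_distrib_left sum_subtractf algebra_simps sum.distrib)
  then show ?thesis unfolding bidegree_def local_bidegree_def sum_prod card by simp
qed

text \<open>The total degree of a cell is \<open>2 * cd g - 1 - card U\<close>, and a simplex of
  dimension \<open>i\<close> has \<open>i + 1\<close> vertices; this accounts for the index
  \<open>2 * cd g - 2 - k\<close>.\<close>

lemma local_homology_free:
  "\<exists>\<phi>. free_on (local_homology E cd G r g k) {U\<in>cells g. fst (local_bidegree g U) + snd (local_bidegree g U) = k} \<phi>"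
proof -
  have "{U\<in>cells g. fst (local_bidegree g U) + snd (local_bidegree g U) = k}
      = {U\<in>cells g. int (card U) = (2 * int (cd g) - 2 - k) + 1}"
    by (auto simp: local_bidegree_def)
  then show ?thesis using reduced_homology_free[of g "2 * int (cd g) - 2 - k"] by (simp add: local_homology_def)
qed

lemma bi_local_homology_free:
  "\<exists>\<phi>. free_on (bi_local_homology E cd G r g pq) {U\<in>cells g. local_bidegree g U = pq} \<phi>"
proof -
  let ?I = "{i. (2 * (int (cd g) - 2 - i), 2 + i) = pq}"
  obtain \<phi> where \<phi>: "free_on (bi_local_homology E cd G r g pq) (Sigma ?I (\<lambda>i. {U\<in>cells g. int (card U) = i + 1})) \<phi>"
    unfolding bi_local_homology_def using direct_sum_free[where J="?I" and M="reduced_homology r (under g)", OF someI_ex[OF reduced_homology_free]] by auto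
  \<comment> \<open>The index \<open>i\<close> of the direct sum can be forgotten, since it is
    \<open>card U - 1\<close>.\<close>
  have "bij_betw snd (Sigma ?I (\<lambda>i. {U\<in>cells g. int (card U) = i + 1})) {U\<in>cells g. local_bidegree g U = pq}"
    by (rule bij_betw_byWitness[where f'="\<lambda>U. (int (card U) - 1, U)"]) (auto simp: local_bidegree_def)
  from free_on_bij[OF \<phi> this] show ?thesis by blast
qed

lemma shift_total_degree: "shift (total_degree k) = total_degree (k - 1)"
  by (auto simp: shift_def total_degree_def)

lemma shift_singleton: "shift {pq} = {pq - (2, - 1)}"
  by (auto simp: shift_def eq_diff_eq)

lemma homology_isomorphisms:
  "H_leray E cd G r k \<cong>\<^sub>\<rat> H_CM E cd G r k"
  "H_CM E cd G r k \<cong>\<^sub>\<rat> direct_sum Fl (\<lambda>f. graded_tensor (Fc f) (local_homology E cd G r) k)"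
  "bi_H_leray E cd G r pq \<cong>\<^sub>\<rat> bi_H_CM E cd G r pq"
  "bi_H_CM E cd G r pq \<cong>\<^sub>\<rat> direct_sum Fl (\<lambda>f. graded_tensor (Fc f) (bi_local_homology E cd G r) pq)"
proof -
  have H: "\<exists>\<phi>. free_on (H_CM E cd G r k) {T\<in>critical. bidegree T \<in> total_degree k} \<phi>"
    "\<exists>\<phi>. free_on (H_leray E cd G r k) {T\<in>critical. bidegree T \<in> total_degree k} \<phi>"
    using homology_critical[of "total_degree k"] by (simp_all only: H_CM_def H_leray_def shift_total_degree)
  have B: "\<exists>\<phi>. free_on (bi_H_CM E cd G r pq) {T\<in>critical. bidegree T \<in> {pq}} \<phi>"
    "\<exists>\<phi>. free_on (bi_H_leray E cd G r pq) {T\<in>critical. bidegree T \<in> {pq}} \<phi>"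
    using homology_critical[of "{pq}"] by (simp_all only: bi_H_CM_def bi_H_leray_def shift_singleton)
  have critical: "bidegree T = (\<Sum>g\<in>Fc (jn T). local_bidegree g (blw T g))" if "T \<in> critical" for T
    using that by (intro bidegree_sum) (simp add: critical_def)
  have "(\<Sum>g\<in>Fc (jn T). fst (local_bidegree g (blw T g)) + snd (local_bidegree g (blw T g))) = k
      \<longleftrightarrow> bidegree T \<in> total_degree k" if "T \<in> critical" for T
    unfolding critical[OF that] by (simp add: total_degree_def case_prod_beta fst_sum snd_sum sum.distrib)
  then have e1: "{T\<in>critical. (\<Sum>g\<in>Fc (jn T). fst (local_bidegree g (blw T g)) + snd (local_bidegree g (blw T g))) = k}
      = {T\<in>critical. bidegree T \<in> total_degree k}" by blast
  have e2: "{T\<in>critical. (\<Sum>g\<in>Fc (jn T). local_bidegree g (blw T g)) = pq} = {T\<in>critical. bidegree T \<in> {pq}}"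
    using critical by auto
  note D1 = tensor_side_free[where V="local_homology E cd G r" and k=k, OF local_homology_free, unfolded e1]
  note D2 = tensor_side_free[where V="bi_local_homology E cd G r" and k=pq, OF bi_local_homology_free, unfolded e2]
  show "H_leray E cd G r k \<cong>\<^sub>\<rat> H_CM E cd G r k" using H free_on_iso by blast
  show "H_CM E cd G r k \<cong>\<^sub>\<rat> direct_sum Fl (\<lambda>f. graded_tensor (Fc f) (local_homology E cd G r) k)"
    using H(1) D1 free_on_iso by blast
  show "bi_H_leray E cd G r pq \<cong>\<^sub>\<rat> bi_H_CM E cd G r pq" using B free_on_iso by blast
  show "bi_H_CM E cd G r pq \<cong>\<^sub>\<rat> direct_sum Fl (\<lambda>f. graded_tensor (Fc f) (bi_local_homology E cd G r) pq)"
    using B(1) D2 free_on_iso by blast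
qed

end

theorem theorem3p15:
  fixes E :: "'a set" and cd :: "'a set \<Rightarrow> nat" and G :: "'a set set" and r :: "'a set rel"
  assumes "polymatroid E cd"
    and "building_set E cd G"
    and "strict_linear_order_on G r"
    and "\<And>g h. g \<in> G \<Longrightarrow> h \<in> G \<Longrightarrow> g \<subset> h \<Longrightarrow> (g, h) \<in> r"
  shows "(\<forall>k. H_leray E cd G r k \<cong>\<^sub>\<rat> H_CM E cd G r k \<and>
              H_CM E cd G r k \<cong>\<^sub>\<rat> direct_sum (carrier (flats E cd))
                (\<lambda>f. graded_tensor (factors G f) (local_homology E cd G r) k))
       \<and> (\<forall>pq. bi_H_leray E cd G r pq \<cong>\<^sub>\<rat> bi_H_CM E cd G r pq \<and>
              bi_H_CM E cd G r pq \<cong>\<^sub>\<rat> direct_sum (carrier (flats E cd))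
                (\<lambda>f. graded_tensor (factors G f) (bi_local_homology E cd G r) pq))"
proof -
  interpret building_polymatroid E cd G r
    using assms by (intro building_polymatroid.intro building_polymatroid_axioms.intro)
  show ?thesis using homology_isomorphisms by blast
qed

end
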